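(* Let $D\subset\mathbb C$, $D\ne\mathbb C$, be a convex domain with $\infty\notin\partial D$, with hyperbolic (conformal) radius $R=R(\cdot,D)$, and let $F:(-\infty,0)\to\mathbb R$ be a convex increasing function of class $C^2$. Let $z_0\in D_0$, and let $u$ be a subharmonic function on $D$ with $u(z_0)\ne-\infty$ and Riesz measure $\nu_u$ such that $u\le M:=F\circ(-R)$ on $D\setminus D_0$. Then for every number $b\ge0$ there exist constants $C\ge0$, depending only on $z_0,D,D_0,b$, and $\overline C_M\ge0$, depending only on $z_0,D,D_0,M$, such that for every convex increasing function $f:\mathbb R^+\to\mathbb R^+$ with $f(0)=0$ and every function $s\in\mathrm{sbh}^+(D\setminus D_0)$ satisfying $$t_0:=\sup_{z\in D\setminus D_0}\frac{s(z)}{R(z,D)}<+\infty,\qquad f(t_0)\sup_{z\in\partial D_0}R(z,D)\le b,$$ one has $$\int_{D\setminus D_0}R\,f\Bigl(\frac sR\Bigr)\,d\nu_u\le\frac1{2\pi}\int_{D\setminus D_0}R\,f\Bigl(\frac sR\Bigr)\Bigl(4F''(-R)+\bigl(F''(-R)R-F'(-R)\bigr)\Delta R\Bigr)\,d\lambda+C\,\overline C_M-C\,u(z_0).$$ In particular, if the integral on the right-hand side is finite, then so is the integral on the left-hand side. If $u=\log|h|$ with $h\not\equiv0$ holomorphic on $D$ and vanishing on $\mathtt Z=\{\mathtt z_k\}_{k\in\mathbb N}\subset D$, the left-hand side may be written as the sum $\sum_{\mathtt z_k\in D\setminus D_0}R(\mathtt z_k,D)\,f\bigl(s(\mathtt z_k)/R(\mathtt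 z_k,D)\bigr)$.
   Context: $\mathbb C_\infty=\mathbb C\cup\{\infty\}$; closures, boundaries and relative compactness ($\Subset$) are understood in $\mathbb C_\infty$. $D_0$ is a domain with $\varnothing\ne D_0\Subset D$. $\mathbb R^+=[0,+\infty)$; increasing is non-strict; $\lambda$ is Lebesgue measure. The hyperbolic radius is $R(z,D)=1/\lambda_D(z)$, where $\lambda_D$ is the coefficient (density) of the Poincaré metric of $D$ with Gaussian curvature $-4$ (e.g. $R(z,\mathbb D)=1-|z|^2$ for the unit disc). The Riesz measure of a subharmonic $u\not\equiv-\infty$ is $\nu_u=\frac1{2\pi}\Delta u$. $\mathrm{sbh}^+(D\setminus D_0)$ is the class of nonnegative restrictions to $D\setminus D_0$ of functions subharmonic in some open set containing $D\setminus D_0$. A holomorphic $h\not\equiv0$ vanishes on $\mathtt Z$ if at each point $z$ the multiplicity of the zero of $h$ is at least the number of repetitions of $z$ in $\mathtt Z$.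
   Formalization: The integral on the left equals the sum over Z only when Z lists all zeros of h with exact multiplicity; if h merely vanishes on Z, the sum is at most the left-hand side, and the inequality holds with the sum in its place. *)

theory Defs
  imports "HOL-Complex_Analysis.Complex_Analysis"
begin

section \<open>The extended complex plane\<close>

definition riemann_sphere :: "complex option topology" where
  "riemann_sphere = Alexandroff_compactification euclidean"
  \<comment> \<open>The point at infinity is \<^const>\<open>None\<close>; a finite point \<open>z\<close> is \<open>Some z\<close>.\<close>

definition rel_compact_in :: "complex set \<Rightarrow> complex set \<Rightarrow> bool" where
  "rel_compact_in S D \<longleftrightarrow>
     compactin riemann_sphere (riemann_sphere closure_of (Some ` S)) \<and>
     riemann_sphere closure_of (Some ` S) \<subseteq> Some ` D"


section \<open>Hyperbolic radius\<close>

text \<open>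
  The Poincare metric of curvature \<open>-4\<close> is \<open>|d\<zeta>| / (1 - |\<zeta>|\<^sup>2)\<close> on the unit disc; on a domain \<open>D\<close>
  it is the metric whose pull-back under every holomorphic covering \<open>p\<close> of \<open>D\<close> by the disc is
  that of the disc.
\<close>

definition poincare_density :: "complex set \<Rightarrow> complex \<Rightarrow> real" where
  "poincare_density D z =
     (THE l. \<exists>p \<zeta>. p holomorphic_on ball 0 1 \<and> covering_space (ball 0 1) p D \<and>
                    \<zeta> \<in> ball 0 1 \<and> p \<zeta> = z \<and>
                    l * cmod (deriv p \<zeta>) = 1 / (1 - (cmod \<zeta>)\<^sup>2))"

definition hyperbolic_radius :: "complex set \<Rightarrow> complex \<Rightarrow> real" where
  "hyperbolic_radius D z = 1 / poincare_density D z"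


section \<open>Differential operators in the plane\<close>

definition partial_x :: "(complex \<Rightarrow> real) \<Rightarrow> complex \<Rightarrow> real" where
  "partial_x g z = deriv (\<lambda>x. g (Complex x (Im z))) (Re z)"

definition partial_y :: "(complex \<Rightarrow> real) \<Rightarrow> complex \<Rightarrow> real" where
  "partial_y g z = deriv (\<lambda>y. g (Complex (Re z) y)) (Im z)"

definition laplacian :: "(complex \<Rightarrow> real) \<Rightarrow> complex \<Rightarrow> real" where
  "laplacian g z = partial_x (partial_x g) z + partial_y (partial_y g) z"

primrec Ck :: "nat \<Rightarrow> (complex \<Rightarrow> real) \<Rightarrow> bool" where
  "Ck 0 g \<longleftrightarrow> continuous_on UNIV g"
| "Ck (Suc n) g \<longleftrightarrow> g differentiable_on UNIV \<and> Ck n (partial_x g) \<and> Ck n (partial_y g)"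

definition test_function :: "complex set \<Rightarrow> (complex \<Rightarrow> real) \<Rightarrow> bool" where
  "test_function D \<phi> \<longleftrightarrow>
     (\<forall>n. Ck n \<phi>) \<and> compact (closure {z. \<phi> z \<noteq> 0}) \<and> closure {z. \<phi> z \<noteq> 0} \<subseteq> D"

text \<open>Class \<open>C\<^sup>2\<close> on an open set of reals.\<close>

definition C2_on :: "real set \<Rightarrow> (real \<Rightarrow> real) \<Rightarrow> bool" where
  "C2_on S F \<longleftrightarrow>
     (\<forall>x\<in>S. F field_differentiable at x) \<and>
     (\<forall>x\<in>S. deriv F field_differentiable at x) \<and>
     continuous_on S (deriv (deriv F))"


section \<open>Subharmonic functions and Riesz measures\<close>

text \<open>
  The integral of an extended-real function as the difference of the integrals of its positive and
  negative parts. It is meaningful unless both are infinite (in which case \<^typ>\<open>ereal\<close> arithmetic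
  gives \<open>\<infinity> - \<infinity> = \<infinity>\<close>).
\<close>

definition ext_integral :: "'a measure \<Rightarrow> 'a set \<Rightarrow> ('a \<Rightarrow> ereal) \<Rightarrow> ereal" where
  "ext_integral \<mu> A g =
     enn2ereal (\<integral>\<^sup>+x\<in>A. e2ennreal (g x) \<partial>\<mu>) - enn2ereal (\<integral>\<^sup>+x\<in>A. e2ennreal (- g x) \<partial>\<mu>)"

definition circle_mean :: "(complex \<Rightarrow> ereal) \<Rightarrow> complex \<Rightarrow> real \<Rightarrow> ereal" where
  "circle_mean u z r =
     ereal (1 / (2 * pi)) * ext_integral lborel {0..2 * pi} (\<lambda>\<theta>. u (z + of_real r * cis \<theta>))"

text \<open>Functions that are identically \<open>-\<infinity>\<close> count as subharmonic.\<close>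

definition subharmonic_on :: "complex set \<Rightarrow> (complex \<Rightarrow> ereal) \<Rightarrow> bool" where
  "subharmonic_on S u \<longleftrightarrow>
     open S \<and>
     (\<forall>z\<in>S. u z < \<infinity>) \<and>
     (\<forall>a. open {z \<in> S. u z < a}) \<and>
     (\<forall>z r. r > 0 \<and> cball z r \<subseteq> S \<longrightarrow> u z \<le> circle_mean u z r)"

text \<open>The class \<open>sbh\<^sup>+(A)\<close>.\<close>

definition sbh_nonneg :: "complex set \<Rightarrow> (complex \<Rightarrow> real) \<Rightarrow> bool" where
  "sbh_nonneg A s \<longleftrightarrow>
     (\<forall>z\<in>A. 0 \<le> s z) \<and>
     (\<exists>S v. A \<subseteq> S \<and> subharmonic_on S v \<and> (\<forall>z\<in>A. v z = ereal (s z)))"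

text \<open>
  \<open>\<nu> = \<Delta>u / (2\<pi>)\<close> in the sense of distributions on \<open>D\<close>, for \<open>u\<close> subharmonic and not identically \<open>-\<infinity>\<close> on
  the domain \<open>D\<close>. Such a \<open>u\<close> is locally integrable, so \<^const>\<open>real_of_ereal\<close> changes its values on a
  null set only.
\<close>

definition is_riesz_measure :: "complex set \<Rightarrow> (complex \<Rightarrow> ereal) \<Rightarrow> complex measure \<Rightarrow> bool" where
  "is_riesz_measure D u \<nu> \<longleftrightarrow>
     sets \<nu> = sets (restrict_space borel D) \<and>
     (\<forall>K. compact K \<and> K \<subseteq> D \<longrightarrow> emeasure \<nu> K < \<infinity>) \<and>
     (\<forall>\<phi>. test_function D \<phi> \<longrightarrow>
        (LINT z|\<nu>. \<phi> z) =
          1 / (2 * pi) * (LINT z:D|lborel. real_of_ereal (u z) * laplacian \<phi> z))"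


section \<open>Zeros of holomorphic functions\<close>

definition log_abs :: "(complex \<Rightarrow> complex) \<Rightarrow> complex \<Rightarrow> ereal" where
  "log_abs h z = (if h z = 0 then - \<infinity> else ereal (ln (cmod (h z))))"

definition vanishes_on_seq ::
    "complex set \<Rightarrow> (complex \<Rightarrow> complex) \<Rightarrow> (nat \<Rightarrow> complex) \<Rightarrow> bool" where
  "vanishes_on_seq D h Z \<longleftrightarrow>
     (\<forall>z\<in>D. finite {k. Z k = z} \<and> int (card {k. Z k = z}) \<le> zorder h z)"

definition is_zero_sequence ::
    "complex set \<Rightarrow> (complex \<Rightarrow> complex) \<Rightarrow> (nat \<Rightarrow> complex) \<Rightarrow> bool" where
  "is_zero_sequence D h Z \<longleftrightarrow>
     (\<forall>z\<in>D. finite {k. Z k = z} \<and> int (card {k. Z k = z}) = zorder h z)"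

end

theory Submission
  imports Defs
begin

text \<open>
  Convexity of \<open>D\<close> makes \<open>R\<close> concave, so \<open>w = R f (s / R)\<close> has the submean property on \<open>D - D\<^sub>0\<close>.
  Let \<open>N\<close> be the Green function of \<open>D\<close> with pole \<open>z\<^sub>0\<close>, smoothed on a small disc about \<open>z\<^sub>0\<close>. For
  suitable \<open>B\<close> and \<open>\<delta>\<close> the function \<open>G = B (N - \<delta>)\<close> exceeds \<open>w\<close> on \<open>\<partial>D\<^sub>0\<close> and is positive only
  on a compact part of \<open>D\<close>. Hence \<open>\<psi> = (max w G - \<epsilon>)\<^sup>+\<close>, continued by \<open>G - \<epsilon>\<close> to \<open>D\<^sub>0\<close>, has compact
  support, and after mollification its Laplacian is negative only near \<open>z\<^sub>0\<close>, where it is a radial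
  kernel of known mass. Testing \<open>\<Delta>(u - M)\<close> against it, the inequality \<open>u \<le> M\<close> leaves only the term at
  \<open>z\<^sub>0\<close>, which the submean property of \<open>u\<close> bounds below by a multiple of \<open>u(z\<^sub>0)\<close>. Letting the
  mollification radius and then \<open>\<epsilon>\<close> tend to \<open>0\<close> gives the estimate. The integrand \<open>\<Delta>M\<close> takes
  the stated form because \<open>|\<nabla>R|\<^sup>2 = R \<Delta>R + 4\<close>.

  The constants may depend on \<open>F\<close> only through the values of \<open>M\<close> on \<open>D - D\<^sub>0\<close>: two values of \<open>M\<close> at
  points near \<open>\<partial>D\<close> control the convex increasing \<open>F\<close> on a compact set.

  For \<open>u = ln |h|\<close> the Riesz mass of small discs about a zero is found by testing against cutoffs and
  replacing \<open>ln |z - a|\<close> by its smoothing.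
\<close>


section \<open>Lebesgue measure in the plane\<close>

text \<open>Since \<open>s\<close> is only upper semicontinuous and the Riesz measure is given by
  its action on smooth test functions, the weight must be mollified. The submean property makes the
  mollification an upper bound on \<open>D - D0\<close>, so continuity of \<open>s\<close> never
  enters; on the other side of the inequality the mollifier is moved onto \<Delta>M, which is
  continuous. The set \<open>D - D0\<close>, where u \<le> M is known, is not open, while
  mollification spreads over its boundary. The set where u < M + 1 is open and contains it, and M +
  1 has the same Laplacian as M. This is the origin of the summand 1 in the constant that depends on
  M. The condition on f(t0) is used twice: w \<le> f(t0) R tends to 0 at the boundary of D, and w
  \<le> b on \<partial>D0. Requiring G \<ge> b + 1 on the closure of D0 fixes B = (b + 1) /
  \<delta>, so the constant C is a multiple of b + 1. Passing from w to max w G costs a multiple of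
  a cutoff h in the integral against \<Delta>M; Green's identity turns that cost into an integral of
  M \<Delta>h, so that derivatives of F stay out of the constants.\<close>

lemma borel_measurable_Complex [measurable]:
  assumes "f \<in> borel_measurable M" "g \<in> borel_measurable M"
  shows "(\<lambda>x. Complex (f x) (g x)) \<in> borel_measurable M"
  using assms by (simp add: borel_measurable_complex_iff)

text \<open>Boxes determine Lebesgue measure, and a box is a product of two intervals. This opens
  the way to Fubini in the real and imaginary parts.\<close>

lemma lborel_complex:
  "distr (lborel \<Otimes>\<^sub>M lborel) borel (\<lambda>p. Complex (fst p) (snd p)) = lborel"
proof (rule lborel_eqI[symmetric])
  fix l u :: complex
  assume le: "\<And>b. b \<in> Basis \<Longrightarrow> l \<bullet> b \<le> u \<bullet> b"
  have l: "Re l \<le> Re u" "Im l \<le> Im u"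
    using le[of 1] le[of \<i>] by (auto simp: Basis_complex_def)
  have eq: "(\<lambda>p. Complex (fst p) (snd p)) -` box l u = {Re l<..<Re u} \<times> {Im l<..<Im u}"
    by (auto simp: box_def Basis_complex_def)
  have "emeasure (distr (lborel \<Otimes>\<^sub>M lborel) borel (\<lambda>p. Complex (fst p) (snd p))) (box l u)
      = emeasure (lborel \<Otimes>\<^sub>M lborel) ({Re l<..<Re u} \<times> {Im l<..<Im u})"
    by (subst emeasure_distr) (auto simp: eq space_pair_measure)
  also have "\<dots> = ennreal (Re u - Re l) * ennreal (Im u - Im l)"
    using l by (subst lborel.emeasure_pair_measure_Times) auto
  also have "\<dots> = (\<Prod>b\<in>Basis. (u - l) \<bullet> b)"
    using l by (simp add: Basis_complex_def ennreal_mult)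
  finally show "emeasure (distr (lborel \<Otimes>\<^sub>M lborel) borel (\<lambda>p. Complex (fst p) (snd p))) (box l u)
      = (\<Prod>b\<in>Basis. (u - l) \<bullet> b)" .
qed auto

lemma nn_integral_complex:
  assumes [measurable]: "f \<in> borel_measurable borel"
  shows "(\<integral>\<^sup>+z. f z \<partial>lborel) = (\<integral>\<^sup>+y. \<integral>\<^sup>+x. f (Complex x y) \<partial>lborel \<partial>lborel)"
    and "(\<integral>\<^sup>+z. f z \<partial>lborel) = (\<integral>\<^sup>+x. \<integral>\<^sup>+y. f (Complex x y) \<partial>lborel \<partial>lborel)"
proof -
  have "(\<integral>\<^sup>+z. f z \<partial>lborel) = (\<integral>\<^sup>+p. f (Complex (fst p) (snd p)) \<partial>(lborel \<Otimes>\<^sub>M lborel))"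
    by (subst lborel_complex[symmetric], subst nn_integral_distr) auto
  then show "(\<integral>\<^sup>+z. f z \<partial>lborel) = (\<integral>\<^sup>+y. \<integral>\<^sup>+x. f (Complex x y) \<partial>lborel \<partial>lborel)"
    and "(\<integral>\<^sup>+z. f z \<partial>lborel) = (\<integral>\<^sup>+x. \<integral>\<^sup>+y. f (Complex x y) \<partial>lborel \<partial>lborel)"
    using lborel_pair.nn_integral_snd[of "\<lambda>(x,y). f (Complex x y)"]
      lborel.nn_integral_fst[of "\<lambda>p. f (Complex (fst p) (snd p))" lborel]
    by (simp_all add: case_prod_beta')
qed

lemma integral_complex:
  fixes f :: "complex \<Rightarrow> real"
  assumes "integrable lborel f"
  shows "(\<integral>z. f z \<partial>lborel) = (\<integral>y. \<integral>x. f (Complex x y) \<partial>lborel \<partial>lborel)"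
    and "(\<integral>z. f z \<partial>lborel) = (\<integral>x. \<integral>y. f (Complex x y) \<partial>lborel \<partial>lborel)"
proof -
  have [measurable]: "f \<in> borel_measurable borel"
    using borel_measurable_integrable[OF assms] by simp
  have eq: "(\<integral>z. f z \<partial>lborel) = (\<integral>p. f (Complex (fst p) (snd p)) \<partial>(lborel \<Otimes>\<^sub>M lborel))"
    by (subst lborel_complex[symmetric], subst integral_distr) auto
  have int: "integrable (lborel \<Otimes>\<^sub>M lborel) (\<lambda>p. f (Complex (fst p) (snd p)))"
    using assms by (subst (asm) lborel_complex[symmetric], subst (asm) integrable_distr_eq) auto
  then have int': "integrable (lborel \<Otimes>\<^sub>M lborel) (\<lambda>(x,y). f (Complex x y))"
    by (simp add: case_prod_beta')
  show "(\<integral>z. f z \<partial>lborel) = (\<integral>y. \<integral>x. f (Complex x y) \<partial>lborel \<partial>lborel)"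
    using lborel_pair.integral_snd[OF int'] eq by (simp add: case_prod_beta')
  show "(\<integral>z. f z \<partial>lborel) = (\<integral>x. \<integral>y. f (Complex x y) \<partial>lborel \<partial>lborel)"
    using lborel_pair.integral_fst'[OF int] eq by simp
qed

section \<open>Invariance under translations, reflections and rotations\<close>

lemma lborel_distr_diff:
  fixes c :: "'a::euclidean_space"
  shows "distr lborel borel (\<lambda>w. c - w) = lborel"
  using lborel_affine[of "-1" c] by (simp add: density_1)

lemma nn_integral_lborel_translate:
  fixes c :: "'a::euclidean_space"
  assumes [measurable]: "f \<in> borel_measurable borel"
  shows "(\<integral>\<^sup>+w. f (c + w) \<partial>lborel) = (\<integral>\<^sup>+w. f w \<partial>lborel)"
  by (subst (2) lborel_distr_plus[of c, symmetric], subst nn_integral_distr) auto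

lemma nn_integral_lborel_reflect:
  fixes c :: "'a::euclidean_space"
  assumes [measurable]: "f \<in> borel_measurable borel"
  shows "(\<integral>\<^sup>+w. f (c - w) \<partial>lborel) = (\<integral>\<^sup>+w. f w \<partial>lborel)"
  by (subst (2) lborel_distr_diff[of c, symmetric], subst nn_integral_distr) auto

lemma integral_lborel_reflect:
  fixes c :: "'a::euclidean_space" and f :: "'a \<Rightarrow> real"
  assumes [measurable]: "f \<in> borel_measurable borel"
  shows "(\<integral>w. f (c - w) \<partial>lborel) = (\<integral>w. f w \<partial>lborel)"
  by (subst (2) lborel_distr_diff[of c, symmetric], subst integral_distr) auto

lemma integrable_lborel_reflect:
  fixes c :: "'a::euclidean_space" and f :: "'a \<Rightarrow> real"
  assumes "integrable lborel f"
  shows "integrable lborel (\<lambda>w. f (c - w))"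
proof -
  have [measurable]: "f \<in> borel_measurable borel"
    using borel_measurable_integrable[OF assms] by simp
  have "integrable (distr lborel borel (\<lambda>w. c - w)) f"
    using assms by (simp add: lborel_distr_diff)
  then show ?thesis
    by (subst (asm) integrable_distr_eq) auto
qed

text \<open>With the other coordinate held fixed, a shear is a translation of the line.\<close>

lemma nn_integral_complex_shear:
  assumes [measurable]: "f \<in> borel_measurable borel"
  shows "(\<integral>\<^sup>+z. f (Complex (Re z + a * Im z) (Im z)) \<partial>lborel) = (\<integral>\<^sup>+z. f z \<partial>lborel)"
    and "(\<integral>\<^sup>+z. f (Complex (Re z) (Im z + a * Re z)) \<partial>lborel) = (\<integral>\<^sup>+z. f z \<partial>lborel)"
proof -
  have "(\<integral>\<^sup>+x. f (Complex (x + a * y) y) \<partial>lborel) = (\<integral>\<^sup>+x. f (Complex x y) \<partial>lborel)" for y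
    using nn_integral_lborel_translate[of "\<lambda>x. f (Complex x y)" "a * y"] by (simp add: add.commute)
  then show "(\<integral>\<^sup>+z. f (Complex (Re z + a * Im z) (Im z)) \<partial>lborel) = (\<integral>\<^sup>+z. f z \<partial>lborel)"
    by (simp add: nn_integral_complex(1))
  have "(\<integral>\<^sup>+y. f (Complex x (y + a * x)) \<partial>lborel) = (\<integral>\<^sup>+y. f (Complex x y) \<partial>lborel)" for x
    using nn_integral_lborel_translate[of "\<lambda>y. f (Complex x y)" "a * x"] by (simp add: add.commute)
  then show "(\<integral>\<^sup>+z. f (Complex (Re z) (Im z + a * Re z)) \<partial>lborel) = (\<integral>\<^sup>+z. f z \<partial>lborel)"
    by (simp add: nn_integral_complex(2))
qed

text \<open>A rotation by an angle other than \<open>\<pi>\<close> is a product of three shears.\<close>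

lemma nn_integral_complex_rotate:
  assumes [measurable]: "f \<in> borel_measurable borel" and c: "cmod c = 1"
  shows "(\<integral>\<^sup>+z. f (c * z) \<partial>lborel) = (\<integral>\<^sup>+z. f z \<partial>lborel)"
proof -
  have *: "(\<integral>\<^sup>+z. f (c * z) \<partial>lborel) = (\<integral>\<^sup>+z. f z \<partial>lborel)"
    if c: "cmod c = 1" "c \<noteq> -1" and [measurable]: "f \<in> borel_measurable borel" for c f
  proof -
    \<comment> \<open>For c = cis \<alpha> these are a = - tan (\<alpha> / 2) and b = sin \<alpha>;
      the shears in x, y, x with slopes a, b, a compose to the rotation by \<alpha>.\<close>
    define a where "a = - Im c / (1 + Re c)"
    define b where "b = Im c"
    have uv: "(Re c)\<^sup>2 + (Im c)\<^sup>2 = 1"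
      using c(1) by (simp add: cmod_def)
    have "Re c \<noteq> -1"
      using c(2) uv by (auto simp: complex_eq_iff)
    then have nz: "1 + Re c \<noteq> 0" by auto
    have ab: "1 + a * b = Re c"
      using nz uv by (simp add: a_def b_def field_simps power2_eq_square)
    have ab2: "a * (1 + Re c) = - Im c"
      using nz by (simp add: a_def)
    define h1 where "h1 z = f (Complex (Re z + a * Im z) (Im z))" for z
    define h2 where "h2 z = h1 (Complex (Re z) (Im z + b * Re z))" for z
    have [measurable]: "h1 \<in> borel_measurable borel" "h2 \<in> borel_measurable borel"
      unfolding h1_def h2_def by measurable
    have "c * z = Complex (Re z + a * Im z + a * (Im z + b * (Re z + a * Im z)))
        (Im z + b * (Re z + a * Im z))" for z
    proof (rule complex_eqI)
      have "Re z + a * Im z + a * (Im z + b * (Re z + a * Im z))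
          = Re z * (1 + a * b) + Im z * (a * (1 + (1 + a * b)))"
        by (simp add: algebra_simps)
      then show "Re (c * z) = Re (Complex (Re z + a * Im z + a * (Im z + b * (Re z + a * Im z)))
        (Im z + b * (Re z + a * Im z)))"
        by (simp add: ab ab2)
      have "Im z + b * (Re z + a * Im z) = Im z * (1 + a * b) + b * Re z"
        by (simp add: algebra_simps)
      then show "Im (c * z) = Im (Complex (Re z + a * Im z + a * (Im z + b * (Re z + a * Im z)))
        (Im z + b * (Re z + a * Im z)))"
        by (simp add: ab) (simp add: b_def)
    qed
    then have "f (c * z) = h2 (Complex (Re z + a * Im z) (Im z))" for z
      by (simp add: h1_def h2_def)
    then have "(\<integral>\<^sup>+z. f (c * z) \<partial>lborel) = (\<integral>\<^sup>+z. h2 z \<partial>lborel)"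
      by (simp add: nn_integral_complex_shear(1)[of h2 a])
    also have "\<dots> = (\<integral>\<^sup>+z. h1 z \<partial>lborel)"
      unfolding h2_def by (rule nn_integral_complex_shear(2)) simp
    also have "\<dots> = (\<integral>\<^sup>+z. f z \<partial>lborel)"
      unfolding h1_def by (rule nn_integral_complex_shear(1)) simp
    finally show ?thesis .
  qed
  show ?thesis
  proof (cases "c = -1")
    \<comment> \<open>The half turn, where the tangent is infinite, is two quarter turns.\<close>
    case True
    have "(\<integral>\<^sup>+z. f (c * z) \<partial>lborel) = (\<integral>\<^sup>+z. f (\<i> * (\<i> * z)) \<partial>lborel)"
      using True by (simp add: mult.assoc[symmetric])
    also have "\<dots> = (\<integral>\<^sup>+z. f (\<i> * z) \<partial>lborel)"
      by (rule *[of \<i> "\<lambda>z. f (\<i> * z)"]) (auto simp: complex_eq_iff)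
    also have "\<dots> = (\<integral>\<^sup>+z. f z \<partial>lborel)"
      by (rule *) (auto simp: complex_eq_iff)
    finally show ?thesis .
  qed (use * c in auto)
qed

lemma integral_complex_rotate:
  fixes f :: "complex \<Rightarrow> real"
  assumes [measurable]: "f \<in> borel_measurable borel" and c: "cmod c = 1"
  shows "(\<integral>z. f (c * z) \<partial>lborel) = (\<integral>z. f z \<partial>lborel)"
proof -
  have "distr lborel borel ((*) c) = lborel"
  proof (rule measure_eqI)
    fix A assume "A \<in> sets (distr lborel borel ((*) c))"
    then have [measurable]: "A \<in> sets borel" by simp
    have "emeasure (distr lborel borel ((*) c)) A = (\<integral>\<^sup>+z. indicator A (c * z) \<partial>lborel)"
      by (subst nn_integral_indicator[symmetric], simp, subst nn_integral_distr) auto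
    also have "\<dots> = emeasure lborel A"
      by (subst nn_integral_complex_rotate) (use c in auto)
    finally show "emeasure (distr lborel borel ((*) c)) A = emeasure lborel A" .
  qed simp
  then show ?thesis
    using integral_distr[of "(*) c" lborel borel f] by simp
qed

section \<open>Circle means and radial kernels\<close>

lemma nn_integral_periodic_shift:
  fixes p :: "real \<Rightarrow> ennreal"
  assumes [measurable]: "p \<in> borel_measurable borel" and per: "\<And>x. p (x + 2 * pi) = p x"
    and a: "0 \<le> a" "a \<le> 2 * pi"
  shows "(\<integral>\<^sup>+x\<in>{0..2*pi}. p (a + x) \<partial>lborel) = (\<integral>\<^sup>+x\<in>{0..2*pi}. p x \<partial>lborel)"
proof -
  have "(\<integral>\<^sup>+x\<in>{0..2*pi}. p (a + x) \<partial>lborel)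
      = (\<integral>\<^sup>+x. p (a + x) * indicator {a..a+2*pi} (a + x) \<partial>lborel)"
    by (intro nn_integral_cong) (auto split: split_indicator)
  also have "\<dots> = (\<integral>\<^sup>+x\<in>{a..a+2*pi}. p x \<partial>lborel)"
    by (rule nn_integral_lborel_translate) simp
  also have "\<dots> = (\<integral>\<^sup>+x. p x * indicator {a..2*pi} x + p x * indicator {2*pi<..2*pi+a} x \<partial>lborel)"
    using a by (intro nn_integral_cong) (auto split: split_indicator)
  also have "\<dots> = (\<integral>\<^sup>+x. p x * indicator {a..2*pi} x \<partial>lborel)
      + (\<integral>\<^sup>+x. p x * indicator {2*pi<..2*pi+a} x \<partial>lborel)"
    by (rule nn_integral_add) auto
  also have "(\<integral>\<^sup>+x. p x * indicator {2*pi<..2*pi+a} x \<partial>lborel)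
      = (\<integral>\<^sup>+x. p (2*pi + x) * indicator {2*pi<..2*pi+a} (2*pi+x) \<partial>lborel)"
    by (rule nn_integral_lborel_translate[symmetric]) simp
  also have "\<dots> = (\<integral>\<^sup>+x. p x * indicator {0<..a} x \<partial>lborel)"
    using per by (intro nn_integral_cong) (auto simp: add.commute split: split_indicator)
  also have "(\<integral>\<^sup>+x. p x * indicator {a..2*pi} x \<partial>lborel) + (\<integral>\<^sup>+x. p x * indicator {0<..a} x \<partial>lborel)
     = (\<integral>\<^sup>+x. p x * indicator {a..2*pi} x + p x * indicator {0<..a} x \<partial>lborel)"
    by (rule nn_integral_add[symmetric]) auto
  also have "\<dots> = (\<integral>\<^sup>+x\<in>{0..2*pi}. p x \<partial>lborel)"
  \<comment> \<open>The two pieces overlap at \<open>a\<close> and miss 0; both points are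
    null.\<close>
  proof (rule nn_integral_cong_AE)
    have "AE x in lborel. x \<noteq> a \<and> x \<noteq> 0"
      using AE_lborel_singleton[of a] AE_lborel_singleton[of "0::real"] by eventually_elim auto
    then show "AE x in lborel. p x * indicator {a..2*pi} x + p x * indicator {0<..a} x
        = p x * indicator {0..2*pi} x"
      by eventually_elim (use a in \<open>auto split: split_indicator\<close>)
  qed
  finally show ?thesis .
qed

text \<open>Fubini over the rotation group replaces polar coordinates.\<close>

lemma nn_integral_radial_le:
  fixes P \<kappa> :: "complex \<Rightarrow> ennreal"
  assumes [measurable]: "P \<in> borel_measurable borel" "\<kappa> \<in> borel_measurable borel"
    and rad: "\<And>w. \<kappa> w = \<kappa> (of_real (cmod w))"
    and supp: "\<And>w. cmod w \<ge> r \<Longrightarrow> \<kappa> w = 0"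
    and mean: "\<And>\<rho>. 0 < \<rho> \<Longrightarrow> \<rho> < r \<Longrightarrow>
        (\<integral>\<^sup>+\<theta>\<in>{0..2*pi}. P (z + of_real \<rho> * cis \<theta>) \<partial>lborel) \<le> ennreal (2 * pi) * P z"
  shows "(\<integral>\<^sup>+w. P (z + w) * \<kappa> w \<partial>lborel) \<le> P z * (\<integral>\<^sup>+w. \<kappa> w \<partial>lborel)"
proof -
  have circ: "\<kappa> w * (\<integral>\<^sup>+\<theta>\<in>{0..2*pi}. P (z + cis \<theta> * w) \<partial>lborel) \<le> \<kappa> w * (ennreal (2 * pi) * P z)"
    for w
  proof (cases "cmod w < r")
    case True
    have "(\<integral>\<^sup>+\<theta>\<in>{0..2*pi}. P (z + cis \<theta> * w) \<partial>lborel) \<le> ennreal (2 * pi) * P z"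
    \<comment> \<open>For w = 0 the circle shrinks to the point z, which \<open>mean\<close> does
      not cover; the bound is then an equality.\<close>
    proof (cases "w = 0")
      case True
      then show ?thesis
        by (simp add: nn_integral_cmult mult.commute)
    next
      case False
      define a where "a = Arg2pi w"
      define p where "p \<theta> = P (z + of_real (cmod w) * cis \<theta>)" for \<theta>
      have w: "w = of_real (cmod w) * cis a"
        using Arg2pi[of w] by (simp add: a_def is_Arg_def cis_conv_exp)
      have [measurable]: "cis \<in> borel_measurable borel"
        by (intro borel_measurable_continuous_onI continuous_intros)
      have [measurable]: "p \<in> borel_measurable borel"
        unfolding p_def by measurable
      have "P (z + cis \<theta> * w) = p (a + \<theta>)" for \<theta>
        unfolding p_def by (subst w) (simp add: cis_mult[symmetric] ac_simps)
      then have "(\<integral>\<^sup>+\<theta>\<in>{0..2*pi}. P (z + cis \<theta> * w) \<partial>lborel) = (\<integral>\<^sup>+\<theta>\<in>{0..2*pi}. p (a + \<theta>) \<partial>lborel)"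
        by simp
      also have "\<dots> = (\<integral>\<^sup>+\<theta>\<in>{0..2*pi}. p \<theta> \<partial>lborel)"
        by (rule nn_integral_periodic_shift)
           (use Arg2pi[of w] in \<open>auto simp: p_def a_def cis.ctr\<close>)
      also have "\<dots> \<le> ennreal (2 * pi) * P z"
        unfolding p_def using False True by (intro mean) auto
      finally show ?thesis .
    qed
    then show ?thesis by (rule mult_left_mono) simp
  qed (simp add: supp)
  have [measurable]: "cis \<in> borel_measurable borel"
    by (intro borel_measurable_continuous_onI continuous_intros)
  have rot: "(\<integral>\<^sup>+w. P (z + cis \<theta> * w) * \<kappa> w \<partial>lborel) = (\<integral>\<^sup>+w. P (z + w) * \<kappa> w \<partial>lborel)" for \<theta>
  proof -
    have "\<kappa> (cis \<theta> * w) = \<kappa> w" for w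
      by (metis rad norm_mult norm_cis mult_1)
    then have "(\<integral>\<^sup>+w. P (z + cis \<theta> * w) * \<kappa> w \<partial>lborel) = (\<integral>\<^sup>+w. P (z + cis \<theta> * w) * \<kappa> (cis \<theta> * w) \<partial>lborel)"
      by simp
    also have "\<dots> = (\<integral>\<^sup>+w. P (z + w) * \<kappa> w \<partial>lborel)"
      by (rule nn_integral_complex_rotate[where f = "\<lambda>w. P (z + w) * \<kappa> w"]) auto
    finally show ?thesis .
  qed
  \<comment> \<open>By \<open>rot\<close> the integral may be averaged over all angles; exchanging
    the integrals then produces the mean of \<open>P\<close> over each circle about z.\<close>
  have "ennreal (2 * pi) * (\<integral>\<^sup>+w. P (z + w) * \<kappa> w \<partial>lborel)
      = (\<integral>\<^sup>+\<theta>\<in>{0..2*pi}. (\<integral>\<^sup>+w. P (z + cis \<theta> * w) * \<kappa> w \<partial>lborel) \<partial>lborel)"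
    unfolding rot by (subst nn_integral_cmult_indicator) (auto simp: mult.commute)
  also have "\<dots> = (\<integral>\<^sup>+\<theta>. \<integral>\<^sup>+w. P (z + cis \<theta> * w) * \<kappa> w * indicator {0..2*pi} \<theta> \<partial>lborel \<partial>lborel)"
    by (intro nn_integral_cong) (simp add: nn_integral_multc)
  also have "\<dots> = (\<integral>\<^sup>+w. \<integral>\<^sup>+\<theta>. P (z + cis \<theta> * w) * \<kappa> w * indicator {0..2*pi} \<theta> \<partial>lborel \<partial>lborel)"
    by (rule lborel_pair.Fubini') simp
  also have "\<dots> = (\<integral>\<^sup>+w. \<kappa> w * (\<integral>\<^sup>+\<theta>\<in>{0..2*pi}. P (z + cis \<theta> * w) \<partial>lborel) \<partial>lborel)"
    by (intro nn_integral_cong) (simp add: nn_integral_cmult[symmetric] ac_simps)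
  also have "\<dots> \<le> (\<integral>\<^sup>+w. \<kappa> w * (ennreal (2 * pi) * P z) \<partial>lborel)"
    by (intro nn_integral_mono circ)
  also have "\<dots> = ennreal (2 * pi) * (P z * (\<integral>\<^sup>+w. \<kappa> w \<partial>lborel))"
    by (subst nn_integral_multc) (auto simp: ac_simps)
  finally show ?thesis
    by (subst (asm) ennreal_mult_le_mult_iff) (auto simp: ennreal_eq_0_iff not_le)
qed

section \<open>Smooth functions\<close>

lemma has_derivative_slices:
  assumes "(g has_derivative g') (at z)"
  shows "((\<lambda>x. g (Complex x (Im z))) has_real_derivative g' 1) (at (Re z))"
    and "((\<lambda>y. g (Complex (Re z) y)) has_real_derivative g' \<i>) (at (Im z))"
proof -
  interpret bounded_linear g' using assms by (rule has_derivative_bounded_linear)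
  have eqx: "(\<lambda>x. Complex x (Im z)) = (\<lambda>x. of_real x + \<i> * of_real (Im z))"
    and eqy: "(\<lambda>y. Complex (Re z) y) = (\<lambda>y. of_real (Re z) + \<i> * of_real y)"
    by (simp_all add: fun_eq_iff complex_eq_iff)
  have dx: "((\<lambda>x. Complex x (Im z)) has_derivative (\<lambda>h. of_real h)) (at (Re z))"
    unfolding eqx by (auto intro!: derivative_eq_intros)
  have dy: "((\<lambda>y. Complex (Re z) y) has_derivative (\<lambda>h. \<i> * of_real h)) (at (Im z))"
    unfolding eqy by (auto intro!: derivative_eq_intros)
  have zz: "Complex (Re z) (Im z) = z" by simp
  have "((\<lambda>x. g (Complex x (Im z))) has_derivative (\<lambda>h. g' (of_real h))) (at (Re z))"
    using has_derivative_compose[OF dx, of g g'] assms by simp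
  moreover have "(\<lambda>h. g' (of_real h)) = (*) (g' 1)"
    using scaleR[of _ 1] by (auto simp: fun_eq_iff scaleR_conv_of_real mult.commute)
  ultimately show "((\<lambda>x. g (Complex x (Im z))) has_real_derivative g' 1) (at (Re z))"
    by (simp add: has_field_derivative_def)
  have "((\<lambda>y. g (Complex (Re z) y)) has_derivative (\<lambda>h. g' (\<i> * of_real h))) (at (Im z))"
    using has_derivative_compose[OF dy, of g g'] assms by simp
  moreover have "(\<lambda>h. g' (\<i> * of_real h)) = (*) (g' \<i>)"
    using scaleR[of _ \<i>] by (auto simp: fun_eq_iff scaleR_conv_of_real mult.commute)
  ultimately show "((\<lambda>y. g (Complex (Re z) y)) has_real_derivative g' \<i>) (at (Im z))"
    by (simp add: has_field_derivative_def)
qed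

lemma partial_has_derivative:
  assumes "(g has_derivative g') (at z)"
  shows "partial_x g z = g' 1" "partial_y g z = g' \<i>"
  using has_derivative_slices[OF assms] by (auto simp: partial_x_def partial_y_def DERIV_imp_deriv)

lemma differentiable_has_derivative_partials:
  assumes "g differentiable (at z)"
  shows "(g has_derivative (\<lambda>h. Re h * partial_x g z + Im h * partial_y g z)) (at z)"
proof -
  obtain g' where g': "(g has_derivative g') (at z)"
    using assms by (auto simp: differentiable_def)
  interpret bounded_linear g' using g' by (rule has_derivative_bounded_linear)
  have "g' h = Re h * g' 1 + Im h * g' \<i>" for h
  proof -
    have "h = Re h *\<^sub>R 1 + Im h *\<^sub>R \<i>" by (simp add: complex_eq_iff)
    then have "g' h = g' (Re h *\<^sub>R 1 + Im h *\<^sub>R \<i>)" by simp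
    then show ?thesis by (simp only: add scaleR) simp
  qed
  then have "g' = (\<lambda>h. Re h * partial_x g z + Im h * partial_y g z)"
    unfolding partial_has_derivative[OF g'] by (rule ext)
  then show ?thesis using g' by simp
qed

text \<open>Smoothness of reflections, of bumps and of convolutions is proved below by naming, in
  each case, a class that is closed under both partial derivatives.\<close>

lemma Ck_coinduct:
  assumes "P g"
    and "\<And>g. P g \<Longrightarrow> g differentiable_on UNIV \<and> P (partial_x g) \<and> P (partial_y g)"
  shows "Ck n g"
  using assms(1)
proof (induction n arbitrary: g)
  case 0
  then show ?case
    using assms(2) by (auto intro: differentiable_imp_continuous_on)
next
  case (Suc n)
  then show ?case using assms(2) by auto
qed

definition smooth :: "(complex \<Rightarrow> real) \<Rightarrow> bool" where
  "smooth g \<longleftrightarrow> (\<forall>n. Ck n g)"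

lemma smooth_coinduct:
  assumes "P g"
    and "\<And>g. P g \<Longrightarrow> g differentiable_on UNIV \<and> P (partial_x g) \<and> P (partial_y g)"
  shows "smooth g"
  using Ck_coinduct[of P, OF assms] by (simp add: smooth_def)

lemma smoothD:
  assumes "smooth g"
  shows "smooth (partial_x g)" "smooth (partial_y g)" "g differentiable (at z)"
    "continuous_on UNIV g" "g \<in> borel_measurable borel"
    "(g has_derivative (\<lambda>h. Re h * partial_x g z + Im h * partial_y g z)) (at z)"
proof -
  have *: "Ck (Suc n) g" for n using assms by (auto simp: smooth_def)
  show "smooth (partial_x g)" "smooth (partial_y g)"
    using * by (auto simp: smooth_def)
  show d: "g differentiable (at z)"
    using *[of 0] by (auto simp: differentiable_on_def)
  show c: "continuous_on UNIV g"
    using *[of 0] by (auto intro: differentiable_imp_continuous_on)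
  show "g \<in> borel_measurable borel" using c by (rule borel_measurable_continuous_onI)
  show "(g has_derivative (\<lambda>h. Re h * partial_x g z + Im h * partial_y g z)) (at z)"
    using d by (rule differentiable_has_derivative_partials)
qed

lemma smooth_slices:
  assumes "smooth g"
  shows "((\<lambda>x. g (Complex x y)) has_real_derivative partial_x g (Complex x y)) (at x)"
    and "((\<lambda>y. g (Complex x y)) has_real_derivative partial_y g (Complex x y)) (at y)"
  using has_derivative_slices[OF smoothD(6)[OF assms, of "Complex x y"]] by simp_all

lemma smooth_laplacian_continuous:
  assumes "smooth g" shows "continuous_on UNIV (laplacian g)"
  unfolding laplacian_def using assms by (intro continuous_intros smoothD(4) smoothD(1,2))

lemma partial_locally_zero:
  assumes "open S" "z \<in> S" "\<And>w. w \<in> S \<Longrightarrow> g w = 0"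
  shows "partial_x g z = 0" "partial_y g z = 0"
proof -
  have "(g has_derivative (\<lambda>h. 0)) (at z)"
    by (rule has_derivative_transform_within_open[of "\<lambda>_. 0"]) (use assms in auto)
  from partial_has_derivative[OF this] show "partial_x g z = 0" "partial_y g z = 0" by auto
qed

lemma smooth_reflect:
  assumes "smooth g"
  shows "smooth (\<lambda>w. g (c - w))"
    and "partial_x (\<lambda>w. g (c - w)) = (\<lambda>w. - partial_x g (c - w))"
    and "partial_y (\<lambda>w. g (c - w)) = (\<lambda>w. - partial_y g (c - w))"
    and "laplacian (\<lambda>w. g (c - w)) = (\<lambda>w. laplacian g (c - w))"
proof -
  have der: "((\<lambda>w. a * g (c - w)) has_derivative
      (\<lambda>h. a * (Re (- h) * partial_x g (c - z) + Im (- h) * partial_y g (c - z)))) (at z)"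
    if "smooth g" for g z and a :: real
  proof -
    have "((\<lambda>w. c - w) has_derivative (\<lambda>h. - h)) (at z)"
      by (auto intro!: derivative_eq_intros)
    from has_derivative_compose[OF this smoothD(6)[OF that]]
    have "((\<lambda>w. g (c - w)) has_derivative
      (\<lambda>h. (Re (- h) * partial_x g (c - z) + Im (- h) * partial_y g (c - z)))) (at z)" .
    from has_derivative_mult_right[OF this, of a] show ?thesis .
  qed
  have px: "partial_x (\<lambda>w. a * g (c - w)) = (\<lambda>w. (- a) * partial_x g (c - w))"
    and py: "partial_y (\<lambda>w. a * g (c - w)) = (\<lambda>w. (- a) * partial_y g (c - w))"
    if "smooth g" for g and a :: real
    using partial_has_derivative[OF der[OF that]] by auto
  \<comment> \<open>The factor \<open>a\<close> is needed for closure, because every differentiation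
    brings a sign.\<close>
  let ?P = "\<lambda>G. \<exists>a g. smooth g \<and> G = (\<lambda>w. a * g (c - w))"
  show "smooth (\<lambda>w. g (c - w))"
  proof (rule smooth_coinduct[of ?P])
    show "?P (\<lambda>w. g (c - w))" using assms by (intro exI[of _ 1]) auto
  next
    fix G assume "?P G"
    then obtain a g where G: "smooth g" "G = (\<lambda>w. a * g (c - w))" by auto
    have "G differentiable_on UNIV"
      unfolding G(2) differentiable_on_def differentiable_def using der[OF G(1)] by blast
    moreover have "?P (partial_x G)" "?P (partial_y G)"
      unfolding G(2) px[OF G(1)] py[OF G(1)] using smoothD(1,2)[OF G(1)] by blast+
    ultimately show "G differentiable_on UNIV \<and> ?P (partial_x G) \<and> ?P (partial_y G)" by blast
  qed
  show x: "partial_x (\<lambda>w. g (c - w)) = (\<lambda>w. - partial_x g (c - w))"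
    using px[OF assms, of 1] by simp
  show y: "partial_y (\<lambda>w. g (c - w)) = (\<lambda>w. - partial_y g (c - w))"
    using py[OF assms, of 1] by simp
  show "laplacian (\<lambda>w. g (c - w)) = (\<lambda>w. laplacian g (c - w))"
    unfolding laplacian_def[abs_def] x y
    using px[OF smoothD(1)[OF assms], of "-1"] py[OF smoothD(2)[OF assms], of "-1"] by simp
qed

subsection \<open>A smooth bump\<close>

text \<open>The powers of 1/x accompany exp (- 1/x) so that the family is closed under
  differentiation up to linear combinations.\<close>

definition flat :: "nat \<Rightarrow> real \<Rightarrow> real" where
  "flat k x = (if x \<le> 0 then 0 else inverse x ^ k * exp (- inverse x))"

lemma flat_tendsto_0: "(flat k \<longlongrightarrow> 0) (at 0)"
proof -
  have "((\<lambda>x::real. inverse x ^ k / exp (inverse x)) \<longlongrightarrow> 0) (at_right 0)"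
    by (rule filterlim_compose[OF tendsto_power_div_exp_0 filterlim_inverse_at_top_right])
  then have r: "(flat k \<longlongrightarrow> 0) (at_right 0)"
    by (rule Lim_transform_eventually)
       (auto simp: flat_def eventually_at_filter exp_minus divide_inverse)
  have l: "(flat k \<longlongrightarrow> 0) (at_left 0)"
    by (rule tendsto_eventually) (auto simp: flat_def eventually_at_filter)
  show ?thesis using l r by (simp add: filterlim_split_at)
qed

lemma flat_has_derivative:
  "(flat k has_real_derivative flat (k + 2) x - real k * flat (k + 1) x) (at x)"
proof -
  consider "x < 0" | "x = 0" | "x > 0" by linarith
  then show ?thesis
  proof cases
    case 1
    have "((\<lambda>_. 0) has_real_derivative 0) (at x)" by simp
    then have "(flat k has_real_derivative 0) (at x)"
      by (rule has_field_derivative_transform_within_open[of _ _ _ "{..<0}"]) (use 1 in \<open>auto simp: flat_def\<close>)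
    then show ?thesis using 1 by (simp add: flat_def)
  next
    case 2
    \<comment> \<open>The difference quotient at 0 is \<open>flat (Suc k)\<close>, which tends to
      0.\<close>
    have "((\<lambda>h. (flat k (0 + h) - flat k 0) / h) \<longlongrightarrow> 0) (at 0)"
      by (rule Lim_transform_eventually[OF flat_tendsto_0[of "Suc k"]])
         (auto simp: flat_def eventually_at_filter divide_inverse)
    then show ?thesis using 2 by (simp add: DERIV_def flat_def)
  next
    case 3
    have "((\<lambda>x. inverse x ^ k * exp (- inverse x)) has_real_derivative
       flat (k + 2) x - real k * flat (k + 1) x) (at x)"
    proof (rule DERIV_cong)
      show "((\<lambda>x. inverse x ^ k * exp (- inverse x)) has_real_derivative
        real k * inverse x ^ (k - 1) * (- (inverse x * inverse x)) * exp (- inverse x)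
          + inverse x ^ k * (exp (- inverse x) * (inverse x * inverse x))) (at x)"
        by (rule derivative_eq_intros refl | use 3 in simp)+
      show "real k * inverse x ^ (k - 1) * (- (inverse x * inverse x)) * exp (- inverse x)
          + inverse x ^ k * (exp (- inverse x) * (inverse x * inverse x))
          = flat (k + 2) x - real k * flat (k + 1) x"
        using 3 by (cases k) (auto simp: flat_def algebra_simps)
    qed
    then show ?thesis
      by (rule has_field_derivative_transform_within_open[of _ _ _ "{0<..}"]) (use 3 in \<open>auto simp: flat_def\<close>)
  qed
qed

text \<open>An algebra containing the bumps exp (- 1 / (a - |z|^2)) and closed under both partials,
  so all its members are smooth. |z|^2 is spelled out in coordinates, whose derivatives are again in
  the algebra.\<close>

inductive bump_algebra :: "real \<Rightarrow> (complex \<Rightarrow> real) \<Rightarrow> bool" for a where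
  flat: "bump_algebra a (\<lambda>z. flat k (a - ((Re z)\<^sup>2 + (Im z)\<^sup>2)))"
| const: "bump_algebra a (\<lambda>z. c)"
| re: "bump_algebra a Re"
| im: "bump_algebra a Im"
| add: "bump_algebra a g \<Longrightarrow> bump_algebra a h \<Longrightarrow> bump_algebra a (\<lambda>z. g z + h z)"
| mult: "bump_algebra a g \<Longrightarrow> bump_algebra a h \<Longrightarrow> bump_algebra a (\<lambda>z. g z * h z)"

lemma bump_algebra_derivative:
  assumes "bump_algebra a g"
  shows "\<exists>gx gy. bump_algebra a gx \<and> bump_algebra a gy \<and>
    (\<forall>z. (g has_derivative (\<lambda>h. Re h * gx z + Im h * gy z)) (at z))"
  using assms
proof induction
  case (flat k)
  define f' where "f' z = flat (k + 2) (a - ((Re z)\<^sup>2 + (Im z)\<^sup>2))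
    + (- real k) * flat (k + 1) (a - ((Re z)\<^sup>2 + (Im z)\<^sup>2))" for z
  have f': "bump_algebra a f'"
    unfolding f'_def by (intro bump_algebra.intros)
  have "bump_algebra a (\<lambda>z. f' z * ((-2) * Re z))" "bump_algebra a (\<lambda>z. f' z * ((-2) * Im z))"
    by (intro bump_algebra.intros f')+
  moreover have "((\<lambda>z. flat k (a - ((Re z)\<^sup>2 + (Im z)\<^sup>2))) has_derivative
     (\<lambda>h. Re h * (f' z * ((-2) * Re z)) + Im h * (f' z * ((-2) * Im z)))) (at z)" for z
  proof -
    have "((\<lambda>z. a - ((Re z)\<^sup>2 + (Im z)\<^sup>2)) has_derivative
        (\<lambda>h. - (2 * Re z * Re h + 2 * Im z * Im h))) (at z)"
      by (auto intro!: derivative_eq_intros simp: fun_eq_iff)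
    from has_derivative_compose[OF this flat_has_derivative[unfolded has_field_derivative_def], of k]
    show ?thesis
      by (rule has_derivative_eq_rhs) (auto simp: f'_def fun_eq_iff algebra_simps)
  qed
  ultimately show ?case by blast
next
  case (const c)
  show ?case
    by (rule exI[of _ "\<lambda>_. 0"], rule exI[of _ "\<lambda>_. 0"], intro conjI bump_algebra.const) simp
next
  case re
  show ?case
    by (rule exI[of _ "\<lambda>_. 1"], rule exI[of _ "\<lambda>_. 0"], intro conjI bump_algebra.const)
       (auto intro!: derivative_eq_intros)
next
  case im
  show ?case
    by (rule exI[of _ "\<lambda>_. 0"], rule exI[of _ "\<lambda>_. 1"], intro conjI bump_algebra.const)
       (auto intro!: derivative_eq_intros)
next
  case (add g h)
  obtain gx gy where g: "bump_algebra a gx" "bump_algebra a gy"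
    "\<And>z. (g has_derivative (\<lambda>h. Re h * gx z + Im h * gy z)) (at z)"
    using add.IH(1) by blast
  obtain hx hy where h: "bump_algebra a hx" "bump_algebra a hy"
    "\<And>z. (h has_derivative (\<lambda>h. Re h * hx z + Im h * hy z)) (at z)"
    using add.IH(2) by blast
  note * = g(1,2) h(1,2) g(3) h(3)
  have "((\<lambda>z. g z + h z) has_derivative (\<lambda>k. Re k * (gx z + hx z) + Im k * (gy z + hy z))) (at z)" for z
    by (rule has_derivative_eq_rhs[OF has_derivative_add[OF *(5,6)]]) (auto simp: algebra_simps)
  moreover have "bump_algebra a (\<lambda>z. gx z + hx z)" "bump_algebra a (\<lambda>z. gy z + hy z)"
    by (intro bump_algebra.intros *)+
  ultimately show ?case by blast
next
  case (mult g h)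
  obtain gx gy where g: "bump_algebra a gx" "bump_algebra a gy"
    "\<And>z. (g has_derivative (\<lambda>h. Re h * gx z + Im h * gy z)) (at z)"
    using mult.IH(1) by blast
  obtain hx hy where h: "bump_algebra a hx" "bump_algebra a hy"
    "\<And>z. (h has_derivative (\<lambda>h. Re h * hx z + Im h * hy z)) (at z)"
    using mult.IH(2) by blast
  note * = g(1,2) h(1,2) g(3) h(3)
  have "((\<lambda>z. g z * h z) has_derivative
     (\<lambda>k. Re k * (gx z * h z + g z * hx z) + Im k * (gy z * h z + g z * hy z))) (at z)" for z
    by (rule has_derivative_eq_rhs[OF has_derivative_mult[OF *(5,6)]]) (auto simp: algebra_simps)
  moreover have "bump_algebra a (\<lambda>z. gx z * h z + g z * hx z)" "bump_algebra a (\<lambda>z. gy z * h z + g z * hy z)"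
    by (intro bump_algebra.intros * mult)+
  ultimately show ?case by blast
qed

lemma bump_algebra_smooth:
  assumes "bump_algebra a g" shows "smooth g"
  using assms
proof (rule smooth_coinduct)
  fix g assume "bump_algebra a g"
  then obtain gx gy where *: "bump_algebra a gx" "bump_algebra a gy"
    "\<And>z. (g has_derivative (\<lambda>h. Re h * gx z + Im h * gy z)) (at z)"
    using bump_algebra_derivative by blast
  have "partial_x g = gx" "partial_y g = gy"
    using partial_has_derivative[OF *(3)] by auto
  then show "g differentiable_on UNIV \<and> bump_algebra a (partial_x g) \<and> bump_algebra a (partial_y g)"
    using * by (auto simp: differentiable_on_def differentiable_def)
qed

text \<open>The classical bump exp (- 1 / (\<eta>^2 - |z|^2)) on the disc of radius
  \<open>\<eta>\<close>, normalised to mass 1. It is radial, so circle means control convolutions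
  with it.\<close>

definition mollifier :: "real \<Rightarrow> complex \<Rightarrow> real" where
  "mollifier \<eta> z = inverse (\<integral>w. flat 0 (\<eta>\<^sup>2 - (cmod w)\<^sup>2) \<partial>lborel) * flat 0 (\<eta>\<^sup>2 - (cmod z)\<^sup>2)"

lemma smooth_mollifier: "smooth (mollifier \<eta>)"
proof -
  have "bump_algebra (\<eta>\<^sup>2) (mollifier \<eta>)"
    unfolding mollifier_def[abs_def] cmod_power2 by (intro bump_algebra.intros)
  then show ?thesis by (rule bump_algebra_smooth)
qed

lemma mollifier_eq_0: "0 < \<eta> \<Longrightarrow> cmod z \<ge> \<eta> \<Longrightarrow> mollifier \<eta> z = 0"
  by (simp add: mollifier_def flat_def)

lemma mollifier_radial: "cmod z = cmod w \<Longrightarrow> mollifier \<eta> z = mollifier \<eta> w"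
  by (simp add: mollifier_def)

lemma mollifier_nonneg: "mollifier \<eta> z \<ge> 0"
  unfolding mollifier_def by (intro mult_nonneg_nonneg) (auto simp: flat_def intro!: integral_nonneg)

lemma integrable_continuous_compact_support:
  fixes g :: "complex \<Rightarrow> real"
  assumes "compact K" "continuous_on K g" "\<And>z. z \<notin> K \<Longrightarrow> g z = 0"
  shows "integrable lborel g"
proof -
  have "integrable lborel (\<lambda>z. indicator K z *\<^sub>R g z)"
    by (rule borel_integrable_compact) fact+
  also have "(\<lambda>z. indicator K z *\<^sub>R g z) = g"
    using assms(3) by (auto split: split_indicator)
  finally show ?thesis .
qed

lemma integrable_mollifier:
  assumes "0 < \<eta>" shows "integrable lborel (mollifier \<eta>)"
  by (rule integrable_continuous_compact_support[of "cball 0 \<eta>"])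
     (use assms smoothD(4)[OF smooth_mollifier] mollifier_eq_0 in \<open>auto intro: continuous_on_subset\<close>)

lemma integral_mollifier:
  assumes "0 < \<eta>" shows "(\<integral>z. mollifier \<eta> z \<partial>lborel) = 1"
proof -
  let ?f = "\<lambda>w. flat 0 (\<eta>\<^sup>2 - (cmod w)\<^sup>2)"
  have "bump_algebra (\<eta>\<^sup>2) ?f"
    unfolding cmod_power2 by (rule bump_algebra.flat)
  then have sm: "smooth ?f" by (rule bump_algebra_smooth)
  have int: "integrable lborel ?f"
    by (rule integrable_continuous_compact_support[of "cball 0 \<eta>"])
       (use assms smoothD(4)[OF sm] in \<open>auto intro: continuous_on_subset simp: flat_def\<close>)
  have "(\<integral>w. ?f w \<partial>lborel) \<noteq> 0"
  proof
    assume "(\<integral>w. ?f w \<partial>lborel) = 0"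
    then have ae: "AE w in lborel. ?f w = 0"
      using int by (subst (asm) integral_nonneg_eq_0_iff_AE) (auto simp: flat_def)
    have nz: "?f w \<noteq> 0" if "w \<in> ball 0 \<eta>" for w :: complex
      using that power_strict_mono[of "cmod w" \<eta> 2] by (simp add: flat_def)
    from ae have "AE w in lborel. w \<notin> ball (0::complex) \<eta>"
      by (rule eventually_mono) (rule notI, drule nz, blast)
    then have "emeasure lborel (ball (0::complex) \<eta>) = 0"
      by (subst (asm) AE_iff_measurable[of "ball 0 \<eta>"]) auto
    then show False
      using assms emeasure_ball[of \<eta> "0::complex"] content_ball_pos[of \<eta> "0::complex"]
      by (simp add: measure_def)
  qed
  then show ?thesis
    unfolding mollifier_def by simp
qed

subsection \<open>Convolution\<close>

text \<open>The rough factor comes first and the smooth kernel second: all derivatives fall on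
  \<open>g\<close>, and \<open>\<psi>\<close> need only be integrable.\<close>

definition conv :: "(complex \<Rightarrow> real) \<Rightarrow> (complex \<Rightarrow> real) \<Rightarrow> complex \<Rightarrow> real" where
  "conv \<psi> g z = (\<integral>w. \<psi> w * g (z - w) \<partial>lborel)"

lemma compact_support_bounded:
  fixes g :: "complex \<Rightarrow> real"
  assumes "continuous_on UNIV g" "\<And>z. r < cmod z \<Longrightarrow> g z = 0"
  obtains K where "0 \<le> K" "\<And>z. \<bar>g z\<bar> \<le> K"
proof -
  have "compact (g ` cball 0 r)"
    using assms(1) by (intro compact_continuous_image) (auto intro: continuous_on_subset)
  then have "bounded (g ` cball 0 r)"
    by (rule compact_imp_bounded)
  then obtain K where K: "\<And>z. z \<in> cball 0 r \<Longrightarrow> \<bar>g z\<bar> \<le> K"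
    unfolding bounded_iff by (metis imageI real_norm_def)
  show thesis
  proof (rule that[of "max K 0"])
    show "\<bar>g z\<bar> \<le> max K 0" for z
      using K[of z] assms(2)[of z] by (cases "z \<in> cball 0 r") auto
  qed simp
qed

lemma compact_support_uniformly_continuous:
  fixes g :: "complex \<Rightarrow> real"
  assumes "continuous_on UNIV g" "\<And>z. r < cmod z \<Longrightarrow> g z = 0" "0 < e"
  obtains d where "0 < d" "\<And>z z'. dist z' z < d \<Longrightarrow> \<bar>g z' - g z\<bar> < e"
proof -
  have "uniformly_continuous_on (cball 0 (r + 1)) g"
    using assms(1) by (intro compact_uniformly_continuous) (auto intro: continuous_on_subset)
  then obtain d where d: "0 < d" "\<And>z z'. z \<in> cball 0 (r+1) \<Longrightarrow> z' \<in> cball 0 (r+1) \<Longrightarrow> dist z' z < d \<Longrightarrow> dist (g z') (g z) < e"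
    using assms(3) unfolding uniformly_continuous_on_def by metis
  show thesis
  proof (rule that[of "min d 1"])
    fix z z' :: complex assume dz: "dist z' z < min d 1"
    show "\<bar>g z' - g z\<bar> < e"
    proof (cases "z \<in> cball 0 (r+1) \<and> z' \<in> cball 0 (r+1)")
      case True
      then show ?thesis using d(2)[of z z'] dz by (auto simp: dist_real_def)
    next
      case False
      have "cmod z \<le> cmod z' + dist z' z" "cmod z' \<le> cmod z + dist z' z"
        by (metis dist_norm norm_minus_commute norm_triangle_sub)+
      then have "r < cmod z" "r < cmod z'" using False dz by auto
      then show ?thesis using assms by simp
    qed
  qed (use d in auto)
qed

lemma partial_compact_support:
  assumes "\<And>z. r < cmod z \<Longrightarrow> g z = 0" "r < cmod z"
  shows "partial_x g z = 0" "partial_y g z = 0"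
proof -
  have "open {z. r < cmod z}" by (intro open_Collect_less continuous_intros)
  from partial_locally_zero[OF this, of z g] show "partial_x g z = 0" "partial_y g z = 0"
    using assms by auto
qed

lemma integrable_conv:
  fixes \<psi> g :: "complex \<Rightarrow> real"
  assumes "integrable lborel \<psi>" "continuous_on UNIV g" "\<And>z. r < cmod z \<Longrightarrow> g z = 0"
  shows "integrable lborel (\<lambda>w. \<psi> w * g (z - w))"
proof -
  obtain K where K: "\<And>z. \<bar>g z\<bar> \<le> K" "0 \<le> K"
    using compact_support_bounded[OF assms(2,3)] by metis
  have [measurable]: "g \<in> borel_measurable borel" "\<psi> \<in> borel_measurable borel"
    using assms(2) borel_measurable_continuous_onI borel_measurable_integrable[OF assms(1)] by auto
  show ?thesis
  proof (rule Bochner_Integration.integrable_bound[of _ "\<lambda>w. K * \<bar>\<psi> w\<bar>"])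
    have "norm (\<psi> w * g (z - w)) \<le> norm (K * \<bar>\<psi> w\<bar>)" for w
      using mult_right_mono[OF K(1)[of "z - w"], of "\<bar>\<psi> w\<bar>"] K(2) by (simp add: abs_mult mult.commute)
    then show "AE w in lborel. norm (\<psi> w * g (z - w)) \<le> norm (K * \<bar>\<psi> w\<bar>)" by simp
  qed (use assms(1) in auto)
qed

text \<open>The partials of \<open>g\<close> are uniformly continuous by compact support, so the
  linearisation error of \<open>g\<close> is o(|h|) uniformly in the base point and survives
  integration against \<open>\<psi>\<close>.\<close>

lemma conv_has_derivative:
  assumes \<psi>: "integrable lborel \<psi>" and g: "smooth g" and r: "\<And>z. r < cmod z \<Longrightarrow> g z = 0"
  shows "(conv \<psi> g has_derivative
      (\<lambda>h. Re h * conv \<psi> (partial_x g) z + Im h * conv \<psi> (partial_y g) z)) (at z)"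
proof -
  let ?L = "\<lambda>z h. Re h * partial_x g z + Im h * partial_y g z"
  have cx: "continuous_on UNIV (partial_x g)" "continuous_on UNIV (partial_y g)" "continuous_on UNIV g"
    using g smoothD by blast+
  have zx: "partial_x g z = 0" "partial_y g z = 0" if "r < cmod z" for z
    using partial_compact_support[of r g z] r that by auto
  note ints = integrable_conv[OF \<psi> cx(1) zx(1)] integrable_conv[OF \<psi> cx(2) zx(2)] integrable_conv[OF \<psi> cx(3) r]
  have unif: "\<exists>d>0. \<forall>z h. cmod h < d \<longrightarrow> \<bar>g (z + h) - g z - ?L z h\<bar> \<le> e * cmod h" if "0 < e" for e
  proof -
    have e2: "0 < e/2" using that by simp
    obtain d1 where d1: "0 < d1" "\<And>z z'. dist z' z < d1 \<Longrightarrow> \<bar>partial_x g z' - partial_x g z\<bar> < e/2"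
      using compact_support_uniformly_continuous[OF cx(1) zx(1) e2] by metis
    obtain d2 where d2: "0 < d2" "\<And>z z'. dist z' z < d2 \<Longrightarrow> \<bar>partial_y g z' - partial_y g z\<bar> < e/2"
      using compact_support_uniformly_continuous[OF cx(2) zx(2) e2] by metis
    have "\<bar>g (z + h) - g z - ?L z h\<bar> \<le> e * cmod h" if h: "cmod h < min d1 d2" for z h
    proof -
      \<comment> \<open>Subtracting the linear part at \<open>z\<close> leaves a function with small
        derivative on the disc, to which the mean value inequality applies.\<close>
      define G where "G w = g w - ?L z w" for w
      have der: "(G has_derivative (\<lambda>k. ?L w k - ?L z k)) (at w within ball z (min d1 d2))" for w
      proof -
        have "bounded_linear (?L z)"
          by (intro bounded_linear_add bounded_linear_compose[OF bounded_linear_mult_left]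
              bounded_linear_Re bounded_linear_Im)
        then show ?thesis
          unfolding G_def
          by (intro has_derivative_diff has_derivative_at_withinI[OF smoothD(6)[OF g]]
              bounded_linear_imp_has_derivative)
      qed
      have on: "onorm (\<lambda>k. ?L w k - ?L z k) \<le> e" if "w \<in> ball z (min d1 d2)" for w
      proof (rule onorm_bound)
        fix k :: complex
        have "norm (?L w k - ?L z k) = \<bar>Re k * (partial_x g w - partial_x g z) + Im k * (partial_y g w - partial_y g z)\<bar>"
          by (simp add: algebra_simps)
        also have "\<dots> \<le> \<bar>Re k\<bar> * \<bar>partial_x g w - partial_x g z\<bar> + \<bar>Im k\<bar> * \<bar>partial_y g w - partial_y g z\<bar>"
          by (metis abs_mult abs_triangle_ineq)
        also have "\<dots> \<le> cmod k * (e/2) + cmod k * (e/2)"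
          using d1(2)[of w z] d2(2)[of w z] that abs_Re_le_cmod[of k] abs_Im_le_cmod[of k] \<open>0 < e\<close>
          by (intro add_mono mult_mono) (auto simp: dist_commute)
        finally show "norm (?L w k - ?L z k) \<le> e * norm k" by (simp add: algebra_simps)
      qed (use that in \<open>auto simp: \<open>0 < e\<close> less_imp_le\<close>)
      have "norm (G (z + h) - G z) \<le> e * norm (z + h - z)"
        by (rule differentiable_bound[OF convex_ball der on]) (use h d1 d2 in \<open>auto simp: dist_norm\<close>)
      then show ?thesis by (simp add: G_def algebra_simps)
    qed
    then show ?thesis using d1(1) d2(1) by (intro exI[of _ "min d1 d2"]) auto
  qed
  show ?thesis
    unfolding has_derivative_at_alt
  proof (intro conjI allI impI)
    show "bounded_linear (\<lambda>h. Re h * conv \<psi> (partial_x g) z + Im h * conv \<psi> (partial_y g) z)"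
      by (intro bounded_linear_add bounded_linear_compose[OF bounded_linear_mult_left]
              bounded_linear_Re bounded_linear_Im)
  next
    fix e :: real assume "0 < e"
    define I where "I = (\<integral>w. \<bar>\<psi> w\<bar> \<partial>lborel)"
    have I: "I \<ge> 0" by (simp add: I_def)
    \<comment> \<open>The added 1 covers I = 0.\<close>
    then have "0 < e / (I + 1)" using \<open>0 < e\<close> by simp
    from unif[OF this] obtain d where d: "d > 0"
      "\<And>z h. cmod h < d \<Longrightarrow> \<bar>g (z + h) - g z - ?L z h\<bar> \<le> e / (I + 1) * cmod h" by blast
    show "\<exists>d>0. \<forall>y. norm (y - z) < d \<longrightarrow> norm (conv \<psi> g y - conv \<psi> g z -
       (Re (y - z) * conv \<psi> (partial_x g) z + Im (y - z) * conv \<psi> (partial_y g) z)) \<le> e * norm (y - z)"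
    proof (intro exI[of _ d] conjI allI impI d(1))
      fix y assume y: "norm (y - z) < d"
      define E where "E w = \<psi> w * (g (y - w) - g (z - w) - ?L (z - w) (y - z))" for w
      have Eq: "E w = \<psi> w * g (y - w) - \<psi> w * g (z - w) - (Re (y - z) * (\<psi> w * partial_x g (z - w)) + Im (y - z) * (\<psi> w * partial_y g (z - w)))" for w
        by (simp add: E_def algebra_simps)
      have intE: "integrable lborel E"
        unfolding Eq by (intro Bochner_Integration.integrable_diff Bochner_Integration.integrable_add integrable_mult_right ints)
      have "conv \<psi> g y - conv \<psi> g z - (Re (y - z) * conv \<psi> (partial_x g) z + Im (y - z) * conv \<psi> (partial_y g) z) = (\<integral>w. E w \<partial>lborel)"
        unfolding Eq conv_def
        by (simp add: ints)
      also have "norm \<dots> \<le> (\<integral>w. norm (E w) \<partial>lborel)"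
        by (rule integral_norm_bound)
      also have "\<dots> \<le> (\<integral>w. e / (I + 1) * cmod (y - z) * \<bar>\<psi> w\<bar> \<partial>lborel)"
      proof (rule integral_mono)
        fix w
        have "norm (E w) = \<bar>\<psi> w\<bar> * \<bar>g ((z - w) + (y - z)) - g (z - w) - ?L (z - w) (y - z)\<bar>"
          by (simp add: E_def abs_mult)
        also have "\<dots> \<le> \<bar>\<psi> w\<bar> * (e / (I + 1) * cmod (y - z))"
          by (intro mult_left_mono d(2) y) simp
        finally show "norm (E w) \<le> e / (I + 1) * cmod (y - z) * \<bar>\<psi> w\<bar>" by (simp add: mult.commute)
      qed (use intE \<psi> in auto)
      also have "\<dots> = e / (I + 1) * I * cmod (y - z)"
        by (simp add: I_def)
      also have "\<dots> \<le> e * cmod (y - z)"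
        using I \<open>0 < e\<close> by (intro mult_right_mono) (auto simp: field_simps)
      finally show "norm (conv \<psi> g y - conv \<psi> g z -
       (Re (y - z) * conv \<psi> (partial_x g) z + Im (y - z) * conv \<psi> (partial_y g) z)) \<le> e * norm (y - z)" .
    qed
  qed
qed

lemma conv_smooth:
  assumes \<psi>: "integrable lborel \<psi>" and g: "smooth g" and r: "\<And>z. r < cmod z \<Longrightarrow> g z = 0"
  shows "smooth (conv \<psi> g)" and "laplacian (conv \<psi> g) = conv \<psi> (laplacian g)"
proof -
  have part: "partial_x (conv \<psi> g) = conv \<psi> (partial_x g)" "partial_y (conv \<psi> g) = conv \<psi> (partial_y g)"
    if "smooth g" "\<And>z. r < cmod z \<Longrightarrow> g z = 0" for g
    using partial_has_derivative[OF conv_has_derivative[OF \<psi> that]] by auto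
  let ?P = "\<lambda>G. \<exists>g. smooth g \<and> (\<forall>z. r < cmod z \<longrightarrow> g z = 0) \<and> G = conv \<psi> g"
  show "smooth (conv \<psi> g)"
  proof (rule smooth_coinduct[of ?P])
    show "?P (conv \<psi> g)" using g r by blast
  next
    fix G assume "?P G"
    then obtain g where G: "smooth g" "\<And>z. r < cmod z \<Longrightarrow> g z = 0" "G = conv \<psi> g" by blast
    have "G differentiable_on UNIV"
      using conv_has_derivative[OF \<psi> G(1,2)] unfolding G(3) differentiable_on_def differentiable_def by blast
    moreover have "partial_x G = conv \<psi> (partial_x g)" "partial_y G = conv \<psi> (partial_y g)"
      using part[OF G(1,2)] G(3) by simp_all
    then have "?P (partial_x G)" "?P (partial_y G)"
      using smoothD(1,2)[OF G(1)] partial_compact_support[of r g] G(2) by auto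
    ultimately show "G differentiable_on UNIV \<and> ?P (partial_x G) \<and> ?P (partial_y G)" by blast
  qed
  have gx: "smooth (partial_x g)" "smooth (partial_y g)" using g smoothD by blast+
  have zx: "partial_x g z = 0" "partial_y g z = 0" if "r < cmod z" for z
    using partial_compact_support[of r g z] r that by auto
  have zxx: "partial_x (partial_x g) z = 0" "partial_y (partial_y g) z = 0" if "r < cmod z" for z
    using partial_compact_support[of r "partial_x g" z] partial_compact_support[of r "partial_y g" z] zx that by auto
  have "integrable lborel (\<lambda>w. \<psi> w * partial_x (partial_x g) (z - w))"
    "integrable lborel (\<lambda>w. \<psi> w * partial_y (partial_y g) (z - w))" for z
    using integrable_conv[OF \<psi> smoothD(4)[OF smoothD(1)[OF gx(1)]] zxx(1)]
      integrable_conv[OF \<psi> smoothD(4)[OF smoothD(2)[OF gx(2)]] zxx(2)] by auto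
  then show "laplacian (conv \<psi> g) = conv \<psi> (laplacian g)"
    using part[of g, OF g r] part(1)[of "partial_x g", OF gx(1) zx(1)] part(2)[of "partial_y g", OF gx(2) zx(2)]
    by (auto simp: laplacian_def[abs_def] conv_def distrib_left)
qed

lemma conv_eq_0:
  assumes "\<And>w. w \<notin> K \<Longrightarrow> \<psi> w = 0" "\<And>z. r < cmod z \<Longrightarrow> g z = 0"
    and "\<And>w. w \<in> K \<Longrightarrow> r < dist z w"
  shows "conv \<psi> g z = 0"
proof -
  have "\<psi> w * g (z - w) = 0" for w
    using assms by (cases "w \<in> K") (auto simp: dist_norm)
  then have "(\<lambda>w. \<psi> w * g (z - w)) = (\<lambda>_. 0)" by blast
  then show ?thesis by (simp add: conv_def)
qed

lemma conv_test_function: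
  assumes \<psi>: "integrable lborel \<psi>" and g: "smooth g" and r: "\<And>z. r < cmod z \<Longrightarrow> g z = 0"
    and K: "compact K" "\<And>w. w \<notin> K \<Longrightarrow> \<psi> w = 0" and KD: "\<And>w. w \<in> K \<Longrightarrow> cball w r \<subseteq> D"
  shows "test_function D (conv \<psi> g)"
proof -
  define S where "S = {x + y |x y. x \<in> K \<and> y \<in> cball 0 r}"
  have S: "compact S"
    unfolding S_def by (intro compact_sums K compact_cball)
  have SD: "S \<subseteq> D"
    using KD by (auto simp: S_def dist_norm subset_iff)
  have sub: "{z. conv \<psi> g z \<noteq> 0} \<subseteq> S"
  proof clarify
    fix z assume nz: "conv \<psi> g z \<noteq> 0"
    have "\<exists>w\<in>K. dist z w \<le> r"
    proof (rule ccontr)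
      assume "\<not> (\<exists>w\<in>K. dist z w \<le> r)"
      then have "conv \<psi> g z = 0"
        by (intro conv_eq_0[of K \<psi> r g z] K(2) r) auto
      then show False using nz by simp
    qed
    then obtain w where w: "w \<in> K" "dist z w \<le> r" by blast
    then have "z = w + (z - w)" "z - w \<in> cball 0 r" by (auto simp: dist_norm norm_minus_commute)
    then show "z \<in> S" using w(1) unfolding S_def by blast
  qed
  then have cl: "closure {z. conv \<psi> g z \<noteq> 0} \<subseteq> S"
    using S by (simp add: closure_minimal compact_imp_closed)
  moreover have "compact (closure {z. conv \<psi> g z \<noteq> 0})"
    using bounded_subset[OF compact_imp_bounded[OF S] sub] by (simp add: compact_closure)
  ultimately show ?thesis
    using SD conv_smooth(1)[OF \<psi> g r] by (auto simp: test_function_def smooth_def)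
qed

section \<open>Green's identity against test functions\<close>

text \<open>The fundamental theorem on an interval beyond the support. Integrability of
  \<open>G'\<close> need not be assumed: otherwise its integral is 0 by convention.\<close>

lemma integral_deriv_compact_support:
  fixes G :: "real \<Rightarrow> real"
  assumes G: "\<And>x. (G has_real_derivative G' x) (at x)" and L: "\<And>x. L < \<bar>x\<bar> \<Longrightarrow> G x = 0"
  shows "(\<integral>x. G' x \<partial>lborel) = 0"
proof (cases "integrable lborel G'")
  case True
  define b where "b = \<bar>L\<bar> + 1"
  have b: "b > 0" "L < b" by (auto simp: b_def)
  have "(G' has_integral (G b - G (- b))) {- b..b}"
    by (rule fundamental_theorem_of_calculus)
       (use b has_field_derivative_at_within[OF G] in \<open>auto simp: has_real_derivative_iff_has_vector_derivative[symmetric]\<close>)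
  then have "(G' has_integral 0) {- b..b}"
    using L[of b] L[of "- b"] b by (simp add: b_def)
  moreover have "G' x = 0" if "x \<notin> {- b..b}" for x
  proof -
    have "((\<lambda>_. 0) has_real_derivative 0) (at x)" by simp
    then have "(G has_real_derivative 0) (at x)"
      by (rule has_field_derivative_transform_within_open[where S = "{..<-b} \<union> {b<..}"])
         (use that L in \<open>auto simp: b_def\<close>)
    then show ?thesis using G DERIV_unique by blast
  qed
  ultimately have "(G' has_integral 0) UNIV"
    by (rule has_integral_on_superset) auto
  moreover have "(G' has_integral (\<integral>x. G' x \<partial>lborel)) UNIV"
    using True by (rule has_integral_integral_lborel)
  ultimately show ?thesis by (rule has_integral_unique[symmetric])
qed (rule not_integrable_integral_eq)

lemma test_functionE:
  assumes "test_function U \<phi>"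
  obtains K where "compact K" "K \<subseteq> U" "smooth \<phi>"
    "\<And>z. z \<notin> K \<Longrightarrow> \<phi> z = 0" "\<And>z. z \<notin> K \<Longrightarrow> laplacian \<phi> z = 0"
    "\<And>z. z \<notin> K \<Longrightarrow> partial_x \<phi> z = 0" "\<And>z. z \<notin> K \<Longrightarrow> partial_y \<phi> z = 0"
    "\<And>z. z \<notin> K \<Longrightarrow> partial_x (partial_x \<phi>) z = 0" "\<And>z. z \<notin> K \<Longrightarrow> partial_y (partial_y \<phi>) z = 0"
proof -
  define K where "K = closure {z. \<phi> z \<noteq> 0}"
  have K: "compact K" "K \<subseteq> U" "smooth \<phi>"
    using assms by (auto simp: test_function_def smooth_def K_def)
  have 0: "\<phi> z = 0" if "z \<notin> K" for z
    using that closure_subset[of "{z. \<phi> z \<noteq> 0}"] unfolding K_def by blast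
  have op: "open (- K)" unfolding K_def by (intro open_Compl closed_closure)
  have 1: "partial_x \<phi> z = 0" "partial_y \<phi> z = 0" if "z \<notin> K" for z
    using partial_locally_zero[OF op, of z \<phi>] that 0 by auto
  have 2: "partial_x (partial_x \<phi>) z = 0" "partial_y (partial_y \<phi>) z = 0" if "z \<notin> K" for z
    using partial_locally_zero[OF op, of z "partial_x \<phi>"] partial_locally_zero[OF op, of z "partial_y \<phi>"]
      that 1 by auto
  have 3: "laplacian \<phi> z = 0" if "z \<notin> K" for z
    using 2 that by (simp add: laplacian_def)
  show thesis by (rule that[OF K 0 3 1 2])
qed

text \<open>On every horizontal line V \<phi>_xx - V_xx \<phi> is the derivative of V \<phi>_x - V_x
  \<phi>, which has compact support; likewise vertically. The derivatives of \<open>V\<close> are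
  supplied as functions because \<open>V\<close> is regular only on \<open>U\<close>.\<close>

lemma green_identity:
  assumes U: "open U" and \<phi>: "test_function U \<phi>"
    and Vx: "\<And>z. z \<in> U \<Longrightarrow> ((\<lambda>x. V (Complex x (Im z))) has_real_derivative Vx z) (at (Re z))"
    and Vxx: "\<And>z. z \<in> U \<Longrightarrow> ((\<lambda>x. Vx (Complex x (Im z))) has_real_derivative Vxx z) (at (Re z))"
    and Vy: "\<And>z. z \<in> U \<Longrightarrow> ((\<lambda>y. V (Complex (Re z) y)) has_real_derivative Vy z) (at (Im z))"
    and Vyy: "\<And>z. z \<in> U \<Longrightarrow> ((\<lambda>y. Vy (Complex (Re z) y)) has_real_derivative Vyy z) (at (Im z))"
    and cont: "continuous_on U V" "continuous_on U Vxx" "continuous_on U Vyy"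
  shows "integrable lborel (\<lambda>z. V z * laplacian \<phi> z)"
    and "integrable lborel (\<lambda>z. \<phi> z * (Vxx z + Vyy z))"
    and "(\<integral>z. V z * laplacian \<phi> z \<partial>lborel) = (\<integral>z. \<phi> z * (Vxx z + Vyy z) \<partial>lborel)"
proof -
  obtain K where K: "compact K" "K \<subseteq> U" "smooth \<phi>"
    and z0: "\<And>z. z \<notin> K \<Longrightarrow> \<phi> z = 0" and z3: "\<And>z. z \<notin> K \<Longrightarrow> laplacian \<phi> z = 0"
    and z1: "\<And>z. z \<notin> K \<Longrightarrow> partial_x \<phi> z = 0" "\<And>z. z \<notin> K \<Longrightarrow> partial_y \<phi> z = 0"
    and z2: "\<And>z. z \<notin> K \<Longrightarrow> partial_x (partial_x \<phi>) z = 0" "\<And>z. z \<notin> K \<Longrightarrow> partial_y (partial_y \<phi>) z = 0"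
    using test_functionE[OF \<phi>, of thesis] by blast
  obtain L where L: "\<And>z. z \<in> K \<Longrightarrow> cmod z \<le> L"
    using compact_imp_bounded[OF K(1)] unfolding bounded_iff by blast
  note sm = K(3) smoothD(1,2)[OF K(3)]
  note sm2 = smoothD(1)[OF sm(2)] smoothD(2)[OF sm(3)]
  have int: "integrable lborel (\<lambda>z. g z * h z)"
    if "continuous_on U g" "continuous_on UNIV h" "\<And>z. z \<notin> K \<Longrightarrow> h z = 0" for g h :: "complex \<Rightarrow> real"
    by (rule integrable_continuous_compact_support[OF K(1)])
       (use that K(2) in \<open>auto intro!: continuous_on_mult intro: continuous_on_subset\<close>)
  have i1: "integrable lborel (\<lambda>z. V z * partial_x (partial_x \<phi>) z)"
    "integrable lborel (\<lambda>z. V z * partial_y (partial_y \<phi>) z)"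
    by (intro int cont smoothD(4)[OF sm2(1)] smoothD(4)[OF sm2(2)] z2; assumption)+
  have i2: "integrable lborel (\<lambda>z. Vxx z * \<phi> z)" "integrable lborel (\<lambda>z. Vyy z * \<phi> z)"
    by (intro int cont smoothD(4)[OF sm(1)] z0; assumption)+
  have op: "open (- K)" using compact_imp_closed[OF K(1)] by auto
  have eqx: "(\<integral>z. (V z * partial_x (partial_x \<phi>) z - Vxx z * \<phi> z) \<partial>lborel) = 0"
  proof -
    have "(\<integral>x. (V (Complex x y) * partial_x (partial_x \<phi>) (Complex x y)
        - Vxx (Complex x y) * \<phi> (Complex x y)) \<partial>lborel) = 0" for y
    proof (rule integral_deriv_compact_support[of "\<lambda>x. V (Complex x y) * partial_x \<phi> (Complex x y)
        - Vx (Complex x y) * \<phi> (Complex x y)" _ L])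
      fix x
      show "((\<lambda>x. V (Complex x y) * partial_x \<phi> (Complex x y) - Vx (Complex x y) * \<phi> (Complex x y))
          has_real_derivative V (Complex x y) * partial_x (partial_x \<phi>) (Complex x y)
        - Vxx (Complex x y) * \<phi> (Complex x y)) (at x)"
      proof (cases "Complex x y \<in> K")
        case True
        then have "Complex x y \<in> U" using K by blast
        then show ?thesis
          using Vx[of "Complex x y"] Vxx[of "Complex x y"]
          by (auto intro!: derivative_eq_intros smooth_slices(1)[OF sm(1)] smooth_slices(1)[OF sm(2)]
              simp: algebra_simps)
      next
        \<comment> \<open>Nothing is known of \<open>V\<close> outside \<open>U\<close>, but off
          \<open>K\<close> the whole expression is locally 0.\<close>
        case False
        have "open ((\<lambda>x. Complex x y) -` (- K))"
          by (intro open_vimage op) (auto intro!: continuous_intros simp: Complex_eq)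
        then have "((\<lambda>x. V (Complex x y) * partial_x \<phi> (Complex x y) - Vx (Complex x y) * \<phi> (Complex x y))
          has_real_derivative 0) (at x)"
          by (rule has_field_derivative_transform_within_open[where f = "\<lambda>_. 0" and a = x, rotated])
             (use False z0 z1 in auto)
        then show ?thesis using False z0 z2 by simp
      qed
    next
      fix x assume "L < \<bar>x\<bar>"
      then have "Complex x y \<notin> K"
        using L[of "Complex x y"] abs_Re_le_cmod[of "Complex x y"] by auto
      then show "V (Complex x y) * partial_x \<phi> (Complex x y) - Vx (Complex x y) * \<phi> (Complex x y) = 0"
        using z0 z1 by simp
    qed
    then show ?thesis
      by (subst integral_complex(1)) (use i1 i2 in auto)
  qed
  have eqy: "(\<integral>z. (V z * partial_y (partial_y \<phi>) z - Vyy z * \<phi> z) \<partial>lborel) = 0"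
  proof -
    have "(\<integral>y. (V (Complex x y) * partial_y (partial_y \<phi>) (Complex x y)
        - Vyy (Complex x y) * \<phi> (Complex x y)) \<partial>lborel) = 0" for x
    proof (rule integral_deriv_compact_support[of "\<lambda>y. V (Complex x y) * partial_y \<phi> (Complex x y)
        - Vy (Complex x y) * \<phi> (Complex x y)" _ L])
      fix y
      show "((\<lambda>y. V (Complex x y) * partial_y \<phi> (Complex x y) - Vy (Complex x y) * \<phi> (Complex x y))
          has_real_derivative V (Complex x y) * partial_y (partial_y \<phi>) (Complex x y)
        - Vyy (Complex x y) * \<phi> (Complex x y)) (at y)"
      proof (cases "Complex x y \<in> K")
        case True
        then have "Complex x y \<in> U" using K by blast
        then show ?thesis
          using Vy[of "Complex x y"] Vyy[of "Complex x y"]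
          by (auto intro!: derivative_eq_intros smooth_slices(2)[OF sm(1)] smooth_slices(2)[OF sm(3)]
              simp: algebra_simps)
      next
        case False
        have "open ((\<lambda>y. Complex x y) -` (- K))"
          by (intro open_vimage op) (auto intro!: continuous_intros simp: Complex_eq)
        then have "((\<lambda>y. V (Complex x y) * partial_y \<phi> (Complex x y) - Vy (Complex x y) * \<phi> (Complex x y))
          has_real_derivative 0) (at y)"
          by (rule has_field_derivative_transform_within_open[where f = "\<lambda>_. 0" and a = y, rotated])
             (use False z0 z1 in auto)
        then show ?thesis using False z0 z2 by simp
      qed
    next
      fix y assume "L < \<bar>y\<bar>"
      then have "Complex x y \<notin> K"
        using L[of "Complex x y"] abs_Im_le_cmod[of "Complex x y"] by auto
      then show "V (Complex x y) * partial_y \<phi> (Complex x y) - Vy (Complex x y) * \<phi> (Complex x y) = 0"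
        using z0 z1 by simp
    qed
    then show ?thesis
      by (subst integral_complex(2)) (use i1 i2 in auto)
  qed
  have e1: "(\<lambda>z. V z * laplacian \<phi> z) = (\<lambda>z. V z * partial_x (partial_x \<phi>) z + V z * partial_y (partial_y \<phi>) z)"
    by (auto simp: laplacian_def distrib_left)
  have e2: "(\<lambda>z. \<phi> z * (Vxx z + Vyy z)) = (\<lambda>z. Vxx z * \<phi> z + Vyy z * \<phi> z)"
    by (auto simp: algebra_simps)
  show "integrable lborel (\<lambda>z. V z * laplacian \<phi> z)"
    unfolding e1 using i1 by (rule Bochner_Integration.integrable_add)
  show "integrable lborel (\<lambda>z. \<phi> z * (Vxx z + Vyy z))"
    unfolding e2 using i2 by (rule Bochner_Integration.integrable_add)
  show "(\<integral>z. V z * laplacian \<phi> z \<partial>lborel) = (\<integral>z. \<phi> z * (Vxx z + Vyy z) \<partial>lborel)"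
    unfolding e1 e2 using eqx eqy i1 i2 by simp
qed

section \<open>Submean property and Laplacian\<close>

lemma nn_integral_Icc_continuous:
  fixes f :: "real \<Rightarrow> real"
  assumes "continuous_on {a..b} f" "\<And>x. x \<in> {a..b} \<Longrightarrow> 0 \<le> f x"
  shows "(\<integral>\<^sup>+x\<in>{a..b}. ennreal (f x) \<partial>lborel) = ennreal (integral {a..b} f)"
proof -
  have int: "integrable lborel (\<lambda>x. indicator {a..b} x *\<^sub>R f x)"
    by (rule borel_integrable_compact) (use assms in auto)
  have "(\<integral>\<^sup>+x\<in>{a..b}. ennreal (f x) \<partial>lborel) = (\<integral>\<^sup>+x. ennreal (indicator {a..b} x *\<^sub>R f x) \<partial>lborel)"
    by (intro nn_integral_cong) (auto split: split_indicator)
  also have "\<dots> = ennreal (\<integral>x. indicator {a..b} x *\<^sub>R f x \<partial>lborel)"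
    using int assms by (intro nn_integral_eq_integral) (auto split: split_indicator)
  also have "(\<integral>x. indicator {a..b} x *\<^sub>R f x \<partial>lborel) = integral {a..b} f"
    using set_borel_integral_eq_integral(2)[of "{a..b}" f] int
    by (simp add: set_integrable_def set_lebesgue_integral_def)
  finally show ?thesis .
qed

text \<open>The mean value theorem along the segment needs only that both first partials are
  differentiable at \<open>z\<close>. Symmetry of the mixed partials is not established; they enter
  through their sum, multiplied by Re h * Im h, which averages to 0 over a circle.\<close>

lemma smooth_taylor2:
  assumes "smooth \<phi>" "0 < e"
  obtains d where "0 < d" "\<And>h. cmod h < d \<Longrightarrow> \<bar>\<phi> (z + h) - \<phi> z
    - (Re h * partial_x \<phi> z + Im h * partial_y \<phi> z)
    - ((Re h)\<^sup>2 * partial_x (partial_x \<phi>) z + Re h * Im h * (partial_y (partial_x \<phi>) z + partial_x (partial_y \<phi>) z)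
       + (Im h)\<^sup>2 * partial_y (partial_y \<phi>) z) / 2\<bar> \<le> e * (cmod h)\<^sup>2"
proof -
  define L where "L h = Re h * partial_x \<phi> z + Im h * partial_y \<phi> z" for h
  define Lx where "Lx h = Re h * partial_x (partial_x \<phi>) z + Im h * partial_y (partial_x \<phi>) z" for h
  define Ly where "Ly h = Re h * partial_x (partial_y \<phi>) z + Im h * partial_y (partial_y \<phi>) z" for h
  define Q where "Q h = Re h * Lx h + Im h * Ly h" for h
  have e2: "0 < e/2" using assms by simp
  have "(partial_x \<phi> has_derivative Lx) (at z)" "(partial_y \<phi> has_derivative Ly) (at z)"
    unfolding Lx_def[abs_def] Ly_def[abs_def] using assms by (intro smoothD(6) smoothD(1,2); simp)+
  then obtain d1 d2 where d: "d1 > 0" "d2 > 0"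
    "\<And>y. norm (y - z) < d1 \<Longrightarrow> norm (partial_x \<phi> y - partial_x \<phi> z - Lx (y - z)) \<le> e/2 * norm (y - z)"
    "\<And>y. norm (y - z) < d2 \<Longrightarrow> norm (partial_y \<phi> y - partial_y \<phi> z - Ly (y - z)) \<le> e/2 * norm (y - z)"
    unfolding has_derivative_at_alt using e2 by metis
  show thesis
  proof (rule that[of "min d1 d2"])
    show "0 < min d1 d2" using d by simp
    fix h assume h: "cmod h < min d1 d2"
    define E where "E t = \<phi> (z + of_real t * h) - t * L h - t\<^sup>2 * Q h / 2" for t :: real
    define E' where "E' t = Re h * (partial_x \<phi> (z + of_real t * h) - partial_x \<phi> z - t * Lx h)
      + Im h * (partial_y \<phi> (z + of_real t * h) - partial_y \<phi> z - t * Ly h)" for t :: real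
    have der: "(E has_real_derivative E' t) (at t)" for t
    proof -
      have "((\<lambda>t. z + of_real t * h) has_derivative (\<lambda>s. of_real s * h)) (at t)"
        by (auto intro!: derivative_eq_intros)
      from has_derivative_compose[OF this smoothD(6)[OF assms(1)]]
      have "((\<lambda>t. \<phi> (z + of_real t * h)) has_derivative (*) (Re h * partial_x \<phi> (z + of_real t * h)
          + Im h * partial_y \<phi> (z + of_real t * h))) (at t)"
        by (rule has_derivative_eq_rhs) (auto simp: fun_eq_iff algebra_simps)
      then have *: "((\<lambda>t. \<phi> (z + of_real t * h)) has_real_derivative (Re h * partial_x \<phi> (z + of_real t * h)
          + Im h * partial_y \<phi> (z + of_real t * h))) (at t)"
        by (simp add: has_field_derivative_def)
      show ?thesis
        unfolding E_def
        by (rule DERIV_cong, (rule derivative_eq_intros * refl | simp)+)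
           (simp add: E'_def L_def Q_def algebra_simps)
    qed
    have bound: "\<bar>E' t\<bar> \<le> e * (cmod h)\<^sup>2" if t: "0 \<le> t" "t \<le> 1" for t
    proof -
      have th: "cmod (of_real t * h) \<le> cmod h"
        using t by (simp add: norm_mult mult_left_le_one_le)
      have lin: "Lx (of_real t * h) = t * Lx h" "Ly (of_real t * h) = t * Ly h"
        by (auto simp: Lx_def Ly_def algebra_simps)
      have "\<bar>partial_x \<phi> (z + of_real t * h) - partial_x \<phi> z - t * Lx h\<bar> \<le> e/2 * cmod (of_real t * h)"
        using d(3)[of "z + of_real t * h"] th h lin by simp
      also have "\<dots> \<le> e/2 * cmod h" using th assms by (intro mult_left_mono) auto
      finally have 1: "\<bar>partial_x \<phi> (z + of_real t * h) - partial_x \<phi> z - t * Lx h\<bar> \<le> e/2 * cmod h" .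
      have "\<bar>partial_y \<phi> (z + of_real t * h) - partial_y \<phi> z - t * Ly h\<bar> \<le> e/2 * cmod (of_real t * h)"
        using d(4)[of "z + of_real t * h"] th h lin by simp
      also have "\<dots> \<le> e/2 * cmod h" using th assms by (intro mult_left_mono) auto
      finally have 2: "\<bar>partial_y \<phi> (z + of_real t * h) - partial_y \<phi> z - t * Ly h\<bar> \<le> e/2 * cmod h" .
      have "\<bar>E' t\<bar> \<le> \<bar>Re h\<bar> * \<bar>partial_x \<phi> (z + of_real t * h) - partial_x \<phi> z - t * Lx h\<bar>
         + \<bar>Im h\<bar> * \<bar>partial_y \<phi> (z + of_real t * h) - partial_y \<phi> z - t * Ly h\<bar>"
        unfolding E'_def by (metis abs_mult abs_triangle_ineq)
      also have "\<dots> \<le> cmod h * (e/2 * cmod h) + cmod h * (e/2 * cmod h)"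
        using 1 2 abs_Re_le_cmod[of h] abs_Im_le_cmod[of h] by (intro add_mono mult_mono) auto
      finally show ?thesis by (simp add: power2_eq_square algebra_simps)
    qed
    have "\<exists>t>0. t < 1 \<and> E 1 - E 0 = (1 - 0) * E' t"
      by (rule MVT2) (use der in auto)
    then have "\<bar>E 1 - E 0\<bar> \<le> e * (cmod h)\<^sup>2" using bound by auto
    moreover have "E 1 - E 0 = \<phi> (z + h) - \<phi> z - L h - Q h / 2"
      by (simp add: E_def)
    moreover have "Q h = (Re h)\<^sup>2 * partial_x (partial_x \<phi>) z + Re h * Im h * (partial_y (partial_x \<phi>) z + partial_x (partial_y \<phi>) z)
       + (Im h)\<^sup>2 * partial_y (partial_y \<phi>) z"
      by (simp add: Q_def Lx_def Ly_def power2_eq_square algebra_simps)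
    ultimately show "\<bar>\<phi> (z + h) - \<phi> z
    - (Re h * partial_x \<phi> z + Im h * partial_y \<phi> z)
    - ((Re h)\<^sup>2 * partial_x (partial_x \<phi>) z + Re h * Im h * (partial_y (partial_x \<phi>) z + partial_x (partial_y \<phi>) z)
       + (Im h)\<^sup>2 * partial_y (partial_y \<phi>) z) / 2\<bar> \<le> e * (cmod h)\<^sup>2"
      by (simp add: L_def)
  qed
qed

lemma has_integral_trig_quadratic:
  fixes a b c d e :: real
  shows "((\<lambda>\<theta>. a * cos \<theta> + b * sin \<theta> + c * (cos \<theta>)\<^sup>2 + d * (cos \<theta> * sin \<theta>) + e * (sin \<theta>)\<^sup>2)
    has_integral pi * (c + e)) {0..2*pi}"
proof -
  define G where "G \<theta> = a * sin \<theta> - b * cos \<theta> + c * (\<theta> + sin \<theta> * cos \<theta>) / 2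
      + d * (sin \<theta>)\<^sup>2 / 2 + e * (\<theta> - sin \<theta> * cos \<theta>) / 2" for \<theta>
  have "(G has_real_derivative a * cos \<theta> + b * sin \<theta> + c * (cos \<theta>)\<^sup>2 + d * (cos \<theta> * sin \<theta>) + e * (sin \<theta>)\<^sup>2) (at \<theta>)" for \<theta>
  proof -
    have cs: "1 = (cos \<theta>)\<^sup>2 + (sin \<theta>)\<^sup>2" by simp
    have "(G has_real_derivative a * cos \<theta> + b * sin \<theta> + c * (1 + (cos \<theta> * cos \<theta> - sin \<theta> * sin \<theta>)) / 2
       + d * (2 * sin \<theta> * cos \<theta>) / 2 + e * (1 - (cos \<theta> * cos \<theta> - sin \<theta> * sin \<theta>)) / 2) (at \<theta>)"
      unfolding G_def by (auto intro!: derivative_eq_intros simp: field_simps)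
    moreover have "1 + (cos \<theta> * cos \<theta> - sin \<theta> * sin \<theta>) = 2 * (cos \<theta>)\<^sup>2"
      using cs by algebra
    moreover have "1 - (cos \<theta> * cos \<theta> - sin \<theta> * sin \<theta>) = 2 * (sin \<theta>)\<^sup>2"
      using cs by algebra
    ultimately show ?thesis
      by (simp add: mult.commute)
  qed
  note der = has_field_derivative_at_within[OF this]
  have "((\<lambda>\<theta>. a * cos \<theta> + b * sin \<theta> + c * (cos \<theta>)\<^sup>2 + d * (cos \<theta> * sin \<theta>) + e * (sin \<theta>)\<^sup>2)
    has_integral G (2 * pi) - G 0) {0..2*pi}"
    by (intro fundamental_theorem_of_calculus)
       (auto intro: der simp: has_real_derivative_iff_has_vector_derivative[symmetric])
  then show ?thesis by (simp add: G_def field_simps)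
qed

text \<open>The mean of the second order Taylor polynomial over a circle of radius \<rho> is
  \<phi>(z) + \<rho>^2 \<Delta>\<phi>(z) / 4. Writing the submean inequality for L - \<phi> \<ge> 0
  keeps it within nonnegative integrals.\<close>

lemma laplacian_nonneg_of_submean:
  assumes \<phi>: "smooth \<phi>" and L: "\<And>w. \<phi> w \<le> L" and r0: "0 < r0"
    and mean: "\<And>\<rho>. 0 < \<rho> \<Longrightarrow> \<rho> < r0 \<Longrightarrow>
        (\<integral>\<^sup>+\<theta>\<in>{0..2*pi}. ennreal (L - \<phi> (z + of_real \<rho> * cis \<theta>)) \<partial>lborel) \<le> ennreal (2 * pi) * ennreal (L - \<phi> z)"
  shows "0 \<le> laplacian \<phi> z"
proof (rule field_le_epsilon)
  fix e' :: real assume "0 < e'"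
  \<comment> \<open>The Taylor error contributes 2 pi \<rho>^2 e'/4, the Laplacian (pi \<rho>^2 / 2)
    \<Delta>\<phi>(z); the common factor leaves \<Delta>\<phi>(z) + e'.\<close>
  then have e: "0 < e'/4" by simp
  obtain d where d: "0 < d" and taylor: "\<And>h. cmod h < d \<Longrightarrow> \<bar>\<phi> (z + h) - \<phi> z
    - (Re h * partial_x \<phi> z + Im h * partial_y \<phi> z)
    - ((Re h)\<^sup>2 * partial_x (partial_x \<phi>) z + Re h * Im h * (partial_y (partial_x \<phi>) z + partial_x (partial_y \<phi>) z)
       + (Im h)\<^sup>2 * partial_y (partial_y \<phi>) z) / 2\<bar> \<le> e'/4 * (cmod h)\<^sup>2"
    using smooth_taylor2[OF \<phi> e, of z] by blast
  define \<rho> where "\<rho> = min d r0 / 2"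
  have \<rho>: "0 < \<rho>" "\<rho> < d" "\<rho> < r0" using d r0 by (auto simp: \<rho>_def)
  have contc: "continuous_on {0..2*pi} (\<lambda>\<theta>. \<phi> (z + of_real \<rho> * cis \<theta>))"
    by (rule continuous_on_compose2[OF smoothD(4)[OF \<phi>]]) (auto intro!: continuous_intros)
  have "ennreal (integral {0..2*pi} (\<lambda>\<theta>. L - \<phi> (z + of_real \<rho> * cis \<theta>))) \<le> ennreal (2 * pi * (L - \<phi> z))"
    using mean[of \<rho>] \<rho> L contc
    by (subst (asm) nn_integral_Icc_continuous) (auto simp: ennreal_mult intro!: continuous_intros)
  then have "integral {0..2*pi} (\<lambda>\<theta>. L - \<phi> (z + of_real \<rho> * cis \<theta>)) \<le> 2 * pi * (L - \<phi> z)"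
    by (subst (asm) ennreal_le_iff) (use L[of z] in auto)
  moreover have int: "(\<lambda>\<theta>. \<phi> (z + of_real \<rho> * cis \<theta>)) integrable_on {0..2*pi}"
    using contc by (rule integrable_continuous_real)
  have "integral {0..2*pi} (\<lambda>\<theta>. L - \<phi> (z + of_real \<rho> * cis \<theta>))
      = 2 * pi * L - integral {0..2*pi} (\<lambda>\<theta>. \<phi> (z + of_real \<rho> * cis \<theta>))"
    by (subst Henstock_Kurzweil_Integration.integral_diff) (use int in auto)
  ultimately have m: "2 * pi * \<phi> z \<le> integral {0..2*pi} (\<lambda>\<theta>. \<phi> (z + of_real \<rho> * cis \<theta>))"
    by (simp add: algebra_simps)
  define q where "q \<theta> = (\<rho> * partial_x \<phi> z) * cos \<theta> + (\<rho> * partial_y \<phi> z) * sin \<theta>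
     + (\<rho>\<^sup>2 / 2 * partial_x (partial_x \<phi>) z) * (cos \<theta>)\<^sup>2
     + (\<rho>\<^sup>2 / 2 * (partial_y (partial_x \<phi>) z + partial_x (partial_y \<phi>) z)) * (cos \<theta> * sin \<theta>)
     + (\<rho>\<^sup>2 / 2 * partial_y (partial_y \<phi>) z) * (sin \<theta>)\<^sup>2" for \<theta>
  have q: "(q has_integral pi * (\<rho>\<^sup>2 / 2 * laplacian \<phi> z)) {0..2*pi}"
    using has_integral_trig_quadratic[of "\<rho> * partial_x \<phi> z" "\<rho> * partial_y \<phi> z" "\<rho>\<^sup>2 / 2 * partial_x (partial_x \<phi>) z"
       "\<rho>\<^sup>2 / 2 * (partial_y (partial_x \<phi>) z + partial_x (partial_y \<phi>) z)" "\<rho>\<^sup>2 / 2 * partial_y (partial_y \<phi>) z"]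
    by (simp add: q_def[abs_def] laplacian_def distrib_left)
  have up: "\<phi> (z + of_real \<rho> * cis \<theta>) \<le> (\<phi> z + e'/4 * \<rho>\<^sup>2) + q \<theta>" for \<theta>
  proof -
    have n: "cmod (of_real \<rho> * cis \<theta>) = \<rho>" using \<rho> by (simp add: norm_mult)
    have "\<bar>\<phi> (z + of_real \<rho> * cis \<theta>) - \<phi> z - q \<theta>\<bar> \<le> e'/4 * \<rho>\<^sup>2"
    proof -
      have eq: "\<phi> (z + of_real \<rho> * cis \<theta>) - \<phi> z - q \<theta> = \<phi> (z + of_real \<rho> * cis \<theta>) - \<phi> z
        - (\<rho> * cos \<theta> * partial_x \<phi> z + \<rho> * sin \<theta> * partial_y \<phi> z)
        - ((\<rho> * cos \<theta>)\<^sup>2 * partial_x (partial_x \<phi>) z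
           + \<rho> * cos \<theta> * (\<rho> * sin \<theta>) * (partial_y (partial_x \<phi>) z + partial_x (partial_y \<phi>) z)
           + (\<rho> * sin \<theta>)\<^sup>2 * partial_y (partial_y \<phi>) z) / 2"
        unfolding q_def by (simp add: field_simps power2_eq_square)
      show ?thesis
        unfolding eq using taylor[of "of_real \<rho> * cis \<theta>"] \<rho> unfolding n by simp
    qed
    then show ?thesis by linarith
  qed
  have "((\<lambda>\<theta>. (\<phi> z + e'/4 * \<rho>\<^sup>2) + q \<theta>) has_integral ((2 * pi - 0) *\<^sub>R (\<phi> z + e'/4 * \<rho>\<^sup>2) + pi * (\<rho>\<^sup>2 / 2 * laplacian \<phi> z))) {0..2*pi}"
    by (intro has_integral_add q) (use has_integral_const_real[of "\<phi> z + e'/4 * \<rho>\<^sup>2" 0 "2*pi"] in simp)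
  then have "integral {0..2*pi} (\<lambda>\<theta>. \<phi> (z + of_real \<rho> * cis \<theta>))
     \<le> 2 * pi * (\<phi> z + e'/4 * \<rho>\<^sup>2) + pi * (\<rho>\<^sup>2 / 2 * laplacian \<phi> z)"
    using has_integral_le[OF integrable_integral[OF int]] up by fastforce
  with m have nn: "0 \<le> (pi * \<rho>\<^sup>2 / 2) * (laplacian \<phi> z + e')"
    by (simp add: algebra_simps)
  have pos: "0 < pi * \<rho>\<^sup>2 / 2" using \<rho> by simp
  show "0 \<le> laplacian \<phi> z + e'"
    using nn mult_pos_neg[OF pos, of "laplacian \<phi> z + e'"] by linarith
qed

section \<open>Subharmonic functions\<close>

lemma subharmonic_measurable:
  assumes "subharmonic_on S u"
  shows "(\<lambda>z. if z \<in> S then u z else - \<infinity>) \<in> borel_measurable borel"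
proof (rule borel_measurableI_less)
  fix a :: ereal
  have S: "open S" "open {z \<in> S. u z < a}" using assms by (auto simp: subharmonic_on_def)
  have "{z \<in> space borel. (if z \<in> S then u z else - \<infinity>) < a}
     = {z \<in> S. u z < a} \<union> (if - \<infinity> < a then - S else {})"
    by auto
  then show "{z \<in> space borel. (if z \<in> S then u z else - \<infinity>) < a} \<in> sets borel"
    using S by (auto intro!: sets.Un)
qed

text \<open>The gap between \<open>u\<close> and an upper bound \<open>a\<close>. Where u \<le> a,
  submean inequalities for \<open>u\<close> become supermean inequalities for a nonnegative
  function, to which Tonelli applies without integrability; u = -\<infinity> becomes
  \<infinity>.\<close>

definition defect :: "complex set \<Rightarrow> (complex \<Rightarrow> ereal) \<Rightarrow> real \<Rightarrow> complex \<Rightarrow> ennreal" where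
  "defect S u a z = (if z \<in> S then e2ennreal (ereal a - u z) else 0)"

lemma defect_measurable:
  assumes "subharmonic_on S u"
  shows "defect S u a \<in> borel_measurable borel"
proof -
  have [measurable]: "S \<in> sets borel" using assms by (auto simp: subharmonic_on_def)
  note [measurable] = subharmonic_measurable[OF assms]
  have "defect S u a = (\<lambda>z. if z \<in> S then e2ennreal (ereal a - (if z \<in> S then u z else - \<infinity>)) else 0)"
    by (auto simp: defect_def)
  also have "\<dots> \<in> borel_measurable borel" by measurable
  finally show ?thesis .
qed

text \<open>A rearrangement free of subtraction of a - g = a - g^+ + g^-, valid also at g =
  -\<infinity>.\<close>

lemma e2ennreal_split:
  assumes "g \<le> ereal a" "0 \<le> a"
  shows "e2ennreal (ereal a - g) + e2ennreal g = ennreal a + e2ennreal (- g)"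
proof (cases g)
  case (real x)
  then show ?thesis
    using assms by (cases "0 \<le> x") (auto simp: ennreal.abs_eq[symmetric] e2ennreal_ereal
        ennreal_plus[symmetric] ennreal_neg simp del: ennreal_plus)
qed (use assms in auto)

text \<open>The upper bound \<open>a\<close> makes the positive part integrable over the circle, so
  \<open>circle_mean\<close> is a genuine difference and the splitting above converts it into the
  integral of a - u.\<close>

lemma subharmonic_circle:
  assumes u: "subharmonic_on S u" and \<rho>: "0 < \<rho>" "cball z \<rho> \<subseteq> S"
    and a: "0 \<le> a" "\<And>w. w \<in> cball z \<rho> \<Longrightarrow> u w \<le> ereal a"
  shows "(\<integral>\<^sup>+\<theta>\<in>{0..2*pi}. defect S u a (z + of_real \<rho> * cis \<theta>) \<partial>lborel)
       \<le> ennreal (2 * pi) * defect S u a z"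
proof -
  define g where "g \<theta> = u (z + of_real \<rho> * cis \<theta>)" for \<theta>
  define A where "A = {0..2*pi}"
  have [measurable]: "A \<in> sets borel" by (simp add: A_def)
  have inC: "z + of_real \<rho> * cis \<theta> \<in> cball z \<rho>" for \<theta>
    using \<rho> by (simp add: dist_norm norm_mult)
  then have inS: "z + of_real \<rho> * cis \<theta> \<in> S" for \<theta> using \<rho> by blast
  have zS: "z \<in> S" using \<rho> by auto
  have [measurable]: "cis \<in> borel_measurable borel"
    by (intro borel_measurable_continuous_onI continuous_intros)
  have [measurable]: "g \<in> borel_measurable borel"
  proof -
    have "g = (\<lambda>\<theta>. (\<lambda>z. if z \<in> S then u z else - \<infinity>) (z + of_real \<rho> * cis \<theta>))"
      using inS by (auto simp: g_def)
    also have "\<dots> \<in> borel_measurable borel"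
      by (rule measurable_compose[OF _ subharmonic_measurable[OF u]]) measurable
    finally show ?thesis .
  qed
  have ga: "g \<theta> \<le> ereal a" for \<theta> unfolding g_def by (intro a inC)
  define Ip where "Ip = (\<integral>\<^sup>+\<theta>\<in>A. e2ennreal (g \<theta>) \<partial>lborel)"
  define Im where "Im = (\<integral>\<^sup>+\<theta>\<in>A. e2ennreal (- g \<theta>) \<partial>lborel)"
  define ID where "ID = (\<integral>\<^sup>+\<theta>\<in>A. e2ennreal (ereal a - g \<theta>) \<partial>lborel)"
  have cA: "(\<integral>\<^sup>+\<theta>\<in>A. ennreal a \<partial>lborel) = ennreal (2 * pi * a)"
    by (subst nn_integral_cmult_indicator) (auto simp: A_def ennreal_mult[symmetric] a mult.commute)
  have "ID + Ip = (\<integral>\<^sup>+\<theta>\<in>A. (e2ennreal (ereal a - g \<theta>) + e2ennreal (g \<theta>)) \<partial>lborel)"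
    unfolding ID_def Ip_def by (subst nn_integral_add[symmetric]) (auto simp: distrib_right)
  also have "\<dots> = (\<integral>\<^sup>+\<theta>\<in>A. (ennreal a + e2ennreal (- g \<theta>)) \<partial>lborel)"
    by (intro nn_integral_cong) (simp add: e2ennreal_split[OF ga a(1)])
  also have "\<dots> = ennreal (2 * pi * a) + Im"
    unfolding Im_def cA[symmetric] by (subst nn_integral_add[symmetric]) (auto simp: distrib_right)
  finally have eq: "ID + Ip = ennreal (2 * pi * a) + Im" .
  have "Ip \<le> (\<integral>\<^sup>+\<theta>\<in>A. ennreal a \<partial>lborel)"
    unfolding Ip_def using e2ennreal_mono[OF ga] a
    by (intro nn_integral_mono mult_right_mono) (auto simp: e2ennreal_ereal)
  then have Ipf: "Ip < \<infinity>" unfolding cA by (simp add: le_less_trans)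
  have sub: "u z \<le> ereal (1 / (2 * pi)) * (enn2ereal Ip - enn2ereal Im)"
    using u \<rho> unfolding subharmonic_on_def circle_mean_def ext_integral_def Ip_def Im_def A_def g_def by blast
  have goal: "(\<integral>\<^sup>+\<theta>\<in>{0..2*pi}. defect S u a (z + of_real \<rho> * cis \<theta>) \<partial>lborel) = ID"
    unfolding ID_def A_def by (simp add: defect_def inS g_def)
  have uz: "u z \<noteq> \<infinity>" using u zS by (auto simp: subharmonic_on_def)
  show ?thesis
  proof (cases "u z")
    case PInf
    then show ?thesis using uz by simp
  next
    case MInf
    then show ?thesis using zS by (simp add: defect_def ennreal_mult_top)
  next
    case (real x)
    obtain p where p: "Ip = ennreal p" "0 \<le> p" using Ipf by (cases Ip) auto
    \<comment> \<open>An infinite negative part would make the mean, and hence u(z), equal to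
      -\<infinity>.\<close>
    have "Im \<noteq> \<infinity>"
    proof
      assume "Im = \<infinity>"
      then have "u z \<le> - \<infinity>"
        using sub p by simp
      then show False using real by simp
    qed
    then obtain q where q: "Im = ennreal q" "0 \<le> q" by (cases Im) auto
    have "ID \<le> ID + Ip" by (simp add: add_increasing2)
    also have "\<dots> < \<infinity>" unfolding eq q(1) by simp
    finally have "ID < \<infinity>" .
    then obtain i where i: "ID = ennreal i" "0 \<le> i" by (cases ID) auto
    have x: "x \<le> (p - q) / (2 * pi)"
      using sub real p q by (simp add: enn2ereal_ennreal)
    have "ennreal (i + p) = ennreal (2 * pi * a + q)"
      using eq i p q a by (simp add: ennreal_plus)
    then have "i + p = 2 * pi * a + q"
      using i p q a by (subst (asm) ennreal_inj) auto
    moreover have "2 * pi * x \<le> p - q" using x by (simp add: field_simps)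
    ultimately have "i \<le> 2 * pi * (a - x)" by (simp add: algebra_simps)
    moreover have "x \<le> a" using a(2)[of z] \<rho> real by simp
    ultimately have "ID \<le> ennreal (2 * pi) * ennreal (a - x)"
      using i by (simp add: ennreal_mult[symmetric])
    then show ?thesis
      unfolding goal using real zS by (simp add: defect_def e2ennreal_ereal)
  qed
qed

lemma subharmonic_radial:
  assumes u: "subharmonic_on S u" and r: "cball z r \<subseteq> S"
    and a: "0 \<le> a" "\<And>w. w \<in> cball z r \<Longrightarrow> u w \<le> ereal a"
    and \<kappa>: "\<kappa> \<in> borel_measurable borel" "\<And>w. \<kappa> w = \<kappa> (of_real (cmod w))" "\<And>w. cmod w \<ge> r \<Longrightarrow> \<kappa> w = 0"
  shows "(\<integral>\<^sup>+w. defect S u a (z + w) * \<kappa> w \<partial>lborel) \<le> defect S u a z * (\<integral>\<^sup>+w. \<kappa> w \<partial>lborel)"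
proof (rule nn_integral_radial_le[OF defect_measurable[OF u] \<kappa>])
  fix \<rho> assume "0 < \<rho>" "\<rho> < r"
  then have "cball z \<rho> \<subseteq> cball z r" by auto
  then show "(\<integral>\<^sup>+\<theta>\<in>{0..2*pi}. defect S u a (z + of_real \<rho> * cis \<theta>) \<partial>lborel)
       \<le> ennreal (2 * pi) * defect S u a z"
    using r a \<open>0 < \<rho>\<close> by (intro subharmonic_circle[OF u]) auto
qed

lemma subharmonic_bounded_above_compact:
  assumes u: "subharmonic_on S u" and K: "compact K" "K \<subseteq> S"
  obtains a where "0 \<le> a" "\<And>z. z \<in> K \<Longrightarrow> u z \<le> ereal a"
proof -
  let ?U = "\<lambda>n::nat. {z \<in> S. u z < ereal (real n)}"
  have op: "\<And>n. open (?U n)" using u by (auto simp: subharmonic_on_def)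
  have "K \<subseteq> (\<Union>n. ?U n)"
  proof
    fix z assume "z \<in> K"
    then have "z \<in> S" "u z < \<infinity>" using K u by (auto simp: subharmonic_on_def)
    then obtain n where "u z < ereal (real n)"
      using less_PInf_Ex_of_nat by auto
    then show "z \<in> (\<Union>n. ?U n)" using \<open>z \<in> S\<close> by auto
  qed
  then obtain N where N: "finite N" "K \<subseteq> (\<Union>n\<in>N. ?U n)"
    using compactE_image[OF K(1), of UNIV ?U thesis] op by simp
  show thesis
  \<comment> \<open>The sum dominates every member of the finite set and is 0 for the empty one,
    where a maximum would be undefined.\<close>
  proof (rule that[of "real (\<Sum>N)"])
    fix z assume "z \<in> K"
    then obtain n where n: "n \<in> N" "u z < ereal (real n)" using N by blast
    have "n \<le> \<Sum>N" using N(1) n(1) member_le_sum[of n N "\<lambda>x. x"] by simp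
    then have "ereal (real n) \<le> ereal (real (\<Sum>N))" by (simp del: of_nat_sum)
    then show "u z \<le> ereal (real (\<Sum>N))" using n(2) by (metis less_imp_le order_trans)
  qed (simp add: sum_nonneg)
qed

lemma ball_sets_borel [measurable]: "ball z r \<in> sets (borel :: complex measure)"
  by simp

text \<open>The radial inequality with the indicator of a disc as kernel: a finite value at the
  centre bounds the integral over the disc.\<close>

lemma subharmonic_negative_part_disc:
  assumes u: "subharmonic_on S u" and r: "0 < r" "cball z r \<subseteq> S" and z: "u z \<noteq> - \<infinity>"
  shows "(\<integral>\<^sup>+w\<in>ball z r. defect S u 0 w \<partial>lborel) < \<infinity>"
proof -
  note [measurable] = defect_measurable[OF u]
  obtain a where a: "0 \<le> a" "\<And>w. w \<in> cball z r \<Longrightarrow> u w \<le> ereal a"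
    using subharmonic_bounded_above_compact[OF u, of "cball z r"] r by (auto simp: compact_cball)
  have "(\<integral>\<^sup>+w\<in>ball z r. defect S u 0 w \<partial>lborel) = (\<integral>\<^sup>+w. defect S u 0 (z + w) * indicator (ball z r) (z + w) \<partial>lborel)"
    by (rule nn_integral_lborel_translate[symmetric]) measurable
  also have "\<dots> \<le> (\<integral>\<^sup>+w. defect S u a (z + w) * indicator (ball 0 r) w \<partial>lborel)"
    using a(1) by (intro nn_integral_mono mult_mono)
      (auto simp: defect_def dist_norm intro!: e2ennreal_mono ereal_minus_mono split: split_indicator)
  also have "\<dots> \<le> defect S u a z * (\<integral>\<^sup>+w. indicator (ball (0::complex) r) w \<partial>lborel)"
    using subharmonic_radial[of S u z r a "indicator (ball 0 r)"] u r a by (auto simp: indicator_def)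
  also have "\<dots> < \<infinity>"
  proof -
    have "z \<in> S" using r by auto
    moreover have "u z \<noteq> \<infinity>" using u \<open>z \<in> S\<close> by (auto simp: subharmonic_on_def)
    ultimately have "defect S u a z < \<infinity>" using z by (cases "u z") (auto simp: defect_def e2ennreal_ereal)
    moreover have "(\<integral>\<^sup>+w. indicator (ball (0::complex) r) w \<partial>lborel) < \<infinity>"
      using emeasure_bounded_finite[of "ball (0::complex) r"] by simp
    ultimately show ?thesis by (simp add: ennreal_mult_less_top)
  qed
  finally show ?thesis .
qed

lemma open_AE_nonempty:
  assumes "open W" "W \<noteq> {}" "AE z in lborel. z \<in> W \<longrightarrow> P z"
  shows "\<exists>z\<in>W. P (z::complex)"
proof (rule ccontr)
  assume "\<not> (\<exists>z\<in>W. P z)"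
  with assms(3) have "AE z in lborel. z \<notin> W" by (auto elim: eventually_mono)
  then have "emeasure lborel W = 0"
    using assms(1) by (subst (asm) AE_iff_measurable[of W]) auto
  moreover obtain z r where "0 < r" "ball z r \<subseteq> W"
    using assms(1,2) openE by blast
  ultimately have "emeasure lborel (ball z r) = 0"
    using emeasure_mono[of "ball z r" W lborel] assms(1) by simp
  then show False
    using content_ball_pos[OF \<open>0 < r\<close>, of z] by (simp add: measure_def)
qed

text \<open>The points near which the negative part is integrable form a set \<open>T\<close> that
  is open and closed in \<open>S\<close>; it contains \<open>z0\<close>, so connectedness gives T =
  S, and finitely many discs cover \<open>K\<close>.\<close>

lemma subharmonic_locally_integrable:
  assumes u: "subharmonic_on S u" and S: "connected S" and z0: "z0 \<in> S" "u z0 \<noteq> - \<infinity>"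
    and K: "compact K" "K \<subseteq> S"
  shows "(\<integral>\<^sup>+w\<in>K. defect S u 0 w \<partial>lborel) < \<infinity>"
proof -
  note [measurable] = defect_measurable[OF u]
  have oS: "open S" using u by (simp add: subharmonic_on_def)
  define I where "I A = (\<integral>\<^sup>+w\<in>A. defect S u 0 w \<partial>lborel)" for A
  have I_mono: "I A \<le> I B" if "A \<subseteq> B" for A B
    unfolding I_def using that by (intro nn_integral_mono mult_left_mono) (auto split: split_indicator)
  define T where "T = {z \<in> S. \<exists>r>0. ball z r \<subseteq> S \<and> I (ball z r) < \<infinity>}"
  have "open T"
  proof (rule openI)
    fix z assume "z \<in> T"
    then obtain r where r: "r > 0" "ball z r \<subseteq> S" "I (ball z r) < \<infinity>" by (auto simp: T_def)
    have "y \<in> T" if "y \<in> ball z (r/2)" for y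
    proof -
      have sub: "ball y (r/2) \<subseteq> ball z r"
        using that by (auto intro!: subsetI simp: dist_commute) (smt (verit) dist_commute dist_triangle field_sum_of_halves)
      then have "I (ball y (r/2)) < \<infinity>" using I_mono r(3) le_less_trans by blast
      moreover have "y \<in> ball z r" using that r(1) by auto
      ultimately show ?thesis
        unfolding T_def using r sub by (auto intro!: exI[of _ "r/2"])
    qed
    then show "\<exists>e>0. ball z e \<subseteq> T" using r(1) by (intro exI[of _ "r/2"]) auto
  qed
  moreover have "open (S - T)"
  proof (rule openI)
    fix z assume z: "z \<in> S - T"
    obtain r' where r': "r' > 0" "cball z r' \<subseteq> S" using oS z open_contains_cball by blast
    define r where "r = r' / 2"
    have r: "r > 0" using r' by (simp add: r_def)
    \<comment> \<open>If \<open>y\<close> were in \<open>T\<close>, then u > -\<infinity> almost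
      everywhere near \<open>y\<close>. A point \<open>x\<close> of this kind within distance
      \<open>r\<close> of \<open>z\<close> is the centre of a disc of integrability that contains a
      neighbourhood of \<open>z\<close>.\<close>
    have "y \<notin> T" if y: "y \<in> ball z r" for y
    proof
      assume "y \<in> T"
      then obtain q where q: "q > 0" "ball y q \<subseteq> S" "I (ball y q) < \<infinity>" by (auto simp: T_def)
      have "AE w in lborel. defect S u 0 w * indicator (ball y q) w \<noteq> \<infinity>"
        using q(3) unfolding I_def by (intro nn_integral_PInf_AE) auto
      then have ae: "AE w in lborel. w \<in> ball y q \<inter> ball z r \<longrightarrow> defect S u 0 w \<noteq> \<infinity>"
        by (rule eventually_mono) (auto split: split_indicator_asm)
      moreover have "y \<in> ball y q \<inter> ball z r" using y q by simp
      ultimately obtain x where x: "x \<in> ball y q \<inter> ball z r" "defect S u 0 x \<noteq> \<infinity>"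
        using open_AE_nonempty[of "ball y q \<inter> ball z r" "\<lambda>w. defect S u 0 w \<noteq> \<infinity>"] by blast
      have "cball x r \<subseteq> cball z r'"
      proof
        fix w assume "w \<in> cball x r"
        then have "dist z w \<le> dist z x + dist x w" "dist x w \<le> r" "dist z x < r"
          using x(1) by (auto intro: dist_triangle)
        then show "w \<in> cball z r'" by (simp add: r_def)
      qed
      then have xS: "cball x r \<subseteq> S" using r' by blast
      then have "x \<in> S" using r by auto
      then have "u x \<noteq> - \<infinity>" using x(2) by (auto simp: defect_def)
      then have fin: "I (ball x r) < \<infinity>"
        unfolding I_def by (intro subharmonic_negative_part_disc[OF u r xS])
      define p where "p = r - dist x z"
      have p: "p > 0" using x(1) by (simp add: p_def dist_commute)
      have sub: "ball z p \<subseteq> ball x r"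
      proof
        fix w assume "w \<in> ball z p"
        then have "dist x w \<le> dist x z + dist z w" "dist z w < p"
          by (auto intro: dist_triangle)
        then show "w \<in> ball x r" by (simp add: p_def)
      qed
      then have "I (ball z p) < \<infinity>" using I_mono fin le_less_trans by blast
      moreover have "ball z p \<subseteq> S" using sub xS ball_subset_cball by blast
      ultimately have "z \<in> T" using p z by (auto simp: T_def)
      then show False using z by simp
    qed
    moreover have "ball z r \<subseteq> S" using r' r by (auto simp: r_def subset_iff)
    ultimately show "\<exists>e>0. ball z e \<subseteq> S - T" using r by (intro exI[of _ r]) auto
  qed
  moreover have "z0 \<in> T"
  proof -
    obtain r where r: "r > 0" "cball z0 r \<subseteq> S" using oS z0 open_contains_cball by blast
    then have "I (ball z0 r) < \<infinity>"
      unfolding I_def by (intro subharmonic_negative_part_disc[OF u r z0(2)])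
    then show ?thesis using r z0 by (auto simp: T_def intro!: exI[of _ r])
  qed
  ultimately have TS: "S \<subseteq> T"
    using connectedD[OF S, of T "S - T"] z0 by blast
  define r where "r z = (SOME r. r > 0 \<and> ball z r \<subseteq> S \<and> I (ball z r) < \<infinity>)" for z
  have r: "r z > 0" "I (ball z (r z)) < \<infinity>" if "z \<in> S" for z
  proof -
    have "\<exists>r. r > 0 \<and> ball z r \<subseteq> S \<and> I (ball z r) < \<infinity>" using TS that by (auto simp: T_def)
    from someI_ex[OF this] show "r z > 0" "I (ball z (r z)) < \<infinity>" unfolding r_def by auto
  qed
  have "K \<subseteq> (\<Union>z\<in>K. ball z (r z))" using r K by force
  then obtain N where N: "N \<subseteq> K" "finite N" "K \<subseteq> (\<Union>z\<in>N. ball z (r z))"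
    using compactE_image[OF K(1), of K "\<lambda>z. ball z (r z)" thesis] by auto
  have "I K \<le> (\<integral>\<^sup>+w. (\<Sum>z\<in>N. defect S u 0 w * indicator (ball z (r z)) w) \<partial>lborel)"
    unfolding I_def
  proof (intro nn_integral_mono)
    fix w
    show "defect S u 0 w * indicator K w \<le> (\<Sum>z\<in>N. defect S u 0 w * indicator (ball z (r z)) w)"
    proof (cases "w \<in> K")
      case True
      then obtain z where z: "z \<in> N" "w \<in> ball z (r z)" using N by blast
      have "defect S u 0 w * indicator (ball z (r z)) w \<le> (\<Sum>z\<in>N. defect S u 0 w * indicator (ball z (r z)) w)"
        by (rule member_le_sum) (use z N in auto)
      then show ?thesis using z True by simp
    qed simp
  qed
  also have "\<dots> = (\<Sum>z\<in>N. I (ball z (r z)))"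
    unfolding I_def by (rule nn_integral_sum) measurable
  also have "\<dots> < \<infinity>"
    using N K r by (subst infinity_ennreal_def, subst ennreal_sum_less_top) (auto simp: subset_iff)
  finally show ?thesis unfolding I_def .
qed

lemma subharmonic_set_integrable:
  assumes u: "subharmonic_on S u" and S: "connected S" and z0: "z0 \<in> S" "u z0 \<noteq> - \<infinity>"
    and K: "compact K" "K \<subseteq> S"
  shows "integrable lborel (\<lambda>z. indicator K z * real_of_ereal (u z))"
    and "AE z in lborel. z \<in> K \<longrightarrow> u z \<noteq> - \<infinity>"
proof -
  note [measurable] = defect_measurable[OF u] subharmonic_measurable[OF u]
  have KS: "K \<in> sets borel" by (intro borel_closed compact_imp_closed K)
  note [measurable] = this
  have fin: "(\<integral>\<^sup>+w\<in>K. defect S u 0 w \<partial>lborel) < \<infinity>"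
    by (rule subharmonic_locally_integrable[OF assms])
  obtain a where a: "0 \<le> a" "\<And>w. w \<in> K \<Longrightarrow> u w \<le> ereal a"
    using subharmonic_bounded_above_compact[OF u K] by metis
  have "AE w in lborel. defect S u 0 w * indicator K w \<noteq> \<infinity>"
    using fin by (intro nn_integral_PInf_AE) auto
  then show "AE z in lborel. z \<in> K \<longrightarrow> u z \<noteq> - \<infinity>"
    by (rule eventually_mono) (use K in \<open>auto simp: defect_def\<close>)
  have eq: "(\<lambda>z. indicator K z * real_of_ereal (u z)) = (\<lambda>z. indicator K z * real_of_ereal (if z \<in> S then u z else - \<infinity>))"
    using K by (auto simp: fun_eq_iff split: split_indicator)
  show "integrable lborel (\<lambda>z. indicator K z * real_of_ereal (u z))"
  proof (rule integrableI_bounded)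
    show "(\<lambda>z. indicator K z * real_of_ereal (u z)) \<in> borel_measurable lborel"
      unfolding eq by measurable
    have "(\<integral>\<^sup>+z. ennreal (norm (indicator K z * real_of_ereal (u z))) \<partial>lborel)
        \<le> (\<integral>\<^sup>+z. (ennreal a * indicator K z + defect S u 0 z * indicator K z) \<partial>lborel)"
    proof (intro nn_integral_mono)
      fix z
      show "ennreal (norm (indicator K z * real_of_ereal (u z))) \<le> ennreal a * indicator K z + defect S u 0 z * indicator K z"
      proof (cases "z \<in> K")
        case True
        then have "z \<in> S" "u z \<noteq> \<infinity>" using K u by (auto simp: subharmonic_on_def)
        show ?thesis
        proof (cases "u z")
          case (real x)
          then have "x \<le> a" using a(2)[OF True] by simp
          then have "\<bar>x\<bar> \<le> a + max 0 (- x)" using a(1) by auto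
          then have "ennreal \<bar>x\<bar> \<le> ennreal (a + max 0 (- x))" by (rule ennreal_leI)
          also have "\<dots> = ennreal a + ennreal (max 0 (- x))" using a(1) by (simp add: ennreal_plus)
          also have "ennreal (max 0 (- x)) = ennreal (- x)" by (auto simp: max_def ennreal_neg)
          finally show ?thesis using True \<open>z \<in> S\<close> real by (simp add: defect_def e2ennreal_ereal)
        qed (use True \<open>u z \<noteq> \<infinity>\<close> in auto)
      qed simp
    qed
    also have "\<dots> = ennreal a * emeasure lborel K + (\<integral>\<^sup>+w\<in>K. defect S u 0 w \<partial>lborel)"
      by (subst nn_integral_add) (auto simp: nn_integral_cmult_indicator)
    also have "\<dots> < \<infinity>"
      using fin emeasure_compact_finite[OF K(1)] by (simp add: ennreal_mult_less_top)
    finally show "(\<integral>\<^sup>+z. ennreal (norm (indicator K z * real_of_ereal (u z))) \<partial>lborel) < \<infinity>" .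
  qed
qed

section \<open>The extended plane\<close>

text \<open>The point \<infinity> is not in D, hence not interior to it; off the frontier it is
  therefore off the closure. A neighbourhood of \<infinity> missing D is the complement of a compact
  set.\<close>

lemma bounded_if_infinity_not_in_frontier:
  assumes "None \<notin> riemann_sphere frontier_of (Some ` D)"
  shows "bounded D"
proof -
  have "None \<notin> riemann_sphere interior_of (Some ` D)"
    using interior_of_subset[of riemann_sphere "Some ` D"] by auto
  then have "None \<notin> riemann_sphere closure_of (Some ` D)"
    using assms by (simp add: frontier_of_def)
  moreover have "None \<in> topspace riemann_sphere"
    by (simp add: riemann_sphere_def)
  ultimately obtain T where T: "None \<in> T" "openin riemann_sphere T" "T \<inter> Some ` D = {}"
    unfolding in_closure_of by blast
  then obtain C where C: "compact C" "T = insert None (Some ` (- C))"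
    unfolding riemann_sphere_def openin_Alexandroff_compactification by (auto simp: Compl_eq_Diff_UNIV)
  have "D \<subseteq> C" using T(3) C(2) by auto
  then show ?thesis using C(1) compact_imp_bounded bounded_subset by blast
qed

text \<open>A closed subset of the one-point compactification that avoids \<infinity> is the image
  of a compact plane set.\<close>

lemma rel_compact_in_closure:
  assumes "rel_compact_in S D"
  shows "compact (closure S)" "closure S \<subseteq> D"
proof -
  let ?C = "riemann_sphere closure_of (Some ` S)"
  have "closedin riemann_sphere ?C" by simp
  moreover have "None \<notin> ?C" using assms by (auto simp: rel_compact_in_def)
  ultimately obtain K where K: "compact K" "?C = Some ` K"
    unfolding riemann_sphere_def closedin_Alexandroff_compactification by auto
  have "Some ` S \<subseteq> ?C"
    by (rule closure_of_subset) (simp add: riemann_sphere_def, blast)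
  then have "S \<subseteq> K" unfolding K(2) by blast
  then have sub: "closure S \<subseteq> K" using K(1) by (simp add: closure_minimal compact_imp_closed)
  moreover have "K \<subseteq> D" using assms K(2) by (auto simp: rel_compact_in_def)
  ultimately show "closure S \<subseteq> D" by blast
  show "compact (closure S)"
    using sub K(1) bounded_subset[OF compact_imp_bounded] closure_subset by (metis compact_closure subset_trans)
qed

section \<open>The hyperbolic radius\<close>

lemma Moebius_has_derivative:
  assumes "1 - cnj w * z \<noteq> 0"
  shows "(Moebius_function 0 w has_field_derivative (1 - (cmod w)\<^sup>2) / (1 - cnj w * z)\<^sup>2) (at z)"
proof -
  have M: "Moebius_function 0 w = (\<lambda>z. (z - w) / (1 - cnj w * z))"
    by (auto simp: Moebius_function_simple)
  have d: "((\<lambda>z. (z - w) / (1 - cnj w * z)) has_field_derivative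
      (1 * (1 - cnj w * z) - (z - w) * (- cnj w)) / ((1 - cnj w * z) * (1 - cnj w * z))) (at z)"
    by (rule derivative_eq_intros refl | use assms in simp)+
  have num: "1 * (1 - cnj w * z) - (z - w) * (- cnj w) = of_real (1 - (cmod w)\<^sup>2)"
    unfolding of_real_diff complex_norm_square by (simp add: algebra_simps)
  show ?thesis
    using d unfolding M num power2_eq_square[of "1 - cnj w * z"] by simp
qed

text \<open>Moebius maps move z and q(z) to 0, which reduces the claim to the Schwarz lemma; the
  factors 1 - |z|^2 and 1 - |q z|^2 are their derivatives.\<close>

lemma Schwarz_Pick:
  assumes q: "q holomorphic_on ball 0 1" "q ` ball 0 1 \<subseteq> ball 0 1" and z: "z \<in> ball 0 1"
  shows "cmod (deriv q z) * (1 - (cmod z)\<^sup>2) \<le> 1 - (cmod (q z))\<^sup>2"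
proof -
  define a where "a = q z"
  have a: "cmod a < 1" using subsetD[OF q(2) imageI[OF z]] by (simp add: a_def)
  have z1: "cmod z < 1" using z by simp
  define F where "F = Moebius_function 0 a \<circ> q \<circ> Moebius_function 0 (- z)"
  have M0: "Moebius_function 0 (- z) 0 = z" by (simp add: Moebius_function_simple)
  have Mb: "Moebius_function 0 (- z) ` ball 0 1 \<subseteq> ball 0 1"
    using Moebius_function_norm_lt_1[of "- z"] z1 by auto
  have hF: "F holomorphic_on ball 0 1"
    unfolding F_def
    by (intro holomorphic_on_compose holomorphic_on_compose_gen[of _ _ _ "ball 0 1"] Moebius_function_holomorphic
        holomorphic_on_subset[OF q(1)] holomorphic_on_subset[OF Moebius_function_holomorphic[OF a]])
       (use a z1 q Mb in auto)
  have F0: "F 0 = 0" by (simp add: F_def M0 a_def Moebius_function_eq_zero)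
  have Fn: "cmod (F w) < 1" if "cmod w < 1" for w
  proof -
    have "Moebius_function 0 (- z) w \<in> ball 0 1" by (rule subsetD[OF Mb imageI]) (use that in simp)
    then have "cmod (q (Moebius_function 0 (- z) w)) < 1"
      using subsetD[OF q(2) imageI] by simp
    then show ?thesis unfolding F_def using Moebius_function_norm_lt_1[OF a] by simp
  qed
  have "cmod (deriv F 0) \<le> 1" using Schwarz_Lemma(2)[OF hF F0 Fn, of 0] by simp
  have "(F has_field_derivative
      (1 - (cmod a)\<^sup>2) / (1 - cnj a * a)\<^sup>2 * (deriv q z * ((1 - (cmod z)\<^sup>2)))) (at 0)"
  proof -
    have aa: "1 - cnj a * a = of_real (1 - (cmod a)\<^sup>2)"
      by (simp add: complex_norm_square mult.commute del: of_real_power)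
    have anz: "1 - (cmod a)\<^sup>2 \<noteq> 0" using a abs_square_less_1[of "cmod a"] by simp
    have d1: "(Moebius_function 0 (- z) has_field_derivative (1 - (cmod z)\<^sup>2)) (at 0)"
      using Moebius_has_derivative[of "- z" 0] by simp
    have "(q has_field_derivative deriv q z) (at (Moebius_function 0 (- z) 0))"
      unfolding M0 using q(1) z by (intro holomorphic_derivI[of _ "ball 0 1"]) auto
    from DERIV_chain[OF this d1]
    have d2: "(q \<circ> Moebius_function 0 (- z) has_field_derivative (deriv q z * ((1 - (cmod z)\<^sup>2)))) (at 0)" .
    have "(Moebius_function 0 a has_field_derivative (1 - (cmod a)\<^sup>2) / (1 - cnj a * a)\<^sup>2)
       (at ((q \<circ> Moebius_function 0 (- z)) 0))"
      unfolding o_def M0 a_def[symmetric]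
      by (rule Moebius_has_derivative) (use anz in \<open>simp only: aa of_real_eq_0_iff, simp\<close>)
    from DERIV_chain[OF this d2] show ?thesis by (simp add: F_def o_assoc)
  qed
  then have dF: "deriv F 0 = (1 - (cmod a)\<^sup>2) / (1 - cnj a * a)\<^sup>2 * (deriv q z * ((1 - (cmod z)\<^sup>2)))"
    by (rule DERIV_imp_deriv)
  have pos: "1 - (cmod a)\<^sup>2 > 0" "1 - (cmod z)\<^sup>2 > 0" using a z1 by (auto simp: abs_square_less_1)
  define A Z where "A = 1 - (cmod a)\<^sup>2" and "Z = 1 - (cmod z)\<^sup>2"
  have AZ: "A > 0" "Z > 0" using pos by (auto simp: A_def Z_def)
  have aa: "1 - cnj a * a = of_real A"
    unfolding A_def of_real_diff complex_norm_square by simp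
  have "deriv F 0 = of_real A / (of_real A)\<^sup>2 * (deriv q z * of_real Z)"
    unfolding dF aa by (simp add: A_def Z_def)
  then have "cmod (deriv F 0) = A / A\<^sup>2 * (cmod (deriv q z) * Z)"
    using AZ by (simp add: norm_mult norm_divide norm_power)
  also have "\<dots> = cmod (deriv q z) * Z / A"
    using AZ by (simp add: power2_eq_square)
  finally have "cmod (deriv F 0) = cmod (deriv q z) * Z / A" .
  with \<open>cmod (deriv F 0) \<le> 1\<close> have "cmod (deriv q z) * Z \<le> A"
    using AZ by (simp add: field_simps)
  then show ?thesis by (simp add: A_def Z_def a_def)
qed

section \<open>Riemann maps with their inverses, and the hyperbolic radius computed from
  them\<close>

definition conformal_pair :: "complex set \<Rightarrow> (complex \<Rightarrow> complex) \<Rightarrow> (complex \<Rightarrow> complex) \<Rightarrow> bool" where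
  "conformal_pair D g p \<longleftrightarrow> open D \<and> g holomorphic_on D \<and> p holomorphic_on ball 0 1 \<and>
     (\<forall>z\<in>D. g z \<in> ball 0 1 \<and> p (g z) = z) \<and> (\<forall>w\<in>ball 0 1. p w \<in> D \<and> g (p w) = w)"

lemma conformal_pair_exists:
  assumes "open D" "convex D" "D \<noteq> UNIV" "D \<noteq> {}"
  obtains g p where "conformal_pair D g p"
proof -
  have "simply_connected D" using assms(2) by (rule convex_imp_simply_connected)
  then have "\<exists>g p. g holomorphic_on D \<and> p holomorphic_on ball 0 1 \<and>
     (\<forall>z\<in>D. g z \<in> ball 0 1 \<and> p (g z) = z) \<and> (\<forall>w\<in>ball 0 1. p w \<in> D \<and> g (p w) = w)"
    using Riemann_mapping_theorem[of D] assms by blast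
  then show thesis using that assms(1) unfolding conformal_pair_def by blast
qed

lemma conformal_pair_deriv:
  assumes "conformal_pair D g p" "z \<in> D"
  shows "deriv p (g z) * deriv g z = 1"
proof -
  have *: "open D" "g holomorphic_on D" "p holomorphic_on ball 0 1" "g z \<in> ball 0 1" "\<forall>z\<in>D. p (g z) = z"
    using assms by (auto simp: conformal_pair_def)
  have "(p has_field_derivative deriv p (g z)) (at (g z))"
    using * by (intro holomorphic_derivI[of _ "ball 0 1"]) auto
  moreover have "(g has_field_derivative deriv g z) (at z)"
    using * assms by (intro holomorphic_derivI[of _ D]) auto
  ultimately have "(p \<circ> g has_field_derivative deriv p (g z) * deriv g z) (at z)"
    by (rule DERIV_chain)
  moreover have "(p \<circ> g has_field_derivative 1) (at z)"
    by (rule has_field_derivative_transform_within_open[OF DERIV_ident *(1) assms(2)]) (use * in auto)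
  ultimately show ?thesis by (rule DERIV_unique)
qed

lemma conformal_pair_Schwarz_Pick:
  assumes cp: "conformal_pair D g p" and q: "q holomorphic_on ball 0 1" "q ` ball 0 1 \<subseteq> D" and w: "w \<in> ball 0 1"
  shows "cmod (deriv q w) * (1 - (cmod w)\<^sup>2) * cmod (deriv g (q w)) \<le> 1 - (cmod (g (q w)))\<^sup>2"
proof -
  have *: "open D" "g holomorphic_on D" "q w \<in> D" "\<forall>z\<in>D. g z \<in> ball 0 1"
    using cp q w by (auto simp: conformal_pair_def)
  have hol: "g \<circ> q holomorphic_on ball 0 1"
    using q(1) *(2) q(2) by (rule holomorphic_on_compose_gen)
  have im: "(g \<circ> q) ` ball 0 1 \<subseteq> ball 0 1" using *(4) q(2) by auto
  have "(q has_field_derivative deriv q w) (at w)"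
    using q w by (intro holomorphic_derivI[of _ "ball 0 1"]) auto
  moreover have "(g has_field_derivative deriv g (q w)) (at (q w))"
    using * by (intro holomorphic_derivI[of _ D]) auto
  ultimately have "(g \<circ> q has_field_derivative deriv g (q w) * deriv q w) (at w)"
    using DERIV_chain by blast
  then have "deriv (g \<circ> q) w = deriv g (q w) * deriv q w" by (rule DERIV_imp_deriv)
  then show ?thesis
    using Schwarz_Pick[OF hol im w] by (simp add: norm_mult mult_ac)
qed

text \<open>The density is a definite description over all holomorphic coverings, so each covering
  must yield the value given by the Riemann map. Two applications of Schwarz-Pick in opposite
  directions force equality.\<close>

lemma hyperbolic_radius_conformal:
  assumes cp: "conformal_pair D g p" and z: "z \<in> D"
  shows "hyperbolic_radius D z = (1 - (cmod (g z))\<^sup>2) / cmod (deriv g z)"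
proof -
  have D: "open D" "g holomorphic_on D" "p holomorphic_on ball 0 1" "\<forall>z\<in>D. g z \<in> ball 0 1 \<and> p (g z) = z"
    "\<forall>w\<in>ball 0 1. p w \<in> D \<and> g (p w) = w"
    using cp by (auto simp: conformal_pair_def)
  define a where "a = g z"
  have a: "a \<in> ball 0 1" "p a = z" using D z by (auto simp: a_def)
  have apos: "1 - (cmod a)\<^sup>2 > 0" using a by (auto simp: abs_square_less_1)
  have dd: "deriv p a * deriv g z = 1" unfolding a_def by (rule conformal_pair_deriv[OF cp z])
  then have g0: "cmod (deriv g z) > 0" by auto
  have pg: "cmod (deriv p a) = 1 / cmod (deriv g z)"
    using dd g0 by (metis nonzero_eq_divide_eq norm_mult norm_one order_less_irrefl)
  define l where "l = cmod (deriv g z) / (1 - (cmod a)\<^sup>2)"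
  have cov: "covering_space (ball 0 1) p D"
  proof (rule homeomorphism_imp_covering_space)
    show "homeomorphism (ball 0 1) D p g"
      unfolding homeomorphism_def
      using D holomorphic_on_imp_continuous_on by (auto intro!: image_eqI)
  qed
  let ?P = "\<lambda>l. \<exists>p \<zeta>. p holomorphic_on ball 0 1 \<and> covering_space (ball 0 1) p D \<and>
                    \<zeta> \<in> ball 0 1 \<and> p \<zeta> = z \<and> l * cmod (deriv p \<zeta>) = 1 / (1 - (cmod \<zeta>)\<^sup>2)"
  have "(THE l. ?P l) = l"
  proof (rule the_equality)
    have "l * cmod (deriv p a) = 1 / (1 - (cmod a)\<^sup>2)"
      using g0 apos by (simp add: l_def pg)
    then show "?P l" using D cov a by blast
  next
    fix l' assume "?P l'"
    then obtain p2 b where p2: "p2 holomorphic_on ball 0 1" "covering_space (ball 0 1) p2 D"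
      "b \<in> ball 0 1" "p2 b = z" "l' * cmod (deriv p2 b) = 1 / (1 - (cmod b)\<^sup>2)" by blast
    have bpos: "1 - (cmod b)\<^sup>2 > 0" using p2 by (auto simp: abs_square_less_1)
    then have "l' * cmod (deriv p2 b) \<noteq> 0" using p2(5) by simp
    then have dnz: "cmod (deriv p2 b) > 0" by auto
    have im2: "p2 ` ball 0 1 \<subseteq> D" using covering_space_imp_surjective[OF p2(2)] by simp
    \<comment> \<open>First direction: Schwarz-Pick for \<open>g\<close> composed with
      \<open>p2\<close>.\<close>
    have up: "cmod (deriv p2 b) * (1 - (cmod b)\<^sup>2) * cmod (deriv g z) \<le> 1 - (cmod a)\<^sup>2"
      using conformal_pair_Schwarz_Pick[OF cp p2(1) im2 p2(3)] by (simp add: p2(4) a_def)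
    \<comment> \<open>Second direction: the disc is simply connected, so \<open>p\<close> lifts
      through the covering \<open>p2\<close> to a self-map \<open>k\<close> of the disc.\<close>
    obtain k where k: "continuous_on (ball 0 1) k" "k \<in> ball 0 1 \<rightarrow> ball 0 1" "k a = b"
      "\<And>y. y \<in> ball 0 1 \<Longrightarrow> p2 (k y) = p y"
    proof -
      have 1: "simply_connected (ball (0::complex) 1)" by (intro convex_imp_simply_connected convex_ball)
      have 2: "locally path_connected (ball (0::complex) 1)"
        by (intro convex_imp_locally_path_connected convex_ball)
      have 3: "continuous_on (ball 0 1) p" using D(3) by (rule holomorphic_on_imp_continuous_on)
      have 4: "p \<in> ball 0 1 \<rightarrow> D" "p a = p2 b" using D a p2 by auto
      show thesis
        by (rule covering_space_lift_strong[OF p2(2,3) a(1) 1 2 3 4]) (rule that; blast)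
    qed
    have kh: "k holomorphic_on ball 0 1"
      by (rule covering_space_lift_is_holomorphic[OF p2(2) open_ball p2(1) D(3) _ k(2) k(1) k(4)])
         (use D in auto)
    have sp: "cmod (deriv k a) * (1 - (cmod a)\<^sup>2) \<le> 1 - (cmod b)\<^sup>2"
      using Schwarz_Pick[OF kh _ a(1)] k by auto
    have "(k has_field_derivative deriv k a) (at a)"
      using kh a by (intro holomorphic_derivI[of _ "ball 0 1"]) auto
    moreover have "(p2 has_field_derivative deriv p2 b) (at (k a))"
      unfolding k(3) using p2(1,3) by (intro holomorphic_derivI[of _ "ball 0 1"]) auto
    ultimately have "(p2 \<circ> k has_field_derivative deriv p2 b * deriv k a) (at a)"
      using DERIV_chain by blast
    then have "(p has_field_derivative deriv p2 b * deriv k a) (at a)"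
      by (rule has_field_derivative_transform_within_open[OF _ open_ball a(1)]) (simp add: k(4))
    then have "deriv p a = deriv p2 b * deriv k a" by (rule DERIV_imp_deriv)
    then have "1 / cmod (deriv g z) = cmod (deriv p2 b) * cmod (deriv k a)"
      using pg by (simp add: norm_mult)
    then have "1 / cmod (deriv g z) * (1 - (cmod a)\<^sup>2) = cmod (deriv p2 b) * (cmod (deriv k a) * (1 - (cmod a)\<^sup>2))"
      by simp
    also have "\<dots> \<le> cmod (deriv p2 b) * (1 - (cmod b)\<^sup>2)"
      using sp by (intro mult_left_mono) auto
    finally have "1 - (cmod a)\<^sup>2 \<le> cmod (deriv p2 b) * (1 - (cmod b)\<^sup>2) * cmod (deriv g z)"
      using g0 by (simp add: field_simps)
    with up have eq: "1 - (cmod a)\<^sup>2 = cmod (deriv p2 b) * (1 - (cmod b)\<^sup>2) * cmod (deriv g z)" by simp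
    have "l' = 1 / (cmod (deriv p2 b) * (1 - (cmod b)\<^sup>2))"
      using p2(5) dnz bpos by (simp add: field_simps)
    also have "\<dots> = l"
      unfolding l_def eq using g0 by simp
    finally show "l' = l" .
  qed
  then have "poincare_density D z = l" by (simp add: poincare_density_def)
  then show ?thesis by (simp add: hyperbolic_radius_def l_def a_def)
qed

text \<open>Half of an extremal description: the radius at a point is the largest |q'(0)| among
  holomorphic maps q of the disc into D that send 0 to the point.\<close>

lemma hyperbolic_radius_extremal_le:
  assumes cp: "conformal_pair D g p" and q: "q holomorphic_on ball 0 1" "q ` ball 0 1 \<subseteq> D"
  shows "cmod (deriv q 0) \<le> hyperbolic_radius D (q 0)"
proof -
  have z: "q 0 \<in> D" using q by auto
  have "cmod (deriv g (q 0)) > 0" using conformal_pair_deriv[OF cp z] by auto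
  then show ?thesis
    using conformal_pair_Schwarz_Pick[OF cp q, of 0]
    by (simp add: hyperbolic_radius_conformal[OF cp z] field_simps)
qed

text \<open>The inverse Riemann map, recentred and rotated, attains the extremal value. The
  derivative at 0 is normalised to be positive, so that derivatives of two extremal maps add without
  cancellation.\<close>

lemma hyperbolic_radius_extremal_ex:
  assumes cp: "conformal_pair D g p" and z: "z \<in> D"
  shows "\<exists>q. q holomorphic_on ball 0 1 \<and> q ` ball 0 1 \<subseteq> D \<and> q 0 = z \<and>
     (q has_field_derivative of_real (hyperbolic_radius D z)) (at 0)"
proof -
  have D: "open D" "g holomorphic_on D" "p holomorphic_on ball 0 1" "\<forall>z\<in>D. g z \<in> ball 0 1 \<and> p (g z) = z"
    "\<forall>w\<in>ball 0 1. p w \<in> D \<and> g (p w) = w"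
    using cp by (auto simp: conformal_pair_def)
  define a where "a = g z"
  have a: "a \<in> ball 0 1" "p a = z" "cmod a < 1" using D z by (auto simp: a_def)
  have dd: "deriv p a * deriv g z = 1" unfolding a_def by (rule conformal_pair_deriv[OF cp z])
  then have nz: "deriv g z \<noteq> 0" by auto
  \<comment> \<open>Rotating by the argument of g'(z) cancels the argument of p'(a) = 1 /
    g'(z).\<close>
  define c where "c = sgn (deriv g z)"
  have c: "cmod c = 1" using nz by (simp add: c_def norm_sgn)
  define r where "r w = Moebius_function 0 (- a) (c * w)" for w
  have rb: "r ` ball 0 1 \<subseteq> ball 0 1"
    using Moebius_function_norm_lt_1[of "- a"] a c by (auto simp: r_def norm_mult)
  have "Moebius_function 0 (- a) \<circ> (\<lambda>w. c * w) holomorphic_on ball 0 1"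
    by (rule holomorphic_on_compose_gen[of _ _ _ "ball 0 1"])
       (use a c in \<open>auto intro!: holomorphic_intros Moebius_function_holomorphic simp: norm_mult\<close>)
  then have rh: "r holomorphic_on ball 0 1" by (simp add: r_def[abs_def] o_def)
  have r0: "r 0 = a" by (simp add: r_def Moebius_function_simple)
  have dM: "(Moebius_function 0 (- a) has_field_derivative (1 - (cmod a)\<^sup>2)) (at (c * 0))"
    using Moebius_has_derivative[of "- a" 0] by simp
  have "((\<lambda>w. c * w) has_field_derivative c) (at 0)"
    by (auto intro!: derivative_eq_intros)
  from DERIV_chain[OF dM this]
  have dr: "(r has_field_derivative (1 - (cmod a)\<^sup>2) * c) (at 0)"
    by (simp add: r_def[abs_def] o_def)
  have "(p has_field_derivative deriv p a) (at (r 0))"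
    unfolding r0 using D a by (intro holomorphic_derivI[of _ "ball 0 1"]) auto
  from DERIV_chain[OF this dr]
  have "(p \<circ> r has_field_derivative deriv p a * ((1 - (cmod a)\<^sup>2) * c)) (at 0)" .
  moreover have "deriv p a * ((1 - (cmod a)\<^sup>2) * c) = of_real (hyperbolic_radius D z)"
  proof -
    have "deriv p a * c = of_real (1 / cmod (deriv g z))"
      using dd nz by (simp add: c_def sgn_eq field_simps)
    then have "deriv p a * ((1 - (cmod a)\<^sup>2) * c) = of_real (1 - (cmod a)\<^sup>2) * of_real (1 / cmod (deriv g z))"
      by (metis mult.assoc mult.commute)
    then show ?thesis by (simp add: hyperbolic_radius_conformal[OF cp z] a_def)
  qed
  ultimately have "(p \<circ> r has_field_derivative of_real (hyperbolic_radius D z)) (at 0)" by simp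
  moreover have "p \<circ> r holomorphic_on ball 0 1"
    using rh D(3) rb by (rule holomorphic_on_compose_gen)
  moreover have "(p \<circ> r) ` ball 0 1 \<subseteq> D" using rb D(5) by auto
  ultimately show ?thesis using r0 a by (intro exI[of _ "p \<circ> r"]) auto
qed

lemma hyperbolic_radius_pos:
  assumes cp: "conformal_pair D g p" and z: "z \<in> D"
  shows "0 < hyperbolic_radius D z"
proof -
  have "cmod (g z) < 1" using cp z by (auto simp: conformal_pair_def)
  moreover have "deriv g z \<noteq> 0" using conformal_pair_deriv[OF cp z] by auto
  ultimately show ?thesis by (simp add: hyperbolic_radius_conformal[OF cp z] abs_square_less_1)
qed

text \<open>A convex combination of extremal maps for two points is a competitor for the convex
  combination of the points.\<close>

lemma hyperbolic_radius_concave: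
  assumes cp: "conformal_pair D g p" and D: "convex D"
  shows "concave_on D (hyperbolic_radius D)"
  unfolding concave_on_iff
proof (intro conjI D ballI allI impI)
  fix x y and u v :: real
  assume xy: "x \<in> D" "y \<in> D" and uv: "0 \<le> u" "0 \<le> v" "u + v = 1"
  obtain q1 where q1: "q1 holomorphic_on ball 0 1" "q1 ` ball 0 1 \<subseteq> D" "q1 0 = x"
     "(q1 has_field_derivative of_real (hyperbolic_radius D x)) (at 0)"
    using hyperbolic_radius_extremal_ex[OF cp xy(1)] by blast
  obtain q2 where q2: "q2 holomorphic_on ball 0 1" "q2 ` ball 0 1 \<subseteq> D" "q2 0 = y"
     "(q2 has_field_derivative of_real (hyperbolic_radius D y)) (at 0)"
    using hyperbolic_radius_extremal_ex[OF cp xy(2)] by blast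
  define q where "q w = u *\<^sub>R q1 w + v *\<^sub>R q2 w" for w
  have "q holomorphic_on ball 0 1"
    unfolding q_def scaleR_conv_of_real by (intro holomorphic_intros q1 q2)
  moreover have "q ` ball 0 1 \<subseteq> D"
  proof (rule image_subsetI)
    fix w :: complex assume w: "w \<in> ball 0 1"
    have "q1 w \<in> D" "q2 w \<in> D" using q1(2) q2(2) w by blast+
    then show "q w \<in> D" unfolding q_def by (rule convexD[OF D _ _ uv])
  qed
  ultimately have "cmod (deriv q 0) \<le> hyperbolic_radius D (q 0)"
    by (rule hyperbolic_radius_extremal_le[OF cp])
  moreover have "(q has_field_derivative of_real (u * hyperbolic_radius D x + v * hyperbolic_radius D y)) (at 0)"
    unfolding q_def scaleR_conv_of_real by (auto intro!: derivative_eq_intros q1 q2)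
  then have "deriv q 0 = of_real (u * hyperbolic_radius D x + v * hyperbolic_radius D y)"
    by (rule DERIV_imp_deriv)
  moreover have "0 \<le> u * hyperbolic_radius D x + v * hyperbolic_radius D y"
    using hyperbolic_radius_pos[OF cp] xy uv by (simp add: less_imp_le)
  ultimately show "u * hyperbolic_radius D x + v * hyperbolic_radius D y \<le> hyperbolic_radius D (u *\<^sub>R x + v *\<^sub>R y)"
    by (simp add: q_def q1 q2 del: of_real_add of_real_mult)
qed

text \<open>Comparison with a half-plane containing \<open>D\<close>.\<close>

lemma hyperbolic_radius_le_dist:
  assumes cp: "conformal_pair D g p" and D: "convex D" and z: "z \<in> D" and w: "w \<notin> D"
  shows "hyperbolic_radius D z \<le> 2 * dist z w"
proof -
  have oD: "open D" using cp by (simp add: conformal_pair_def)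
  obtain a b where ab: "a \<noteq> 0" "\<And>x. x \<in> D \<Longrightarrow> inner a x \<le> b" "b \<le> inner a w"
  proof -
    have "\<exists>a b. a \<noteq> 0 \<and> (\<forall>x\<in>D. inner a x \<le> b) \<and> (\<forall>x\<in>{w}. inner a x \<ge> b)"
      by (rule separating_hyperplane_sets) (use D w z in auto)
    then show thesis using that by auto
  qed
  \<comment> \<open>Openness of \<open>D\<close> keeps it off the separating line, so
    \<open>F\<close> below has strictly positive real part.\<close>
  have strict: "inner a x < b" if x: "x \<in> D" for x
  proof -
    obtain e where e: "e > 0" "cball x e \<subseteq> D" using oD x open_contains_cball by blast
    have "x + (e / norm a) *\<^sub>R a \<in> cball x e" using ab(1) e by (simp add: dist_norm)
    then have "inner a (x + (e / norm a) *\<^sub>R a) \<le> b" using ab(2) e by blast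
    moreover have "inner a ((e / norm a) *\<^sub>R a) > 0" using ab(1) e by simp
    ultimately show ?thesis by (simp only: inner_add_right)
  qed
  obtain q where q: "q holomorphic_on ball 0 1" "q ` ball 0 1 \<subseteq> D" "q 0 = z"
     "(q has_field_derivative of_real (hyperbolic_radius D z)) (at 0)"
    using hyperbolic_radius_extremal_ex[OF cp z] by blast
  have inn: "inner a x = Re (cnj a * x)" for x
    by (simp add: inner_complex_def)
  define F where "F x = of_real b - cnj a * q x" for x
  have F: "Re (F x) > 0" if "cmod x < 1" for x
  proof -
    have "q x \<in> D" using that by (intro subsetD[OF q(2)] imageI) simp
    then show ?thesis using strict[of "q x"] by (auto simp: F_def inn)
  qed
  \<comment> \<open>\<open>F\<close> sends the disc into the right half-plane and \<open>G\<close>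
    follows it with the Cayley transform taking F(0) to 0. The bound |G'(0)| \<le> 1 then reads |a|
    R(z) \<le> 2 (b - a \<bullet> z).\<close>
  define G where "G x = (F x - F 0) / (F x + cnj (F 0))" for x
  have F0: "Re (F 0) > 0" using F[of 0] by simp
  have den: "F x + cnj (F 0) \<noteq> 0" if "cmod x < 1" for x
    using F[OF that] F0 by (auto simp: complex_eq_iff)
  have hF: "F holomorphic_on ball 0 1" unfolding F_def by (intro holomorphic_intros q)
  have hG: "G holomorphic_on ball 0 1"
    unfolding G_def by (intro holomorphic_intros hF) (use den in auto)
  have G1: "cmod (G x) < 1" if "cmod x < 1" for x
  proof -
    have "(cmod (F x - F 0))\<^sup>2 < (cmod (F x + cnj (F 0)))\<^sup>2"
    proof -
      have "(cmod (F x + cnj (F 0)))\<^sup>2 - (cmod (F x - F 0))\<^sup>2 = 4 * Re (F x) * Re (F 0)"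
        unfolding cmod_power2 by (simp add: power2_eq_square algebra_simps)
      then show ?thesis using F[OF that] F0 by (smt (verit) mult_pos_pos)
    qed
    then have "cmod (F x - F 0) < cmod (F x + cnj (F 0))"
      by (rule power_less_imp_less_base) simp
    then show ?thesis using den[OF that] by (simp add: G_def norm_divide)
  qed
  have dF: "(F has_field_derivative (- cnj a * of_real (hyperbolic_radius D z))) (at 0)"
    unfolding F_def by (auto intro!: derivative_eq_intros q)
  have "(G has_field_derivative ((- cnj a * of_real (hyperbolic_radius D z)) * (F 0 + cnj (F 0))
      - (F 0 - F 0) * (- cnj a * of_real (hyperbolic_radius D z))) / ((F 0 + cnj (F 0)) * (F 0 + cnj (F 0)))) (at 0)"
    unfolding G_def by (rule derivative_eq_intros dF refl | use den[of 0] in simp)+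
  then have "deriv G 0 = - cnj a * of_real (hyperbolic_radius D z) / (F 0 + cnj (F 0))"
    using den[of 0] by (simp add: DERIV_imp_deriv)
  moreover have "cmod (deriv G 0) \<le> 1"
  proof -
    have "G 0 = 0" by (simp add: G_def)
    then show ?thesis using Schwarz_Lemma(2)[OF hG _ G1, of 0] by simp
  qed
  moreover have "cmod (F 0 + cnj (F 0)) = 2 * Re (F 0)"
    using F0 by (simp add: complex_add_cnj)
  ultimately have "cmod a * hyperbolic_radius D z \<le> 2 * Re (F 0)"
    using F0 hyperbolic_radius_pos[OF cp z] by (simp add: norm_mult norm_divide field_simps)
  also have "\<dots> = 2 * (b - inner a z)" by (simp add: F_def q inn)
  also have "\<dots> \<le> 2 * inner a (w - z)" using ab(3) by (simp add: inner_diff_right)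
  also have "\<dots> \<le> 2 * (cmod a * dist z w)"
    using norm_cauchy_schwarz[of a "w - z"] by (simp add: dist_norm norm_minus_commute)
  finally show ?thesis using ab(1) by simp
qed

text \<open>With \<open>h\<^sup>2 = 1 / g'\<close> and \<open>k = g h\<close>, the radius \<open>(1 - |g|\<^sup>2) / |g'|\<close> becomes \<open>|h|\<^sup>2 - |k|\<^sup>2\<close>.\<close>

lemma hyperbolic_radius_norm_squares:
  assumes cp: "conformal_pair D g p" and D: "convex D"
  obtains h k where "h holomorphic_on D" "k holomorphic_on D"
    "\<And>z. z \<in> D \<Longrightarrow> hyperbolic_radius D z = (cmod (h z))\<^sup>2 - (cmod (k z))\<^sup>2"
    "\<And>z. z \<in> D \<Longrightarrow> h z * deriv k z - k z * deriv h z = 1"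
proof -
  have oD: "open D" "g holomorphic_on D" using cp by (auto simp: conformal_pair_def)
  have nz: "deriv g z \<noteq> 0" if "z \<in> D" for z using conformal_pair_deriv[OF cp that] by auto
  have hd: "(\<lambda>z. inverse (deriv g z)) holomorphic_on D"
    using oD nz by (intro holomorphic_intros) auto
  obtain h where h: "h holomorphic_on D" "\<And>z. z \<in> D \<Longrightarrow> inverse (deriv g z) = (h z)\<^sup>2"
    using contractible_imp_holomorphic_sqrt[OF hd convex_imp_contractible[OF D]] nz by auto
  have hk: "(\<lambda>z. g z * h z) holomorphic_on D" by (intro holomorphic_intros oD h)
  show thesis
  proof (rule that[OF h(1) hk])
    fix z assume z: "z \<in> D"
    have n: "(cmod (h z))\<^sup>2 = 1 / cmod (deriv g z)"
      using arg_cong[OF h(2)[OF z], of cmod] by (simp add: norm_power norm_divide inverse_eq_divide)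
    show "hyperbolic_radius D z = (cmod (h z))\<^sup>2 - (cmod (g z * h z))\<^sup>2"
      by (simp add: hyperbolic_radius_conformal[OF cp z] norm_mult power_mult_distrib n diff_divide_distrib)
    have "((\<lambda>z. g z * h z) has_field_derivative (g z * deriv h z + deriv g z * h z)) (at z)"
      by (rule DERIV_mult'; rule holomorphic_derivI[OF _ oD(1) z]) (use oD h in auto)
    then have "deriv (\<lambda>z. g z * h z) z = g z * deriv h z + deriv g z * h z" by (rule DERIV_imp_deriv)
    then have "h z * deriv (\<lambda>z. g z * h z) z - g z * h z * deriv h z = deriv g z * (h z)\<^sup>2"
      by (simp add: algebra_simps power2_eq_square)
    then show "h z * deriv (\<lambda>z. g z * h z) z - g z * h z * deriv h z = 1"
      using nz[OF z] by (simp add: h(2)[OF z, symmetric])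
  qed
qed

text \<open>The derivatives are carried along as explicit functions, since \<open>V\<close> is
  controlled only on \<open>U\<close>. Only the pure second derivatives appear: they are what the
  Laplacian and Green's identity use.\<close>

definition C2_planar :: "complex set \<Rightarrow> (complex \<Rightarrow> real) \<Rightarrow> (complex \<Rightarrow> real) \<Rightarrow> (complex \<Rightarrow> real)
    \<Rightarrow> (complex \<Rightarrow> real) \<Rightarrow> (complex \<Rightarrow> real) \<Rightarrow> bool" where
  "C2_planar U V Vx Vxx Vy Vyy \<longleftrightarrow>
    continuous_on U V \<and> continuous_on U Vx \<and> continuous_on U Vy \<and> continuous_on U Vxx \<and> continuous_on U Vyy \<and>
    (\<forall>z\<in>U. ((\<lambda>x. V (Complex x (Im z))) has_real_derivative Vx z) (at (Re z)) \<and>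
           ((\<lambda>x. Vx (Complex x (Im z))) has_real_derivative Vxx z) (at (Re z)) \<and>
           ((\<lambda>y. V (Complex (Re z) y)) has_real_derivative Vy z) (at (Im z)) \<and>
           ((\<lambda>y. Vy (Complex (Re z) y)) has_real_derivative Vyy z) (at (Im z)))"

lemma C2_planar_laplacian:
  assumes U: "open U" and C: "C2_planar U V Vx Vxx Vy Vyy" and z: "z \<in> U"
  shows "laplacian V z = Vxx z + Vyy z"
proof -
  have px: "partial_x V w = Vx w" and py: "partial_y V w = Vy w" if "w \<in> U" for w
    using C that by (auto simp: C2_planar_def partial_x_def partial_y_def intro!: DERIV_imp_deriv)
  have ox: "open ((\<lambda>x. Complex x (Im z)) -` U)" and oy: "open ((\<lambda>y. Complex (Re z) y) -` U)"
    by (intro open_vimage U; auto intro!: continuous_intros simp: Complex_eq)+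
  have "((\<lambda>x. Vx (Complex x (Im z))) has_real_derivative Vxx z) (at (Re z))"
    "((\<lambda>y. Vy (Complex (Re z) y)) has_real_derivative Vyy z) (at (Im z))"
    using C z by (auto simp: C2_planar_def)
  then have "((\<lambda>x. partial_x V (Complex x (Im z))) has_real_derivative Vxx z) (at (Re z))"
    "((\<lambda>y. partial_y V (Complex (Re z) y)) has_real_derivative Vyy z) (at (Im z))"
    using has_field_derivative_transform_within_open[OF _ ox, of "\<lambda>x. Vx (Complex x (Im z))" "Vxx z" "Re z" "\<lambda>x. partial_x V (Complex x (Im z))"]
      has_field_derivative_transform_within_open[OF _ oy, of "\<lambda>y. Vy (Complex (Re z) y)" "Vyy z" "Im z" "\<lambda>y. partial_y V (Complex (Re z) y)"]
      z px py by auto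
  then show ?thesis
    by (simp add: laplacian_def partial_x_def[of "partial_x V"] partial_y_def[of "partial_y V"] DERIV_imp_deriv)
qed

text \<open>Taking f = h differentiates |h|^2. The second derivatives need two different factors,
  because the first derivative is already 2 Re (h' cnj h).\<close>

lemma Re_mult_cnj_slices:
  assumes "(f has_field_derivative f') (at z)" "(h has_field_derivative h') (at z)"
  shows "((\<lambda>x. Re (f (Complex x (Im z)) * cnj (h (Complex x (Im z))))) has_real_derivative
            Re (f' * cnj (h z)) + Re (f z * cnj h')) (at (Re z))"
    and "((\<lambda>y. Re (f (Complex (Re z) y) * cnj (h (Complex (Re z) y)))) has_real_derivative
            Re (\<i> * f' * cnj (h z)) + Re (f z * cnj (\<i> * h'))) (at (Im z))"
proof -
  have f: "(f has_derivative (\<lambda>v. f' * v)) (at z)" and h: "(h has_derivative (\<lambda>v. h' * v)) (at z)"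
    using assms by (auto simp: has_field_derivative_def)
  have "((\<lambda>z. Re (f z * cnj (h z))) has_derivative (\<lambda>v. Re (f z * cnj (h' * v) + f' * v * cnj (h z)))) (at z)"
    by (intro bounded_linear.has_derivative[OF bounded_linear_Re] has_derivative_mult f
        bounded_linear.has_derivative[OF bounded_linear_cnj h])
  from has_derivative_slices[OF this]
  show "((\<lambda>x. Re (f (Complex x (Im z)) * cnj (h (Complex x (Im z))))) has_real_derivative
            Re (f' * cnj (h z)) + Re (f z * cnj h')) (at (Re z))"
    and "((\<lambda>y. Re (f (Complex (Re z) y) * cnj (h (Complex (Re z) y)))) has_real_derivative
            Re (\<i> * f' * cnj (h z)) + Re (f z * cnj (\<i> * h'))) (at (Im z))"
    by (simp_all add: algebra_simps)
qed

lemma C2_planar_norm_square: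
  assumes D: "open D" and h: "h holomorphic_on D"
  shows "C2_planar D (\<lambda>z. (cmod (h z))\<^sup>2) (\<lambda>z. 2 * Re (deriv h z * cnj (h z)))
     (\<lambda>z. 2 * Re (deriv (deriv h) z * cnj (h z)) + 2 * (cmod (deriv h z))\<^sup>2)
     (\<lambda>z. 2 * Re (\<i> * deriv h z * cnj (h z)))
     (\<lambda>z. - 2 * Re (deriv (deriv h) z * cnj (h z)) + 2 * (cmod (deriv h z))\<^sup>2)"
proof -
  have h1: "deriv h holomorphic_on D" by (rule holomorphic_deriv[OF h D])
  have h2: "deriv (deriv h) holomorphic_on D" by (rule holomorphic_deriv[OF h1 D])
  note c = holomorphic_on_imp_continuous_on[OF h] holomorphic_on_imp_continuous_on[OF h1] holomorphic_on_imp_continuous_on[OF h2]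
  have sq: "(cmod w)\<^sup>2 = Re (w * cnj w)" for w by (simp add: cmod_power2) (simp add: power2_eq_square)
  have d: "(h has_field_derivative deriv h z) (at z)" "(deriv h has_field_derivative deriv (deriv h) z) (at z)"
    "((\<lambda>z. \<i> * deriv h z) has_field_derivative \<i> * deriv (deriv h) z) (at z)" if "z \<in> D" for z
    using holomorphic_derivI[OF h D that] holomorphic_derivI[OF h1 D that] by (auto intro!: derivative_eq_intros)
  show ?thesis
    unfolding C2_planar_def
  proof (intro conjI ballI)
    fix z assume z: "z \<in> D"
    show "((\<lambda>x. (cmod (h (Complex x (Im z))))\<^sup>2) has_real_derivative 2 * Re (deriv h z * cnj (h z))) (at (Re z))"
      unfolding sq by (rule DERIV_cong[OF Re_mult_cnj_slices(1)[OF d(1)[OF z] d(1)[OF z]]]) (simp add: algebra_simps)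
    show "((\<lambda>y. (cmod (h (Complex (Re z) y)))\<^sup>2) has_real_derivative 2 * Re (\<i> * deriv h z * cnj (h z))) (at (Im z))"
      unfolding sq by (rule DERIV_cong[OF Re_mult_cnj_slices(2)[OF d(1)[OF z] d(1)[OF z]]]) (simp add: algebra_simps)
    show "((\<lambda>x. 2 * Re (deriv h (Complex x (Im z)) * cnj (h (Complex x (Im z))))) has_real_derivative
        2 * Re (deriv (deriv h) z * cnj (h z)) + 2 * (cmod (deriv h z))\<^sup>2) (at (Re z))"
      unfolding sq by (rule DERIV_cong[OF DERIV_cmult[OF Re_mult_cnj_slices(1)[OF d(2)[OF z] d(1)[OF z]]]]) (simp add: algebra_simps)
    show "((\<lambda>y. 2 * Re (\<i> * deriv h (Complex (Re z) y) * cnj (h (Complex (Re z) y)))) has_real_derivative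
        - 2 * Re (deriv (deriv h) z * cnj (h z)) + 2 * (cmod (deriv h z))\<^sup>2) (at (Im z))"
      unfolding sq by (rule DERIV_cong[OF DERIV_cmult[OF Re_mult_cnj_slices(2)[OF d(3)[OF z] d(1)[OF z]]]]) (simp add: algebra_simps)
  qed (intro continuous_intros c)+
qed

lemma C2_planar_diff:
  assumes "C2_planar U V Vx Vxx Vy Vyy" "C2_planar U W Wx Wxx Wy Wyy"
  shows "C2_planar U (\<lambda>z. V z - W z) (\<lambda>z. Vx z - Wx z) (\<lambda>z. Vxx z - Wxx z) (\<lambda>z. Vy z - Wy z) (\<lambda>z. Vyy z - Wyy z)"
  using assms unfolding C2_planar_def by (auto intro!: continuous_intros DERIV_diff)

lemma C2_planar_cong:
  assumes U: "open U" and C: "C2_planar U V Vx Vxx Vy Vyy" and eq: "\<And>z. z \<in> U \<Longrightarrow> W z = V z"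
  shows "C2_planar U W Vx Vxx Vy Vyy"
proof -
  have "((\<lambda>x. W (Complex x (Im z))) has_real_derivative Vx z) (at (Re z))"
    "((\<lambda>y. W (Complex (Re z) y)) has_real_derivative Vy z) (at (Im z))" if z: "z \<in> U" for z
  proof -
    have ox: "open ((\<lambda>x. Complex x (Im z)) -` U)" and oy: "open ((\<lambda>y. Complex (Re z) y) -` U)"
      by (intro open_vimage U; auto intro!: continuous_intros simp: Complex_eq)+
    show "((\<lambda>x. W (Complex x (Im z))) has_real_derivative Vx z) (at (Re z))"
      by (rule has_field_derivative_transform_within_open[OF _ ox, of "\<lambda>x. V (Complex x (Im z))"])
         (use C z eq in \<open>auto simp: C2_planar_def\<close>)
    show "((\<lambda>y. W (Complex (Re z) y)) has_real_derivative Vy z) (at (Im z))"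
      by (rule has_field_derivative_transform_within_open[OF _ oy, of "\<lambda>y. V (Complex (Re z) y)"])
         (use C z eq in \<open>auto simp: C2_planar_def\<close>)
  qed
  moreover have "continuous_on U W" using C eq by (auto simp: C2_planar_def cong: continuous_on_cong)
  ultimately show ?thesis using C by (auto simp: C2_planar_def)
qed

text \<open>For R = |h|^2 - |k|^2 with h, k holomorphic, \<Delta>R = 4 (|h'|^2 - |k'|^2) and
  |\<nabla>R|^2 = 4 |h' cnj h - k' cnj k|^2. The claim is a Lagrange identity: R \<Delta>R -
  |\<nabla>R|^2 = - 4 |h k' - k h'|^2.\<close>

lemma wronskian_identity:
  fixes h k h' k' :: complex
  assumes "h * k' - k * h' = 1"
  shows "((cmod h)\<^sup>2 - (cmod k)\<^sup>2) * (4 * ((cmod h')\<^sup>2 - (cmod k')\<^sup>2))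
    - ((2 * Re (h' * cnj h) - 2 * Re (k' * cnj k))\<^sup>2 + (2 * Re (\<i> * h' * cnj h) - 2 * Re (\<i> * k' * cnj k))\<^sup>2) = - 4"
proof -
  have "((cmod h)\<^sup>2 - (cmod k)\<^sup>2) * (4 * ((cmod h')\<^sup>2 - (cmod k')\<^sup>2))
    - ((2 * Re (h' * cnj h) - 2 * Re (k' * cnj k))\<^sup>2 + (2 * Re (\<i> * h' * cnj h) - 2 * Re (\<i> * k' * cnj k))\<^sup>2)
    = - 4 * (cmod (h * k' - k * h'))\<^sup>2"
    unfolding cmod_power2 by (simp add: power2_eq_square) (simp add: algebra_simps)
  then show ?thesis by (simp add: assms)
qed

text \<open>Adding the tangent inequalities at two points shows that \<open>f'\<close> is
  monotone.\<close>

lemma convex_second_derivative_nonneg: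
  fixes f :: "real \<Rightarrow> real"
  assumes A: "open A" "convex A" and f: "convex_on A f"
    and d1: "\<And>x. x \<in> A \<Longrightarrow> (f has_real_derivative f' x) (at x)"
    and d2: "(f' has_real_derivative D) (at x)" and x: "x \<in> A"
  shows "0 \<le> D"
proof (rule mono_on_imp_deriv_nonneg[OF _ d2])
  show "x \<in> interior A" using A x by (simp add: interior_open)
  show "mono_on A f'"
  proof (rule mono_onI)
    fix a b assume ab: "a \<in> A" "b \<in> A" "a \<le> b"
    have tan: "f' c * (y - c) \<le> f y - f c" if "c \<in> A" "y \<in> A" for c y
      using convex_on_imp_above_tangent[OF f convex_connected[OF A(2)], of c y "f' c"] that A d1
      by (auto simp: interior_open intro: has_field_derivative_at_within)
    have "f' a * (b - a) \<le> f' b * (b - a)"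
      using tan[of a b] tan[of b a] ab by (simp add: algebra_simps)
    then show "f' a \<le> f' b" using ab by (cases "a = b") (auto simp: mult_le_cancel_right)
  qed
qed

text \<open>Concavity restricts to horizontal and vertical lines, where each pure second derivative
  is at most 0.\<close>

lemma C2_planar_concave:
  assumes oD: "open D" and C: "C2_planar D V Vx Vxx Vy Vyy" and V: "concave_on D V" and z: "z \<in> D"
  shows "Vxx z + Vyy z \<le> 0"
proof -
  have conc: "convex_on D (\<lambda>z. - V z)"
    using V by (simp add: concave_on_def)
  have D: "convex D" using conc by (rule convex_on_imp_convex)
  have cx: "convex_on A (\<lambda>x. - V (a + x *\<^sub>R v))" if A: "A = (\<lambda>x. a + x *\<^sub>R v) -` D" for a v A
  proof -
    have cA: "convex A"
      unfolding A
    proof (rule convexI)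
      fix x y u w :: real assume *: "x \<in> (\<lambda>x. a + x *\<^sub>R v) -` D" "y \<in> (\<lambda>x. a + x *\<^sub>R v) -` D" "0 \<le> u" "0 \<le> w" "u + w = 1"
      have "a + (u *\<^sub>R x + w *\<^sub>R y) *\<^sub>R v = u *\<^sub>R (a + x *\<^sub>R v) + w *\<^sub>R (a + y *\<^sub>R v)"
      proof -
        have "a = u *\<^sub>R a + w *\<^sub>R a" using *(5) by (metis scaleR_add_left scaleR_one)
        then show ?thesis by (simp add: algebra_simps)
      qed
      then show "u *\<^sub>R x + w *\<^sub>R y \<in> (\<lambda>x. a + x *\<^sub>R v) -` D"
        using convexD[OF D] * by auto
    qed
    show ?thesis
    proof (rule convex_onI)
      fix t x y :: real assume *: "0 < t" "t < 1" "x \<in> A" "y \<in> A"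
      have "a + ((1 - t) *\<^sub>R x + t *\<^sub>R y) *\<^sub>R v = (1 - t) *\<^sub>R (a + x *\<^sub>R v) + t *\<^sub>R (a + y *\<^sub>R v)"
        by (simp add: algebra_simps)
      then show "- V (a + ((1 - t) *\<^sub>R x + t *\<^sub>R y) *\<^sub>R v) \<le> (1 - t) * - V (a + x *\<^sub>R v) + t * - V (a + y *\<^sub>R v)"
        using convex_onD[OF conc, of t "a + x *\<^sub>R v" "a + y *\<^sub>R v"] * A by simp
    qed (rule cA)
  qed
  have "0 \<le> - Vxx z"
  proof -
    define A where "A = (\<lambda>x. Complex x (Im z)) -` D"
    have e: "(\<lambda>x. Complex x (Im z)) = (\<lambda>x. Complex 0 (Im z) + x *\<^sub>R 1)" by (auto simp: complex_eq_iff)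
    have oA: "open A" unfolding A_def by (intro open_vimage oD; auto intro!: continuous_intros simp: Complex_eq)
    have cv: "convex_on A (\<lambda>x. - V (Complex x (Im z)))"
      using cx[of A "Complex 0 (Im z)" 1] unfolding A_def e[symmetric] e[THEN fun_cong, symmetric] by simp
    show ?thesis
      by (rule convex_second_derivative_nonneg[OF oA convex_on_imp_convex[OF cv] cv,
         where x = "Re z" and f' = "\<lambda>x. - Vx (Complex x (Im z))"])
         (use C z in \<open>auto simp: C2_planar_def A_def intro!: DERIV_minus dest: bspec\<close>)
  qed
  moreover have "0 \<le> - Vyy z"
  proof -
    define A where "A = (\<lambda>y. Complex (Re z) y) -` D"
    have e: "(\<lambda>y. Complex (Re z) y) = (\<lambda>y. Complex (Re z) 0 + y *\<^sub>R \<i>)" by (auto simp: complex_eq_iff)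
    have oA: "open A" unfolding A_def by (intro open_vimage oD; auto intro!: continuous_intros simp: Complex_eq)
    have cv: "convex_on A (\<lambda>y. - V (Complex (Re z) y))"
      using cx[of A "Complex (Re z) 0" \<i>] unfolding A_def e[symmetric] e[THEN fun_cong, symmetric] by simp
    show ?thesis
      by (rule convex_second_derivative_nonneg[OF oA convex_on_imp_convex[OF cv] cv,
         where x = "Im z" and f' = "\<lambda>y. - Vy (Complex (Re z) y)"])
         (use C z in \<open>auto simp: C2_planar_def A_def intro!: DERIV_minus dest: bspec\<close>)
  qed
  ultimately show ?thesis by linarith
qed

theorem hyperbolic_radius_C2:
  assumes cp: "conformal_pair D g p" and D: "convex D"
  obtains Rx Rxx Ry Ryy where "C2_planar D (hyperbolic_radius D) Rx Rxx Ry Ryy"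
    "\<And>z. z \<in> D \<Longrightarrow> (Rx z)\<^sup>2 + (Ry z)\<^sup>2 = hyperbolic_radius D z * (Rxx z + Ryy z) + 4"
    "\<And>z. z \<in> D \<Longrightarrow> Rxx z + Ryy z \<le> 0"
proof -
  let ?R = "hyperbolic_radius D"
  have oD: "open D" using cp by (simp add: conformal_pair_def)
  obtain h k where hk: "h holomorphic_on D" "k holomorphic_on D"
    "\<And>z. z \<in> D \<Longrightarrow> ?R z = (cmod (h z))\<^sup>2 - (cmod (k z))\<^sup>2"
    "\<And>z. z \<in> D \<Longrightarrow> h z * deriv k z - k z * deriv h z = 1"
    using hyperbolic_radius_norm_squares[OF cp D] by blast
  note C = C2_planar_cong[OF oD C2_planar_diff[OF C2_planar_norm_square[OF oD hk(1)] C2_planar_norm_square[OF oD hk(2)]] hk(3)]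
  show thesis
  proof (rule that[OF C])
    fix z assume z: "z \<in> D"
    show "(2 * Re (deriv h z * cnj (h z)) - 2 * Re (deriv k z * cnj (k z)))\<^sup>2
        + (2 * Re (\<i> * deriv h z * cnj (h z)) - 2 * Re (\<i> * deriv k z * cnj (k z)))\<^sup>2
      = ?R z * (2 * Re (deriv (deriv h) z * cnj (h z)) + 2 * (cmod (deriv h z))\<^sup>2 -
          (2 * Re (deriv (deriv k) z * cnj (k z)) + 2 * (cmod (deriv k z))\<^sup>2) +
          (- 2 * Re (deriv (deriv h) z * cnj (h z)) + 2 * (cmod (deriv h z))\<^sup>2 -
          (- 2 * Re (deriv (deriv k) z * cnj (k z)) + 2 * (cmod (deriv k z))\<^sup>2))) + 4"
      using wronskian_identity[OF hk(4)[OF z]] unfolding hk(3)[OF z] by (simp add: algebra_simps)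
  next
    fix z assume "z \<in> D"
    from C2_planar_concave[OF oD C hyperbolic_radius_concave[OF cp D] this]
    show "2 * Re (deriv (deriv h) z * cnj (h z)) + 2 * (cmod (deriv h z))\<^sup>2 -
          (2 * Re (deriv (deriv k) z * cnj (k z)) + 2 * (cmod (deriv k z))\<^sup>2) +
          (- 2 * Re (deriv (deriv h) z * cnj (h z)) + 2 * (cmod (deriv h z))\<^sup>2 -
          (- 2 * Re (deriv (deriv k) z * cnj (k z)) + 2 * (cmod (deriv k z))\<^sup>2)) \<le> 0" .
  qed
qed

section \<open>Mollified functions with the submean property\<close>

text \<open>The submean inequality over one circle, expressed through L - \<psi>. For \<psi> \<le> L
  this is the usual inequality, but as a comparison of nonnegative integrals it can be averaged with
  Tonelli.\<close>

definition submean_at :: "(complex \<Rightarrow> real) \<Rightarrow> real \<Rightarrow> complex \<Rightarrow> real \<Rightarrow> bool" where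
  "submean_at \<psi> L z \<rho> \<longleftrightarrow>
     (\<integral>\<^sup>+\<theta>\<in>{0..2*pi}. ennreal (L - \<psi> (z + of_real \<rho> * cis \<theta>)) \<partial>lborel) \<le> ennreal (2 * pi) * ennreal (L - \<psi> z)"

lemma smooth_conv_mollifier:
  assumes "integrable lborel \<psi>" "0 < \<eta>"
  shows "smooth (conv \<psi> (mollifier \<eta>))"
    "laplacian (conv \<psi> (mollifier \<eta>)) = conv \<psi> (laplacian (mollifier \<eta>))"
  by (rule conv_smooth[OF assms(1) smooth_mollifier, of \<eta>]; use assms(2) mollifier_eq_0 in auto)+

lemma integrable_conv_mollifier:
  assumes "integrable lborel \<psi>" "0 < \<eta>"
  shows "integrable lborel (\<lambda>w. \<psi> w * mollifier \<eta> (z - w))"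
  by (rule integrable_conv[OF assms(1) smoothD(4)[OF smooth_mollifier], of \<eta>])
     (use assms(2) mollifier_eq_0 in auto)

lemma integral_mollifier_shift:
  assumes "0 < \<eta>"
  shows "(\<integral>w. mollifier \<eta> (z - w) \<partial>lborel) = 1" "integrable lborel (\<lambda>w. mollifier \<eta> (z - w))"
proof -
  show "(\<integral>w. mollifier \<eta> (z - w) \<partial>lborel) = 1"
    using integral_lborel_reflect[OF smoothD(5)[OF smooth_mollifier], of \<eta> z] integral_mollifier[OF assms] by simp
  show "integrable lborel (\<lambda>w. mollifier \<eta> (z - w))"
    by (rule integrable_lborel_reflect[OF integrable_mollifier[OF assms]])
qed

lemma conv_mollifier_defect:
  assumes \<psi>: "integrable lborel \<psi>" "\<And>z. \<psi> z \<le> L" and \<eta>: "0 < \<eta>"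
  shows "ennreal (L - conv \<psi> (mollifier \<eta>) z)
      = (\<integral>\<^sup>+w. ennreal (L - \<psi> (z - w)) * ennreal (mollifier \<eta> w) \<partial>lborel)"
    and "conv \<psi> (mollifier \<eta>) z \<le> L"
proof -
  have [measurable]: "\<psi> \<in> borel_measurable borel" "mollifier \<eta> \<in> borel_measurable borel"
    using borel_measurable_integrable[OF \<psi>(1)] smoothD(5)[OF smooth_mollifier] by auto
  have eq: "(L - \<psi> w) * mollifier \<eta> (z - w) = L * mollifier \<eta> (z - w) - \<psi> w * mollifier \<eta> (z - w)" for w
    by (simp add: algebra_simps)
  have int: "integrable lborel (\<lambda>w. (L - \<psi> w) * mollifier \<eta> (z - w))"
    unfolding eq using integral_mollifier_shift(2)[OF \<eta>, of z] integrable_conv_mollifier[OF \<psi>(1) \<eta>, of z]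
    by (intro Bochner_Integration.integrable_diff integrable_mult_right)
  have val: "(\<integral>w. (L - \<psi> w) * mollifier \<eta> (z - w) \<partial>lborel) = L - conv \<psi> (mollifier \<eta>) z"
    unfolding eq conv_def using integral_mollifier_shift[OF \<eta>, of z] integrable_conv_mollifier[OF \<psi>(1) \<eta>, of z]
    by simp
  have nn: "0 \<le> (L - \<psi> w) * mollifier \<eta> (z - w)" for w
    using \<psi>(2) mollifier_nonneg by simp
  have "0 \<le> (\<integral>w. (L - \<psi> w) * mollifier \<eta> (z - w) \<partial>lborel)"
    using nn by (intro Bochner_Integration.integral_nonneg) auto
  then show "conv \<psi> (mollifier \<eta>) z \<le> L" unfolding val by simp
  have "ennreal (L - conv \<psi> (mollifier \<eta>) z) = (\<integral>\<^sup>+w. ennreal ((L - \<psi> w) * mollifier \<eta> (z - w)) \<partial>lborel)"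
    unfolding val[symmetric] using int nn by (intro nn_integral_eq_integral[symmetric]) auto
  also have "\<dots> = (\<integral>\<^sup>+w. ennreal (L - \<psi> w) * ennreal (mollifier \<eta> (z - w)) \<partial>lborel)"
    using \<psi>(2) mollifier_nonneg by (intro nn_integral_cong ennreal_mult) auto
  also have "\<dots> = (\<integral>\<^sup>+w. ennreal (L - \<psi> (z - w)) * ennreal (mollifier \<eta> (z - (z - w))) \<partial>lborel)"
    by (rule nn_integral_lborel_reflect[symmetric]) measurable
  finally show "ennreal (L - conv \<psi> (mollifier \<eta>) z)
      = (\<integral>\<^sup>+w. ennreal (L - \<psi> (z - w)) * ennreal (mollifier \<eta> w) \<partial>lborel)" by simp
qed

lemma nn_integral_mollifier: "0 < \<eta> \<Longrightarrow> (\<integral>\<^sup>+w. ennreal (mollifier \<eta> w) \<partial>lborel) = 1"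
  using nn_integral_eq_integral[OF integrable_mollifier, of \<eta>] mollifier_nonneg integral_mollifier[of \<eta>]
  by simp

text \<open>The mollifier averages circle means about \<open>z\<close>, each of which is at least
  \<psi>(z); \<open>nn_integral_radial_le\<close> does the averaging.\<close>

lemma conv_mollifier_ge:
  assumes \<psi>: "integrable lborel \<psi>" "\<And>z. \<psi> z \<le> L" and \<eta>: "0 < \<eta>"
    and mean: "\<And>\<rho>. 0 < \<rho> \<Longrightarrow> \<rho> < \<eta> \<Longrightarrow> submean_at \<psi> L z \<rho>"
  shows "\<psi> z \<le> conv \<psi> (mollifier \<eta>) z"
proof -
  have [measurable]: "\<psi> \<in> borel_measurable borel" "mollifier \<eta> \<in> borel_measurable borel"
    using borel_measurable_integrable[OF \<psi>(1)] smoothD(5)[OF smooth_mollifier] by auto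
  have "ennreal (L - conv \<psi> (mollifier \<eta>) z)
      = (\<integral>\<^sup>+w. ennreal (L - \<psi> (z - w)) * ennreal (mollifier \<eta> w) \<partial>lborel)"
    by (rule conv_mollifier_defect[OF \<psi> \<eta>])
  also have "\<dots> = (\<integral>\<^sup>+w. ennreal (L - \<psi> (z - (0 - w))) * ennreal (mollifier \<eta> (0 - w)) \<partial>lborel)"
    by (rule nn_integral_lborel_reflect[symmetric]) measurable
  also have "\<dots> = (\<integral>\<^sup>+w. ennreal (L - \<psi> (z + w)) * ennreal (mollifier \<eta> w) \<partial>lborel)"
    using mollifier_radial[of "- w" w \<eta> for w] by simp
  also have "\<dots> \<le> ennreal (L - \<psi> z) * (\<integral>\<^sup>+w. ennreal (mollifier \<eta> w) \<partial>lborel)"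
  proof (rule nn_integral_radial_le[where r = \<eta> and \<kappa> = "\<lambda>w. ennreal (mollifier \<eta> w)"])
    show "ennreal (mollifier \<eta> w) = ennreal (mollifier \<eta> (of_real (cmod w)))" for w
      using mollifier_radial[of w "of_real (cmod w)" \<eta>] by simp
    show "\<eta> \<le> cmod w \<Longrightarrow> ennreal (mollifier \<eta> w) = 0" for w
      using mollifier_eq_0[OF \<eta>, of w] by simp
    show "0 < \<rho> \<Longrightarrow> \<rho> < \<eta> \<Longrightarrow> (\<integral>\<^sup>+\<theta>\<in>{0..2 * pi}. ennreal (L - \<psi> (z + of_real \<rho> * cis \<theta>)) \<partial>lborel)
         \<le> ennreal (2 * pi) * ennreal (L - \<psi> z)" for \<rho>
      using mean unfolding submean_at_def .
  qed measurable
  also have "\<dots> = ennreal (L - \<psi> z)" using \<eta> by (simp add: nn_integral_mollifier)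
  finally have "L - conv \<psi> (mollifier \<eta>) z \<le> L - \<psi> z"
    using \<psi>(2)[of z] by (subst (asm) ennreal_le_iff) auto
  then show ?thesis by simp
qed

text \<open>By Fubini the mollification inherits submean inequalities from all translates z - w with
  |w| < \<eta>; being smooth, it then has a nonnegative Laplacian. Hence the hypothesis on a whole
  \<open>\<eta>\<close>-disc about \<open>z\<close>.\<close>

lemma conv_mollifier_laplacian_nonneg:
  assumes \<psi>: "integrable lborel \<psi>" "\<And>z. \<psi> z \<le> L" and \<eta>: "0 < \<eta>" and \<sigma>: "0 < \<sigma>"
    and mean: "\<And>y \<rho>. dist y z < \<eta> \<Longrightarrow> 0 < \<rho> \<Longrightarrow> \<rho> < \<sigma> \<Longrightarrow> submean_at \<psi> L y \<rho>"
  shows "0 \<le> laplacian (conv \<psi> (mollifier \<eta>)) z"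
proof (rule laplacian_nonneg_of_submean[OF smooth_conv_mollifier(1)[OF \<psi>(1) \<eta>] conv_mollifier_defect(2)[OF \<psi> \<eta>] \<sigma>])
  fix \<rho> assume \<rho>: "0 < \<rho>" "\<rho> < \<sigma>"
  have [measurable]: "\<psi> \<in> borel_measurable borel" "mollifier \<eta> \<in> borel_measurable borel"
    using borel_measurable_integrable[OF \<psi>(1)] smoothD(5)[OF smooth_mollifier] by auto
  have [measurable]: "cis \<in> borel_measurable borel"
    by (intro borel_measurable_continuous_onI continuous_intros)
  note rep = conv_mollifier_defect(1)[OF \<psi> \<eta>]
  have "(\<integral>\<^sup>+\<theta>\<in>{0..2*pi}. ennreal (L - conv \<psi> (mollifier \<eta>) (z + of_real \<rho> * cis \<theta>)) \<partial>lborel)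
    = (\<integral>\<^sup>+\<theta>. \<integral>\<^sup>+w. ennreal (L - \<psi> (z + of_real \<rho> * cis \<theta> - w)) * ennreal (mollifier \<eta> w) * indicator {0..2*pi} \<theta> \<partial>lborel \<partial>lborel)"
    unfolding rep by (intro nn_integral_cong) (simp add: nn_integral_multc)
  also have "\<dots> = (\<integral>\<^sup>+w. \<integral>\<^sup>+\<theta>. ennreal (L - \<psi> (z + of_real \<rho> * cis \<theta> - w)) * ennreal (mollifier \<eta> w) * indicator {0..2*pi} \<theta> \<partial>lborel \<partial>lborel)"
    by (rule lborel_pair.Fubini') measurable
  also have "\<dots> = (\<integral>\<^sup>+w. ennreal (mollifier \<eta> w) * (\<integral>\<^sup>+\<theta>\<in>{0..2*pi}. ennreal (L - \<psi> ((z - w) + of_real \<rho> * cis \<theta>)) \<partial>lborel) \<partial>lborel)"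
    by (intro nn_integral_cong) (simp add: nn_integral_cmult[symmetric] algebra_simps)
  also have "\<dots> \<le> (\<integral>\<^sup>+w. ennreal (mollifier \<eta> w) * (ennreal (2 * pi) * ennreal (L - \<psi> (z - w))) \<partial>lborel)"
  proof (intro nn_integral_mono)
    fix w
    show "ennreal (mollifier \<eta> w) * (\<integral>\<^sup>+\<theta>\<in>{0..2*pi}. ennreal (L - \<psi> ((z - w) + of_real \<rho> * cis \<theta>)) \<partial>lborel)
      \<le> ennreal (mollifier \<eta> w) * (ennreal (2 * pi) * ennreal (L - \<psi> (z - w)))"
    proof (cases "cmod w < \<eta>")
      case True
      then have "submean_at \<psi> L (z - w) \<rho>" using \<rho> by (intro mean) (auto simp: dist_norm)
      then show ?thesis unfolding submean_at_def by (intro mult_left_mono) auto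
    next
      case False
      then show ?thesis using mollifier_eq_0[OF \<eta>, of w] by simp
    qed
  qed
  also have "\<dots> = (\<integral>\<^sup>+w. ennreal (2 * pi) * (ennreal (L - \<psi> (z - w)) * ennreal (mollifier \<eta> w)) \<partial>lborel)"
    by (intro nn_integral_cong) (simp add: mult_ac)
  also have "\<dots> = ennreal (2 * pi) * ennreal (L - conv \<psi> (mollifier \<eta>) z)"
    unfolding rep by (rule nn_integral_cmult) measurable
  finally show "(\<integral>\<^sup>+\<theta>\<in>{0..2*pi}. ennreal (L - conv \<psi> (mollifier \<eta>) (z + of_real \<rho> * cis \<theta>)) \<partial>lborel)
    \<le> ennreal (2 * pi) * ennreal (L - conv \<psi> (mollifier \<eta>) z)" .
qed

lemma test_function_mollifier_reflect:
  assumes "0 < \<eta>" "cball z \<eta> \<subseteq> U"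
  shows "test_function U (\<lambda>w. mollifier \<eta> (z - w))"
proof -
  have "{w. mollifier \<eta> (z - w) \<noteq> 0} \<subseteq> cball z \<eta>"
    using mollifier_eq_0[OF assms(1), of "z - w" for w] by (auto simp: dist_norm) (metis linear)
  then have "closure {w. mollifier \<eta> (z - w) \<noteq> 0} \<subseteq> cball z \<eta>"
    and "bounded {w. mollifier \<eta> (z - w) \<noteq> 0}"
    by (rule closure_minimal[OF _ closed_cball], rule bounded_subset[OF bounded_cball])
  then show ?thesis
    using smooth_reflect(1)[OF smooth_mollifier, of \<eta> z] assms(2)
    by (auto simp: test_function_def smooth_def compact_closure)
qed

lemma C2_planar_green:
  assumes U: "open U" and \<phi>: "test_function U \<phi>" and C: "C2_planar U V Vx Vxx Vy Vyy"
  shows "integrable lborel (\<lambda>z. V z * laplacian \<phi> z)"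
    and "integrable lborel (\<lambda>z. \<phi> z * (Vxx z + Vyy z))"
    and "(\<integral>z. V z * laplacian \<phi> z \<partial>lborel) = (\<integral>z. \<phi> z * (Vxx z + Vyy z) \<partial>lborel)"
proof -
  have *: "\<And>z. z \<in> U \<Longrightarrow> ((\<lambda>x. V (Complex x (Im z))) has_real_derivative Vx z) (at (Re z))"
    "\<And>z. z \<in> U \<Longrightarrow> ((\<lambda>x. Vx (Complex x (Im z))) has_real_derivative Vxx z) (at (Re z))"
    "\<And>z. z \<in> U \<Longrightarrow> ((\<lambda>y. V (Complex (Re z) y)) has_real_derivative Vy z) (at (Im z))"
    "\<And>z. z \<in> U \<Longrightarrow> ((\<lambda>y. Vy (Complex (Re z) y)) has_real_derivative Vyy z) (at (Im z))"
    "continuous_on U V" "continuous_on U Vxx" "continuous_on U Vyy"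
    using C by (auto simp: C2_planar_def)
  note green_identity[OF U \<phi>, of V Vx Vxx Vy Vyy, OF *]
  then show "integrable lborel (\<lambda>z. V z * laplacian \<phi> z)"
    and "integrable lborel (\<lambda>z. \<phi> z * (Vxx z + Vyy z))"
    and "(\<integral>z. V z * laplacian \<phi> z \<partial>lborel) = (\<integral>z. \<phi> z * (Vxx z + Vyy z) \<partial>lborel)" by auto
qed

text \<open>The Laplacian is first put on the mollifier, then moved to \<open>\<psi>\<close> by
  Green's identity. Only values of \<open>\<psi>\<close> within \<open>\<eta>\<close> of
  \<open>z\<close> matter, so regularity on \<open>U\<close> is enough.\<close>

lemma laplacian_conv_mollifier_C2:
  assumes \<psi>: "integrable lborel \<psi>" and \<eta>: "0 < \<eta>" and U: "open U" "cball z \<eta> \<subseteq> U"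
    and C: "C2_planar U \<psi> Vx Vxx Vy Vyy"
  shows "laplacian (conv \<psi> (mollifier \<eta>)) z = (\<integral>w. mollifier \<eta> (z - w) * (Vxx w + Vyy w) \<partial>lborel)"
proof -
  have "laplacian (conv \<psi> (mollifier \<eta>)) z = (\<integral>w. \<psi> w * laplacian (\<lambda>w. mollifier \<eta> (z - w)) w \<partial>lborel)"
    unfolding smooth_conv_mollifier(2)[OF \<psi> \<eta>] smooth_reflect(4)[OF smooth_mollifier] by (simp add: conv_def)
  also have "\<dots> = (\<integral>w. mollifier \<eta> (z - w) * (Vxx w + Vyy w) \<partial>lborel)"
    by (rule C2_planar_green(3)[OF U(1) test_function_mollifier_reflect[OF \<eta> U(2)] C])
  finally show ?thesis .
qed

section \<open>The model singularity\<close>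

text \<open>Minus the Laplacian of z \<mapsto> \<open>log_cap r\<close> (|z|^2), defined below: a
  continuous radial substitute for a point mass at the pole.\<close>

definition truncated_density :: "real \<Rightarrow> complex \<Rightarrow> real" where
  "truncated_density r w = 4 * max 0 (r\<^sup>2 - (cmod w)\<^sup>2) / r ^ 4"

lemma truncated_density_continuous: "0 < r \<Longrightarrow> continuous_on UNIV (truncated_density r)"
  unfolding truncated_density_def[abs_def] by (intro continuous_intros) auto

lemma truncated_density_nonneg: "0 \<le> truncated_density r w"
  by (simp add: truncated_density_def)

lemma truncated_density_eq_0: "0 < r \<Longrightarrow> r \<le> cmod w \<Longrightarrow> truncated_density r w = 0"
  by (simp add: truncated_density_def)

lemma truncated_density_integrable:
  assumes "0 < r" shows "integrable lborel (truncated_density r)"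
  by (rule integrable_continuous_compact_support[of "cball 0 r"])
     (use assms truncated_density_continuous truncated_density_eq_0 in \<open>auto intro: continuous_on_subset\<close>)

definition truncated_mass :: "real \<Rightarrow> real" where
  "truncated_mass r = (\<integral>w. truncated_density r w \<partial>lborel)"

lemma truncated_mass_pos:
  assumes "0 < r" shows "0 < truncated_mass r"
proof -
  have "truncated_mass r \<noteq> 0"
  proof
    assume "truncated_mass r = 0"
    then have "AE w in lborel. truncated_density r w = 0"
      unfolding truncated_mass_def using truncated_density_integrable[OF assms] truncated_density_nonneg
      by (subst (asm) integral_nonneg_eq_0_iff_AE) auto
    then have "AE w in lborel. w \<in> ball 0 r \<longrightarrow> truncated_density r w = 0"
      by (rule eventually_mono) blast
    then obtain w :: complex where w: "w \<in> ball 0 r" "truncated_density r w = 0"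
      using open_AE_nonempty[of "ball 0 r" "\<lambda>w. truncated_density r w = 0"] assms by auto
    then show False
      using power_strict_mono[of "cmod w" r 2] assms by (simp add: truncated_density_def)
  qed
  moreover have "0 \<le> truncated_mass r"
    unfolding truncated_mass_def using truncated_density_nonneg by (intro Bochner_Integration.integral_nonneg) auto
  ultimately show ?thesis by simp
qed

text \<open>The mollified kernel stays radial because rotating the integration variable changes
  neither factor; \<open>\<kappa> (of_real (cmod w))\<close> is the form of radiality that
  \<open>nn_integral_radial_le\<close> expects. Tonelli preserves the mass.\<close>

lemma conv_truncated_density:
  assumes r: "0 < r" and \<eta>: "0 < \<eta>"
  defines "\<kappa> \<equiv> conv (truncated_density r) (mollifier \<eta>)"
  shows "\<kappa> \<in> borel_measurable borel" "0 \<le> \<kappa> w" "r + \<eta> \<le> cmod w \<Longrightarrow> \<kappa> w = 0"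
    "\<kappa> w = \<kappa> (of_real (cmod w))" "(\<integral>\<^sup>+w. ennreal (\<kappa> w) \<partial>lborel) = ennreal (truncated_mass r)"
    "integrable lborel \<kappa>" "(\<integral>w. \<kappa> w \<partial>lborel) = truncated_mass r"
proof -
  note td = truncated_density_integrable[OF r] truncated_density_nonneg
  have [measurable]: "truncated_density r \<in> borel_measurable borel" "mollifier \<eta> \<in> borel_measurable borel"
    using borel_measurable_integrable[OF td(1)] smoothD(5)[OF smooth_mollifier] by auto
  have sm: "smooth \<kappa>" unfolding \<kappa>_def by (rule smooth_conv_mollifier[OF td(1) \<eta>])
  show m: "\<kappa> \<in> borel_measurable borel" by (rule smoothD(5)[OF sm])
  show nn: "0 \<le> \<kappa> w" for w
    unfolding \<kappa>_def conv_def using td(2) mollifier_nonneg by (intro Bochner_Integration.integral_nonneg) auto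
  show z: "\<kappa> w = 0" if "r + \<eta> \<le> cmod w" for w
  proof -
    have "truncated_density r x * mollifier \<eta> (w - x) = 0" for x
    proof (cases "r \<le> cmod x")
      case False
      have "cmod w \<le> cmod (w - x) + cmod x" by (metis diff_add_cancel norm_triangle_ineq)
      then have "\<eta> \<le> cmod (w - x)" using False that by simp
      then show ?thesis using mollifier_eq_0[OF \<eta>] by simp
    qed (simp add: truncated_density_eq_0[OF r])
    then have "(\<lambda>x. truncated_density r x * mollifier \<eta> (w - x)) = (\<lambda>_. 0)" by blast
    then show ?thesis by (simp add: \<kappa>_def conv_def)
  qed
  have rot: "\<kappa> (c * w) = \<kappa> w" if c: "cmod c = 1" for c w
  proof -
    have "\<kappa> (c * w) = (\<integral>x. truncated_density r (c * x) * mollifier \<eta> (c * w - c * x) \<partial>lborel)"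
      unfolding \<kappa>_def conv_def
      by (rule integral_complex_rotate[where f = "\<lambda>x. truncated_density r x * mollifier \<eta> (c * w - x)", symmetric])
         (use c in measurable)
    also have "\<dots> = (\<integral>x. truncated_density r x * mollifier \<eta> (w - x) \<partial>lborel)"
    proof -
      have "truncated_density r (c * x) = truncated_density r x" for x
        using c by (simp add: truncated_density_def norm_mult)
      moreover have "mollifier \<eta> (c * w - c * x) = mollifier \<eta> (w - x)" for x
        by (rule mollifier_radial) (metis c mult_1 norm_mult right_diff_distrib)
      ultimately show ?thesis by simp
    qed
    finally show ?thesis by (simp add: \<kappa>_def conv_def)
  qed
  show "\<kappa> w = \<kappa> (of_real (cmod w))"
  proof (cases "w = 0")
    case False
    have "w = sgn w * of_real (cmod w)" using False by (simp add: sgn_eq)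
    then show ?thesis using rot[of "sgn w" "of_real (cmod w)"] False by (simp add: norm_sgn)
  qed simp
  have rep: "ennreal (\<kappa> w) = (\<integral>\<^sup>+x. ennreal (truncated_density r x) * ennreal (mollifier \<eta> (w - x)) \<partial>lborel)" for w
    unfolding \<kappa>_def conv_def using td mollifier_nonneg integrable_conv_mollifier[OF td(1) \<eta>, of w]
    by (subst nn_integral_eq_integral[symmetric]) (auto simp: ennreal_mult)
  have "(\<integral>\<^sup>+w. ennreal (\<kappa> w) \<partial>lborel)
      = (\<integral>\<^sup>+x. \<integral>\<^sup>+w. ennreal (truncated_density r x) * ennreal (mollifier \<eta> (w - x)) \<partial>lborel \<partial>lborel)"
    unfolding rep by (rule lborel_pair.Fubini') measurable
  also have "\<dots> = (\<integral>\<^sup>+x. ennreal (truncated_density r x) \<partial>lborel)"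
  proof (intro nn_integral_cong)
    fix x
    have "(\<integral>\<^sup>+w. ennreal (mollifier \<eta> (- x + w)) \<partial>lborel) = (\<integral>\<^sup>+w. ennreal (mollifier \<eta> w) \<partial>lborel)"
      by (rule nn_integral_lborel_translate) measurable
    then show "(\<integral>\<^sup>+w. ennreal (truncated_density r x) * ennreal (mollifier \<eta> (w - x)) \<partial>lborel)
       = ennreal (truncated_density r x)"
      using \<eta> by (subst nn_integral_cmult) (auto simp: nn_integral_mollifier)
  qed
  also have "\<dots> = ennreal (truncated_mass r)"
    unfolding truncated_mass_def using td by (intro nn_integral_eq_integral) auto
  finally show I: "(\<integral>\<^sup>+w. ennreal (\<kappa> w) \<partial>lborel) = ennreal (truncated_mass r)" .
  show int: "integrable lborel \<kappa>"
    using I m nn by (intro integrableI_nonneg) (auto simp: less_top[symmetric])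
  show "(\<integral>w. \<kappa> w \<partial>lborel) = truncated_mass r"
    using I nn_integral_eq_integral[OF int] nn truncated_mass_pos[OF r] Bochner_Integration.integral_nonneg[of lborel \<kappa>]
    by (auto simp: ennreal_inj)
qed

section \<open>Integration against the Riesz measure\<close>

lemma riesz_measure_measurable:
  assumes "is_riesz_measure D u \<nu>" "f \<in> borel_measurable borel"
  shows "f \<in> borel_measurable \<nu>"
proof -
  have "sets \<nu> = sets (restrict_space borel D)" using assms by (simp add: is_riesz_measure_def)
  then show ?thesis
    using measurable_restrict_space1[OF assms(2)] measurable_cong_sets by blast
qed

text \<open>Nonnegativity is recorded separately because \<open>ennreal\<close> would turn a
  negative right-hand side into 0 and lose the information.\<close>

lemma riesz_measure_test_function:
  assumes \<nu>: "is_riesz_measure D u \<nu>" and \<phi>: "test_function D \<phi>" and nn: "\<And>z. 0 \<le> \<phi> z"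
  shows "(\<integral>\<^sup>+z. ennreal (\<phi> z) \<partial>\<nu>) = ennreal (1 / (2 * pi) * (\<integral>z. real_of_ereal (u z) * laplacian \<phi> z \<partial>lborel))"
    and "0 \<le> 1 / (2 * pi) * (\<integral>z. real_of_ereal (u z) * laplacian \<phi> z \<partial>lborel)"
proof -
  obtain K where K: "compact K" "K \<subseteq> D" "smooth \<phi>"
    and z0: "\<And>z. z \<notin> K \<Longrightarrow> \<phi> z = 0" and z3: "\<And>z. z \<notin> K \<Longrightarrow> laplacian \<phi> z = 0"
    using test_functionE[OF \<phi>, of thesis] by blast
  have [measurable]: "\<phi> \<in> borel_measurable \<nu>"
    by (rule riesz_measure_measurable[OF \<nu> smoothD(5)[OF K(3)]])
  have sp: "sets \<nu> = sets (restrict_space borel D)" using \<nu> by (simp add: is_riesz_measure_def)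
  have Ks: "K \<in> sets \<nu>"
    unfolding sp using K(1,2) by (auto simp: sets_restrict_space intro!: image_eqI[of _ _ K] borel_compact)
  have fin: "emeasure \<nu> K < \<infinity>" using \<nu> K by (simp add: is_riesz_measure_def)
  obtain L where L: "\<And>z. z \<in> K \<Longrightarrow> \<bar>\<phi> z\<bar> \<le> L"
  proof -
    have "compact (\<phi> ` K)" using K smoothD(4)[OF K(3)] by (intro compact_continuous_image) (auto intro: continuous_on_subset)
    then have "bounded (\<phi> ` K)" by (rule compact_imp_bounded)
    then show thesis using that unfolding bounded_iff by auto
  qed
  have "integrable \<nu> \<phi>"
  proof (rule Bochner_Integration.integrable_bound[of _ "\<lambda>z. L * indicator K z"])
    show "integrable \<nu> (\<lambda>z. L * indicator K z)" using Ks fin by (simp add: less_top)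
    have "norm (\<phi> z) \<le> norm (L * indicator K z)" for z
      using L[of z] z0[of z] by (cases "z \<in> K") auto
    then show "AE z in \<nu>. norm (\<phi> z) \<le> norm (L * indicator K z)" by simp
  qed simp
  then have eq: "(\<integral>\<^sup>+z. ennreal (\<phi> z) \<partial>\<nu>) = ennreal (LINT z|\<nu>. \<phi> z)"
    using nn by (intro nn_integral_eq_integral) auto
  have "0 \<le> (LINT z|\<nu>. \<phi> z)" using nn by (intro Bochner_Integration.integral_nonneg) auto
  have "(LINT z|\<nu>. \<phi> z) = 1 / (2 * pi) * (LINT z:D|lborel. real_of_ereal (u z) * laplacian \<phi> z)"
    using \<nu> \<phi> by (simp add: is_riesz_measure_def)
  also have "(LINT z:D|lborel. real_of_ereal (u z) * laplacian \<phi> z) = (\<integral>z. real_of_ereal (u z) * laplacian \<phi> z \<partial>lborel)"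
    unfolding set_lebesgue_integral_def
    by (intro Bochner_Integration.integral_cong) (use z3 K(2) in \<open>auto split: split_indicator\<close>)
  finally have val: "(LINT z|\<nu>. \<phi> z) = 1 / (2 * pi) * (\<integral>z. real_of_ereal (u z) * laplacian \<phi> z \<partial>lborel)" .
  show "(\<integral>\<^sup>+z. ennreal (\<phi> z) \<partial>\<nu>) = ennreal (1 / (2 * pi) * (\<integral>z. real_of_ereal (u z) * laplacian \<phi> z \<partial>lborel))"
    using eq unfolding val .
  show "0 \<le> 1 / (2 * pi) * (\<integral>z. real_of_ereal (u z) * laplacian \<phi> z \<partial>lborel)"
    using \<open>0 \<le> (LINT z|\<nu>. \<phi> z)\<close> unfolding val .
qed

text \<open>A constant between u(z) and M(z) separates them in a neighbourhood, by upper
  semicontinuity of \<open>u\<close> and continuity of \<open>M\<close>.\<close>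

lemma open_subharmonic_less:
  assumes u: "subharmonic_on D u" and M: "continuous_on D M"
  shows "open {z \<in> D. u z < ereal (M z)}"
proof -
  have oD: "open D" using u by (simp add: subharmonic_on_def)
  have "{z \<in> D. u z < ereal (M z)} = (\<Union>a. {z \<in> D. u z < ereal a} \<inter> (D \<inter> M -` {a<..}))"
  proof (intro subset_antisym subsetI)
    fix z assume "z \<in> {z \<in> D. u z < ereal (M z)}"
    moreover then obtain a where "u z < ereal a" "ereal a < ereal (M z)"
      using ereal_dense2[of "u z" "ereal (M z)"] by auto
    ultimately show "z \<in> (\<Union>a. {z \<in> D. u z < ereal a} \<inter> (D \<inter> M -` {a<..}))" by auto
  next
    fix z assume "z \<in> (\<Union>a. {z \<in> D. u z < ereal a} \<inter> (D \<inter> M -` {a<..}))"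
    then obtain a where "z \<in> D" "u z < ereal a" "ereal a < ereal (M z)" by auto
    then show "z \<in> {z \<in> D. u z < ereal (M z)}" using less_trans by blast
  qed
  moreover have "open ({z \<in> D. u z < ereal a} \<inter> (D \<inter> M -` {a<..}))" for a
    using u continuous_open_preimage[OF M oD, of "{a<..}"] by (auto simp: subharmonic_on_def)
  ultimately show ?thesis by auto
qed

lemma ennreal_add_le:
  assumes "0 \<le> y" shows "ennreal (x + y) \<le> ennreal x + ennreal y"
proof (cases "0 \<le> x")
  case True
  then show ?thesis using assms by (simp add: ennreal_plus)
next
  case False
  then have "ennreal (x + y) \<le> ennreal y" by (intro ennreal_leI) simp
  also have "\<dots> \<le> ennreal x + ennreal y" by simp
  finally show ?thesis .
qed

text \<open>The testing argument for an abstract weight \<open>\<psi>\<close>, which is regular only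
  on \<open>D0\<close>, where its Laplacian is \<open>- B\<close> times the radial density, and
  satisfies submean inequalities away from the pole. The number \<open>m\<close> bounds
  \<open>M\<close> on \<open>D0\<close>, where \<open>u\<close> and \<open>M\<close> are not
  comparable. The second conclusion keeps the bound meaningful under \<open>ennreal\<close>.\<close>

theorem riesz_potential_estimate:
  assumes D: "open D" "connected D" and u: "subharmonic_on D u" and \<nu>: "is_riesz_measure D u \<nu>"
    and z0: "u z0 = ereal u0"
    and M: "C2_planar D M Mx Mxx My Myy" and lapM: "\<And>z. z \<in> D \<Longrightarrow> 0 \<le> Mxx z + Myy z"
    and uM: "\<And>z. z \<in> D - D0 \<Longrightarrow> u z \<le> ereal (M z)"
    and D0: "open D0" "D0 \<subseteq> D" and r: "0 < r" "r < r'" "cball z0 r' \<subseteq> D0"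
    and m: "\<And>z. z \<in> D0 \<Longrightarrow> M z \<le> m"
    and \<psi>: "\<psi> \<in> borel_measurable borel" "\<And>z. 0 \<le> \<psi> z" "\<And>z. \<psi> z \<le> L"
    and K: "compact K" "K \<subseteq> D" "\<And>z. z \<notin> K \<Longrightarrow> \<psi> z = 0"
    and C: "C2_planar D0 \<psi> Vx Vxx Vy Vyy" and V: "\<And>z. z \<in> D0 \<Longrightarrow> Vxx z + Vyy z = - B * truncated_density r (z - z0)"
    and B: "0 \<le> B" and \<sigma>: "0 < \<sigma>"
    and mean: "\<And>y \<rho>. r' \<le> dist y z0 \<Longrightarrow> 0 < \<rho> \<Longrightarrow> \<rho> < \<sigma> \<Longrightarrow> submean_at \<psi> L y \<rho>"
  shows "(\<integral>\<^sup>+z\<in>D - D0. ennreal (\<psi> z) \<partial>\<nu>)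
     \<le> ennreal (1 / (2 * pi) * ((\<integral>z. \<psi> z * (Mxx z + Myy z) \<partial>lborel) + B * truncated_mass r * (m + 1 - u0)))"
    and "0 \<le> 1 / (2 * pi) * ((\<integral>z. \<psi> z * (Mxx z + Myy z) \<partial>lborel) + B * truncated_mass r * (m + 1 - u0))"
proof -
  let ?q = "\<lambda>z. Mxx z + Myy z"
  have \<psi>_int: "integrable lborel \<psi>"
  proof (rule Bochner_Integration.integrable_bound[of _ "\<lambda>z. L * indicator K z"])
    show "integrable lborel (\<lambda>z. L * indicator K z :: real)"
      using emeasure_compact_finite[OF K(1)] borel_compact[OF K(1)] by (simp add: less_top)
    have "norm (\<psi> z) \<le> norm (L * indicator K z)" for z
      using \<psi>(2,3)[of z] K(3)[of z] by (cases "z \<in> K") auto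
    then show "AE z in lborel. norm (\<psi> z) \<le> norm (L * indicator K z)" by simp
  qed (use \<psi> in simp)
  have [measurable]: "\<psi> \<in> borel_measurable borel" by (rule \<psi>)
  have z0D0: "z0 \<in> D0" using r by auto
  obtain d where d: "0 < d" "(\<Union>x\<in>K. cball x d) \<subseteq> D"
    using compact_subset_open_imp_cball_epsilon_subset[OF K(1) D(1) K(2)] by metis
  \<comment> \<open>A compact neighbourhood of \<open>K\<close> that carries every mollification of
    radius below \<open>d\<close>.\<close>
  define K1 where "K1 = {x + y |x y. x \<in> K \<and> y \<in> cball 0 d}"
  have K1: "compact K1" unfolding K1_def by (intro compact_sums K compact_cball)
  have K1_eq: "K1 = (\<Union>x\<in>K. cball x d)"
    unfolding K1_def by (auto simp: dist_norm) (metis add_diff_cancel_left' diff_add_cancel norm_minus_commute add.commute)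
  have K1D: "K1 \<subseteq> D" unfolding K1_eq by (rule d)
  have K1D0: "\<psi> w = 0" if "z \<notin> K1" "dist z w \<le> d" for z w
    using that K(3)[of w] unfolding K1_eq by (auto simp: dist_commute)
  have contq: "continuous_on K1 ?q"
    using M K1D by (auto simp: C2_planar_def intro!: continuous_intros intro: continuous_on_subset)
  have contM: "continuous_on D M" using M by (simp add: C2_planar_def)
  \<comment> \<open>The slack 1 makes room for mollification: \<open>W\<close> is open and contains
    \<open>D - D0\<close>, so the rest of \<open>K1\<close> is a compact subset of \<open>D0\<close>
    and has a collar of width \<open>d1\<close> inside \<open>D0\<close>.\<close>
  define W where "W = {z \<in> D. u z < ereal (M z + 1)}"
  have W: "open W" unfolding W_def using u by (rule open_subharmonic_less) (intro continuous_intros contM)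
  have "D - D0 \<subseteq> W"
  proof
    fix z assume z: "z \<in> D - D0"
    have "u z \<le> ereal (M z)" using uM z by blast
    also have "\<dots> < ereal (M z + 1)" by simp
    finally show "z \<in> W" using z by (simp add: W_def)
  qed
  then have "compact (K1 - W)" "K1 - W \<subseteq> D0"
    using K1 W K1D by (auto intro: compact_diff)
  then obtain d1 where d1: "0 < d1" "(\<Union>x\<in>K1 - W. cball x d1) \<subseteq> D0"
    using compact_subset_open_imp_cball_epsilon_subset[OF _ D0(1)] by metis
  \<comment> \<open>A collar of the disc about \<open>z0\<close> inside \<open>D0\<close>: small
    discs that leave \<open>D0\<close> stay away from the pole.\<close>
  obtain d2 where d2: "0 < d2" "(\<Union>x\<in>cball z0 r'. cball x d2) \<subseteq> D0"
    using compact_subset_open_imp_cball_epsilon_subset[OF compact_cball D0(1) r(3)] by metis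
  have main: "(\<integral>\<^sup>+z\<in>D - D0. ennreal (\<psi> z) \<partial>\<nu>)
     \<le> ennreal (1 / (2 * pi) * ((\<integral>z. conv \<psi> (mollifier \<eta>) z * ?q z \<partial>lborel) + B * truncated_mass r * (m + 1 - u0)))"
    "0 \<le> 1 / (2 * pi) * ((\<integral>z. conv \<psi> (mollifier \<eta>) z * ?q z \<partial>lborel) + B * truncated_mass r * (m + 1 - u0))"
    if \<eta>: "0 < \<eta>" "\<eta> < d" "\<eta> < d1" "\<eta> < d2 / 2" "\<eta> < \<sigma>" "\<eta> < (r' - r) / 2" for \<eta>
  proof -
    define \<phi> where "\<phi> = conv \<psi> (mollifier \<eta>)"
    define v where "v z = real_of_ereal (u z)" for z
    define \<kappa> where "\<kappa> = conv (truncated_density r) (mollifier \<eta>)"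
    note \<kappa> = conv_truncated_density[OF r(1) \<eta>(1), folded \<kappa>_def]
    have \<phi>t: "test_function D \<phi>"
      unfolding \<phi>_def
    proof (rule conv_test_function[OF \<psi>_int smooth_mollifier _ K(1,3), of \<eta>])
      fix w assume "w \<in> K"
      then have "cball w d \<subseteq> D" using d(2) by blast
      moreover have "cball w \<eta> \<subseteq> cball w d" using \<eta>(2) by auto
      ultimately show "cball w \<eta> \<subseteq> D" by blast
    next
      fix w assume "\<eta> < cmod w"
      then show "mollifier \<eta> w = 0" using mollifier_eq_0[OF \<eta>(1), of w] by simp
    qed
    have \<phi>s: "smooth \<phi>" unfolding \<phi>_def by (rule smooth_conv_mollifier[OF \<psi>_int \<eta>(1)])
    have \<phi>nn: "0 \<le> \<phi> z" for z
      unfolding \<phi>_def conv_def using \<psi>(2) mollifier_nonneg by (intro Bochner_Integration.integral_nonneg) auto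
    have \<phi>0: "\<phi> z = 0" if "z \<notin> K1" for z
      unfolding \<phi>_def
    proof (rule conv_eq_0[of K \<psi> \<eta>])
      fix w assume "w \<in> K"
      then show "\<eta> < dist z w" using that \<eta>(2) unfolding K1_eq by (force simp: dist_commute)
    next
      fix w assume "\<eta> < cmod w"
      then show "mollifier \<eta> w = 0" using mollifier_eq_0[OF \<eta>(1), of w] by simp
    qed (rule K(3))
    have oK1: "open (- K1)" using K1 compact_imp_closed by blast
    have \<phi>x0: "laplacian \<phi> z = 0" if "z \<notin> K1" for z
    proof -
      have 1: "partial_x \<phi> w = 0" "partial_y \<phi> w = 0" if "w \<in> - K1" for w
        using partial_locally_zero[OF oK1 that, of \<phi>] \<phi>0 by auto
      have "partial_x (partial_x \<phi>) z = 0" "partial_y (partial_y \<phi>) z = 0"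
        using partial_locally_zero[OF oK1, of z "partial_x \<phi>"] partial_locally_zero[OF oK1, of z "partial_y \<phi>"] that 1 by auto
      then show ?thesis by (simp add: laplacian_def)
    qed
    \<comment> \<open>Every point used when mollifying at such a \<open>z\<close> is at distance at
      least r' from the pole, hence in the range of \<open>mean\<close>.\<close>
    have far: "r' \<le> dist y z0" if "z \<in> D - D0 \<or> \<not> cball z \<eta> \<subseteq> D0" "dist y z < \<eta>" for y z
    proof (rule ccontr)
      assume "\<not> r' \<le> dist y z0"
      then have y: "y \<in> cball z0 r'" by (simp add: dist_commute)
      have "cball z \<eta> \<subseteq> cball y d2"
      proof
        fix w assume "w \<in> cball z \<eta>"
        then have "dist y w \<le> dist y z + dist z w" "dist z w \<le> \<eta>" by (auto intro: dist_triangle)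
        then show "w \<in> cball y d2" using that(2) \<eta>(4) by simp
      qed
      then have "cball z \<eta> \<subseteq> D0" using d2(2) y by blast
      moreover have "z \<in> cball z \<eta>" using \<eta>(1) by simp
      ultimately show False using that(1) by blast
    qed
    have \<phi>ge: "\<psi> z \<le> \<phi> z" if "z \<in> D - D0" for z
      unfolding \<phi>_def
      by (rule conv_mollifier_ge[OF \<psi>_int \<psi>(3) \<eta>(1)]) (use far[of z z] that mean \<eta> in auto)
    have lap_pos: "0 \<le> laplacian \<phi> z" if "\<not> cball z \<eta> \<subseteq> D0" for z
      unfolding \<phi>_def
      by (rule conv_mollifier_laplacian_nonneg[OF \<psi>_int \<psi>(3) \<eta>(1) \<sigma>]) (use far[of z] that mean in auto)
    \<comment> \<open>Within \<open>D0\<close> the Laplacian of the mollified weight is the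
      mollified density; this is the one place where it is negative.\<close>
    have lap_D0: "laplacian \<phi> z = - B * \<kappa> (z - z0)" if z: "cball z \<eta> \<subseteq> D0" for z
    proof -
      have "laplacian \<phi> z = (\<integral>w. mollifier \<eta> (z - w) * (Vxx w + Vyy w) \<partial>lborel)"
        unfolding \<phi>_def by (rule laplacian_conv_mollifier_C2[OF \<psi>_int \<eta>(1) D0(1) z C])
      also have "\<dots> = (\<integral>w. - B * (truncated_density r (w - z0) * mollifier \<eta> (z - w)) \<partial>lborel)"
      proof (rule Bochner_Integration.integral_cong)
        fix w
        show "mollifier \<eta> (z - w) * (Vxx w + Vyy w) = - B * (truncated_density r (w - z0) * mollifier \<eta> (z - w))"
        proof (cases "w \<in> cball z \<eta>")
          case True
          then show ?thesis using V[of w] z by auto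
        next
          case False
          then show ?thesis using mollifier_eq_0[OF \<eta>(1), of "z - w"] by (simp add: dist_norm)
        qed
      qed simp
      also have "\<dots> = - B * (\<integral>w. truncated_density r (w - z0) * mollifier \<eta> (z - w) \<partial>lborel)"
        by simp
      also have "(\<integral>w. truncated_density r (w - z0) * mollifier \<eta> (z - w) \<partial>lborel)
         = (\<integral>w. truncated_density r ((z - w) - z0) * mollifier \<eta> (z - (z - w)) \<partial>lborel)"
        by (rule integral_lborel_reflect[where c = z, symmetric])
           (use smoothD(5)[OF smooth_mollifier] borel_measurable_continuous_onI[OF truncated_density_continuous[OF r(1)]] in measurable)
      also have "\<dots> = (\<integral>w. truncated_density r ((z - z0) - w) * mollifier \<eta> ((z - z0) - ((z - z0) - w)) \<partial>lborel)"
        by (simp add: algebra_simps)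
      also have "\<dots> = \<kappa> (z - z0)"
        unfolding \<kappa>_def conv_def
        by (rule integral_lborel_reflect[where c = "z - z0"])
           (use smoothD(5)[OF smooth_mollifier] borel_measurable_continuous_onI[OF truncated_density_continuous[OF r(1)]] in measurable)
      finally show ?thesis .
    qed
    have u_int: "integrable lborel (\<lambda>z. v z * g z)" if "continuous_on UNIV g" "\<And>z. z \<notin> K1 \<Longrightarrow> g z = 0" for g
    proof -
      have "compact (g ` K1)" using K1 that(1) by (intro compact_continuous_image) (auto intro: continuous_on_subset)
      then have "bounded (g ` K1)" by (rule compact_imp_bounded)
      then obtain c where c: "\<And>z. z \<in> K1 \<Longrightarrow> \<bar>g z\<bar> \<le> c" unfolding bounded_iff by auto
      have i: "integrable lborel (\<lambda>z. indicator K1 z * v z)"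
        unfolding v_def
        by (rule subharmonic_set_integrable(1)[OF u D(2) _ _ K1 K1D, of z0]) (use z0D0 D0 z0 in auto)
      have [measurable]: "(\<lambda>z. indicator K1 z * v z) \<in> borel_measurable borel" "g \<in> borel_measurable borel"
        using borel_measurable_integrable[OF i] borel_measurable_continuous_onI[OF that(1)] by auto
      have eq: "v z * g z = (indicator K1 z * v z) * g z" for z using that(2)[of z] by (cases "z \<in> K1") auto
      show ?thesis
      proof (rule Bochner_Integration.integrable_bound[of _ "\<lambda>z. c * \<bar>indicator K1 z * v z\<bar>"])
        show "integrable lborel (\<lambda>z. c * \<bar>indicator K1 z * v z\<bar>)" using i by auto
        show "(\<lambda>z. v z * g z) \<in> borel_measurable lborel" unfolding eq by measurable
        have "norm (v z * g z) \<le> norm (c * \<bar>indicator K1 z * v z\<bar>)" for z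
        proof (cases "z \<in> K1")
          case True
          then have "\<bar>v z\<bar> * \<bar>g z\<bar> \<le> \<bar>v z\<bar> * c" by (intro mult_left_mono c) auto
          moreover have "c \<ge> 0" using c[OF True] by linarith
          ultimately show ?thesis using True by (simp add: abs_mult mult.commute)
        qed (use that(2) in auto)
        then show "AE z in lborel. norm (v z * g z) \<le> norm (c * \<bar>indicator K1 z * v z\<bar>)" by simp
      qed
    qed
    define M1 where "M1 z = M z + 1" for z
    have M1C: "C2_planar D M1 Mx Mxx My Myy"
      using M unfolding C2_planar_def M1_def by (auto intro!: continuous_intros derivative_eq_intros)
    note gI = C2_planar_green(1)[OF D(1) \<phi>t M1C] and gE = C2_planar_green(3)[OF D(1) \<phi>t M1C]
    have vI: "integrable lborel (\<lambda>z. v z * laplacian \<phi> z)"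
      by (rule u_int[OF smooth_laplacian_continuous[OF \<phi>s] \<phi>x0])
    have kap: "\<kappa> (z - z0) = 0" if "dist z z0 \<ge> r + \<eta>" for z
      using \<kappa>(3)[of "z - z0"] that by (simp add: dist_norm)
    have nearD0: "cball z \<eta> \<subseteq> D0" "z \<in> D0" if "dist z z0 < r + \<eta>" for z
    proof -
      have "z \<in> cball z0 r'" using that \<eta>(1,6) by (simp add: dist_commute)
      then have "cball z d2 \<subseteq> D0" using d2(2) by blast
      moreover have "cball z \<eta> \<subseteq> cball z d2" using \<eta>(1,4) by auto
      ultimately show "cball z \<eta> \<subseteq> D0" by blast
      then show "z \<in> D0" using \<eta>(1) by auto
    qed
    \<comment> \<open>An auxiliary upper bound for \<open>u\<close> near the pole: it makes a - u
      nonnegative for the radial submean estimate, and cancels in the final sum.\<close>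
    obtain a where a: "0 \<le> a" "\<And>z. z \<in> cball z0 r' \<Longrightarrow> u z \<le> ereal a"
      using subharmonic_bounded_above_compact[OF u compact_cball, of z0 r'] r(3) D0(2) by blast
    define \<kappa>1 where "\<kappa>1 z = \<kappa> (z - z0)" for z
    have [measurable]: "\<kappa> \<in> borel_measurable borel" "defect D u a \<in> borel_measurable borel"
      by (rule \<kappa>(1), rule defect_measurable[OF u])
    have tr: "(\<integral>\<^sup>+z. ennreal (\<kappa>1 z) \<partial>lborel) = ennreal (truncated_mass r)"
      using nn_integral_lborel_translate[of "\<lambda>w. ennreal (\<kappa> w)" "- z0"] \<kappa>(5) by (simp add: \<kappa>1_def)
    have \<kappa>1_nn: "0 \<le> \<kappa>1 z" for z unfolding \<kappa>1_def by (rule \<kappa>(2))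
    have [measurable]: "\<kappa>1 \<in> borel_measurable borel" unfolding \<kappa>1_def[abs_def] by measurable
    have \<kappa>1I: "integrable lborel \<kappa>1"
      using tr \<kappa>1_nn by (intro integrableI_nonneg) (auto simp: less_top[symmetric])
    have \<kappa>1E: "(\<integral>z. \<kappa>1 z \<partial>lborel) = truncated_mass r"
      using tr nn_integral_eq_integral[OF \<kappa>1I] \<kappa>1_nn truncated_mass_pos[OF r(1)] Bochner_Integration.integral_nonneg[of lborel \<kappa>1]
      by (auto simp: ennreal_inj)
    have aeu: "AE z in lborel. z \<in> K1 \<union> cball z0 r' \<longrightarrow> u z \<noteq> - \<infinity>"
      by (rule subharmonic_set_integrable(2)[OF u D(2), of z0])
         (use z0D0 D0 z0 K1 K1D r(3) in auto)
    have a_nn: "AE z in lborel. 0 \<le> (a - v z) * \<kappa>1 z"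
    proof -
      have "AE z in lborel. ennreal ((a - v z) * \<kappa>1 z) = defect D u a z * ennreal (\<kappa>1 z) \<and> 0 \<le> (a - v z) * \<kappa>1 z"
        using aeu
      proof eventually_elim
        case (elim z)
        show ?case
        proof (cases "dist z z0 < r + \<eta>")
          case True
          then have zb: "z \<in> cball z0 r'" "z \<in> D" using nearD0 D0 \<eta>(1,6) by (auto simp: dist_commute)
          then have "u z \<noteq> - \<infinity>" "u z \<noteq> \<infinity>" "u z \<le> ereal a"
            using elim u a by (auto simp: subharmonic_on_def)
          then obtain x where "u z = ereal x" "x \<le> a" by (cases "u z") auto
          then show ?thesis
            using zb \<kappa>1_nn[of z] by (simp add: v_def defect_def e2ennreal_ereal ennreal_mult)
        next
          case False
          then show ?thesis using kap[of z] by (simp add: \<kappa>1_def)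
        qed
      qed
      note ae = this
      then show ?thesis by (rule eventually_mono) blast
    qed
    have a_le: "(\<integral>\<^sup>+z. ennreal ((a - v z) * \<kappa>1 z) \<partial>lborel) \<le> ennreal ((a - u0) * truncated_mass r)"
    proof -
      have "AE z in lborel. ennreal ((a - v z) * \<kappa>1 z) = defect D u a z * ennreal (\<kappa>1 z)"
        using aeu
      proof eventually_elim
        case (elim z)
        show ?case
        proof (cases "dist z z0 < r + \<eta>")
          case True
          then have zb: "z \<in> cball z0 r'" "z \<in> D" using nearD0 D0 \<eta>(1,6) by (auto simp: dist_commute)
          then have "u z \<noteq> - \<infinity>" "u z \<noteq> \<infinity>" "u z \<le> ereal a"
            using elim u a by (auto simp: subharmonic_on_def)
          then obtain x where "u z = ereal x" "x \<le> a" by (cases "u z") auto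
          then show ?thesis
            using zb \<kappa>1_nn[of z] by (simp add: v_def defect_def e2ennreal_ereal ennreal_mult)
        next
          case False
          then show ?thesis using kap[of z] by (simp add: \<kappa>1_def)
        qed
      qed
      then have "(\<integral>\<^sup>+z. ennreal ((a - v z) * \<kappa>1 z) \<partial>lborel) = (\<integral>\<^sup>+z. defect D u a z * ennreal (\<kappa>1 z) \<partial>lborel)"
        by (rule nn_integral_cong_AE)
      also have "\<dots> = (\<integral>\<^sup>+w. defect D u a (z0 + w) * ennreal (\<kappa>1 (z0 + w)) \<partial>lborel)"
        by (rule nn_integral_lborel_translate[symmetric]) measurable
      also have "\<dots> = (\<integral>\<^sup>+w. defect D u a (z0 + w) * ennreal (\<kappa> w) \<partial>lborel)" by (simp add: \<kappa>1_def)
      also have "\<dots> \<le> defect D u a z0 * (\<integral>\<^sup>+w. ennreal (\<kappa> w) \<partial>lborel)"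
      proof (rule subharmonic_radial[OF u _ a, of z0 r'])
        show "cball z0 r' \<subseteq> D" using r(3) D0 by blast
        show "ennreal (\<kappa> w) = ennreal (\<kappa> (of_real (cmod w)))" for w using \<kappa>(4)[of w] by simp
        show "r' \<le> cmod w \<Longrightarrow> ennreal (\<kappa> w) = 0" for w using \<kappa>(3)[of w] \<eta>(1,6) by simp
      qed measurable
      also have "\<dots> = ennreal ((a - u0) * truncated_mass r)"
      proof -
        have "u0 \<le> a" using a(2)[of z0] z0 r by simp
        then show ?thesis
          using z0 z0D0 D0 \<kappa>(5) truncated_mass_pos[OF r(1)]
          by (auto simp: defect_def e2ennreal_ereal ennreal_mult)
      qed
      finally show ?thesis .
    qed
    have vk: "integrable lborel (\<lambda>z. (a - v z) * \<kappa>1 z)"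
    proof (rule integrableI_nonneg[OF _ a_nn])
      show "(\<integral>\<^sup>+z. ennreal ((a - v z) * \<kappa>1 z) \<partial>lborel) < \<infinity>"
        using a_le by (rule le_less_trans) simp
      have "integrable lborel (\<lambda>z. indicator (cball z0 r') z * v z)"
        unfolding v_def
        by (rule subharmonic_set_integrable(1)[OF u D(2) _ _ compact_cball, of z0]) (use z0D0 D0 z0 r in auto)
      then have [measurable]: "(\<lambda>z. indicator (cball z0 r') z * v z) \<in> borel_measurable borel"
        using borel_measurable_integrable by auto
      have "(a - v z) * \<kappa>1 z = a * \<kappa>1 z - indicator (cball z0 r') z * v z * \<kappa>1 z" for z
        using kap[of z] \<eta>(1,6) by (cases "z \<in> cball z0 r'") (auto simp: \<kappa>1_def algebra_simps dist_commute)
      then show "(\<lambda>z. (a - v z) * \<kappa>1 z) \<in> borel_measurable lborel" by simp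
    qed
    have vkE: "(\<integral>z. (a - v z) * \<kappa>1 z \<partial>lborel) \<le> (a - u0) * truncated_mass r"
    proof -
      have "u0 \<le> a" using a(2)[of z0] z0 r by simp
      moreover have "ennreal (\<integral>z. (a - v z) * \<kappa>1 z \<partial>lborel) \<le> ennreal ((a - u0) * truncated_mass r)"
        using a_le nn_integral_eq_integral[OF vk a_nn] by simp
      ultimately show ?thesis
        using truncated_mass_pos[OF r(1)] by (subst (asm) ennreal_le_iff) auto
    qed
    \<comment> \<open>If the \<open>\<eta>\<close>-disc about \<open>z\<close> lies in
      \<open>D0\<close>, the Laplacian is \<open>- B * \<kappa>1\<close> and M is replaced by its
      bound \<open>m\<close>. Otherwise the Laplacian is nonnegative and u < M + 1, so the integrand
      is at most 0.\<close>
    have "(\<integral>z. (v z - M1 z) * laplacian \<phi> z \<partial>lborel) \<le> (\<integral>z. B * ((m + 1 - a) * \<kappa>1 z + (a - v z) * \<kappa>1 z) \<partial>lborel)"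
    proof (rule integral_mono_AE)
      show "integrable lborel (\<lambda>z. (v z - M1 z) * laplacian \<phi> z)"
        using vI gI by (simp add: left_diff_distrib)
      show "integrable lborel (\<lambda>z. B * ((m + 1 - a) * \<kappa>1 z + (a - v z) * \<kappa>1 z))"
        using vk \<kappa>1I by (intro integrable_mult_right Bochner_Integration.integrable_add)
      show "AE z in lborel. (v z - M1 z) * laplacian \<phi> z \<le> B * ((m + 1 - a) * \<kappa>1 z + (a - v z) * \<kappa>1 z)"
        using aeu
      proof eventually_elim
        case (elim z)
        have rhs: "B * ((m + 1 - a) * \<kappa>1 z + (a - v z) * \<kappa>1 z) = B * ((m + 1 - v z) * \<kappa>1 z)"
          by (simp add: algebra_simps)
        show ?case
        proof (cases "cball z \<eta> \<subseteq> D0")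
          case True
          then have zD0: "z \<in> D0" using \<eta>(1) by auto
          have "(M1 z - v z) * (B * \<kappa>1 z) \<le> (m + 1 - v z) * (B * \<kappa>1 z)"
            using m[OF zD0] B \<kappa>1_nn[of z] by (intro mult_right_mono) (auto simp: M1_def)
          then show ?thesis
            unfolding rhs lap_D0[OF True] by (simp add: \<kappa>1_def algebra_simps)
        next
          case False
          then have "\<not> dist z z0 < r + \<eta>" using nearD0 by blast
          then have k0: "\<kappa>1 z = 0" using kap by (simp add: \<kappa>1_def)
          have "(v z - M1 z) * laplacian \<phi> z \<le> 0"
          proof (cases "z \<in> K1")
            case True
            \<comment> \<open>A point of \<open>K1\<close> outside \<open>W\<close> would have its
              whole \<open>d1\<close>-disc in \<open>D0\<close>, contrary to the case
              assumption.\<close>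
            have "z \<in> W"
            proof (rule ccontr)
              assume "z \<notin> W"
              then have "cball z d1 \<subseteq> D0" using d1(2) True by blast
              moreover have "cball z \<eta> \<subseteq> cball z d1" using \<eta>(3) by auto
              ultimately show False using False by blast
            qed
            then have "u z < ereal (M1 z)" by (simp add: W_def M1_def)
            moreover have "u z \<noteq> - \<infinity>" using elim True by blast
            ultimately have "v z \<le> M1 z" unfolding v_def by (cases "u z") auto
            then show ?thesis using lap_pos[OF False] by (simp add: mult_nonpos_nonneg)
          qed (simp add: \<phi>x0)
          then show ?thesis unfolding rhs k0 by simp
        qed
      qed
    qed
    also have "\<dots> = B * ((m + 1 - a) * truncated_mass r + (\<integral>z. (a - v z) * \<kappa>1 z \<partial>lborel))"
      using vk \<kappa>1I \<kappa>1E by simp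
    also have "\<dots> \<le> B * ((m + 1 - a) * truncated_mass r + (a - u0) * truncated_mass r)"
      using vkE B by (intro mult_left_mono) auto
    also have "\<dots> = B * truncated_mass r * (m + 1 - u0)" by (simp add: algebra_simps)
    finally have "(\<integral>z. v z * laplacian \<phi> z \<partial>lborel) \<le> (\<integral>z. \<phi> z * ?q z \<partial>lborel) + B * truncated_mass r * (m + 1 - u0)"
      using vI gI gE by (simp add: left_diff_distrib)
    then have le: "1 / (2 * pi) * (\<integral>z. v z * laplacian \<phi> z \<partial>lborel) \<le>
        1 / (2 * pi) * ((\<integral>z. \<phi> z * ?q z \<partial>lborel) + B * truncated_mass r * (m + 1 - u0))"
      by (intro mult_left_mono) auto
    have "(\<integral>\<^sup>+z\<in>D - D0. ennreal (\<psi> z) \<partial>\<nu>) \<le> (\<integral>\<^sup>+z. ennreal (\<phi> z) \<partial>\<nu>)"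
      using \<phi>ge by (intro nn_integral_mono) (auto split: split_indicator intro: ennreal_leI)
    also have "\<dots> = ennreal (1 / (2 * pi) * (\<integral>z. v z * laplacian \<phi> z \<partial>lborel))"
      unfolding v_def by (rule riesz_measure_test_function(1)[OF \<nu> \<phi>t \<phi>nn])
    also have "\<dots> \<le> ennreal (1 / (2 * pi) * ((\<integral>z. \<phi> z * ?q z \<partial>lborel) + B * truncated_mass r * (m + 1 - u0)))"
      by (rule ennreal_leI[OF le])
    finally show "(\<integral>\<^sup>+z\<in>D - D0. ennreal (\<psi> z) \<partial>\<nu>) \<le> ennreal (1 / (2 * pi) * ((\<integral>z. conv \<psi> (mollifier \<eta>) z * ?q z \<partial>lborel) + B * truncated_mass r * (m + 1 - u0)))"
      by (simp add: \<phi>_def)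
    show "0 \<le> 1 / (2 * pi) * ((\<integral>z. conv \<psi> (mollifier \<eta>) z * ?q z \<partial>lborel) + B * truncated_mass r * (m + 1 - u0))"
      using order_trans[OF riesz_measure_test_function(2)[OF \<nu> \<phi>t \<phi>nn] le[unfolded v_def]] by (simp add: \<phi>_def)
  qed
  have qI: "integrable lborel (\<lambda>z. \<psi> z * ?q z)"
  proof -
    have "compact (?q ` K1)" using K1 contq by (intro compact_continuous_image)
    then have "bounded (?q ` K1)" by (rule compact_imp_bounded)
    then obtain c where c: "\<And>z. z \<in> K1 \<Longrightarrow> \<bar>?q z\<bar> \<le> c" unfolding bounded_iff by auto
    have KK1: "K \<subseteq> K1" unfolding K1_eq using d(1) by force
    have [measurable]: "(\<lambda>z. indicator K1 z *\<^sub>R ?q z) \<in> borel_measurable borel"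
      by (rule borel_measurable_continuous_on_indicator[OF borel_compact[OF K1] contq])
    have eq: "\<psi> z * ?q z = \<psi> z * (indicator K1 z *\<^sub>R ?q z)" for z
      using K(3)[of z] KK1 by (cases "z \<in> K1") auto
    show ?thesis
    proof (rule Bochner_Integration.integrable_bound[of _ "\<lambda>z. c * \<bar>\<psi> z\<bar>"])
      show "integrable lborel (\<lambda>z. c * \<bar>\<psi> z\<bar>)" using \<psi>_int by auto
      show "(\<lambda>z. \<psi> z * ?q z) \<in> borel_measurable lborel" unfolding eq by measurable
      have "norm (\<psi> z * ?q z) \<le> norm (c * \<bar>\<psi> z\<bar>)" for z
      proof (cases "z \<in> K1")
        case True
        then have "\<bar>\<psi> z\<bar> * \<bar>?q z\<bar> \<le> \<bar>\<psi> z\<bar> * c" by (intro mult_left_mono c) auto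
        moreover have "c \<ge> 0" using c[OF True] by linarith
        ultimately show ?thesis by (simp add: abs_mult mult.commute)
      next
        case False
        then have "\<psi> z = 0" using K(3) KK1 by blast
        then show ?thesis by simp
      qed
      then show "AE z in lborel. norm (\<psi> z * ?q z) \<le> norm (c * \<bar>\<psi> z\<bar>)" by simp
    qed
  qed
  \<comment> \<open>\<open>\<psi>\<close> need not be continuous, so the mollifier is moved by
    Tonelli onto the density \<Delta>M, whose oscillation over distance \<open>\<eta>\<close> is at
    most \<open>e\<close>.\<close>
  have conv_le: "(\<integral>z. conv \<psi> (mollifier \<eta>) z * ?q z \<partial>lborel) \<le> (\<integral>z. \<psi> z * ?q z \<partial>lborel) + e * (\<integral>z. \<psi> z \<partial>lborel)"
    if e: "0 < e" and \<eta>: "0 < \<eta>" "\<eta> < d" and unif: "\<And>z w. z \<in> K1 \<Longrightarrow> w \<in> K1 \<Longrightarrow> dist z w < \<eta> \<Longrightarrow> ?q z \<le> ?q w + e" for e \<eta>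
  proof -
    define Q where "Q z = indicator K1 z *\<^sub>R ?q z" for z
    have [measurable]: "Q \<in> borel_measurable borel" "mollifier \<eta> \<in> borel_measurable borel"
      unfolding Q_def[abs_def]
      by (rule borel_measurable_continuous_on_indicator[OF borel_compact[OF K1] contq], rule smoothD(5)[OF smooth_mollifier])
    have Qnn: "0 \<le> Q z" for z using lapM K1D by (auto simp: Q_def split: split_indicator)
    have KK1: "K \<subseteq> K1" unfolding K1_eq using d(1) by force
    have mz: "mollifier \<eta> z = 0" if "\<eta> < cmod z" for z using mollifier_eq_0[OF \<eta>(1)] that by auto
    have cz: "conv \<psi> (mollifier \<eta>) z = 0" if "z \<notin> K1" for z
    proof (rule conv_eq_0[of K \<psi> \<eta>])
      fix w assume "w \<in> K"
      then show "\<eta> < dist z w" using that \<eta>(2) unfolding K1_eq by (force simp: dist_commute)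
    qed (use K(3) mz in auto)
    have cnn: "0 \<le> conv \<psi> (mollifier \<eta>) z" for z
      unfolding conv_def using \<psi>(2) mollifier_nonneg by (intro Bochner_Integration.integral_nonneg) auto
    have rep: "ennreal (conv \<psi> (mollifier \<eta>) z) = (\<integral>\<^sup>+w. ennreal (\<psi> w) * ennreal (mollifier \<eta> (z - w)) \<partial>lborel)" for z
      unfolding conv_def using \<psi>(2) mollifier_nonneg integrable_conv_mollifier[OF \<psi>_int \<eta>(1), of z]
      by (subst nn_integral_eq_integral[symmetric]) (auto simp: ennreal_mult)
    have "(\<integral>\<^sup>+z. ennreal (conv \<psi> (mollifier \<eta>) z * ?q z) \<partial>lborel) = (\<integral>\<^sup>+z. ennreal (conv \<psi> (mollifier \<eta>) z) * ennreal (Q z) \<partial>lborel)"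
    proof (intro nn_integral_cong)
      fix z
      show "ennreal (conv \<psi> (mollifier \<eta>) z * ?q z) = ennreal (conv \<psi> (mollifier \<eta>) z) * ennreal (Q z)"
        using cz[of z] cnn[of z] lapM[of z] K1D by (cases "z \<in> K1") (auto simp: Q_def ennreal_mult)
    qed
    also have "\<dots> = (\<integral>\<^sup>+z. \<integral>\<^sup>+w. ennreal (\<psi> w) * ennreal (mollifier \<eta> (z - w)) * ennreal (Q z) \<partial>lborel \<partial>lborel)"
      unfolding rep by (intro nn_integral_cong nn_integral_multc[symmetric]) measurable
    also have "\<dots> = (\<integral>\<^sup>+w. \<integral>\<^sup>+z. ennreal (\<psi> w) * ennreal (mollifier \<eta> (z - w)) * ennreal (Q z) \<partial>lborel \<partial>lborel)"
      by (rule lborel_pair.Fubini') measurable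
    also have "\<dots> \<le> (\<integral>\<^sup>+w. ennreal (\<psi> w * (?q w + e)) \<partial>lborel)"
    proof (intro nn_integral_mono)
      fix w
      show "(\<integral>\<^sup>+z. ennreal (\<psi> w) * ennreal (mollifier \<eta> (z - w)) * ennreal (Q z) \<partial>lborel) \<le> ennreal (\<psi> w * (?q w + e))"
      proof (cases "w \<in> K")
        case True
        then have wK1: "w \<in> K1" using KK1 by blast
        then have qw: "0 \<le> ?q w" using lapM K1D by blast
        have "(\<integral>\<^sup>+z. ennreal (\<psi> w) * ennreal (mollifier \<eta> (z - w)) * ennreal (Q z) \<partial>lborel)
          \<le> (\<integral>\<^sup>+z. ennreal (\<psi> w * (?q w + e)) * ennreal (mollifier \<eta> (z - w)) \<partial>lborel)"
        proof (intro nn_integral_mono)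
          fix z
          show "ennreal (\<psi> w) * ennreal (mollifier \<eta> (z - w)) * ennreal (Q z) \<le> ennreal (\<psi> w * (?q w + e)) * ennreal (mollifier \<eta> (z - w))"
          proof (cases "dist z w < \<eta>")
            case d: True
            have "z \<in> cball w d" using d \<eta>(2) by (simp add: dist_commute)
            then have "z \<in> K1" using True unfolding K1_eq by blast
            then have "Q z \<le> ?q w + e" using unif[OF _ wK1 d] by (simp add: Q_def)
            then have "\<psi> w * mollifier \<eta> (z - w) * Q z \<le> \<psi> w * mollifier \<eta> (z - w) * (?q w + e)"
              using \<psi>(2) mollifier_nonneg by (intro mult_left_mono) auto
            then have "ennreal (\<psi> w * mollifier \<eta> (z - w) * Q z) \<le> ennreal (\<psi> w * (?q w + e) * mollifier \<eta> (z - w))"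
              by (intro ennreal_leI) (simp add: mult_ac)
            then show ?thesis
              using \<psi>(2)[of w] mollifier_nonneg[of \<eta> "z - w"] Qnn[of z] qw e by (simp add: ennreal_mult)
          next
            case False
            then show ?thesis using mollifier_eq_0[OF \<eta>(1), of "z - w"] by (simp add: dist_norm)
          qed
        qed
        also have "\<dots> = ennreal (\<psi> w * (?q w + e)) * (\<integral>\<^sup>+z. ennreal (mollifier \<eta> (- w + z)) \<partial>lborel)"
          by (subst nn_integral_cmult) (auto simp: add.commute)
        also have "(\<integral>\<^sup>+z. ennreal (mollifier \<eta> (- w + z)) \<partial>lborel) = 1"
          using nn_integral_lborel_translate[of "\<lambda>z. ennreal (mollifier \<eta> z)" "- w"] nn_integral_mollifier[OF \<eta>(1)] by simp
        finally show ?thesis by simp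
      qed (simp add: K(3))
    qed
    also have "\<dots> = ennreal (\<integral>w. \<psi> w * (?q w + e) \<partial>lborel)"
    proof (rule nn_integral_eq_integral)
      show "integrable lborel (\<lambda>w. \<psi> w * (?q w + e))"
        using qI \<psi>_int by (simp add: distrib_left[of _ "?q _" e])
      have "0 \<le> \<psi> w * (?q w + e)" for w
        using \<psi>(2)[of w] lapM[of w] K(2) K(3)[of w] e by (cases "w \<in> K") auto
      then show "AE w in lborel. 0 \<le> \<psi> w * (?q w + e)" by simp
    qed
    finally have le: "(\<integral>\<^sup>+z. ennreal (conv \<psi> (mollifier \<eta>) z * ?q z) \<partial>lborel) \<le> ennreal (\<integral>w. \<psi> w * (?q w + e) \<partial>lborel)" .
    have nn1: "0 \<le> conv \<psi> (mollifier \<eta>) z * ?q z" for z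
      using cz[of z] cnn[of z] lapM[of z] K1D by (cases "z \<in> K1") auto
    have "0 \<le> \<psi> w * (?q w + e)" for w
      using \<psi>(2)[of w] lapM[of w] K(2) K(3)[of w] e by (cases "w \<in> K") auto
    then have nn2: "0 \<le> (\<integral>w. \<psi> w * (?q w + e) \<partial>lborel)" by (intro Bochner_Integration.integral_nonneg) auto
    have "(\<integral>z. conv \<psi> (mollifier \<eta>) z * ?q z \<partial>lborel) \<le> (\<integral>w. \<psi> w * (?q w + e) \<partial>lborel)"
    \<comment> \<open>In the non-integrable case the left side is 0 by convention and the right side
      is nonnegative.\<close>
    proof (cases "integrable lborel (\<lambda>z. conv \<psi> (mollifier \<eta>) z * ?q z)")
      case True
      then show ?thesis
        using le nn_integral_eq_integral[OF True] nn1 nn2 by (simp add: ennreal_le_iff)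
    qed (simp add: not_integrable_integral_eq nn2)
    also have "\<dots> = (\<integral>z. \<psi> z * ?q z \<partial>lborel) + e * (\<integral>z. \<psi> z \<partial>lborel)"
      using qI \<psi>_int by (simp add: distrib_left[of _ "?q _" e] mult.commute)
    finally show ?thesis .
  qed
  have approx: "\<exists>\<eta>. 0 < \<eta> \<and> \<eta> < d \<and> \<eta> < d1 \<and> \<eta> < d2 / 2 \<and> \<eta> < \<sigma> \<and> \<eta> < (r' - r) / 2 \<and>
      1 / (2 * pi) * ((\<integral>z. conv \<psi> (mollifier \<eta>) z * ?q z \<partial>lborel) + B * truncated_mass r * (m + 1 - u0)) \<le> 1 / (2 * pi) * ((\<integral>z. \<psi> z * ?q z \<partial>lborel) + B * truncated_mass r * (m + 1 - u0)) + \<epsilon>" if \<epsilon>: "0 < \<epsilon>" for \<epsilon>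
  proof -
    define I where "I = (\<integral>z. \<psi> z \<partial>lborel)"
    have I: "0 \<le> I" unfolding I_def using \<psi>(2) by (intro Bochner_Integration.integral_nonneg) auto
    define e where "e = \<epsilon> / (I + 1)"
    have e: "0 < e" "e * I \<le> \<epsilon>" using I \<epsilon> by (auto simp: e_def field_simps)
    have "uniformly_continuous_on K1 ?q" using K1 contq by (rule compact_uniformly_continuous[rotated])
    then obtain d3 where d3: "0 < d3" "\<And>z w. z \<in> K1 \<Longrightarrow> w \<in> K1 \<Longrightarrow> dist z w < d3 \<Longrightarrow> dist (?q z) (?q w) < e"
      unfolding uniformly_continuous_on_def using e(1) by metis
    define \<eta> where "\<eta> = Min {d, d1, d2 / 2, \<sigma>, (r' - r) / 2, d3} / 2"
    have pos: "0 < Min {d, d1, d2 / 2, \<sigma>, (r' - r) / 2, d3}"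
      using d d1 d2 \<sigma> r d3 by simp
    have le: "Min {d, d1, d2 / 2, \<sigma>, (r' - r) / 2, d3} \<le> x" if "x \<in> {d, d1, d2 / 2, \<sigma>, (r' - r) / 2, d3}" for x
      using that by (intro Min_le) auto
    have lt: "\<eta> < x" if "x \<in> {d, d1, d2 / 2, \<sigma>, (r' - r) / 2, d3}" for x
      using le[OF that] pos unfolding \<eta>_def by linarith
    have \<eta>: "0 < \<eta>" "\<eta> < d" "\<eta> < d1" "\<eta> < d2 / 2" "\<eta> < \<sigma>" "\<eta> < (r' - r) / 2" "\<eta> < d3"
      using pos by (simp add: \<eta>_def) (intro lt; simp)+
    have unif: "?q z \<le> ?q w + e" if "z \<in> K1" "w \<in> K1" "dist z w < \<eta>" for z w
      using d3(2)[OF that(1,2)] that(3) \<eta>(7) by (auto simp: dist_real_def abs_less_iff)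
    have cl: "(\<integral>z. conv \<psi> (mollifier \<eta>) z * ?q z \<partial>lborel) \<le> (\<integral>z. \<psi> z * ?q z \<partial>lborel) + \<epsilon>"
      using conv_le[OF e(1) \<eta>(1,2) unif] e(2) unfolding I_def[symmetric] by simp
      have "1 / (2 * pi) * ((\<integral>z. conv \<psi> (mollifier \<eta>) z * ?q z \<partial>lborel) + B * truncated_mass r * (m + 1 - u0))
        \<le> 1 / (2 * pi) * (((\<integral>z. \<psi> z * ?q z \<partial>lborel) + \<epsilon>) + B * truncated_mass r * (m + 1 - u0))"
        using cl by (intro mult_left_mono) auto
      also have "\<dots> = 1 / (2 * pi) * ((\<integral>z. \<psi> z * ?q z \<partial>lborel) + B * truncated_mass r * (m + 1 - u0)) + 1 / (2 * pi) * \<epsilon>"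
        by (simp add: field_simps)
      also have "1 / (2 * pi) * \<epsilon> \<le> 1 * \<epsilon>"
        using \<epsilon> pi_gt3 by (intro mult_right_mono) (auto simp: field_simps)
      finally have "1 / (2 * pi) * ((\<integral>z. conv \<psi> (mollifier \<eta>) z * ?q z \<partial>lborel) + B * truncated_mass r * (m + 1 - u0))
        \<le> 1 / (2 * pi) * ((\<integral>z. \<psi> z * ?q z \<partial>lborel) + B * truncated_mass r * (m + 1 - u0)) + \<epsilon>" by simp
    then show ?thesis using \<eta> by blast
  qed
  show "(\<integral>\<^sup>+z\<in>D - D0. ennreal (\<psi> z) \<partial>\<nu>) \<le> ennreal (1 / (2 * pi) * ((\<integral>z. \<psi> z * (Mxx z + Myy z) \<partial>lborel) + B * truncated_mass r * (m + 1 - u0)))"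
  proof (rule ennreal_le_epsilon)
    fix \<epsilon> :: real assume \<epsilon>: "0 < \<epsilon>"
    obtain \<eta> where \<eta>: "0 < \<eta>" "\<eta> < d" "\<eta> < d1" "\<eta> < d2 / 2" "\<eta> < \<sigma>" "\<eta> < (r' - r) / 2"
      and le: "1 / (2 * pi) * ((\<integral>z. conv \<psi> (mollifier \<eta>) z * ?q z \<partial>lborel) + B * truncated_mass r * (m + 1 - u0)) \<le> 1 / (2 * pi) * ((\<integral>z. \<psi> z * ?q z \<partial>lborel) + B * truncated_mass r * (m + 1 - u0)) + \<epsilon>"
      using approx[OF \<epsilon>] by blast
    have "(\<integral>\<^sup>+z\<in>D - D0. ennreal (\<psi> z) \<partial>\<nu>) \<le> ennreal (1 / (2 * pi) * ((\<integral>z. conv \<psi> (mollifier \<eta>) z * ?q z \<partial>lborel) + B * truncated_mass r * (m + 1 - u0)))"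
      by (rule main(1)[OF \<eta>])
    also have "\<dots> \<le> ennreal (1 / (2 * pi) * ((\<integral>z. \<psi> z * ?q z \<partial>lborel) + B * truncated_mass r * (m + 1 - u0)) + \<epsilon>)"
      by (rule ennreal_leI[OF le])
    also have "\<dots> \<le> ennreal (1 / (2 * pi) * ((\<integral>z. \<psi> z * ?q z \<partial>lborel) + B * truncated_mass r * (m + 1 - u0))) + ennreal \<epsilon>"
      by (rule ennreal_add_le) (use \<epsilon> in simp)
    finally show "(\<integral>\<^sup>+z\<in>D - D0. ennreal (\<psi> z) \<partial>\<nu>) \<le> ennreal (1 / (2 * pi) * ((\<integral>z. \<psi> z * ?q z \<partial>lborel) + B * truncated_mass r * (m + 1 - u0))) + ennreal \<epsilon>" .
  qed
  show "0 \<le> 1 / (2 * pi) * ((\<integral>z. \<psi> z * (Mxx z + Myy z) \<partial>lborel) + B * truncated_mass r * (m + 1 - u0))"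
  proof (rule field_le_epsilon)
    fix \<epsilon> :: real assume \<epsilon>: "0 < \<epsilon>"
    obtain \<eta> where \<eta>: "0 < \<eta>" "\<eta> < d" "\<eta> < d1" "\<eta> < d2 / 2" "\<eta> < \<sigma>" "\<eta> < (r' - r) / 2"
      and le: "1 / (2 * pi) * ((\<integral>z. conv \<psi> (mollifier \<eta>) z * ?q z \<partial>lborel) + B * truncated_mass r * (m + 1 - u0)) \<le> 1 / (2 * pi) * ((\<integral>z. \<psi> z * ?q z \<partial>lborel) + B * truncated_mass r * (m + 1 - u0)) + \<epsilon>"
      using approx[OF \<epsilon>] by blast
    show "0 \<le> 1 / (2 * pi) * ((\<integral>z. \<psi> z * ?q z \<partial>lborel) + B * truncated_mass r * (m + 1 - u0)) + \<epsilon>"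
      using main(2)[OF \<eta>] le by linarith
  qed
qed

section \<open>Submean inequalities\<close>

text \<open>An integrable minorant \<open>h\<close> on the circle suffices. Comparing nonnegative
  integrals requires no measurability of \<open>\<psi>\<close> along the circle, so weights defined
  by cases can be treated.\<close>

lemma submean_atI:
  assumes L: "\<And>z. \<psi> z \<le> L" and h: "set_integrable lborel {0..2*pi} h"
    and le: "\<And>\<theta>. h \<theta> \<le> \<psi> (y + of_real \<rho> * cis \<theta>)"
    and mean: "2 * pi * \<psi> y \<le> (LINT \<theta>:{0..2*pi}|lborel. h \<theta>)"
  shows "submean_at \<psi> L y \<rho>"
proof -
  have c: "set_integrable lborel {0..2*pi} (\<lambda>_. L)"
    by (simp add: set_integrable_def)
  have i: "set_integrable lborel {0..2*pi} (\<lambda>\<theta>. L - h \<theta>)"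
    using c h by (rule set_integral_diff)
  have hL: "h \<theta> \<le> L" for \<theta> using le[of \<theta>] L order_trans by blast
  have "(\<integral>\<^sup>+\<theta>\<in>{0..2*pi}. ennreal (L - \<psi> (y + of_real \<rho> * cis \<theta>)) \<partial>lborel)
     \<le> (\<integral>\<^sup>+\<theta>. ennreal (indicator {0..2*pi} \<theta> *\<^sub>R (L - h \<theta>)) \<partial>lborel)"
    using le by (intro nn_integral_mono) (auto split: split_indicator intro!: ennreal_leI)
  also have "\<dots> = ennreal (\<integral>\<theta>. indicator {0..2*pi} \<theta> *\<^sub>R (L - h \<theta>) \<partial>lborel)"
    using i hL unfolding set_integrable_def by (intro nn_integral_eq_integral) (auto split: split_indicator)
  also have "(\<integral>\<theta>. indicator {0..2*pi} \<theta> *\<^sub>R (L - h \<theta>) \<partial>lborel) = (LINT \<theta>:{0..2*pi}|lborel. L - h \<theta>)"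
    by (simp add: set_lebesgue_integral_def)
  also have "\<dots> = 2 * pi * L - (LINT \<theta>:{0..2*pi}|lborel. h \<theta>)"
    by (subst set_integral_diff(2)[OF c h]) (simp add: set_lebesgue_integral_def)
  also have "ennreal \<dots> \<le> ennreal (2 * pi * (L - \<psi> y))"
    using mean by (intro ennreal_leI) (simp add: algebra_simps)
  also have "\<dots> = ennreal (2 * pi) * ennreal (L - \<psi> y)"
    using L[of y] by (intro ennreal_mult) auto
  finally show ?thesis by (simp add: submean_at_def)
qed

lemma circle_in_cball:
  assumes "0 < \<rho>" shows "y + of_real \<rho> * cis \<theta> \<in> cball y \<rho>"
  using assms by (simp add: dist_norm norm_mult)

lemma cis_measurable [measurable]: "cis \<in> borel_measurable borel"
  by (intro borel_measurable_continuous_onI continuous_intros)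

lemma set_integrable_bounded_Icc:
  fixes h :: "real \<Rightarrow> real"
  assumes "h \<in> borel_measurable borel" "\<And>\<theta>. \<bar>h \<theta>\<bar> \<le> c"
  shows "set_integrable lborel {0..2*pi} h"
  unfolding set_integrable_def
proof (rule Bochner_Integration.integrable_bound[of _ "\<lambda>\<theta>. c * indicator {0..2*pi} \<theta>"])
  show "AE x in lborel. norm (indicator {0..2*pi} x *\<^sub>R h x) \<le> norm (c * indicator {0..2*pi} x)"
  proof (intro AE_I2)
    fix x
    show "norm (indicator {0..2*pi} x *\<^sub>R h x) \<le> norm (c * indicator {0..2*pi} x)"
      using assms(2)[of x] by (auto split: split_indicator)
  qed
qed (use assms(1) in auto)

text \<open>Antipodal points have the centre as midpoint, so R(y + v) + R(y - v) \<le> 2 R(y);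
  shifting the angle by pi shows that both terms have the same mean.\<close>

lemma concave_circle_mean:
  fixes R :: "complex \<Rightarrow> real"
  assumes R: "concave_on D R" "continuous_on D R" and nn: "\<And>z. z \<in> D \<Longrightarrow> 0 \<le> R z"
    and \<rho>: "0 < \<rho>" "cball y \<rho> \<subseteq> D"
  shows "set_integrable lborel {0..2*pi} (\<lambda>\<theta>. R (y + of_real \<rho> * cis \<theta>))"
    and "(LINT \<theta>:{0..2*pi}|lborel. R (y + of_real \<rho> * cis \<theta>)) \<le> 2 * pi * R y"
proof -
  have inD: "y + of_real \<rho> * cis \<theta> \<in> D" for \<theta> using circle_in_cball[OF \<rho>(1)] \<rho>(2) by blast
  have cont: "continuous_on UNIV (\<lambda>\<theta>. R (y + of_real \<rho> * cis \<theta>))"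
    by (rule continuous_on_compose2[OF R(2)]) (auto intro!: continuous_intros inD)
  then have [measurable]: "(\<lambda>\<theta>. R (y + of_real \<rho> * cis \<theta>)) \<in> borel_measurable borel"
    by (rule borel_measurable_continuous_onI)
  have "continuous_on {0..2*pi} (\<lambda>\<theta>. R (y + of_real \<rho> * cis \<theta>))"
    using cont continuous_on_subset by blast
  then show i: "set_integrable lborel {0..2*pi} (\<lambda>\<theta>. R (y + of_real \<rho> * cis \<theta>))"
    unfolding set_integrable_def by (intro borel_integrable_compact) auto
  define p where "p \<theta> = ennreal (R (y + of_real \<rho> * cis \<theta>))" for \<theta>
  have [measurable]: "p \<in> borel_measurable borel" unfolding p_def[abs_def] by measurable
  have yD: "y \<in> D" using \<rho> by auto
  have pair: "p \<theta> + p (pi + \<theta>) \<le> ennreal (2 * R y)" for \<theta>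
  proof -
    have e: "y + of_real \<rho> * cis (pi + \<theta>) = y - of_real \<rho> * cis \<theta>"
      by (simp add: complex_eq_iff)
    have "1 / 2 * R (y + of_real \<rho> * cis \<theta>) + 1 / 2 * R (y + of_real \<rho> * cis (pi + \<theta>))
       \<le> R ((1/2) *\<^sub>R (y + of_real \<rho> * cis \<theta>) + (1/2) *\<^sub>R (y + of_real \<rho> * cis (pi + \<theta>)))"
      by (rule conjunct2[OF R(1)[unfolded concave_on_iff], rule_format]) (use inD in auto)
    also have "(1/2) *\<^sub>R (y + of_real \<rho> * cis \<theta>) + (1/2) *\<^sub>R (y + of_real \<rho> * cis (pi + \<theta>)) = y"
      unfolding e by (simp add: scaleR_conv_of_real algebra_simps)
    finally have "R (y + of_real \<rho> * cis \<theta>) + R (y + of_real \<rho> * cis (pi + \<theta>)) \<le> 2 * R y" by simp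
    then have "ennreal (R (y + of_real \<rho> * cis \<theta>) + R (y + of_real \<rho> * cis (pi + \<theta>))) \<le> ennreal (2 * R y)"
      by (rule ennreal_leI)
    then show ?thesis unfolding p_def using nn[OF inD] by (simp add: ennreal_plus)
  qed
  have per: "p (\<theta> + 2 * pi) = p \<theta>" for \<theta>
    by (simp add: p_def cis.ctr)
  have sh: "(\<integral>\<^sup>+\<theta>\<in>{0..2*pi}. p (pi + \<theta>) \<partial>lborel) = (\<integral>\<^sup>+\<theta>\<in>{0..2*pi}. p \<theta> \<partial>lborel)"
    by (rule nn_integral_periodic_shift[OF \<open>p \<in> borel_measurable borel\<close> per]) auto
  have "2 * (\<integral>\<^sup>+\<theta>\<in>{0..2*pi}. p \<theta> \<partial>lborel) = (\<integral>\<^sup>+\<theta>\<in>{0..2*pi}. p \<theta> \<partial>lborel) + (\<integral>\<^sup>+\<theta>\<in>{0..2*pi}. p (pi + \<theta>) \<partial>lborel)"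
    unfolding sh by (rule mult_2)
  also have "\<dots> = (\<integral>\<^sup>+\<theta>\<in>{0..2*pi}. (p \<theta> + p (pi + \<theta>)) \<partial>lborel)"
    by (subst nn_integral_add[symmetric]) (auto simp: distrib_right)
  also have "\<dots> \<le> (\<integral>\<^sup>+\<theta>\<in>{0..2*pi}. ennreal (2 * R y) \<partial>lborel)"
    by (intro nn_integral_mono mult_right_mono pair) simp
  also have "\<dots> = ennreal (2 * R y) * ennreal (2 * pi)"
    by (subst nn_integral_cmult_indicator) auto
  also have "\<dots> = 2 * ennreal (2 * pi * R y)"
    using nn[OF yD] by (simp add: ennreal_mult[symmetric] mult.commute ennreal_numeral[symmetric] del: ennreal_numeral)
  finally have "2 * (\<integral>\<^sup>+\<theta>\<in>{0..2*pi}. p \<theta> \<partial>lborel) \<le> 2 * ennreal (2 * pi * R y)" .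
  then have le: "(\<integral>\<^sup>+\<theta>\<in>{0..2*pi}. p \<theta> \<partial>lborel) \<le> ennreal (2 * pi * R y)"
    by (subst (asm) ennreal_mult_le_mult_iff) auto
  have "(\<integral>\<^sup>+\<theta>\<in>{0..2*pi}. p \<theta> \<partial>lborel) = (\<integral>\<^sup>+\<theta>. ennreal (indicator {0..2*pi} \<theta> *\<^sub>R R (y + of_real \<rho> * cis \<theta>)) \<partial>lborel)"
    unfolding p_def by (intro nn_integral_cong) (auto split: split_indicator)
  also have "\<dots> = ennreal (LINT \<theta>:{0..2*pi}|lborel. R (y + of_real \<rho> * cis \<theta>))"
    using i nn[OF inD] unfolding set_integrable_def set_lebesgue_integral_def
    by (intro nn_integral_eq_integral) (auto split: split_indicator)
  finally have "ennreal (LINT \<theta>:{0..2*pi}|lborel. R (y + of_real \<rho> * cis \<theta>)) \<le> ennreal (2 * pi * R y)"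
    using le by simp
  then show "(LINT \<theta>:{0..2*pi}|lborel. R (y + of_real \<rho> * cis \<theta>)) \<le> 2 * pi * R y"
    using nn[OF yD] by (subst (asm) ennreal_le_iff) auto
qed

text \<open>The bounds 0 \<le> s \<le> a turn the \<open>ereal\<close> inequality for the
  subharmonic extension into one between ordinary real integrals.\<close>

lemma subharmonic_real_circle_mean:
  assumes v: "subharmonic_on S v" and \<rho>: "0 < \<rho>" "cball y \<rho> \<subseteq> S"
    and s: "\<And>z. z \<in> cball y \<rho> \<Longrightarrow> v z = ereal (s z)" "\<And>z. z \<in> cball y \<rho> \<Longrightarrow> 0 \<le> s z" "\<And>z. z \<in> cball y \<rho> \<Longrightarrow> s z \<le> a"
  shows "set_integrable lborel {0..2*pi} (\<lambda>\<theta>. s (y + of_real \<rho> * cis \<theta>))"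
    and "2 * pi * s y \<le> (LINT \<theta>:{0..2*pi}|lborel. s (y + of_real \<rho> * cis \<theta>))"
proof -
  note inb = circle_in_cball[OF \<rho>(1), of y]
  have inS: "y + of_real \<rho> * cis \<theta> \<in> S" for \<theta> using inb \<rho>(2) by blast
  have yb: "y \<in> cball y \<rho>" "y \<in> S" using \<rho> by auto
  have a: "0 \<le> a" using s(2,3)[OF yb(1)] by linarith
  have m: "(\<lambda>\<theta>. s (y + of_real \<rho> * cis \<theta>)) \<in> borel_measurable borel"
  proof -
    have "(\<lambda>\<theta>. s (y + of_real \<rho> * cis \<theta>)) = (\<lambda>\<theta>. real_of_ereal ((\<lambda>z. if z \<in> S then v z else - \<infinity>) (y + of_real \<rho> * cis \<theta>)))"
      using inS s(1)[OF inb] by auto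
    also have "\<dots> \<in> borel_measurable borel"
      by (intro borel_measurable_real_of_ereal measurable_compose[OF _ subharmonic_measurable[OF v]]) measurable
    finally show ?thesis .
  qed
  show i: "set_integrable lborel {0..2*pi} (\<lambda>\<theta>. s (y + of_real \<rho> * cis \<theta>))"
    by (rule set_integrable_bounded_Icc[OF m, of a]) (use s(2,3)[OF inb] in auto)
  have c: "set_integrable lborel {0..2*pi} (\<lambda>_. a)" by (simp add: set_integrable_def)
  have d: "set_integrable lborel {0..2*pi} (\<lambda>\<theta>. a - s (y + of_real \<rho> * cis \<theta>))"
    using c i by (rule set_integral_diff)
  have "(\<integral>\<^sup>+\<theta>\<in>{0..2*pi}. defect S v a (y + of_real \<rho> * cis \<theta>) \<partial>lborel) \<le> ennreal (2 * pi) * defect S v a y"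
    by (rule subharmonic_circle[OF v \<rho> a]) (use s in auto)
  also have "defect S v a y = ennreal (a - s y)"
    using yb s(1)[OF yb(1)] by (simp add: defect_def e2ennreal_ereal)
  also have "ennreal (2 * pi) * ennreal (a - s y) = ennreal (2 * pi * (a - s y))"
    using s(3)[OF yb(1)] by (intro ennreal_mult[symmetric]) auto
  also have "(\<integral>\<^sup>+\<theta>\<in>{0..2*pi}. defect S v a (y + of_real \<rho> * cis \<theta>) \<partial>lborel)
     = (\<integral>\<^sup>+\<theta>. ennreal (indicator {0..2*pi} \<theta> *\<^sub>R (a - s (y + of_real \<rho> * cis \<theta>))) \<partial>lborel)"
    using inS s(1)[OF inb] by (intro nn_integral_cong) (auto simp: defect_def e2ennreal_ereal split: split_indicator)
  also have "\<dots> = ennreal (LINT \<theta>:{0..2*pi}|lborel. a - s (y + of_real \<rho> * cis \<theta>))"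
    using d s(3)[OF inb] unfolding set_integrable_def set_lebesgue_integral_def
    by (intro nn_integral_eq_integral) (auto split: split_indicator)
  finally have "(LINT \<theta>:{0..2*pi}|lborel. a - s (y + of_real \<rho> * cis \<theta>)) \<le> 2 * pi * (a - s y)"
    using s(3)[OF yb(1)] by (subst (asm) ennreal_le_iff) auto
  also have "(LINT \<theta>:{0..2*pi}|lborel. a - s (y + of_real \<rho> * cis \<theta>))
     = 2 * pi * a - (LINT \<theta>:{0..2*pi}|lborel. s (y + of_real \<rho> * cis \<theta>))"
    by (subst set_integral_diff(2)[OF c i]) (simp add: set_lebesgue_integral_def)
  finally show "2 * pi * s y \<le> (LINT \<theta>:{0..2*pi}|lborel. s (y + of_real \<rho> * cis \<theta>))"
    by (simp add: algebra_simps)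
qed

text \<open>At \<open>y\<close> replace \<open>f\<close> by a supporting line \<open>\<alpha> t + c\<close>; \<open>f 0 = 0\<close> forces \<open>\<alpha> \<ge> 0 \<ge> c\<close>, so that
  \<open>\<alpha> s + c R\<close> is subharmonic, lies below \<open>R f (s / R)\<close> and agrees with it at \<open>y\<close>.\<close>

lemma perspective_submean:
  assumes R: "concave_on D R" "continuous_on D R" "\<And>z. z \<in> D \<Longrightarrow> 0 < R z"
    and f: "convex_on {0..} f" "f 0 = 0" "\<And>t. 0 \<le> t \<Longrightarrow> 0 \<le> f t"
    and v: "subharmonic_on S v" and \<rho>: "0 < \<rho>" "cball y \<rho> \<subseteq> S" "cball y \<rho> \<subseteq> D"
    and s: "\<And>z. z \<in> cball y \<rho> \<Longrightarrow> v z = ereal (s z)" "\<And>z. z \<in> cball y \<rho> \<Longrightarrow> 0 \<le> s z" "\<And>z. z \<in> cball y \<rho> \<Longrightarrow> s z \<le> a"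
  obtains h where "set_integrable lborel {0..2*pi} h"
    "\<And>\<theta>. h \<theta> \<le> R (y + of_real \<rho> * cis \<theta>) * f (s (y + of_real \<rho> * cis \<theta>) / R (y + of_real \<rho> * cis \<theta>))"
    "2 * pi * (R y * f (s y / R y)) \<le> (LINT \<theta>:{0..2*pi}|lborel. h \<theta>)"
proof -
  note inb = circle_in_cball[OF \<rho>(1), of y]
  have inD: "y + of_real \<rho> * cis \<theta> \<in> D" for \<theta> using inb \<rho>(3) by blast
  have yb: "y \<in> cball y \<rho>" "y \<in> D" using \<rho> by auto
  define t where "t = s y / R y"
  have Ry: "0 < R y" using R(3) yb by blast
  have t: "0 \<le> t" using Ry s(2)[OF yb(1)] by (simp add: t_def)
  show thesis
  proof (cases "t = 0")
    case True
    \<comment> \<open>At t = 0 the value at the centre is 0 and the constant 0 is a minorant, since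
      f \<ge> 0. This avoids a supporting line at the endpoint of the domain of
      \<open>f\<close>.\<close>
    show thesis
    proof (rule that[of "\<lambda>_. 0"])
      show "0 \<le> R (y + of_real \<rho> * cis \<theta>) * f (s (y + of_real \<rho> * cis \<theta>) / R (y + of_real \<rho> * cis \<theta>))" for \<theta>
        using R(3)[OF inD, of \<theta>] s(2)[OF inb, of \<theta>] by (intro mult_nonneg_nonneg f(3)) auto
    qed (use True f(2) in \<open>auto simp: t_def set_integrable_def set_lebesgue_integral_def\<close>)
  next
    case False
    have "{0<..} \<subseteq> interior {0::real..}" by (rule interior_maximal) auto
    then have "t \<in> interior {0..}" using t False by auto
    then obtain \<alpha> where \<alpha>: "\<And>x. 0 \<le> x \<Longrightarrow> f t + \<alpha> * (x - t) \<le> f x"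
      using convex_le_Inf_differential[OF f(1), of t] by (metis atLeast_iff)
    define c where "c = f t - \<alpha> * t"
    \<comment> \<open>The supporting line at x = 0 lies below f(0) = 0. With f(t) \<ge> 0 this also
      forces the slope to be nonnegative.\<close>
    have c: "c \<le> 0" using \<alpha>[of 0] f(2) by (simp add: c_def)
    have "0 \<le> \<alpha> * t" using c f(3)[OF t] by (simp add: c_def)
    then have \<alpha>0: "0 \<le> \<alpha>" using t False by (simp add: zero_le_mult_iff)
    have line: "\<alpha> * s z + c * R z \<le> R z * f (s z / R z)" if "z \<in> cball y \<rho>" for z
    proof -
      have Rz: "0 < R z" using R(3) \<rho>(3) that by blast
      have "f t + \<alpha> * (s z / R z - t) \<le> f (s z / R z)" using Rz s(2)[OF that] by (intro \<alpha>) simp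
      then have "R z * (\<alpha> * (s z / R z) + c) \<le> R z * f (s z / R z)"
        using Rz by (intro mult_left_mono) (auto simp: c_def algebra_simps)
      moreover have "R z * (\<alpha> * (s z / R z) + c) = \<alpha> * s z + c * R z" using Rz by (simp add: field_simps)
      ultimately show ?thesis by simp
    qed
    have aty: "R y * f (s y / R y) = \<alpha> * s y + c * R y"
      using Ry by (simp add: c_def t_def[symmetric]) (simp add: t_def field_simps)
    note S = subharmonic_real_circle_mean[OF v \<rho>(1,2) s]
    note C = concave_circle_mean[OF R(1,2) less_imp_le[OF R(3)] \<rho>(1,3)]
    show thesis
    proof (rule that)
      have i1: "set_integrable lborel {0..2*pi} (\<lambda>\<theta>. \<alpha> * s (y + of_real \<rho> * cis \<theta>))"
        and i2: "set_integrable lborel {0..2*pi} (\<lambda>\<theta>. c * R (y + of_real \<rho> * cis \<theta>))"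
        using S(1) C(1) by (auto intro: set_integrable_mult_right)
      show "set_integrable lborel {0..2*pi} (\<lambda>\<theta>. \<alpha> * s (y + of_real \<rho> * cis \<theta>) + c * R (y + of_real \<rho> * cis \<theta>))"
        using i1 i2 by (rule set_integral_add)
      show "\<alpha> * s (y + of_real \<rho> * cis \<theta>) + c * R (y + of_real \<rho> * cis \<theta>)
         \<le> R (y + of_real \<rho> * cis \<theta>) * f (s (y + of_real \<rho> * cis \<theta>) / R (y + of_real \<rho> * cis \<theta>))" for \<theta>
        by (rule line[OF inb])
      have "2 * pi * (R y * f (s y / R y)) = \<alpha> * (2 * pi * s y) + c * (2 * pi * R y)"
        unfolding aty by (simp add: algebra_simps)
      also have "\<dots> \<le> \<alpha> * (LINT \<theta>:{0..2*pi}|lborel. s (y + of_real \<rho> * cis \<theta>)) + c * (LINT \<theta>:{0..2*pi}|lborel. R (y + of_real \<rho> * cis \<theta>))"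
        using S(2) C(2) \<alpha>0 c by (intro add_mono mult_left_mono mult_left_mono_neg) auto
      also have "\<dots> = (LINT \<theta>:{0..2*pi}|lborel. \<alpha> * s (y + of_real \<rho> * cis \<theta>) + c * R (y + of_real \<rho> * cis \<theta>))"
        using i1 i2 by (subst set_integral_add(2)) simp_all
      finally show "2 * pi * (R y * f (s y / R y)) \<le> (LINT \<theta>:{0..2*pi}|lborel. \<alpha> * s (y + of_real \<rho> * cis \<theta>) + c * R (y + of_real \<rho> * cis \<theta>))" .
    qed
  qed
qed

text \<open>Cauchy's formula on the circle, where du / (u - y) = \<i> d\<theta>; then the real part
  is taken.\<close>

lemma holomorphic_mean_value:
  assumes F: "F holomorphic_on ball y \<sigma>" and \<rho>: "0 < \<rho>" "\<rho> < \<sigma>"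
  shows "((\<lambda>\<theta>. Re (F (y + of_real \<rho> * cis \<theta>))) has_integral (2 * pi * Re (F y))) {0..2*pi}"
proof -
  have sub: "cball y \<rho> \<subseteq> ball y \<sigma>" using \<rho> by auto
  have hF: "F holomorphic_on cball y \<rho>" using F sub holomorphic_on_subset by blast
  have "((\<lambda>u. F u / (u - y)) has_contour_integral (2 * of_real pi * \<i> * F y)) (circlepath y \<rho>)"
    by (rule Cauchy_integral_circlepath)
       (use hF \<rho> ball_subset_cball in \<open>auto intro: holomorphic_on_imp_continuous_on holomorphic_on_subset\<close>)
  then have "((\<lambda>t. F (y + of_real \<rho> * cis t) / (y + of_real \<rho> * cis t - y) * of_real \<rho> * \<i> * cis t) has_integral (2 * of_real pi * \<i> * F y)) {0..2*pi}"
    unfolding circlepath_def by (subst (asm) has_contour_integral_part_circlepath_iff) auto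
  moreover have "F (y + of_real \<rho> * cis t) / (y + of_real \<rho> * cis t - y) * of_real \<rho> * \<i> * cis t = \<i> * F (y + of_real \<rho> * cis t)" for t
    using \<rho> by simp
  ultimately have "((\<lambda>t. \<i> * F (y + of_real \<rho> * cis t)) has_integral (2 * of_real pi * \<i> * F y)) {0..2*pi}"
    by (simp only:)
  then have "((\<lambda>t. - \<i> * (\<i> * F (y + of_real \<rho> * cis t))) has_integral (- \<i> * (2 * of_real pi * \<i> * F y))) {0..2*pi}"
    by (rule has_integral_mult_right)
  then have "((\<lambda>t. F (y + of_real \<rho> * cis t)) has_integral (of_real (2 * pi) * F y)) {0..2*pi}"
    by (simp add: algebra_simps)
  from has_integral_linear[OF this bounded_linear_Re]
  show ?thesis by (simp add: o_def)
qed

section \<open>A function with a logarithmic pole\<close>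

text \<open>At the junction both one-sided difference quotients have the limit \<open>D\<close>;
  away from it one branch holds on an open set.\<close>

lemma has_real_derivative_If_less:
  fixes f g :: "real \<Rightarrow> real"
  assumes f: "t \<le> c \<Longrightarrow> (f has_real_derivative D) (at t)" and g: "c \<le> t \<Longrightarrow> (g has_real_derivative D) (at t)"
    and eq: "f c = g c"
  shows "((\<lambda>t. if t < c then f t else g t) has_real_derivative D) (at t)"
proof -
  consider "t < c" | "t = c" | "c < t" by linarith
  then show ?thesis
  proof cases
    case 1
    show ?thesis
      by (rule has_field_derivative_transform_within_open[of f _ _ "{..<c}"]) (use 1 f in auto)
  next
    case 3
    show ?thesis
      by (rule has_field_derivative_transform_within_open[of g _ _ "{c<..}"]) (use 3 g in auto)
  next
    case 2
    let ?h = "\<lambda>t. if t < c then f t else g t"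
    have "((\<lambda>y. (f y - f c) / (y - c)) \<longlongrightarrow> D) (at c)" "((\<lambda>y. (g y - g c) / (y - c)) \<longlongrightarrow> D) (at c)"
      using f g 2 by (auto simp: has_field_derivative_iff)
    then have l: "((\<lambda>y. (f y - f c) / (y - c)) \<longlongrightarrow> D) (at_left c)"
      and r: "((\<lambda>y. (g y - g c) / (y - c)) \<longlongrightarrow> D) (at_right c)"
      by (auto simp: filterlim_at_split)
    have "((\<lambda>y. (?h y - ?h c) / (y - c)) \<longlongrightarrow> D) (at_left c)"
      by (rule Lim_transform_eventually[OF l]) (use eq in \<open>auto simp: eventually_at_filter\<close>)
    moreover have "((\<lambda>y. (?h y - ?h c) / (y - c)) \<longlongrightarrow> D) (at_right c)"
      by (rule Lim_transform_eventually[OF r]) (auto simp: eventually_at_filter)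
    ultimately show ?thesis
      unfolding 2 has_field_derivative_iff by (simp add: filterlim_split_at)
  qed
qed

text \<open>In the variable \<open>t = |z - z\<^sub>0|\<^sup>2\<close>: \<open>- ln |z - z\<^sub>0|\<close> for \<open>t \<ge> r\<^sup>2\<close>, continued to \<open>t < r\<^sup>2\<close> by its
  second Taylor polynomial at \<open>r\<^sup>2\<close>.\<close>

definition log_cap :: "real \<Rightarrow> real \<Rightarrow> real" where
  "log_cap r t = (if t < r\<^sup>2 then - ln (r\<^sup>2) / 2 - (t - r\<^sup>2) / (2 * r\<^sup>2) + (t - r\<^sup>2)\<^sup>2 / (4 * (r\<^sup>2)\<^sup>2) else - ln t / 2)"

definition log_cap' :: "real \<Rightarrow> real \<Rightarrow> real" where
  "log_cap' r t = (if t < r\<^sup>2 then - 1 / (2 * r\<^sup>2) + (t - r\<^sup>2) / (2 * (r\<^sup>2)\<^sup>2) else - 1 / (2 * t))"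

definition log_cap'' :: "real \<Rightarrow> real \<Rightarrow> real" where
  "log_cap'' r t = 1 / (2 * (max t (r\<^sup>2))\<^sup>2)"

lemma log_cap_derivatives:
  assumes "0 < r"
  shows "(log_cap r has_real_derivative log_cap' r t) (at t)"
    and "(log_cap' r has_real_derivative log_cap'' r t) (at t)"
proof -
  define q where "q = r\<^sup>2"
  have q: "0 < q" using assms by (simp add: q_def)
  have "((\<lambda>t. if t < q then - ln q / 2 - (t - q) / (2 * q) + (t - q)\<^sup>2 / (4 * q\<^sup>2) else - ln t / 2) has_real_derivative log_cap' r t) (at t)"
  proof (rule has_real_derivative_If_less)
    assume t: "t \<le> q"
    have "((\<lambda>t. - ln q / 2 - (t - q) / (2 * q) + (t - q)\<^sup>2 / (4 * q\<^sup>2)) has_real_derivative - 1 / (2 * q) + (t - q) / (2 * q\<^sup>2)) (at t)"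
      using q by (auto intro!: derivative_eq_intros simp: field_simps power2_eq_square)
    moreover have "log_cap' r t = - 1 / (2 * q) + (t - q) / (2 * q\<^sup>2)"
      using t q by (cases "t = q") (auto simp: log_cap'_def q_def[symmetric])
    ultimately show "((\<lambda>t. - ln q / 2 - (t - q) / (2 * q) + (t - q)\<^sup>2 / (4 * q\<^sup>2)) has_real_derivative log_cap' r t) (at t)" by simp
  next
    assume t: "q \<le> t"
    then show "((\<lambda>t. - ln t / 2) has_real_derivative log_cap' r t) (at t)"
      using q by (auto intro!: derivative_eq_intros simp: log_cap'_def q_def[symmetric])
  qed simp
  then show "(log_cap r has_real_derivative log_cap' r t) (at t)"
    by (simp only: log_cap_def[abs_def] q_def)
  have "((\<lambda>t. if t < q then - 1 / (2 * q) + (t - q) / (2 * q\<^sup>2) else - 1 / (2 * t)) has_real_derivative log_cap'' r t) (at t)"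
  proof (rule has_real_derivative_If_less)
    assume t: "t \<le> q"
    have "((\<lambda>t. - 1 / (2 * q) + (t - q) / (2 * q\<^sup>2)) has_real_derivative 1 / (2 * q\<^sup>2)) (at t)"
      using q by (auto intro!: derivative_eq_intros simp: power2_eq_square)
    then show "((\<lambda>t. - 1 / (2 * q) + (t - q) / (2 * q\<^sup>2)) has_real_derivative log_cap'' r t) (at t)"
      using t by (simp add: log_cap''_def q_def[symmetric] max_def)
  next
    assume t: "q \<le> t"
    then have l: "log_cap'' r t = 1 / (2 * t\<^sup>2)"
      by (simp add: log_cap''_def q_def[symmetric] max_absorb1)
    show "((\<lambda>t. - 1 / (2 * t)) has_real_derivative log_cap'' r t) (at t)"
      unfolding l using q t by (auto intro!: derivative_eq_intros simp: field_simps power2_eq_square)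
  qed simp
  then show "(log_cap' r has_real_derivative log_cap'' r t) (at t)"
    by (simp only: log_cap'_def[abs_def] q_def)
qed

text \<open>The left side is the Laplacian of z \<mapsto> \<open>log_cap r\<close> (|z|^2) at |z|^2
  = t. It vanishes for t \<ge> r^2 because ln |z| is harmonic.\<close>

lemma log_cap_laplacian:
  assumes "0 < r" "0 \<le> t"
  shows "4 * log_cap' r t + 4 * t * log_cap'' r t = - (4 * max 0 (r\<^sup>2 - t) / r ^ 4)"
proof -
  define q where "q = r\<^sup>2"
  have q: "0 < q" using assms by (simp add: q_def)
  have r4: "r ^ 4 = q\<^sup>2" by (simp add: q_def)
  show ?thesis
  proof (cases "t < q")
    case True
    then have l: "log_cap' r t = - 1 / (2 * q) + (t - q) / (2 * q\<^sup>2)" "log_cap'' r t = 1 / (2 * q\<^sup>2)"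
      by (auto simp: log_cap'_def log_cap''_def q_def[symmetric] max_def)
    show ?thesis
      unfolding l r4 q_def[symmetric] using True q by (simp add: max_def field_simps power2_eq_square)
  next
    case False
    then have l: "log_cap' r t = - 1 / (2 * t)" "log_cap'' r t = 1 / (2 * t\<^sup>2)"
      by (auto simp: log_cap'_def log_cap''_def q_def[symmetric] max_def)
    show ?thesis
      unfolding l r4 q_def[symmetric] using False q by (simp add: max_def field_simps power2_eq_square)
  qed
qed

text \<open>Both correction terms of the Taylor polynomial are nonnegative for t \<le> r^2. This
  keeps the smoothed Green function large near its pole.\<close>

lemma log_cap_ge:
  assumes "0 < r" "t \<le> r\<^sup>2" shows "- ln r \<le> log_cap r t"
proof (cases "t < r\<^sup>2")
  case True
  have 1: "- ln (r\<^sup>2) / 2 = - ln r" using assms by (simp add: ln_realpow)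
  have 2: "(t - r\<^sup>2) / (2 * r\<^sup>2) \<le> 0" using True assms by (simp add: divide_nonpos_pos)
  have 3: "0 \<le> (t - r\<^sup>2)\<^sup>2 / (4 * (r\<^sup>2)\<^sup>2)" by simp
  have "log_cap r t = - ln (r\<^sup>2) / 2 - (t - r\<^sup>2) / (2 * r\<^sup>2) + (t - r\<^sup>2)\<^sup>2 / (4 * (r\<^sup>2)\<^sup>2)"
    using True by (simp only: log_cap_def if_True)
  then show ?thesis using 1 2 3 by linarith
next
  case False
  then have "t = r\<^sup>2" using assms by simp
  then show ?thesis using assms by (simp add: log_cap_def ln_realpow)
qed

lemma C2_planar_log_cap:
  fixes z0 :: complex
  assumes r: "0 < r"
  defines "T \<equiv> \<lambda>z. (Re z - Re z0)\<^sup>2 + (Im z - Im z0)\<^sup>2"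
  shows "C2_planar UNIV (\<lambda>z. log_cap r ((cmod (z - z0))\<^sup>2))
     (\<lambda>z. log_cap' r (T z) * (2 * (Re z - Re z0)))
     (\<lambda>z. log_cap'' r (T z) * (2 * (Re z - Re z0))\<^sup>2 + 2 * log_cap' r (T z))
     (\<lambda>z. log_cap' r (T z) * (2 * (Im z - Im z0)))
     (\<lambda>z. log_cap'' r (T z) * (2 * (Im z - Im z0))\<^sup>2 + 2 * log_cap' r (T z))"
proof -
  have T: "(cmod (z - z0))\<^sup>2 = T z" for z by (simp add: T_def cmod_power2)
  have c1: "continuous_on UNIV (log_cap r)" "continuous_on UNIV (log_cap' r)"
    using log_cap_derivatives[OF r] DERIV_isCont by (blast intro: continuous_at_imp_continuous_on)+
  have c2: "continuous_on UNIV (log_cap'' r)"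
    unfolding log_cap''_def[abs_def] using r by (intro continuous_intros) (auto simp: max_def)
  have cT: "continuous_on UNIV T" unfolding T_def by (intro continuous_intros)
  note cc = continuous_on_compose2[OF c1(1) cT subset_UNIV] continuous_on_compose2[OF c1(2) cT subset_UNIV]
    continuous_on_compose2[OF c2 cT subset_UNIV]
  have dx: "((\<lambda>x. T (Complex x b)) has_real_derivative 2 * (a - Re z0)) (at a)"
    and dy: "((\<lambda>y. T (Complex b y)) has_real_derivative 2 * (a - Im z0)) (at a)" for a b
    unfolding T_def by (auto intro!: derivative_eq_intros)
  show ?thesis
    unfolding C2_planar_def T
  proof (intro conjI ballI)
    fix z :: complex
    have z: "T (Complex (Re z) (Im z)) = T z" by simp
    note X = dx[of "Im z" "Re z"] and Y = dy[of "Re z" "Im z"]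
    show "((\<lambda>x. log_cap r (T (Complex x (Im z)))) has_real_derivative log_cap' r (T z) * (2 * (Re z - Re z0))) (at (Re z))"
      using DERIV_chain2[OF log_cap_derivatives(1)[OF r] X] by simp
    show "((\<lambda>y. log_cap r (T (Complex (Re z) y))) has_real_derivative log_cap' r (T z) * (2 * (Im z - Im z0))) (at (Im z))"
      using DERIV_chain2[OF log_cap_derivatives(1)[OF r] Y] by simp
    have "((\<lambda>x. log_cap' r (T (Complex x (Im z)))) has_real_derivative log_cap'' r (T z) * (2 * (Re z - Re z0))) (at (Re z))"
      using DERIV_chain2[OF log_cap_derivatives(2)[OF r] X] by simp
    then show "((\<lambda>x. log_cap' r (T (Complex x (Im z))) * (2 * (Re (Complex x (Im z)) - Re z0))) has_real_derivative
        log_cap'' r (T z) * (2 * (Re z - Re z0))\<^sup>2 + 2 * log_cap' r (T z)) (at (Re z))"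
      by (auto intro!: derivative_eq_intros simp: power2_eq_square algebra_simps)
    have "((\<lambda>y. log_cap' r (T (Complex (Re z) y))) has_real_derivative log_cap'' r (T z) * (2 * (Im z - Im z0))) (at (Im z))"
      using DERIV_chain2[OF log_cap_derivatives(2)[OF r] Y] by simp
    then show "((\<lambda>y. log_cap' r (T (Complex (Re z) y)) * (2 * (Im (Complex (Re z) y) - Im z0))) has_real_derivative
        log_cap'' r (T z) * (2 * (Im z - Im z0))\<^sup>2 + 2 * log_cap' r (T z)) (at (Im z))"
      by (auto intro!: derivative_eq_intros simp: power2_eq_square algebra_simps)
  qed (intro continuous_intros cc)+
qed

lemma C2_planar_Re:
  assumes D: "open D" and h: "h holomorphic_on D"
  shows "C2_planar D (\<lambda>z. Re (h z)) (\<lambda>z. Re (deriv h z)) (\<lambda>z. Re (deriv (deriv h) z))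
     (\<lambda>z. - Im (deriv h z)) (\<lambda>z. - Re (deriv (deriv h) z))"
proof -
  have h1: "deriv h holomorphic_on D" by (rule holomorphic_deriv[OF h D])
  have h2: "deriv (deriv h) holomorphic_on D" by (rule holomorphic_deriv[OF h1 D])
  note c = holomorphic_on_imp_continuous_on[OF h] holomorphic_on_imp_continuous_on[OF h1] holomorphic_on_imp_continuous_on[OF h2]
  have sl: "((\<lambda>x. Re (k (Complex x (Im z)))) has_real_derivative Re (deriv k z)) (at (Re z))"
    "((\<lambda>y. Re (k (Complex (Re z) y))) has_real_derivative - Im (deriv k z)) (at (Im z))"
    "((\<lambda>y. - Im (k (Complex (Re z) y))) has_real_derivative - Re (deriv k z)) (at (Im z))"
    if "k holomorphic_on D" "z \<in> D" for k z
  proof -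
    have "(k has_derivative (\<lambda>v. deriv k z * v)) (at z)"
      using holomorphic_derivI[OF that(1) D that(2)] by (simp add: has_field_derivative_def)
    from has_derivative_slices[OF bounded_linear.has_derivative[OF bounded_linear_Re this]]
      has_derivative_slices[OF has_derivative_minus[OF bounded_linear.has_derivative[OF bounded_linear_Im this]]]
    show "((\<lambda>x. Re (k (Complex x (Im z)))) has_real_derivative Re (deriv k z)) (at (Re z))"
      "((\<lambda>y. Re (k (Complex (Re z) y))) has_real_derivative - Im (deriv k z)) (at (Im z))"
      "((\<lambda>y. - Im (k (Complex (Re z) y))) has_real_derivative - Re (deriv k z)) (at (Im z))"
      by simp_all
  qed
  show ?thesis
    unfolding C2_planar_def
    by (intro conjI ballI sl h h1; (intro continuous_intros c)?)
qed

lemma C2_planar_affine: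
  assumes "C2_planar U V Vx Vxx Vy Vyy"
  shows "C2_planar U (\<lambda>z. a * V z + c) (\<lambda>z. a * Vx z) (\<lambda>z. a * Vxx z) (\<lambda>z. a * Vy z) (\<lambda>z. a * Vyy z)"
  using assms unfolding C2_planar_def by (auto intro!: continuous_intros derivative_eq_intros)

lemma C2_planar_subset:
  "C2_planar U V Vx Vxx Vy Vyy \<Longrightarrow> S \<subseteq> U \<Longrightarrow> C2_planar S V Vx Vxx Vy Vyy"
  unfolding C2_planar_def by (blast intro: continuous_on_subset)

lemma conformal_pair_centered:
  assumes "open D" "convex D" "D \<noteq> UNIV" "a \<in> D"
  obtains g p where "conformal_pair D g p" "g a = 0"
proof -
  obtain g p where cp: "conformal_pair D g p"
    using conformal_pair_exists[of D] assms by blast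
  then have D: "open D" "g holomorphic_on D" "p holomorphic_on ball 0 1" "\<forall>z\<in>D. g z \<in> ball 0 1 \<and> p (g z) = z"
    "\<forall>w\<in>ball 0 1. p w \<in> D \<and> g (p w) = w"
    by (auto simp: conformal_pair_def)
  define b where "b = g a"
  have b: "cmod b < 1" using D assms by (auto simp: b_def)
  let ?M = "Moebius_function 0 b" and ?N = "Moebius_function 0 (- b)"
  have M: "?M holomorphic_on ball 0 1" "?N holomorphic_on ball 0 1"
    using b by (auto intro: Moebius_function_holomorphic)
  have Mb: "?M w \<in> ball 0 1" "?N w \<in> ball 0 1" if "w \<in> ball 0 1" for w
    using Moebius_function_norm_lt_1[of b w] Moebius_function_norm_lt_1[of "- b" w] b that by auto
  have inv: "?N (?M w) = w" "?M (?N w) = w" if "w \<in> ball 0 1" for w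
    using Moebius_function_compose[of "- b" b w] Moebius_function_compose[of b "- b" w] b that by auto
  have "conformal_pair D (?M \<circ> g) (p \<circ> ?N)"
    unfolding conformal_pair_def
  proof (intro conjI ballI)
    show "open D" by fact
    show "?M \<circ> g holomorphic_on D"
      by (rule holomorphic_on_compose_gen[OF D(2) M(1)]) (use D(4) in auto)
    show "p \<circ> ?N holomorphic_on ball 0 1"
      by (rule holomorphic_on_compose_gen[OF M(2) D(3)]) (use Mb in blast)
    fix z assume z: "z \<in> D"
    then have gz: "g z \<in> ball 0 1" using D(4) by blast
    show "(?M \<circ> g) z \<in> ball 0 1" using Mb(1)[OF gz] by simp
    show "(p \<circ> ?N) ((?M \<circ> g) z) = z" using inv(1)[OF gz] D(4) z by simp
  next
    fix w :: complex assume w: "w \<in> ball 0 1"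
    show "(p \<circ> ?N) w \<in> D" using D(5) Mb(2)[OF w] by simp
    show "(?M \<circ> g) ((p \<circ> ?N) w) = w" using D(5) Mb(2)[OF w] inv(2)[OF w] by simp
  qed
  moreover have "(?M \<circ> g) a = 0" by (simp add: b_def Moebius_function_eq_zero)
  ultimately show thesis using that by blast
qed

text \<open>With g a Riemann map vanishing at z0, the Green function is - ln |g|. Writing g(z) = (z
  - z0) exp (l z) isolates the singular part, so only ln |z - z0| has to be capped and Re l stays
  harmonic. The gap between 2 \<delta> on the closure of \<open>D0\<close> and the level \<delta>
  lets N - \<delta> be at least \<delta> there while being positive only on a compact set.\<close>

theorem log_pole_function:
  assumes D: "open D" "convex D" "D \<noteq> UNIV" and D0: "open D0" "compact (closure D0)" "closure D0 \<subseteq> D" and z0: "z0 \<in> D0"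
  obtains r r' \<delta> Kg N Nx Nxx Ny Nyy where "0 < r" "r < r'" "cball z0 r' \<subseteq> D0" "0 < \<delta>" "compact Kg" "Kg \<subseteq> D"
    "C2_planar D N Nx Nxx Ny Nyy" "\<And>z. z \<in> D \<Longrightarrow> Nxx z + Nyy z = - truncated_density r (z - z0)"
    "\<And>z. z \<in> closure D0 \<Longrightarrow> 2 * \<delta> \<le> N z" "\<And>z. z \<in> D \<Longrightarrow> \<delta> < N z \<Longrightarrow> z \<in> Kg"
    "\<And>y \<rho> \<sigma>. ball y \<sigma> \<subseteq> D \<Longrightarrow> ball y \<sigma> \<inter> cball z0 r = {} \<Longrightarrow> 0 < \<rho> \<Longrightarrow> \<rho> < \<sigma> \<Longrightarrow>
      ((\<lambda>\<theta>. N (y + of_real \<rho> * cis \<theta>)) has_integral (2 * pi * N y)) {0..2*pi}"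
proof -
  have D0D: "D0 \<subseteq> D" using D0(3) closure_subset by blast
  have z0D: "z0 \<in> D" using z0 D0D by blast
  obtain g p where cp: "conformal_pair D g p" and g0: "g z0 = 0"
    using conformal_pair_centered[OF D z0D] by blast
  then have g: "g holomorphic_on D" "p holomorphic_on ball 0 1" "\<And>z. z \<in> D \<Longrightarrow> g z \<in> ball 0 1" "\<And>z. z \<in> D \<Longrightarrow> p (g z) = z"
    "\<And>w. w \<in> ball 0 1 \<Longrightarrow> p w \<in> D"
    by (auto simp: conformal_pair_def)
  have gnz: "g z \<noteq> 0" if "z \<in> D" "z \<noteq> z0" for z
    using g(4)[OF that(1)] g(4)[OF z0D] g0 that(2) by metis
  \<comment> \<open>The quotient with its removable singularity filled; it has no zeros because g is
    injective with nonzero derivative, so it has a logarithm on the convex set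
    \<open>D\<close>.\<close>
  define e where "e z = (if z = z0 then deriv g z0 else (g z - g z0) / (z - z0))" for z
  have e: "e holomorphic_on D" unfolding e_def[abs_def] by (rule pole_lemma_open[OF g(1) D(1)])
  have enz: "e z \<noteq> 0" if "z \<in> D" for z
    using conformal_pair_deriv[OF cp z0D] gnz[OF that] by (auto simp: e_def g0)
  obtain l where l: "l holomorphic_on D" "\<And>z. z \<in> D \<Longrightarrow> e z = exp (l z)"
    using contractible_imp_holomorphic_log[OF e convex_imp_contractible[OF D(2)]] enz by blast
  have ge: "g z = (z - z0) * e z" for z by (simp add: e_def g0)
  obtain r' where r': "0 < r'" "cball z0 r' \<subseteq> D0" using D0(1) z0 open_contains_cball by blast
  have contg: "continuous_on D g" and contl: "continuous_on D l"
    using g(1) l(1) holomorphic_on_imp_continuous_on by blast+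
  obtain m where m: "m \<in> closure D0" "\<And>z. z \<in> closure D0 \<Longrightarrow> cmod (g z) \<le> cmod (g m)"
  proof -
    have "closure D0 \<noteq> {}" using z0 closure_subset by blast
    moreover have "continuous_on (closure D0) (\<lambda>z. cmod (g z))"
      using contg D0(3) by (intro continuous_intros) (auto intro: continuous_on_subset)
    ultimately show thesis using continuous_attains_sup[OF D0(2)] that by blast
  qed
  \<comment> \<open>The maximum with 1/2 keeps \<open>s0\<close> positive even if g vanishes
    identically on the compact set, so that ln s0 is meaningful; s0 < 1 gives \<delta> > 0.\<close>
  define s0 where "s0 = max (cmod (g m)) (1/2)"
  have s0: "0 < s0" "s0 < 1" "\<And>z. z \<in> closure D0 \<Longrightarrow> cmod (g z) \<le> s0"
    using g(3)[of m] m D0(3) by (auto simp: s0_def le_max_iff_disj)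
  define \<delta> where "\<delta> = - ln s0 / 2"
  have \<delta>: "0 < \<delta>" using s0 by (simp add: \<delta>_def)
  have "compact ((\<lambda>z. Re (l z)) ` cball z0 r')"
    using contl r' D0D by (intro compact_continuous_image continuous_intros) (auto intro: continuous_on_subset)
  then have "bounded ((\<lambda>z. Re (l z)) ` cball z0 r')" by (rule compact_imp_bounded)
  then obtain c where "\<forall>x \<in> (\<lambda>z. Re (l z)) ` cball z0 r'. norm x \<le> c" unfolding bounded_iff by blast
  then have c: "\<bar>Re (l z)\<bar> \<le> c" if "z \<in> cball z0 r'" for z using that by simp
  \<comment> \<open>The exponential gives - ln r \<ge> 2 \<delta> + c, which beats Re l \<le> c and
    yields N \<ge> 2 \<delta> also inside the capped disc.\<close>
  define r where "r = min (r' / 2) (exp (- c - 2 * \<delta>))"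
  have r: "0 < r" "r < r'" using r' by (auto simp: r_def)
  have lnr: "2 * \<delta> + c \<le> - ln r"
  proof -
    have "ln r \<le> ln (exp (- c - 2 * \<delta>))" using r(1) by (subst ln_le_cancel_iff) (auto simp: r_def)
    then show ?thesis by simp
  qed
  define N where "N z = log_cap r ((cmod (z - z0))\<^sup>2) - Re (l z)" for z
  have Ng: "N z = - ln (cmod (g z))" if "z \<in> D" "r \<le> cmod (z - z0)" for z
  proof -
    have "r\<^sup>2 \<le> (cmod (z - z0))\<^sup>2" using that(2) r(1) by (simp add: power_mono)
    then have "log_cap r ((cmod (z - z0))\<^sup>2) = - ln ((cmod (z - z0))\<^sup>2) / 2"
      by (simp only: log_cap_def not_less[symmetric] if_False)
    then have "log_cap r ((cmod (z - z0))\<^sup>2) = - ln (cmod (z - z0))"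
      using that(2) r(1) by (simp add: ln_realpow)
    moreover have "cmod (g z) = cmod (z - z0) * exp (Re (l z))"
      by (simp add: ge norm_mult l(2)[OF that(1)])
    moreover have "z \<noteq> z0" using that(2) r(1) by auto
    ultimately show ?thesis by (simp add: N_def ln_mult)
  qed
  note C = C2_planar_diff[OF C2_planar_subset[OF C2_planar_log_cap[OF r(1), of z0] subset_UNIV] C2_planar_Re[OF D(1) l(1)], folded N_def]
  show thesis
  proof (rule that[OF r r'(2) \<delta> _ _ C])
    have "exp (- \<delta>) < 1" using \<delta> by simp
    then have "cball 0 (exp (- \<delta>)) \<subseteq> ball (0::complex) 1" by (simp add: cball_subset_ball_iff)
    then show "compact (cball z0 r \<union> p ` cball 0 (exp (- \<delta>)))"
      by (intro compact_Un compact_continuous_image compact_cball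
          continuous_on_subset[OF holomorphic_on_imp_continuous_on[OF g(2)]])
    show "cball z0 r \<union> p ` cball 0 (exp (- \<delta>)) \<subseteq> D"
    proof -
      have "cball z0 r \<subseteq> cball z0 r'" using r by auto
      moreover have "p ` cball 0 (exp (- \<delta>)) \<subseteq> D"
      proof (rule image_subsetI)
        fix w :: complex assume "w \<in> cball 0 (exp (- \<delta>))"
        moreover have "exp (- \<delta>) < 1" using \<delta> by simp
        ultimately have "cmod w < 1" by (simp only: mem_cball_0)
        then show "p w \<in> D" using g(5) by simp
      qed
      ultimately show ?thesis using r'(2) D0D by blast
    qed
    fix z assume z: "z \<in> D"
    let ?T = "(Re z - Re z0)\<^sup>2 + (Im z - Im z0)\<^sup>2"
    have T: "?T = (cmod (z - z0))\<^sup>2" by (simp add: cmod_power2)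
    have "log_cap'' r ?T * (2 * (Re z - Re z0))\<^sup>2 + 2 * log_cap' r ?T - Re (deriv (deriv l) z) +
        (log_cap'' r ?T * (2 * (Im z - Im z0))\<^sup>2 + 2 * log_cap' r ?T - - Re (deriv (deriv l) z))
      = 4 * log_cap' r ?T + 4 * ?T * log_cap'' r ?T"
      by (simp add: power2_eq_square algebra_simps)
    also have "\<dots> = - truncated_density r (z - z0)"
      unfolding truncated_density_def T by (rule log_cap_laplacian[OF r(1)]) simp
    finally show "log_cap'' r ?T * (2 * (Re z - Re z0))\<^sup>2 + 2 * log_cap' r ?T - Re (deriv (deriv l) z) +
        (log_cap'' r ?T * (2 * (Im z - Im z0))\<^sup>2 + 2 * log_cap' r ?T - - Re (deriv (deriv l) z))
      = - truncated_density r (z - z0)" .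
  next
    fix z assume z: "z \<in> closure D0"
    show "2 * \<delta> \<le> N z"
    proof (cases "r \<le> cmod (z - z0)")
      case True
      have zD: "z \<in> D" using z D0 by blast
      have "z \<noteq> z0" using True r by auto
      then have "0 < cmod (g z)" using gnz[OF zD] by simp
      then have "ln (cmod (g z)) \<le> ln s0" using s0(1) s0(3)[OF z] by simp
      then show ?thesis using Ng[OF zD True] by (simp add: \<delta>_def)
    next
      case False
      then have zb: "z \<in> cball z0 r'" using r by (simp add: dist_norm norm_minus_commute)
      have "(cmod (z - z0))\<^sup>2 \<le> r\<^sup>2" using False by (intro power_mono) auto
      then have "- ln r \<le> log_cap r ((cmod (z - z0))\<^sup>2)" by (rule log_cap_ge[OF r(1)])
      then show ?thesis using lnr c[OF zb] by (simp add: N_def)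
    qed
  next
    fix z assume z: "z \<in> D" "\<delta> < N z"
    show "z \<in> cball z0 r \<union> p ` cball 0 (exp (- \<delta>))"
    proof (cases "r \<le> cmod (z - z0)")
      case True
      have "z \<noteq> z0" using True r by auto
      then have pos: "0 < cmod (g z)" using gnz[OF z(1)] by simp
      have "ln (cmod (g z)) < - \<delta>" using Ng[OF z(1) True] z(2) by simp
      then have "cmod (g z) < exp (- \<delta>)" using pos by (metis exp_less_cancel_iff exp_ln)
      then have "g z \<in> cball 0 (exp (- \<delta>))" by simp
      then show ?thesis using g(4)[OF z(1)] by (metis UnI2 image_eqI)
    next
      case False
      then show ?thesis by (simp add: dist_norm norm_minus_commute)
    qed
  next
    fix y \<rho> \<sigma> assume y: "ball y \<sigma> \<subseteq> D" "ball y \<sigma> \<inter> cball z0 r = {}" and \<rho>: "0 < \<rho>" "\<rho> < (\<sigma>::real)"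
    have far: "r \<le> cmod (z - z0)" if "z \<in> ball y \<sigma>" for z
      using y(2) that by (auto simp: dist_norm norm_minus_commute disjoint_iff)
    have hg: "g holomorphic_on ball y \<sigma>" using g(1) y(1) holomorphic_on_subset by blast
    have nz: "g z \<noteq> 0" if "z \<in> ball y \<sigma>" for z
    proof (rule gnz)
      show "z \<in> D" using y(1) that by blast
      show "z \<noteq> z0" using far[OF that] r(1) by auto
    qed
    \<comment> \<open>On a disc missing the pole g has a logarithm, so N is locally the real part of
      a holomorphic function there.\<close>
    obtain L where L: "L holomorphic_on ball y \<sigma>" "\<And>z. z \<in> ball y \<sigma> \<Longrightarrow> g z = exp (L z)"
      using contractible_imp_holomorphic_log[OF hg convex_imp_contractible[OF convex_ball] nz] by blast
    have NL: "N z = Re (- L z)" if "z \<in> ball y \<sigma>" for z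
      using Ng[of z] y(1) that far[OF that] L(2)[OF that] by auto
    have "((\<lambda>\<theta>. Re (- L (y + of_real \<rho> * cis \<theta>))) has_integral (2 * pi * Re (- L y))) {0..2*pi}"
      by (rule holomorphic_mean_value[of "\<lambda>z. - L z", OF _ \<rho>]) (intro holomorphic_intros L)
    moreover have "y + of_real \<rho> * cis \<theta> \<in> ball y \<sigma>" for \<theta> using \<rho> by (simp add: dist_norm norm_mult)
    moreover have "y \<in> ball y \<sigma>" using \<rho> by simp
    ultimately show "((\<lambda>\<theta>. N (y + of_real \<rho> * cis \<theta>)) has_integral (2 * pi * N y)) {0..2*pi}"
      using NL by simp
  qed
qed

text \<open>The indicator of the closed \<eta>-neighbourhood of \<open>K\<close>, mollified at the
  same scale; \<eta> = d / 2 keeps the support within distance d of \<open>K\<close>.\<close>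

lemma smooth_cutoff:
  assumes K: "compact K" and D: "open D" "K \<subseteq> D"
  obtains h where "test_function D h" "\<And>z. 0 \<le> h z" "\<And>z. h z \<le> 1" "\<And>z. z \<in> K \<Longrightarrow> h z = 1"
proof -
  obtain d where d: "0 < d" "(\<Union>x\<in>K. cball x d) \<subseteq> D"
    using compact_subset_open_imp_cball_epsilon_subset[OF K D] by metis
  define \<eta> where "\<eta> = d / 2"
  have \<eta>: "0 < \<eta>" using d by (simp add: \<eta>_def)
  define K2 where "K2 = {x + y |x y. x \<in> K \<and> y \<in> cball 0 \<eta>}"
  have K2: "compact K2" unfolding K2_def by (intro compact_sums K compact_cball)
  have i: "integrable lborel (indicator K2 :: complex \<Rightarrow> real)"
    using emeasure_compact_finite[OF K2] borel_compact[OF K2] by simp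
  have mz: "mollifier \<eta> z = 0" if "\<eta> < cmod z" for z using mollifier_eq_0[OF \<eta>] that by auto
  show thesis
  proof (rule that)
    show "test_function D (conv (indicator K2) (mollifier \<eta>))"
    proof (rule conv_test_function[OF i smooth_mollifier mz K2])
      fix w assume "w \<in> K2"
      then obtain x y where xy: "w = x + y" "x \<in> K" "cmod y \<le> \<eta>" by (auto simp: K2_def)
      have "cball w \<eta> \<subseteq> cball x d"
      proof
        fix v assume "v \<in> cball w \<eta>"
        moreover have "dist x v \<le> dist x w + dist w v" by (rule dist_triangle)
        moreover have "dist x w = cmod y" by (simp add: xy(1) dist_norm)
        ultimately show "v \<in> cball x d" using xy(3) by (simp add: \<eta>_def)
      qed
      then show "cball w \<eta> \<subseteq> D" using d(2) xy(2) by blast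
    qed (auto simp: indicator_def)
    show "0 \<le> conv (indicator K2) (mollifier \<eta>) z" for z
      unfolding conv_def using mollifier_nonneg by (intro Bochner_Integration.integral_nonneg) auto
    show "conv (indicator K2) (mollifier \<eta>) z \<le> 1" for z
      by (rule conv_mollifier_defect(2)[OF i _ \<eta>]) (simp add: indicator_def)
    fix z assume z: "z \<in> K"
    have "indicator K2 w * mollifier \<eta> (z - w) = mollifier \<eta> (z - w)" for w
    proof (cases "w \<in> K2")
      case False
      have "\<eta> < cmod (z - w)"
      proof (rule ccontr)
        assume "\<not> \<eta> < cmod (z - w)"
        then have "w = z + (w - z)" "w - z \<in> cball 0 \<eta>" by (auto simp: norm_minus_commute)
        then have "w \<in> K2" unfolding K2_def using z by blast
        then show False using False by simp
      qed
      then show ?thesis using mz by simp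
    qed simp
    then have "(\<lambda>w. indicator K2 w * mollifier \<eta> (z - w)) = (\<lambda>w. mollifier \<eta> (z - w))" by blast
    then show "conv (indicator K2) (mollifier \<eta>) z = 1"
      unfolding conv_def by (simp only: integral_mollifier_shift(1)[OF \<eta>])
  qed
qed

section \<open>The weighted estimate\<close>

text \<open>A limit point outside \<open>D\<close> would force R to tend to 0 along the sequence, by
  comparison with twice the distance.\<close>

lemma hyperbolic_radius_superlevel_compact:
  assumes cp: "conformal_pair D g p" and D: "convex D" "bounded D" and e: "0 < e"
  shows "compact {z \<in> D. e \<le> hyperbolic_radius D z}"
proof -
  let ?R = "hyperbolic_radius D"
  have cont: "continuous_on D ?R"
    using hyperbolic_radius_C2[OF cp D(1)] by (metis C2_planar_def)
  have "closed {z \<in> D. e \<le> ?R z}"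
    unfolding closed_sequential_limits
  proof (intro allI impI)
    fix x l assume x: "(\<forall>n. x n \<in> {z \<in> D. e \<le> ?R z}) \<and> x \<longlonglongrightarrow> l"
    then have xD: "x n \<in> D" "e \<le> ?R (x n)" for n by auto
    have lD: "l \<in> D"
    proof (rule ccontr)
      assume l: "l \<notin> D"
      have "(\<lambda>n. dist (x n) l) \<longlonglongrightarrow> 0" using x by (simp add: tendsto_dist_iff[symmetric])
      then have "eventually (\<lambda>n. dist (x n) l < e / 2) sequentially"
        using e by (intro order_tendstoD) auto
      then obtain n where "dist (x n) l < e / 2" using eventually_happens' by force
      then show False using hyperbolic_radius_le_dist[OF cp D(1) xD(1) l, of n] xD(2)[of n] by simp
    qed
    have "(\<lambda>n. ?R (x n)) \<longlonglongrightarrow> ?R l"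
      using cont lD xD(1) x by (auto simp: continuous_on_sequentially o_def)
    then have "e \<le> ?R l" using xD(2) by (intro LIMSEQ_le_const) auto
    then show "l \<in> {z \<in> D. e \<le> ?R z}" using lD by simp
  qed
  moreover have "bounded {z \<in> D. e \<le> ?R z}" using D(2) by (rule bounded_subset) auto
  ultimately show ?thesis by (simp add: compact_eq_bounded_closed)
qed

text \<open>R tends to 0 at a boundary point. This supplies the points near \<partial>D at which M
  is sampled for the constants.\<close>

lemma hyperbolic_radius_small_values:
  assumes cp: "conformal_pair D g p" and D: "convex D" "D \<noteq> {}" "D \<noteq> UNIV" and e: "0 < e"
  obtains z where "z \<in> D" "hyperbolic_radius D z < e"
proof -
  have "open D" using cp by (simp add: conformal_pair_def)
  obtain w where w: "w \<in> frontier D" using D frontier_eq_empty by blast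
  then have "w \<notin> D" "w \<in> closure D"
    using \<open>open D\<close> by (auto simp: frontier_def interior_open)
  then obtain z where z: "z \<in> D" "dist z w < e / 2"
    using e closure_approachable[of w D] by (metis half_gt_zero)
  then have "hyperbolic_radius D z < e"
    using hyperbolic_radius_le_dist[OF cp D(1) z(1) \<open>w \<notin> D\<close>] by simp
  then show thesis using that z by blast
qed

lemma hyperbolic_radius_bounded:
  assumes cp: "conformal_pair D g p" and D: "convex D" "bounded D"
  obtains Rm where "0 < Rm" "\<And>z. z \<in> D \<Longrightarrow> hyperbolic_radius D z \<le> Rm"
proof -
  have "D \<noteq> UNIV" using D(2) not_bounded_UNIV by blast
  then obtain w where w: "w \<notin> D" by blast
  obtain e where e: "\<And>z. z \<in> D \<Longrightarrow> dist w z \<le> e" using D(2) bounded_any_center[of D w] by blast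
  show thesis
  proof (rule that[of "max (2 * e) 1"])
    fix z assume z: "z \<in> D"
    have "hyperbolic_radius D z \<le> 2 * dist z w" by (rule hyperbolic_radius_le_dist[OF cp D(1) z w])
    then show "hyperbolic_radius D z \<le> max (2 * e) 1" using e[OF z] by (simp add: dist_commute)
  qed simp
qed

lemma C2_on_derivatives:
  assumes "C2_on {..<0} F" "t < 0"
  shows "(F has_real_derivative deriv F t) (at t)" "(deriv F has_real_derivative deriv (deriv F) t) (at t)"
  using assms by (auto simp: C2_on_def field_differentiable_derivI)

text \<open>The chain rule gives \<Delta>(F(-R)) = F'' |\<nabla>R|^2 - F' \<Delta>R, into which
  |\<nabla>R|^2 = R \<Delta>R + 4 is substituted. It is nonnegative because F', F'' \<ge> 0 and
  \<Delta>R \<le> 0.\<close>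

lemma C2_planar_radial_composition:
  assumes cp: "conformal_pair D g p" and D: "convex D"
    and F: "convex_on {..<0} F" "mono_on {..<0} F" "C2_on {..<0} F"
  defines "R \<equiv> hyperbolic_radius D"
  obtains Mx Mxx My Myy where "C2_planar D (\<lambda>z. F (- R z)) Mx Mxx My Myy"
    "\<And>z. z \<in> D \<Longrightarrow> Mxx z + Myy z = 4 * deriv (deriv F) (- R z) +
         (deriv (deriv F) (- R z) * R z - deriv F (- R z)) * laplacian R z"
    "\<And>z. z \<in> D \<Longrightarrow> 0 \<le> Mxx z + Myy z"
proof -
  have oD: "open D" using cp by (simp add: conformal_pair_def)
  obtain Rx Rxx Ry Ryy where C: "C2_planar D R Rx Rxx Ry Ryy"
    and grad: "\<And>z. z \<in> D \<Longrightarrow> (Rx z)\<^sup>2 + (Ry z)\<^sup>2 = R z * (Rxx z + Ryy z) + 4"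
    and lap: "\<And>z. z \<in> D \<Longrightarrow> Rxx z + Ryy z \<le> 0"
    using hyperbolic_radius_C2[OF cp D] unfolding R_def by metis
  have Rpos: "0 < R z" if "z \<in> D" for z unfolding R_def by (rule hyperbolic_radius_pos[OF cp that])
  note dF = C2_on_derivatives[OF F(3)]
  have cF: "continuous_on {..<0} F" "continuous_on {..<0} (deriv F)" "continuous_on {..<0} (deriv (deriv F))"
    using DERIV_isCont[OF dF(1)] DERIV_isCont[OF dF(2)] F(3)
    by (auto simp: C2_on_def intro!: continuous_at_imp_continuous_on)
  have cR: "continuous_on D (\<lambda>z. - R z)" "(\<lambda>z. - R z) ` D \<subseteq> {..<0}"
    using C Rpos by (auto simp: C2_planar_def intro!: continuous_intros)
  note cc = continuous_on_compose2[OF cF(1) cR] continuous_on_compose2[OF cF(2) cR] continuous_on_compose2[OF cF(3) cR]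
  have cc': "continuous_on D Rx" "continuous_on D Ry" "continuous_on D Rxx" "continuous_on D Ryy"
    using C by (auto simp: C2_planar_def)
  define Mx where "Mx z = - deriv F (- R z) * Rx z" for z
  define Mxx where "Mxx z = deriv (deriv F) (- R z) * (Rx z)\<^sup>2 - deriv F (- R z) * Rxx z" for z
  define My where "My z = - deriv F (- R z) * Ry z" for z
  define Myy where "Myy z = deriv (deriv F) (- R z) * (Ry z)\<^sup>2 - deriv F (- R z) * Ryy z" for z
  have CM: "C2_planar D (\<lambda>z. F (- R z)) Mx Mxx My Myy"
    unfolding C2_planar_def
  proof (intro conjI ballI)
    fix z assume z: "z \<in> D"
    have neg: "- R z < 0" using Rpos[OF z] by simp
    have zz: "Complex (Re z) (Im z) = z" by simp
    have S: "((\<lambda>x. R (Complex x (Im z))) has_real_derivative Rx z) (at (Re z))"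
      "((\<lambda>x. Rx (Complex x (Im z))) has_real_derivative Rxx z) (at (Re z))"
      "((\<lambda>y. R (Complex (Re z) y)) has_real_derivative Ry z) (at (Im z))"
      "((\<lambda>y. Ry (Complex (Re z) y)) has_real_derivative Ryy z) (at (Im z))"
      using C z by (auto simp: C2_planar_def)
    have dFz: "(F has_real_derivative deriv F (- R z)) (at (- R z))" "(deriv F has_real_derivative deriv (deriv F) (- R z)) (at (- R z))"
      using dF[OF neg] by auto
    have F1: "((\<lambda>x. F (- R (Complex x (Im z)))) has_real_derivative deriv F (- R z) * - Rx z) (at (Re z))"
      "((\<lambda>x. deriv F (- R (Complex x (Im z)))) has_real_derivative deriv (deriv F) (- R z) * - Rx z) (at (Re z))"
      "((\<lambda>y. F (- R (Complex (Re z) y))) has_real_derivative deriv F (- R z) * - Ry z) (at (Im z))"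
      "((\<lambda>y. deriv F (- R (Complex (Re z) y))) has_real_derivative deriv (deriv F) (- R z) * - Ry z) (at (Im z))"
      by (rule DERIV_chain2; use dFz DERIV_minus[OF S(1)] DERIV_minus[OF S(3)] in simp)+
    show "((\<lambda>x. F (- R (Complex x (Im z)))) has_real_derivative Mx z) (at (Re z))"
      "((\<lambda>y. F (- R (Complex (Re z) y))) has_real_derivative My z) (at (Im z))"
      using F1(1,3) by (simp_all add: Mx_def My_def)
    show "((\<lambda>x. Mx (Complex x (Im z))) has_real_derivative Mxx z) (at (Re z))"
      unfolding Mx_def by (rule DERIV_cong[OF DERIV_mult[OF DERIV_minus[OF F1(2)] S(2)]])
        (simp add: Mxx_def power2_eq_square algebra_simps)
    show "((\<lambda>y. My (Complex (Re z) y)) has_real_derivative Myy z) (at (Im z))"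
      unfolding My_def by (rule DERIV_cong[OF DERIV_mult[OF DERIV_minus[OF F1(4)] S(4)]])
        (simp add: Myy_def power2_eq_square algebra_simps)
  next
    show "continuous_on D (\<lambda>z. F (- R z))" by (rule cc)
    show "continuous_on D Mx" "continuous_on D My" "continuous_on D Mxx" "continuous_on D Myy"
      unfolding Mx_def My_def Mxx_def Myy_def by (intro continuous_intros cc cc')+
  qed
  have sum: "Mxx z + Myy z = deriv (deriv F) (- R z) * ((Rx z)\<^sup>2 + (Ry z)\<^sup>2) - deriv F (- R z) * (Rxx z + Ryy z)" for z
    by (simp add: Mxx_def Myy_def algebra_simps)
  show thesis
  proof (rule that[OF CM])
    fix z assume z: "z \<in> D"
    have neg: "- R z < 0" using Rpos[OF z] by simp
    show "Mxx z + Myy z = 4 * deriv (deriv F) (- R z) + (deriv (deriv F) (- R z) * R z - deriv F (- R z)) * laplacian R z"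
      unfolding sum grad[OF z] C2_planar_laplacian[OF oD C z] by (simp add: algebra_simps)
    have "0 \<le> deriv (deriv F) (- R z)"
      by (rule convex_second_derivative_nonneg[OF open_lessThan convex_real_interval(4) F(1), of "deriv F" _ "- R z"])
         (use dF neg in auto)
    moreover have "0 \<le> deriv F (- R z)"
      by (rule mono_on_imp_deriv_nonneg[OF F(2) dF(1)[OF neg]]) (use neg in \<open>simp add: interior_open\<close>)
    ultimately show "0 \<le> Mxx z + Myy z"
      unfolding sum using lap[OF z] mult_nonneg_nonpos[of "deriv F (- R z)" "Rxx z + Ryy z"] by (smt (verit) mult_nonneg_nonneg zero_le_power2)
  qed
qed

section \<open>The weight R f(s/R) and its truncation\<close>

lemma weight_measurable:
  fixes s f D
  defines "R \<equiv> hyperbolic_radius D"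
  assumes cp: "conformal_pair D g p" and D: "convex D" and D0: "open D0"
    and f: "mono_on {0..} f"
    and v: "subharmonic_on S v" "D - D0 \<subseteq> S" "\<And>z. z \<in> D - D0 \<Longrightarrow> v z = ereal (s z)"
    and s: "\<And>z. z \<in> D - D0 \<Longrightarrow> 0 \<le> s z"
  shows "(\<lambda>z. indicator (D - D0) z * (R z * f (s z / R z))) \<in> borel_measurable borel"
proof -
  have oD: "open D" using cp by (simp add: conformal_pair_def)
  have [measurable]: "D \<in> sets borel" "D0 \<in> sets borel" using oD D0 by auto
  have Rpos: "0 < R z" if "z \<in> D" for z unfolding R_def by (rule hyperbolic_radius_pos[OF cp that])
  obtain Rx Rxx Ry Ryy where "C2_planar D R Rx Rxx Ry Ryy"
    using hyperbolic_radius_C2[OF cp D] unfolding R_def by metis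
  then have Rcont: "continuous_on D R" by (simp add: C2_planar_def)
  \<comment> \<open>Constant continuation to negative arguments makes a monotone, hence Borel,
    function on the whole line.\<close>
  define f' where "f' t = f (max t 0)" for t
  have "mono f'"
    unfolding f'_def by (intro monoI mono_onD[OF f]) auto
  then have [measurable]: "f' \<in> borel_measurable borel" by (rule borel_measurable_mono)
  define s' where "s' z = real_of_ereal (if z \<in> S then v z else - \<infinity>)" for z
  have [measurable]: "s' \<in> borel_measurable borel"
    unfolding s'_def using subharmonic_measurable[OF v(1)] by measurable
  have [measurable]: "(\<lambda>z. indicator D z *\<^sub>R R z) \<in> borel_measurable borel"
    by (rule borel_measurable_continuous_on_indicator; use Rcont in auto)
  have eq: "indicator (D - D0) z * (R z * f (s z / R z)) = indicator (D - D0) z * ((indicator D z *\<^sub>R R z) * f' (s' z / (indicator D z *\<^sub>R R z)))" for z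
  proof (cases "z \<in> D - D0")
    case True
    then have "s' z = s z" using v by (auto simp: s'_def)
    moreover have "max (s z / R z) 0 = s z / R z" using s[OF True] Rpos[of z] True by simp
    ultimately show ?thesis using True by (simp add: f'_def)
  qed simp
  show ?thesis unfolding eq by measurable
qed

text \<open>Here the abstract estimate is applied to \<psi> = (max w G - \<epsilon>)^+. The cost of
  G relative to w is paid by a multiple of the cutoff \<open>h\<close>; \<open>X\<close> bounds the
  result uniformly in \<epsilon>.\<close>

lemma truncated_potential_estimate:
  fixes D D0 :: "complex set" and N :: "complex \<Rightarrow> real"
  defines "R \<equiv> hyperbolic_radius D"
  assumes cp: "conformal_pair D g p" and D: "convex D" "bounded D"
    and D0: "open D0" "compact (closure D0)" "closure D0 \<subseteq> D"
    and r: "0 < r" "r < r'" "cball z0 r' \<subseteq> D0" and \<delta>: "0 < \<delta>" and Kg: "compact Kg" "Kg \<subseteq> D"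
    and N: "C2_planar D N Nx Nxx Ny Nyy" "\<And>z. z \<in> D \<Longrightarrow> Nxx z + Nyy z = - truncated_density r (z - z0)"
    and N_ge: "\<And>z. z \<in> closure D0 \<Longrightarrow> 2 * \<delta> \<le> N z" and N_gt: "\<And>z. z \<in> D \<Longrightarrow> \<delta> < N z \<Longrightarrow> z \<in> Kg"
    and N_mean: "\<And>y \<rho> \<sigma>. ball y \<sigma> \<subseteq> D \<Longrightarrow> ball y \<sigma> \<inter> cball z0 r = {} \<Longrightarrow> 0 < \<rho> \<Longrightarrow> \<rho> < \<sigma> \<Longrightarrow>
      ((\<lambda>\<theta>. N (y + of_real \<rho> * cis \<theta>)) has_integral (2 * pi * N y)) {0..2*pi}"
    and c2: "\<And>z. z \<in> closure D0 \<union> Kg \<Longrightarrow> \<bar>N z - \<delta>\<bar> \<le> c2"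
    and u: "subharmonic_on D u" "u z0 = ereal u0" and \<nu>: "is_riesz_measure D u \<nu>"
    and M: "C2_planar D M Mx Mxx My Myy" "\<And>z. z \<in> D \<Longrightarrow> 0 \<le> Mxx z + Myy z"
    and uM: "\<And>z. z \<in> D - D0 \<Longrightarrow> u z \<le> ereal (M z)" and m: "\<And>z. z \<in> D0 \<Longrightarrow> M z \<le> m"
    and h: "test_function D h" "\<And>z. 0 \<le> h z" "\<And>z. z \<in> closure D0 \<union> Kg \<Longrightarrow> h z = 1"
    and f: "convex_on {0..} f" "mono_on {0..} f" "\<And>t. 0 \<le> t \<Longrightarrow> 0 \<le> f t" "f 0 = 0"
    and v: "subharmonic_on S v" "D - D0 \<subseteq> S" "\<And>z. z \<in> D - D0 \<Longrightarrow> v z = ereal (s z)"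
    and s: "\<And>z. z \<in> D - D0 \<Longrightarrow> 0 \<le> s z" "\<And>z. z \<in> D - D0 \<Longrightarrow> s z \<le> t0 * R z" "0 \<le> t0"
    and b: "0 \<le> b" "\<And>z. z \<in> frontier D0 \<Longrightarrow> f t0 * R z \<le> b"
    and \<epsilon>: "0 < \<epsilon>" "\<epsilon> < 1"
    and Iw: "integrable lborel (\<lambda>z. indicator (D - D0) z * (R z * f (s z / R z)) * (Mxx z + Myy z))"
  defines "B \<equiv> (b + 1) / \<delta>"
  defines "X \<equiv> 1 / (2 * pi) * ((\<integral>z. indicator (D - D0) z * (R z * f (s z / R z)) * (Mxx z + Myy z) \<partial>lborel)
      + B * c2 * (\<integral>z. h z * (Mxx z + Myy z) \<partial>lborel) + B * truncated_mass r * (m + 1 - u0))"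
  shows "(\<integral>\<^sup>+z\<in>D - D0. ennreal (R z * f (s z / R z) - \<epsilon>) \<partial>\<nu>) \<le> ennreal X" and "0 \<le> X"
proof -
  have oD: "open D" using cp by (simp add: conformal_pair_def)
  have [measurable]: "D \<in> sets borel" "D0 \<in> sets borel" using oD D0(1) by auto
  have D0D: "D0 \<subseteq> D" using D0(3) closure_subset by blast
  have Rpos: "0 < R z" if "z \<in> D" for z unfolding R_def by (rule hyperbolic_radius_pos[OF cp that])
  obtain Rx Rxx Ry Ryy where "C2_planar D R Rx Rxx Ry Ryy"
    using hyperbolic_radius_C2[OF cp D(1)] unfolding R_def by metis
  then have Rcont: "continuous_on D R" by (simp add: C2_planar_def)
  have Rconc: "concave_on D R" unfolding R_def by (rule hyperbolic_radius_concave[OF cp D(1)])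
  obtain Rm where Rm: "0 < Rm" "\<And>z. z \<in> D \<Longrightarrow> R z \<le> Rm"
    using hyperbolic_radius_bounded[OF cp D] unfolding R_def by metis
  have Ncont: "continuous_on D N" using N(1) by (simp add: C2_planar_def)
  have B: "0 < B" using b \<delta> by (simp add: B_def)
  have z0D0: "z0 \<in> D0" using r by auto
  have c2_nn: "0 \<le> c2"
  proof -
    have "z0 \<in> closure D0" using z0D0 closure_subset by blast
    then show ?thesis using c2[of z0] by auto
  qed
  define G where "G z = B * (N z - \<delta>)" for z
  define w where "w z = R z * f (s z / R z)" for z
  have ft0: "0 \<le> f t0" using f(3) s(3) by blast
  have w_nn: "0 \<le> w z" if "z \<in> D - D0" for z
    unfolding w_def using Rpos[of z] s(1)[OF that] that by (intro mult_nonneg_nonneg f(3)) auto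
  have w_le: "w z \<le> f t0 * R z" if "z \<in> D - D0" for z
  proof -
    have Rz: "0 < R z" using Rpos that by blast
    have "s z / R z \<le> t0" using s(2)[OF that] Rz by (simp add: field_simps)
    then have "f (s z / R z) \<le> f t0"
      using s(1)[OF that] Rz s(3) by (intro mono_onD[OF f(2)]) auto
    then show ?thesis unfolding w_def using Rz by (simp add: mult.commute)
  qed
  \<comment> \<open>N - \<delta> \<ge> \<delta> on the closure of \<open>D0\<close>, and B \<delta>
    = b + 1. On \<partial>D0 this exceeds w \<le> f(t0) R \<le> b by at least 1.\<close>
  have G_ge: "b + 1 \<le> G z" if "z \<in> closure D0" for z
  proof -
    have "B * \<delta> \<le> B * (N z - \<delta>)" using N_ge[OF that] B by (intro mult_left_mono) auto
    then show ?thesis using \<delta> by (simp add: G_def B_def)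
  qed
  have G_le: "G z \<le> B * c2" if "z \<in> closure D0 \<union> Kg" for z
    unfolding G_def using c2[OF that] B by (intro mult_left_mono) auto
  have G_Kg: "z \<in> Kg" if "z \<in> D" "0 < G z" for z
    using N_gt[OF that(1)] that(2) B by (simp add: G_def zero_less_mult_iff)
  \<comment> \<open>On \<open>D0\<close> only G is used, since w lives on the complement; G
    dominates w near \<partial>D0, so the two definitions fit together.\<close>
  define \<psi> where "\<psi> z = (if z \<in> D0 then G z - \<epsilon> else if z \<in> D then max 0 (max (w z - \<epsilon>) (G z - \<epsilon>)) else 0)" for z
  have \<psi>D0: "\<psi> z = G z - \<epsilon>" if "z \<in> D0" for z using that by (simp add: \<psi>_def)
  have \<psi>_nn: "0 \<le> \<psi> z" for z
  proof (cases "z \<in> D0")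
    case True
    then have "b + 1 \<le> G z" using G_ge closure_subset by blast
    then show ?thesis using True b \<epsilon> by (simp add: \<psi>D0)
  qed (simp add: \<psi>_def)
  have \<psi>_ge_G: "G z - \<epsilon> \<le> \<psi> z" if "z \<in> D" for z using that by (auto simp: \<psi>_def le_max_iff_disj)
  have \<psi>_ge_w: "w z - \<epsilon> \<le> \<psi> z" if "z \<in> D - D0" for z using that by (auto simp: \<psi>_def le_max_iff_disj)
  define L where "L = f t0 * Rm + B * c2"
  have \<psi>_L: "\<psi> z \<le> L" for z
  proof -
    have 1: "G z - \<epsilon> \<le> L" if "z \<in> D0"
    proof -
      have "z \<in> closure D0" using that closure_subset by blast
      then have "G z \<le> B * c2" using G_le by blast
      moreover have "0 \<le> f t0 * Rm" using ft0 Rm(1) by simp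
      ultimately show ?thesis unfolding L_def using \<epsilon> by linarith
    qed
    have 2: "max 0 (max (w z - \<epsilon>) (G z - \<epsilon>)) \<le> L" if z: "z \<in> D" "z \<notin> D0"
    proof -
      have "f t0 * R z \<le> f t0 * Rm" using Rm(2)[OF z(1)] ft0 by (rule mult_left_mono)
      then have "w z \<le> f t0 * Rm" using w_le[of z] z by simp
      moreover have "G z \<le> B * c2"
      proof (cases "0 < G z")
        case True
        then show ?thesis using G_Kg[OF z(1)] G_le by blast
      next
        case False
        moreover have "0 \<le> B * c2" using B c2_nn by simp
        ultimately show ?thesis by linarith
      qed
      moreover have "0 \<le> f t0 * Rm" "0 \<le> B * c2" using ft0 Rm(1) B c2_nn by simp_all
      ultimately show ?thesis unfolding L_def using \<epsilon> by (simp add: max_def)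
    qed
    have 3: "0 \<le> L" unfolding L_def using ft0 Rm(1) B c2_nn by simp
    show ?thesis using 1 2 3 by (simp add: \<psi>_def)
  qed
  \<comment> \<open>Outside \<open>K\<close> one has G \<le> 0 and w \<le> f(t0) R \<le> \<epsilon>,
    hence \<psi> = 0. The 1 in the denominator covers f(t0) = 0.\<close>
  define K where "K = closure D0 \<union> Kg \<union> {z \<in> D. \<epsilon> / (f t0 + 1) \<le> R z}"
  have eft: "0 < \<epsilon> / (f t0 + 1)" using ft0 \<epsilon> by simp
  have K: "compact K" "K \<subseteq> D"
    unfolding K_def R_def using D0 Kg hyperbolic_radius_superlevel_compact[OF cp D eft]
    by (auto intro!: compact_Un)
  have \<psi>K: "\<psi> z = 0" if "z \<notin> K" for z
  proof -
    have "z \<notin> D0" using that closure_subset unfolding K_def by blast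
    moreover have "max 0 (max (w z - \<epsilon>) (G z - \<epsilon>)) = 0" if z: "z \<in> D"
    proof -
      have "G z \<le> 0" using G_Kg[OF z] \<open>z \<notin> K\<close> by (force simp: K_def)
      moreover have "w z \<le> \<epsilon>"
      proof -
        have "R z < \<epsilon> / (f t0 + 1)" using \<open>z \<notin> K\<close> z by (auto simp: K_def)
        then have "(f t0 + 1) * R z < \<epsilon>" using ft0 by (simp add: field_simps)
        moreover have "f t0 * R z \<le> (f t0 + 1) * R z" using Rpos[OF z] by (intro mult_right_mono) auto
        ultimately show ?thesis using w_le[of z] z \<open>z \<notin> D0\<close> by simp
      qed
      ultimately show ?thesis using \<epsilon> by simp
    qed
    ultimately show ?thesis by (simp add: \<psi>_def)
  qed
  have [measurable]: "(\<lambda>z. indicator D z *\<^sub>R G z) \<in> borel_measurable borel"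
    by (rule borel_measurable_continuous_on_indicator; use Ncont in \<open>auto simp: G_def intro!: continuous_intros\<close>)
  have [measurable]: "(\<lambda>z. indicator (D - D0) z * w z) \<in> borel_measurable borel"
    unfolding w_def R_def by (rule weight_measurable[OF cp D(1) D0(1) f(2) v s(1)])
  have \<psi>_meas: "\<psi> \<in> borel_measurable borel"
  proof -
    have "\<psi> = (\<lambda>z. if z \<in> D0 then indicator D z *\<^sub>R G z - \<epsilon>
       else if z \<in> D then max 0 (max (indicator (D - D0) z * w z - \<epsilon>) (indicator D z *\<^sub>R G z - \<epsilon>)) else 0)"
      using D0D by (auto simp: \<psi>_def fun_eq_iff)
    also have "\<dots> \<in> borel_measurable borel" by measurable
    finally show ?thesis .
  qed
  have CV: "C2_planar D0 \<psi> (\<lambda>z. B * Nx z) (\<lambda>z. B * Nxx z) (\<lambda>z. B * Ny z) (\<lambda>z. B * Nyy z)"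
    by (rule C2_planar_cong[OF D0(1) C2_planar_subset[OF C2_planar_affine[OF N(1), of B "- B * \<delta> - \<epsilon>"] D0D]])
       (simp add: \<psi>D0 G_def algebra_simps)
  have lapV: "B * Nxx z + B * Nyy z = - B * truncated_density r (z - z0)" if "z \<in> D0" for z
    using N(2)[of z] that D0D by (auto simp: distrib_left[symmetric])
  \<comment> \<open>A compact set containing every point where w can exceed G, disjoint from the
    closure of \<open>D0\<close>. Since w need not be continuous, its bound f(t0) R stands in for
    it.\<close>
  define Z where "Z = (K - D0) \<inter> (\<lambda>z. G z - f t0 * R z) -` {..0}"
  have cZ: "compact Z"
  proof -
    have c: "compact (K - D0)" by (rule compact_diff[OF K(1) D0(1)])
    have "continuous_on (K - D0) (\<lambda>z. G z - f t0 * R z)"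
      unfolding G_def using Ncont Rcont K(2) by (intro continuous_intros) (auto intro: continuous_on_subset)
    then have "closed Z" unfolding Z_def
      by (rule continuous_closed_preimage[OF _ compact_imp_closed[OF c] closed_atMost])
    moreover have "Z \<subseteq> K - D0" by (auto simp: Z_def)
    ultimately show ?thesis using c by (metis compact_Int_closed inf.absorb_iff2)
  qed
  have ZE: "Z \<subseteq> D - closure D0"
  proof
    fix z assume z: "z \<in> Z"
    then have zK: "z \<in> K" "z \<notin> D0" "G z \<le> f t0 * R z" by (auto simp: Z_def)
    have "z \<notin> closure D0"
    proof
      assume c: "z \<in> closure D0"
      then have "z \<in> frontier D0" using zK(2) D0(1) by (simp add: frontier_def interior_open)
      then show False using b(2) G_ge[OF c] zK(3) by fastforce
    qed
    then show "z \<in> D - closure D0" using zK K(2) by blast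
  qed
  have oE: "open (D - closure D0)" using oD by (intro open_Diff closed_closure)
  obtain \<sigma>1 where \<sigma>1: "0 < \<sigma>1" "(\<Union>x\<in>K. cball x \<sigma>1) \<subseteq> D"
    using compact_subset_open_imp_cball_epsilon_subset[OF K(1) oD K(2)] by metis
  obtain \<sigma>2 where \<sigma>2: "0 < \<sigma>2" "(\<Union>x\<in>Z. cball x \<sigma>2) \<subseteq> D - closure D0"
    using compact_subset_open_imp_cball_epsilon_subset[OF cZ oE ZE] by metis
  \<comment> \<open>Radius below \<open>\<sigma>1\<close> keeps circles about points of
    \<open>K\<close> in D, below \<open>\<sigma>2\<close> keeps those about points of
    \<open>Z\<close> off D0, and below r' - r keeps discs about points at distance r' from the pole
    off the capped disc.\<close>
  define \<sigma> where "\<sigma> = min (min \<sigma>1 \<sigma>2) (r' - r)"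
  have \<sigma>: "0 < \<sigma>" "\<sigma> \<le> \<sigma>1" "\<sigma> \<le> \<sigma>2" "\<sigma> \<le> r' - r" using \<sigma>1 \<sigma>2 r by (auto simp: \<sigma>_def)
  have mean: "submean_at \<psi> L y \<rho>" if y: "r' \<le> dist y z0" and \<rho>: "0 < \<rho>" "\<rho> < \<sigma>" for y \<rho>
  proof (cases "\<psi> y = 0")
    case True
    show ?thesis
      by (rule submean_atI[OF \<psi>_L, of "\<lambda>_. 0"]) (use True \<psi>_nn in \<open>auto simp: set_integrable_def set_lebesgue_integral_def\<close>)
  next
    case False
    then have yK: "y \<in> K" using \<psi>K by blast
    then have yD: "y \<in> D" using K by blast
    have bD: "ball y \<sigma> \<subseteq> D"
    proof -
      have "ball y \<sigma> \<subseteq> cball y \<sigma>1" using \<sigma>(2) by auto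
      then show ?thesis using \<sigma>1(2) yK by blast
    qed
    have cby: "cball y \<rho> \<subseteq> ball y \<sigma>" using \<rho> by auto
    have inD: "y + of_real \<rho> * cis \<theta> \<in> D" for \<theta>
      using circle_in_cball[OF \<rho>(1), of y \<theta>] cby bD by blast
    \<comment> \<open>Whichever function realises the maximum at \<open>y\<close> supplies the
      minorant on the circle. The circle may cross \<partial>D0 in the first case, where \<psi>
      \<ge> G - \<epsilon> holds on both sides; in the second it stays in
      \<open>D - D0\<close>.\<close>
    consider "\<psi> y = G y - \<epsilon>" | "y \<notin> D0" "\<psi> y = w y - \<epsilon>" "G y \<le> w y"
      using False yD by (auto simp: \<psi>_def max_def split: if_splits)
    then show ?thesis
    proof cases
      case 1
      have dis: "ball y \<sigma> \<inter> cball z0 r = {}"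
      proof (rule ccontr)
        assume "ball y \<sigma> \<inter> cball z0 r \<noteq> {}"
        then obtain x where "dist y x < \<sigma>" "dist z0 x \<le> r" by auto
        moreover have "dist y z0 \<le> dist y x + dist x z0" by (rule dist_triangle)
        ultimately show False using y \<sigma>(4) by (simp add: dist_commute)
      qed
      have cont: "continuous_on {0..2*pi} (\<lambda>\<theta>. G (y + of_real \<rho> * cis \<theta>) - \<epsilon>)"
        unfolding G_def
        by (intro continuous_intros continuous_on_compose2[OF Ncont]) (auto intro: inD)
      then have i: "set_integrable lborel {0..2*pi} (\<lambda>\<theta>. G (y + of_real \<rho> * cis \<theta>) - \<epsilon>)"
        unfolding set_integrable_def by (intro borel_integrable_compact) auto
      have "((\<lambda>\<theta>. B * N (y + of_real \<rho> * cis \<theta>) - (B * \<delta> + \<epsilon>)) has_integral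
          (B * (2 * pi * N y) - (2 * pi - 0) *\<^sub>R (B * \<delta> + \<epsilon>))) {0..2*pi}"
        by (intro has_integral_diff has_integral_mult_right N_mean[OF bD dis \<rho>])
           (use has_integral_const_real[of "B * \<delta> + \<epsilon>" 0 "2 * pi"] in simp)
      then have "integral {0..2*pi} (\<lambda>\<theta>. G (y + of_real \<rho> * cis \<theta>) - \<epsilon>) = 2 * pi * (G y - \<epsilon>)"
        by (intro integral_unique) (simp add: G_def algebra_simps)
      then have "(LINT \<theta>:{0..2*pi}|lborel. G (y + of_real \<rho> * cis \<theta>) - \<epsilon>) = 2 * pi * (G y - \<epsilon>)"
        using set_borel_integral_eq_integral(2)[OF i] by simp
      then show ?thesis
        by (intro submean_atI[OF \<psi>_L i]) (auto intro: \<psi>_ge_G inD simp: 1)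
    next
      case 2
      have yE: "y \<in> D - D0" using 2 yD by blast
      have "y \<in> Z" unfolding Z_def using yK 2 w_le[OF yE] by simp
      have sub: "cball y \<rho> \<subseteq> D - D0"
      proof -
        have "cball y \<rho> \<subseteq> cball y \<sigma>2" using \<rho> \<sigma>(3) by auto
        then show ?thesis using \<sigma>2(2) \<open>y \<in> Z\<close> closure_subset[of D0] by blast
      qed
      have sb: "s z \<le> t0 * Rm" if "z \<in> cball y \<rho>" for z
      proof -
        have "z \<in> D - D0" using sub that by blast
        then have "s z \<le> t0 * R z" "t0 * R z \<le> t0 * Rm" using s(2,3) Rm(2) by (auto intro: mult_left_mono)
        then show ?thesis by linarith
      qed
      obtain k where k: "set_integrable lborel {0..2*pi} k" "\<And>\<theta>. k \<theta> \<le> w (y + of_real \<rho> * cis \<theta>)"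
        "2 * pi * w y \<le> (LINT \<theta>:{0..2*pi}|lborel. k \<theta>)"
        unfolding w_def
      proof (rule perspective_submean[OF Rconc Rcont Rpos f(1,4,3) v(1) \<rho>(1), of y s "t0 * Rm"])
        show "cball y \<rho> \<subseteq> S" "cball y \<rho> \<subseteq> D" using sub v(2) by blast+
        show "z \<in> cball y \<rho> \<Longrightarrow> v z = ereal (s z)" "z \<in> cball y \<rho> \<Longrightarrow> 0 \<le> s z" for z
          using sub v(3) s(1) by blast+
      qed (use sb in blast)+
      have c: "set_integrable lborel {0..2*pi} (\<lambda>_. \<epsilon>)" by (simp add: set_integrable_def)
      show ?thesis
      proof (rule submean_atI[OF \<psi>_L set_integral_diff(1)[OF k(1) c]])
        show "k \<theta> - \<epsilon> \<le> \<psi> (y + of_real \<rho> * cis \<theta>)" for \<theta>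
        proof -
          have "y + of_real \<rho> * cis \<theta> \<in> D - D0" using sub circle_in_cball[OF \<rho>(1)] by blast
          from \<psi>_ge_w[OF this] k(2)[of \<theta>] show ?thesis by linarith
        qed
        have "(LINT \<theta>:{0..2*pi}|lborel. k \<theta> - \<epsilon>) = (LINT \<theta>:{0..2*pi}|lborel. k \<theta>) - 2 * pi * \<epsilon>"
          by (subst set_integral_diff(2)[OF k(1) c]) (simp add: set_lebesgue_integral_def)
        then show "2 * pi * \<psi> y \<le> (LINT \<theta>:{0..2*pi}|lborel. k \<theta> - \<epsilon>)"
          using k(3) unfolding 2 by (simp add: algebra_simps)
      qed
    qed
  qed
  let ?q = "\<lambda>z. Mxx z + Myy z"
  have main: "(\<integral>\<^sup>+z\<in>D - D0. ennreal (\<psi> z) \<partial>\<nu>)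
     \<le> ennreal (1 / (2 * pi) * ((\<integral>z. \<psi> z * ?q z \<partial>lborel) + B * truncated_mass r * (m + 1 - u0)))"
    "0 \<le> 1 / (2 * pi) * ((\<integral>z. \<psi> z * ?q z \<partial>lborel) + B * truncated_mass r * (m + 1 - u0))"
    by (rule riesz_potential_estimate[OF oD convex_connected[OF D(1)] u(1) \<nu> u(2) M(1,2) uM D0(1) D0D r m
         \<psi>_meas \<psi>_nn \<psi>_L K \<psi>K CV lapV less_imp_le[OF B] \<sigma>(1) mean]; assumption)+
  have hI: "integrable lborel (\<lambda>z. h z * ?q z)" by (rule C2_planar_green(2)[OF oD h(1) M(1)])
  have hD: "h z = 0" if "z \<notin> D" for z
    using test_functionE[OF h(1)] that by (metis subsetD)
  have int_le: "(\<integral>z. \<psi> z * ?q z \<partial>lborel) \<le> (\<integral>z. (indicator (D - D0) z * (R z * f (s z / R z)) * ?q z + B * c2 * (h z * ?q z)) \<partial>lborel)"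
  proof -
    have pt: "\<psi> z * ?q z \<le> indicator (D - D0) z * (R z * f (s z / R z)) * ?q z + B * c2 * (h z * ?q z)" for z
    proof (cases "z \<in> D")
      case False
      then have "\<psi> z = 0" using K \<psi>K by blast
      then show ?thesis using False hD by simp
    next
      case True
      have Bh: "0 \<le> B * c2 * h z" using B c2_nn h(2) by simp
      \<comment> \<open>G is at most B c2 on the closure of \<open>D0\<close> and on
        \<open>Kg\<close>, where h = 1, and is at most 0 elsewhere in D.\<close>
      have "\<psi> z \<le> indicator (D - D0) z * w z + B * c2 * h z"
      proof (cases "z \<in> D0")
        case z: True
        then have "z \<in> closure D0" using closure_subset by blast
        then have "G z \<le> B * c2" "h z = 1" using G_le h(3) by auto
        then show ?thesis using z \<epsilon> by (simp add: \<psi>D0)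
      next
        case z: False
        have wz: "0 \<le> w z" using w_nn True z by blast
        have "G z - \<epsilon> \<le> w z + B * c2 * h z"
        proof (cases "0 < G z")
          case pos: True
          then have "z \<in> Kg" using G_Kg True by blast
          then have "G z \<le> B * c2" "h z = 1" using G_le h(3) by auto
          then show ?thesis using wz \<epsilon> by simp
        qed (use wz Bh \<epsilon> in linarith)
        then show ?thesis using True z wz Bh \<epsilon> by (simp add: \<psi>_def)
      qed
      then have "\<psi> z * ?q z \<le> (indicator (D - D0) z * w z + B * c2 * h z) * ?q z"
        using M(2)[OF True] by (rule mult_right_mono)
      then show ?thesis by (simp add: w_def algebra_simps)
    qed
    show ?thesis
    proof (cases "integrable lborel (\<lambda>z. \<psi> z * ?q z)")
      case True
      then show ?thesis using Iw hI pt by (intro integral_mono) auto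
    next
      \<comment> \<open>Again a non-integrable left side counts as 0, and the right side is
        nonnegative.\<close>
      case False
      have "0 \<le> indicator (D - D0) z * (R z * f (s z / R z)) * ?q z + B * c2 * (h z * ?q z)" for z
      proof (cases "z \<in> D")
        case True
        then show ?thesis using M(2)[OF True] B c2_nn h(2)[of z] w_nn[of z]
          by (auto simp: w_def indicator_def)
      qed (use hD in simp)
      then show ?thesis using False by (simp add: not_integrable_integral_eq Bochner_Integration.integral_nonneg)
    qed
  qed
  have XX: "1 / (2 * pi) * ((\<integral>z. \<psi> z * ?q z \<partial>lborel) + B * truncated_mass r * (m + 1 - u0)) \<le> X"
    unfolding X_def using int_le Iw hI by (intro mult_left_mono) auto
  then show "0 \<le> X" using main(2) by linarith
  have "(\<integral>\<^sup>+z\<in>D - D0. ennreal (R z * f (s z / R z) - \<epsilon>) \<partial>\<nu>) \<le> (\<integral>\<^sup>+z\<in>D - D0. ennreal (\<psi> z) \<partial>\<nu>)"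
    using \<psi>_ge_w by (intro nn_integral_mono) (auto simp: w_def split: split_indicator intro: ennreal_leI)
  also note main(1)
  also have "ennreal (1 / (2 * pi) * ((\<integral>z. \<psi> z * ?q z \<partial>lborel) + B * truncated_mass r * (m + 1 - u0))) \<le> ennreal X"
    using XX by (rule ennreal_leI)
  finally show "(\<integral>\<^sup>+z\<in>D - D0. ennreal (R z * f (s z / R z) - \<epsilon>) \<partial>\<nu>) \<le> ennreal X" .
qed

text \<open>Fatou's lemma along a null sequence: \<open>ennreal\<close> takes the positive part, and
  the bound \<open>C\<close> is independent of \<epsilon>.\<close>

lemma nonneg_part_monotone_limit:
  fixes w :: "'a \<Rightarrow> real"
  assumes w: "(\<lambda>z. indicator A z * w z) \<in> borel_measurable M" and A: "A \<in> sets M"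
    and le: "\<And>\<epsilon>. 0 < \<epsilon> \<Longrightarrow> \<epsilon> < 1 \<Longrightarrow> (\<integral>\<^sup>+z\<in>A. ennreal (w z - \<epsilon>) \<partial>M) \<le> C"
  shows "(\<integral>\<^sup>+z\<in>A. ennreal (w z) \<partial>M) \<le> C"
proof -
  note [measurable] = w A
  \<comment> \<open>The shift by 2 keeps every term below 1, as the hypothesis demands.\<close>
  define e where "e n = 1 / real (n + 2)" for n
  have e: "0 < e n" "e n < 1" for n by (auto simp: e_def)
  have e0: "e \<longlonglongrightarrow> 0"
    unfolding e_def by (rule LIMSEQ_ignore_initial_segment[OF lim_1_over_n])
  define F where "F n z = ennreal (indicator A z * w z - e n) * indicator A z" for n z
  have F_eq: "F n z = ennreal (w z - e n) * indicator A z" for n z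
    by (auto simp: F_def split: split_indicator)
  have [measurable]: "F n \<in> borel_measurable M" for n unfolding F_def by measurable
  have lim: "(\<lambda>n. F n z) \<longlonglongrightarrow> ennreal (w z) * indicator A z" for z
  proof (cases "z \<in> A")
    case True
    have "(\<lambda>n. w z - e n) \<longlonglongrightarrow> w z - 0" by (intro tendsto_diff tendsto_const e0)
    then have "(\<lambda>n. ennreal (w z - e n)) \<longlonglongrightarrow> ennreal (w z - 0)" by (rule tendsto_ennrealI)
    then show ?thesis using True by (simp add: F_eq)
  qed (simp add: F_eq)
  then have "(\<integral>\<^sup>+z\<in>A. ennreal (w z) \<partial>M) = (\<integral>\<^sup>+z. liminf (\<lambda>n. F n z) \<partial>M)"
    using lim_imp_Liminf[OF sequentially_bot lim] by simp
  also have "\<dots> \<le> liminf (\<lambda>n. \<integral>\<^sup>+z. F n z \<partial>M)" by (rule nn_integral_liminf) simp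
  also have "\<dots> \<le> C"
    using le[OF e] by (intro Liminf_le) (auto simp: F_eq)
  finally show ?thesis .
qed

text \<open>All geometric choices (the pole function, the cutoff, the sample points near
  \<partial>D) are made before M, F, u, f, s and b appear, which secures the claimed dependence of
  the constants. The function \<open>A\<close> is defined for arbitrary M; its link with F is used
  only in the estimate.\<close>

theorem weighted_riesz_bound:
  fixes D D0 :: "complex set" and z0 :: complex
  defines "R \<equiv> hyperbolic_radius D"
  assumes D: "open D" "convex D" "bounded D"
    and D0: "open D0" "compact (closure D0)" "closure D0 \<subseteq> D" and z0: "z0 \<in> D0"
  obtains c :: real and A :: "(complex \<Rightarrow> real) \<Rightarrow> real" where "0 < c" "\<And>M. 0 \<le> A M"
    "\<And>F M u \<nu> u0 b f s. convex_on {..<0} F \<Longrightarrow> mono_on {..<0} F \<Longrightarrow> C2_on {..<0} F \<Longrightarrow>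
      (\<And>z. z \<in> D - D0 \<Longrightarrow> M z = F (- R z)) \<Longrightarrow>
      subharmonic_on D u \<Longrightarrow> u z0 = ereal u0 \<Longrightarrow> is_riesz_measure D u \<nu> \<Longrightarrow>
      (\<And>z. z \<in> D - D0 \<Longrightarrow> u z \<le> ereal (M z)) \<Longrightarrow> 0 \<le> b \<Longrightarrow>
      convex_on {0..} f \<Longrightarrow> mono_on {0..} f \<Longrightarrow> (\<And>t. 0 \<le> t \<Longrightarrow> 0 \<le> f t) \<Longrightarrow> f 0 = 0 \<Longrightarrow>
      sbh_nonneg (D - D0) s \<Longrightarrow> bdd_above ((\<lambda>z. s z / R z) ` (D - D0)) \<Longrightarrow>
      f (SUP z\<in>D - D0. s z / R z) * (SUP z\<in>frontier D0. R z) \<le> b \<Longrightarrow>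
      (\<lambda>z. indicator (D - D0) z * (R z * f (s z / R z))) \<in> borel_measurable borel \<and>
      (\<forall>z\<in>D - D0. 0 \<le> R z * f (s z / R z)) \<and>
      (\<forall>z\<in>D - D0. 0 \<le> R z * f (s z / R z) * (4 * deriv (deriv F) (- R z) +
           (deriv (deriv F) (- R z) * R z - deriv F (- R z)) * laplacian R z)) \<and>
      ((\<integral>\<^sup>+z\<in>D - D0. ennreal (R z * f (s z / R z) * (4 * deriv (deriv F) (- R z) +
           (deriv (deriv F) (- R z) * R z - deriv F (- R z)) * laplacian R z)) \<partial>lborel) < \<infinity> \<longrightarrow>
       (\<exists>X. 0 \<le> X \<and> X \<le> 1 / (2 * pi) * enn2real (\<integral>\<^sup>+z\<in>D - D0. ennreal (R z * f (s z / R z) * (4 * deriv (deriv F) (- R z) +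
           (deriv (deriv F) (- R z) * R z - deriv F (- R z)) * laplacian R z)) \<partial>lborel) + c * (b + 1) * (A M - u0) \<and>
        (\<integral>\<^sup>+z\<in>D - D0. ennreal (R z * f (s z / R z)) \<partial>\<nu>) \<le> ennreal X))"
proof -
  have D0D: "D0 \<subseteq> D" using D0(3) closure_subset by blast
  have z0D: "z0 \<in> D" using z0 D0D by blast
  have DU: "D \<noteq> UNIV" using D(3) not_bounded_UNIV by blast
  obtain g p where cp: "conformal_pair D g p"
    using conformal_pair_exists[OF D(1,2) DU] z0D by blast
  have Rpos: "0 < R z" if "z \<in> D" for z unfolding R_def by (rule hyperbolic_radius_pos[OF cp that])
  obtain Rx Rxx Ry Ryy where "C2_planar D R Rx Rxx Ry Ryy"
    using hyperbolic_radius_C2[OF cp D(2)] unfolding R_def by metis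
  then have Rcont: "continuous_on D R" by (simp add: C2_planar_def)
  obtain Rm where Rm: "0 < Rm" "\<And>z. z \<in> D \<Longrightarrow> R z \<le> Rm"
    using hyperbolic_radius_bounded[OF cp D(2,3)] unfolding R_def by metis
  obtain r r' \<delta> Kg N Nx Nxx Ny Nyy where r: "0 < r" "r < r'" "cball z0 r' \<subseteq> D0" and \<delta>: "0 < \<delta>" and Kg: "compact Kg" "Kg \<subseteq> D"
    and N: "C2_planar D N Nx Nxx Ny Nyy" "\<And>z. z \<in> D \<Longrightarrow> Nxx z + Nyy z = - truncated_density r (z - z0)"
    and N_ge: "\<And>z. z \<in> closure D0 \<Longrightarrow> 2 * \<delta> \<le> N z" and N_gt: "\<And>z. z \<in> D \<Longrightarrow> \<delta> < N z \<Longrightarrow> z \<in> Kg"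
    and N_mean: "\<And>y \<rho> \<sigma>. ball y \<sigma> \<subseteq> D \<Longrightarrow> ball y \<sigma> \<inter> cball z0 r = {} \<Longrightarrow> 0 < \<rho> \<Longrightarrow> \<rho> < \<sigma> \<Longrightarrow>
      ((\<lambda>\<theta>. N (y + of_real \<rho> * cis \<theta>)) has_integral (2 * pi * N y)) {0..2*pi}"
    by (rule log_pole_function[OF D(1,2) DU D0 z0]) (rule that; assumption)
  define K3 where "K3 = closure D0 \<union> Kg"
  have K3: "compact K3" "K3 \<subseteq> D" using D0 Kg by (auto simp: K3_def)
  have "continuous_on K3 (\<lambda>z. N z - \<delta>)"
    using N(1) K3(2) by (intro continuous_intros) (auto simp: C2_planar_def intro: continuous_on_subset)
  then have "bounded ((\<lambda>z. N z - \<delta>) ` K3)"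
    using K3(1) by (intro compact_imp_bounded compact_continuous_image)
  then obtain c2 where "\<forall>x \<in> (\<lambda>z. N z - \<delta>) ` K3. norm x \<le> c2" unfolding bounded_iff by blast
  then have c2: "\<bar>N z - \<delta>\<bar> \<le> c2" if "z \<in> closure D0 \<union> Kg" for z using that by (simp add: K3_def)
  have z0K3: "z0 \<in> K3" using z0 closure_subset by (auto simp: K3_def)
  have c2_nn: "0 \<le> c2" using c2[of z0] z0K3 by (auto simp: K3_def)
  obtain h where h: "test_function D h" "\<And>z. 0 \<le> h z" "\<And>z. z \<in> K3 \<Longrightarrow> h z = 1"
    using smooth_cutoff[OF K3(1) D(1) K3(2)] by metis
  obtain K4 where K4: "compact K4" "K4 \<subseteq> D" "smooth h" "\<And>z. z \<notin> K4 \<Longrightarrow> laplacian h z = 0"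
    using test_functionE[OF h(1), of thesis] by blast
  define c3 where "c3 = (\<integral>z. \<bar>laplacian h z\<bar> \<partial>lborel)"
  have lapI: "integrable lborel (laplacian h)"
    by (rule integrable_continuous_compact_support[OF K4(1)])
       (use K4 smooth_laplacian_continuous[OF K4(3)] in \<open>auto intro: continuous_on_subset\<close>)
  have c3: "0 \<le> c3" by (simp add: c3_def)
  \<comment> \<open>The set on which F(-R) must be bounded: it contains D0, for the pole term, and
    the support of \<Delta>h, for the cutoff term.\<close>
  define K5 where "K5 = K3 \<union> K4"
  have K5: "compact K5" "K5 \<subseteq> D" "K5 \<noteq> {}" using K3 K4 z0K3 by (auto simp: K5_def)
  obtain zm where zm: "zm \<in> K5" "\<And>z. z \<in> K5 \<Longrightarrow> R zm \<le> R z"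
    using continuous_attains_inf[OF K5(1,3) continuous_on_subset[OF Rcont K5(2)]] by blast
  have zmD: "0 < R zm" using zm K5 Rpos by blast
  have Dne: "D \<noteq> {}" using z0D by blast
  obtain z2 where z2: "z2 \<in> D" "R z2 < R zm"
    using hyperbolic_radius_small_values[OF cp D(2) Dne DU zmD] unfolding R_def by metis
  obtain z1 where z1: "z1 \<in> D" "R z1 < R z2"
    using hyperbolic_radius_small_values[OF cp D(2) Dne DU, of "R z2"] Rpos[OF z2(1)] unfolding R_def by metis
  have D0K5: "D0 \<subseteq> K5" using closure_subset[of D0] by (auto simp: K5_def K3_def)
  have out: "z1 \<in> D - D0" "z2 \<in> D - D0"
    using z1 z2 zm(2)[of z1] zm(2)[of z2] D0K5 by auto
  \<comment> \<open>As R(z1) < R(z2) < R on \<open>K5\<close>, monotonicity gives F(-R) \<le> M(z2)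
    there. A lower bound is the tangent at - R(z2), whose slope is at most the secant slope towards
    - R(z1). Absolute values make \<open>A\<close> nonnegative for every M.\<close>
  define A where "A M = \<bar>M z2\<bar> + \<bar>M z1 - M z2\<bar> / (R z2 - R z1) * Rm" for M :: "complex \<Rightarrow> real"
  have A_nn: "0 \<le> A M" for M using z1 Rm(1) by (simp add: A_def)
  define c1 where "c1 = truncated_mass r"
  have c1: "0 < c1" unfolding c1_def by (rule truncated_mass_pos[OF r(1)])
  define c where "c = c1 / (2 * pi * \<delta>)"
  \<comment> \<open>The quotient c2 c3 / c1 absorbs the cutoff term into the pole term, and the
    final 1 is the slack in u < M + 1. The factor \<open>c\<close> is chosen so that B c1 / (2 pi) =
    c (b + 1).\<close>
  define A' where "A' M = (c2 * c3 / c1 + 1) * A M + 1" for M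
  have c_pos: "0 < c" using c1 \<delta> by (simp add: c_def)
  have A'_nn: "0 \<le> A' M" for M
    unfolding A'_def using A_nn[of M] c2_nn c3 c1 by (intro add_nonneg_nonneg mult_nonneg_nonneg) auto
  show thesis
  proof (rule that[OF c_pos A'_nn])
    fix F M u \<nu> u0 b f s
    assume F: "convex_on {..<0} F" "mono_on {..<0} F" "C2_on {..<0} F"
      and MF: "\<And>z. z \<in> D - D0 \<Longrightarrow> M z = F (- R z)"
      and u: "subharmonic_on D u" "u z0 = ereal u0" "is_riesz_measure D u \<nu>" "\<And>z. z \<in> D - D0 \<Longrightarrow> u z \<le> ereal (M z)"
      and b: "0 \<le> b"
      and f: "convex_on {0..} f" "mono_on {0..} f" "\<And>t. 0 \<le> t \<Longrightarrow> 0 \<le> f t" "f 0 = 0"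
      and s: "sbh_nonneg (D - D0) s" and bdd: "bdd_above ((\<lambda>z. s z / R z) ` (D - D0))"
      and fb: "f (SUP z\<in>D - D0. s z / R z) * (SUP z\<in>frontier D0. R z) \<le> b"
    obtain Mx Mxx My Myy where C: "C2_planar D (\<lambda>z. F (- R z)) Mx Mxx My Myy"
      and q: "\<And>z. z \<in> D \<Longrightarrow> Mxx z + Myy z = 4 * deriv (deriv F) (- R z) +
         (deriv (deriv F) (- R z) * R z - deriv F (- R z)) * laplacian R z"
      and q_nn: "\<And>z. z \<in> D \<Longrightarrow> 0 \<le> Mxx z + Myy z"
      using C2_planar_radial_composition[OF cp D(2) F] unfolding R_def by metis
    obtain S v where v: "D - D0 \<subseteq> S" "subharmonic_on S v" "\<And>z. z \<in> D - D0 \<Longrightarrow> v z = ereal (s z)"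
      and s_nn: "\<And>z. z \<in> D - D0 \<Longrightarrow> 0 \<le> s z"
      using s unfolding sbh_nonneg_def by blast
    define w where "w z = R z * f (s z / R z)" for z
    have w_meas: "(\<lambda>z. indicator (D - D0) z * w z) \<in> borel_measurable borel"
      unfolding w_def R_def by (rule weight_measurable[OF cp D(2) D0(1) f(2) v(2,1,3) s_nn])
    have w_nn: "0 \<le> w z" if "z \<in> D - D0" for z
      unfolding w_def using Rpos[of z] s_nn[OF that] that by (intro mult_nonneg_nonneg f(3)) auto
    define Q where "Q z = 4 * deriv (deriv F) (- R z) + (deriv (deriv F) (- R z) * R z - deriv F (- R z)) * laplacian R z" for z
    have Qq: "Q z = Mxx z + Myy z" if "z \<in> D" for z using q[OF that] by (simp add: Q_def)
    define t0 where "t0 = (SUP z\<in>D - D0. s z / R z)"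
    have st0: "s z \<le> t0 * R z" if "z \<in> D - D0" for z
    proof -
      have "s z / R z \<le> t0" unfolding t0_def using that bdd by (rule cSUP_upper)
      then show ?thesis using Rpos[of z] that by (simp add: field_simps)
    qed
    have t0: "0 \<le> t0"
    proof -
      have "0 \<le> s z1" "0 < R z1" using s_nn out Rpos z1 by auto
      then show ?thesis using st0[OF out(1)] by (metis not_le mult_neg_pos order_trans)
    qed
    have fr: "frontier D0 \<subseteq> D" using D0(3) by (auto simp: frontier_def)
    have fb': "f t0 * R z \<le> b" if "z \<in> frontier D0" for z
    proof -
      have "bdd_above (R ` frontier D0)" using fr Rm(2) by (intro bdd_aboveI[of _ Rm]) auto
      then have "R z \<le> (SUP z\<in>frontier D0. R z)" using that by (intro cSUP_upper)
      then have "f t0 * R z \<le> f t0 * (SUP z\<in>frontier D0. R z)" using f(3)[OF t0] by (rule mult_left_mono)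
      then show ?thesis using fb unfolding t0_def by linarith
    qed
    have F_bound: "\<bar>F (- R z)\<bar> \<le> A M" "F (- R z) \<le> M z2" if z: "z \<in> K5" for z
    proof -
      have zR: "R z2 < R z" "R z \<le> Rm" "0 < R z2" "0 < R z1"
        using zm(2)[OF z] z2 K5(2) z Rm(2) Rpos z1 by auto
      show up: "F (- R z) \<le> M z2"
        using mono_onD[OF F(2), of "- R z" "- R z2"] zR MF[OF out(2)] by simp
      define a where "a = deriv F (- R z2)"
      have tan: "a * (x - - R z2) \<le> F x - F (- R z2)" if "x < 0" for x
        unfolding a_def
        by (rule convex_on_imp_above_tangent[OF F(1)])
           (use that zR C2_on_derivatives(1)[OF F(3), of "- R z2"] in \<open>auto simp: interior_open intro: has_field_derivative_at_within\<close>)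
      have a0: "0 \<le> a"
        unfolding a_def by (rule mono_on_imp_deriv_nonneg[OF F(2) C2_on_derivatives(1)[OF F(3)]]) (use zR in \<open>auto simp: interior_open\<close>)
      have a1: "a \<le> \<bar>M z1 - M z2\<bar> / (R z2 - R z1)"
      proof -
        have "a * (R z2 - R z1) \<le> M z1 - M z2" using tan[of "- R z1"] zR MF[OF out(1)] MF[OF out(2)] by simp
        then show ?thesis using z1(2) by (simp add: field_simps)
      qed
      have "M z2 - F (- R z) \<le> a * (R z - R z2)" using tan[of "- R z"] zR MF[OF out(2)] by (simp add: algebra_simps)
      also have "\<dots> \<le> a * Rm" using a0 zR by (intro mult_left_mono) auto
      also have "\<dots> \<le> \<bar>M z1 - M z2\<bar> / (R z2 - R z1) * Rm" using a1 Rm(1) by (intro mult_right_mono) auto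
      finally show "\<bar>F (- R z)\<bar> \<le> A M" using up unfolding A_def by linarith
    qed
    have m: "F (- R z) \<le> A M" if "z \<in> D0" for z
      using F_bound(1)[of z] that D0K5 by fastforce
    have hI: "integrable lborel (\<lambda>z. h z * (Mxx z + Myy z))"
      and hE: "(\<integral>z. F (- R z) * laplacian h z \<partial>lborel) = (\<integral>z. h z * (Mxx z + Myy z) \<partial>lborel)"
      and hI': "integrable lborel (\<lambda>z. F (- R z) * laplacian h z)"
      using C2_planar_green[OF D(1) h(1) C] by auto
    \<comment> \<open>Green's identity moves the Laplacian to \<open>h\<close>, so the bound
      involves only values of F(-R), not its derivatives.\<close>
    have h_le: "(\<integral>z. h z * (Mxx z + Myy z) \<partial>lborel) \<le> A M * c3"
    proof -
      have "(\<integral>z. F (- R z) * laplacian h z \<partial>lborel) \<le> (\<integral>z. A M * \<bar>laplacian h z\<bar> \<partial>lborel)"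
      proof (rule integral_mono[OF hI'])
        show "integrable lborel (\<lambda>z. A M * \<bar>laplacian h z\<bar>)" using lapI by auto
        fix z
        show "F (- R z) * laplacian h z \<le> A M * \<bar>laplacian h z\<bar>"
        proof (cases "z \<in> K4")
          case True
          then have "\<bar>F (- R z)\<bar> \<le> A M" using F_bound(1)[of z] by (simp add: K5_def)
          then have "\<bar>F (- R z)\<bar> * \<bar>laplacian h z\<bar> \<le> A M * \<bar>laplacian h z\<bar>" by (rule mult_right_mono) simp
          then show ?thesis by (metis abs_ge_self abs_mult order_trans)
        qed (simp add: K4)
      qed
      then show ?thesis unfolding hE c3_def by simp
    qed
    define B where "B = (b + 1) / \<delta>"
    have B: "0 < B" using b \<delta> by (simp add: B_def)
    have res: "\<exists>X. 0 \<le> X \<and> X \<le> 1 / (2 * pi) * enn2real (\<integral>\<^sup>+z\<in>D - D0. ennreal (w z * Q z) \<partial>lborel) + c * (b + 1) * (A' M - u0) \<and>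
        (\<integral>\<^sup>+z\<in>D - D0. ennreal (w z) \<partial>\<nu>) \<le> ennreal X"
      if fin: "(\<integral>\<^sup>+z\<in>D - D0. ennreal (w z * Q z) \<partial>lborel) < \<infinity>"
    proof -
      let ?f = "\<lambda>z. indicator (D - D0) z * (R z * f (s z / R z)) * (Mxx z + Myy z)"
      have qm: "(\<lambda>z. indicator D z *\<^sub>R (Mxx z + Myy z)) \<in> borel_measurable borel"
        by (rule borel_measurable_continuous_on_indicator)
           (use D(1) C in \<open>auto simp: C2_planar_def intro!: continuous_intros\<close>)
      have f_eq: "?f z = (indicator (D - D0) z * w z) * (indicator D z *\<^sub>R (Mxx z + Myy z))" for z
        by (auto simp: w_def split: split_indicator)
      have f_nn: "0 \<le> ?f z" for z
        using w_nn[of z] q_nn[of z] by (auto simp: w_def split: split_indicator)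
      have f_nn': "(\<integral>\<^sup>+z. ennreal (?f z) \<partial>lborel) = (\<integral>\<^sup>+z\<in>D - D0. ennreal (w z * Q z) \<partial>lborel)"
        by (intro nn_integral_cong) (auto simp: w_def Qq split: split_indicator)
      have Iw: "integrable lborel ?f"
      proof (rule integrableI_nonneg)
        show "?f \<in> borel_measurable lborel" unfolding f_eq using w_meas qm by simp
        show "(\<integral>\<^sup>+z. ennreal (?f z) \<partial>lborel) < \<infinity>" unfolding f_nn' by (rule fin)
      qed (use f_nn in simp)
      have I_eq: "(\<integral>z. ?f z \<partial>lborel) = enn2real (\<integral>\<^sup>+z\<in>D - D0. ennreal (w z * Q z) \<partial>lborel)"
        unfolding f_nn'[symmetric] using Iw f_nn by (subst nn_integral_eq_integral) (auto simp: Bochner_Integration.integral_nonneg)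
      define X where "X = 1 / (2 * pi) * ((\<integral>z. ?f z \<partial>lborel)
          + B * c2 * (\<integral>z. h z * (Mxx z + Myy z) \<partial>lborel) + B * c1 * (A M + 1 - u0))"
      have uM: "u z \<le> ereal (F (- R z))" if "z \<in> D - D0" for z using u(4)[OF that] MF[OF that] by simp
      have main: "(\<integral>\<^sup>+z\<in>D - D0. ennreal (w z - \<epsilon>) \<partial>\<nu>) \<le> ennreal X" "0 \<le> X" if \<epsilon>: "0 < \<epsilon>" "\<epsilon> < 1" for \<epsilon>
      proof -
        note facts = cp D(2,3) D0 r \<delta> Kg N N_ge N_gt N_mean c2 u(1-3) C[unfolded R_def] q_nn uM[unfolded R_def] m[unfolded R_def]
            h(1,2) h(3)[unfolded K3_def] f v(2,1,3) s_nn st0[unfolded R_def] t0 b fb'[unfolded R_def] \<epsilon> Iw[unfolded R_def]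
        note T = truncated_potential_estimate[where D = D and ?D0.0 = D0 and N = N and g = g and p = p and r = r and r' = r' and ?z0.0 = z0
            and \<delta> = \<delta> and Kg = Kg and Nx = Nx and Nxx = Nxx and Ny = Ny and Nyy = Nyy and ?c2.0 = c2 and u = u and ?u0.0 = u0 and \<nu> = \<nu>
            and M = "\<lambda>z. F (- hyperbolic_radius D z)" and Mx = Mx and Mxx = Mxx and My = My and Myy = Myy and m = "A M" and h = h
            and f = f and S = S and v = v and s = s and ?t0.0 = t0 and b = b and \<epsilon> = \<epsilon>]
        show "(\<integral>\<^sup>+z\<in>D - D0. ennreal (w z - \<epsilon>) \<partial>\<nu>) \<le> ennreal X"
          unfolding X_def B_def c1_def w_def R_def by (rule T(1)) (assumption | rule facts)+
        show "0 \<le> X"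
          unfolding X_def B_def c1_def w_def R_def by (rule T(2)) (assumption | rule facts)+
      qed
      have Xle: "X \<le> 1 / (2 * pi) * enn2real (\<integral>\<^sup>+z\<in>D - D0. ennreal (w z * Q z) \<partial>lborel) + c * (b + 1) * (A' M - u0)"
      proof -
        have "B * c2 * (\<integral>z. h z * (Mxx z + Myy z) \<partial>lborel) \<le> B * c2 * (A M * c3)"
          using h_le B c2_nn by (intro mult_left_mono) auto
        then have "X \<le> 1 / (2 * pi) * ((\<integral>z. ?f z \<partial>lborel) + B * c2 * (A M * c3) + B * c1 * (A M + 1 - u0))"
          unfolding X_def by (intro mult_left_mono) auto
        also have "B * c2 * (A M * c3) + B * c1 * (A M + 1 - u0) = B * c1 * (A' M - u0)"
          using c1 by (simp add: A'_def field_simps)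
        then have "1 / (2 * pi) * ((\<integral>z. ?f z \<partial>lborel) + B * c2 * (A M * c3) + B * c1 * (A M + 1 - u0))
            = 1 / (2 * pi) * (\<integral>z. ?f z \<partial>lborel) + 1 / (2 * pi) * (B * c1 * (A' M - u0))"
          by (simp only: add.assoc distrib_left)
        also have "1 / (2 * pi) * (B * c1 * (A' M - u0)) = c * (b + 1) * (A' M - u0)"
          by (simp add: B_def c_def)
        finally show ?thesis unfolding I_eq .
      qed
      have sets: "D - D0 \<in> sets \<nu>"
        using u(3) D(1) D0(1) by (auto simp: is_riesz_measure_def sets_restrict_space intro!: image_eqI[of _ _ "D - D0"])
      have "(\<integral>\<^sup>+z\<in>D - D0. ennreal (w z) \<partial>\<nu>) \<le> ennreal X"
        by (rule nonneg_part_monotone_limit[OF riesz_measure_measurable[OF u(3) w_meas] sets main(1)])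
      then show ?thesis using main(2)[of "1/2"] Xle by auto
    qed
    show "(\<lambda>z. indicator (D - D0) z * (R z * f (s z / R z))) \<in> borel_measurable borel \<and>
      (\<forall>z\<in>D - D0. 0 \<le> R z * f (s z / R z)) \<and>
      (\<forall>z\<in>D - D0. 0 \<le> R z * f (s z / R z) * (4 * deriv (deriv F) (- R z) +
           (deriv (deriv F) (- R z) * R z - deriv F (- R z)) * laplacian R z)) \<and>
      ((\<integral>\<^sup>+z\<in>D - D0. ennreal (R z * f (s z / R z) * (4 * deriv (deriv F) (- R z) +
           (deriv (deriv F) (- R z) * R z - deriv F (- R z)) * laplacian R z)) \<partial>lborel) < \<infinity> \<longrightarrow>
       (\<exists>X. 0 \<le> X \<and> X \<le> 1 / (2 * pi) * enn2real (\<integral>\<^sup>+z\<in>D - D0. ennreal (R z * f (s z / R z) * (4 * deriv (deriv F) (- R z) +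
           (deriv (deriv F) (- R z) * R z - deriv F (- R z)) * laplacian R z)) \<partial>lborel) + c * (b + 1) * (A' M - u0) \<and>
        (\<integral>\<^sup>+z\<in>D - D0. ennreal (R z * f (s z / R z)) \<partial>\<nu>) \<le> ennreal X))"
      unfolding w_def[symmetric] Q_def[symmetric]
      using w_meas w_nn res q_nn Qq by auto
  qed
qed

section \<open>The Riesz measure of the logarithm of a holomorphic function\<close>

text \<open>Layer cake: max 0 (r^2 - |w|^2) is the length of {t. |w|^2 \<le> t \<le> r^2}. After
  exchanging integrals the disc |w|^2 \<le> t contributes its area pi t.\<close>

lemma truncated_mass_eq:
  assumes r: "0 < r" shows "truncated_mass r = 2 * pi"
proof -
  define I where "I w t = (indicator {(cmod w)\<^sup>2..r\<^sup>2} t :: ennreal)" for w t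
  have I: "(\<lambda>(w, t). I w t) \<in> borel_measurable (lborel \<Otimes>\<^sub>M lborel)"
  proof -
    have "closed {p :: complex \<times> real. (cmod (fst p))\<^sup>2 \<le> snd p \<and> snd p \<le> r\<^sup>2}"
      by (intro closed_Collect_conj closed_Collect_le continuous_intros)
    then have "{p :: complex \<times> real. (cmod (fst p))\<^sup>2 \<le> snd p \<and> snd p \<le> r\<^sup>2} \<in> sets (lborel \<Otimes>\<^sub>M lborel)"
      unfolding lborel_prod by (simp add: borel_closed)
    moreover have "(\<lambda>(w, t). I w t) = indicator {p. (cmod (fst p))\<^sup>2 \<le> snd p \<and> snd p \<le> r\<^sup>2}"
      by (auto simp: I_def fun_eq_iff split: split_indicator)
    ultimately show ?thesis by simp
  qed
  have layer: "(\<integral>\<^sup>+t. I w t \<partial>lborel) = ennreal (max 0 (r\<^sup>2 - (cmod w)\<^sup>2))" for w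
    unfolding I_def by (subst nn_integral_indicator) (auto simp: max_def)
  have disc: "(\<integral>\<^sup>+w. I w t \<partial>lborel) = ennreal (pi * t) * indicator {0..r\<^sup>2} t" for t
  proof (cases "0 \<le> t \<and> t \<le> r\<^sup>2")
    case True
    have "(cmod w)\<^sup>2 \<le> t \<longleftrightarrow> cmod w \<le> sqrt t" for w
      using True by (metis abs_norm_cancel real_sqrt_abs real_sqrt_le_iff)
    then have "I w t = indicator (cball 0 (sqrt t)) w" for w
      using True by (auto simp: I_def split: split_indicator)
    then have "(\<integral>\<^sup>+w. I w t \<partial>lborel) = emeasure lborel (cball (0::complex) (sqrt t))"
      by simp
    also have "\<dots> = ennreal (pi * t)"
      using True by (subst emeasure_cball) (auto simp: unit_ball_vol_2)
    finally show ?thesis using True by simp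
  next
    case False
    have "I w t = 0" for w
      using False by (auto simp: I_def split: split_indicator) (metis order_trans zero_le_power2)
    then show ?thesis using False by auto
  qed
  have "ennreal (truncated_mass r) = (\<integral>\<^sup>+w. ennreal (truncated_density r w) \<partial>lborel)"
    unfolding truncated_mass_def
    using truncated_density_integrable[OF r] truncated_density_nonneg by (intro nn_integral_eq_integral[symmetric]) auto
  also have "\<dots> = (\<integral>\<^sup>+w. ennreal (4 / r ^ 4) * (\<integral>\<^sup>+t. I w t \<partial>lborel) \<partial>lborel)"
    unfolding layer truncated_density_def by (intro nn_integral_cong) (simp add: ennreal_mult[symmetric])
  also have "\<dots> = ennreal (4 / r ^ 4) * (\<integral>\<^sup>+w. \<integral>\<^sup>+t. I w t \<partial>lborel \<partial>lborel)"
    using lborel.borel_measurable_nn_integral_fst[OF I] by (intro nn_integral_cmult) simp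
  also have "(\<integral>\<^sup>+w. \<integral>\<^sup>+t. I w t \<partial>lborel \<partial>lborel) = (\<integral>\<^sup>+t. \<integral>\<^sup>+w. I w t \<partial>lborel \<partial>lborel)"
    using lborel_pair.Fubini'[OF I] by simp
  also have "\<dots> = (\<integral>\<^sup>+t\<in>{0..r\<^sup>2}. ennreal (pi * t) \<partial>lborel)" unfolding disc ..
  also have "\<dots> = ennreal (integral {0..r\<^sup>2} (\<lambda>t. pi * t))"
    by (rule nn_integral_Icc_continuous) (auto intro!: continuous_intros)
  also have "integral {0..r\<^sup>2} (\<lambda>t. pi * t) = pi * r ^ 4 / 2"
  proof -
    have "((\<lambda>t. pi * t) has_integral (pi * (r\<^sup>2)\<^sup>2 / 2 - pi * 0\<^sup>2 / 2)) {0..r\<^sup>2}"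
      by (rule fundamental_theorem_of_calculus)
         (auto intro!: derivative_eq_intros simp: has_real_derivative_iff_has_vector_derivative[symmetric])
    then show ?thesis by (intro integral_unique) simp
  qed
  also have "ennreal (4 / r ^ 4) * ennreal (pi * r ^ 4 / 2) = ennreal (2 * pi)"
    using r by (subst ennreal_mult[symmetric]) auto
  finally show ?thesis
    using truncated_mass_pos[OF r] by (subst (asm) ennreal_inj) auto
qed

text \<open>With y = (r^2 - t) / r^2 in [0, 1] the polynomial is - ln r + y / 2 + y^2 / 4. This
  feeds the dominated convergence below.\<close>

lemma log_cap_abs_le:
  assumes r: "0 < r" and t: "0 \<le> t" "t \<le> r\<^sup>2"
  shows "\<bar>log_cap r t\<bar> \<le> \<bar>ln r\<bar> + 1"
proof (cases "t < r\<^sup>2")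
  case True
  define q where "q = r\<^sup>2"
  have q: "0 < q" "t < q" using r True by (auto simp: q_def)
  have 1: "- ln q / 2 = - ln r" using r by (simp add: q_def ln_realpow)
  define y where "y = (q - t) / q"
  have y: "0 \<le> y" "y \<le> 1" using q t by (auto simp: y_def)
  have "log_cap r t = - ln q / 2 - (t - q) / (2 * q) + (t - q)\<^sup>2 / (4 * q\<^sup>2)"
    using True by (simp only: log_cap_def q_def if_True)
  moreover have "(t - q) / (2 * q) = - (y / 2)" using q by (simp add: y_def field_simps)
  moreover have "(t - q)\<^sup>2 / (4 * q\<^sup>2) = y\<^sup>2 / 4" by (simp add: y_def power_divide power2_commute)
  ultimately have eq: "log_cap r t = - ln r + y / 2 + y\<^sup>2 / 4" using 1 by linarith
  have "y\<^sup>2 \<le> 1" "0 \<le> y\<^sup>2" using y by (auto simp: power_le_one)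
  then show ?thesis unfolding eq using y by linarith
next
  case False
  then have "t = r\<^sup>2" using t by simp
  then have "log_cap r t = - ln r" using r by (simp add: log_cap_def ln_realpow)
  then show ?thesis by simp
qed

text \<open>Capping the logarithm at radius e_k gives functions V_k whose Laplacian is n times a
  density of mass 2 pi concentrated where \<phi> = 1. Green's identity yields 2 pi n for every k,
  and dominated convergence passes to \<open>u\<close>.\<close>

lemma riesz_measure_log_test_function:
  fixes \<Lambda> :: "complex \<Rightarrow> complex" and n :: nat
  assumes \<nu>: "is_riesz_measure D u \<nu>" and r: "ball a r \<subseteq> D"
    and \<Lambda>: "\<Lambda> holomorphic_on ball a r"
    and u: "\<And>z. z \<in> ball a r \<Longrightarrow> z \<noteq> a \<Longrightarrow> u z = ereal (Re (\<Lambda> z) + real n * ln (cmod (z - a)))"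
    and int: "\<And>K. compact K \<Longrightarrow> K \<subseteq> ball a r \<Longrightarrow> integrable lborel (\<lambda>z. indicator K z * real_of_ereal (u z))"
    and \<phi>: "test_function (ball a r) \<phi>" "\<And>z. 0 \<le> \<phi> z"
    and \<rho>: "0 < \<rho>" "\<And>z. z \<in> cball a \<rho> \<Longrightarrow> \<phi> z = 1"
  shows "(\<integral>\<^sup>+z. ennreal (\<phi> z) \<partial>\<nu>) = ennreal (real n)"
proof -
  define v where "v z = real_of_ereal (u z)" for z
  have v: "v z = Re (\<Lambda> z) + real n * ln (cmod (z - a))" if "z \<in> ball a r" "z \<noteq> a" for z
    using u[OF that] by (simp add: v_def)
  obtain K where K: "compact K" "K \<subseteq> ball a r" "smooth \<phi>" "\<And>z. z \<notin> K \<Longrightarrow> laplacian \<phi> z = 0"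
    using test_functionE[OF \<phi>(1), of thesis] by blast
  have lapc: "continuous_on UNIV (laplacian \<phi>)" by (rule smooth_laplacian_continuous[OF K(3)])
  then have lapm: "laplacian \<phi> \<in> borel_measurable borel" by (rule borel_measurable_continuous_onI)
  have lapI: "integrable lborel (laplacian \<phi>)"
    by (rule integrable_continuous_compact_support[OF K(1)])
       (use K(4) continuous_on_subset[OF lapc subset_UNIV] in auto)
  have "bounded (laplacian \<phi> ` K)"
    using K(1) lapc by (intro compact_imp_bounded compact_continuous_image) (auto intro: continuous_on_subset)
  then obtain L where L: "\<And>z. z \<in> K \<Longrightarrow> \<bar>laplacian \<phi> z\<bar> \<le> L" unfolding bounded_iff by force
  have "continuous_on K (\<lambda>z. Re (\<Lambda> z))"
    using holomorphic_on_imp_continuous_on[OF \<Lambda>] K(2) by (intro continuous_intros) (auto intro: continuous_on_subset)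
  then have "bounded ((\<lambda>z. Re (\<Lambda> z)) ` K)"
    using K(1) by (intro compact_imp_bounded compact_continuous_image)
  then obtain C where C: "\<And>z. z \<in> K \<Longrightarrow> \<bar>Re (\<Lambda> z)\<bar> \<le> C" unfolding bounded_iff by force
  \<comment> \<open>The bound by \<open>\<rho>\<close> keeps the capped disc where \<phi> = 1; the
    bound by 1/2 makes ln (e k) negative for \<open>V_le\<close>.\<close>
  define m where "m = min \<rho> (1/2)"
  define e where "e k = m / real (Suc k)" for k
  have m: "0 < m" "m \<le> \<rho>" "m < 1" using \<rho> by (auto simp: m_def)
  have e: "0 < e k" "e k \<le> \<rho>" "e k < 1" for k
  proof -
    have "e k \<le> m" using m(1) by (simp add: e_def field_simps)
    then show "e k \<le> \<rho>" "e k < 1" using m by auto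
    show "0 < e k" using m by (simp add: e_def)
  qed
  have e0: "e \<longlonglongrightarrow> 0"
  proof -
    have "(\<lambda>k. m * (1 / real (Suc k))) \<longlonglongrightarrow> m * 0"
      by (intro tendsto_mult tendsto_const) (use LIMSEQ_Suc[OF lim_1_over_n] in simp)
    then show ?thesis by (simp add: e_def[abs_def])
  qed
  define V where "V k z = Re (\<Lambda> z) - (real n * log_cap (e k) ((cmod (z - a))\<^sup>2) + 0)" for k z
  define T where "T z = (Re z - Re a)\<^sup>2 + (Im z - Im a)\<^sup>2" for z
  have T: "T z = (cmod (z - a))\<^sup>2" for z by (simp add: T_def cmod_power2)
  have green: "integrable lborel (\<lambda>z. V k z * laplacian \<phi> z)" "(\<integral>z. V k z * laplacian \<phi> z \<partial>lborel) = 2 * pi * real n" for k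
  proof -
    note C2 = C2_planar_diff[OF C2_planar_Re[OF open_ball \<Lambda>]
        C2_planar_subset[OF C2_planar_affine[OF C2_planar_log_cap[OF e(1)[of k], of a], of "real n" 0] subset_UNIV, of "ball a r"],
        folded T_def V_def]
    note g = C2_planar_green[OF open_ball \<phi>(1) C2]
    show "integrable lborel (\<lambda>z. V k z * laplacian \<phi> z)" by (rule g(1))
    have "\<phi> z * (Re (deriv (deriv \<Lambda>) z) - real n * (log_cap'' (e k) (T z) * (2 * (Re z - Re a))\<^sup>2 + 2 * log_cap' (e k) (T z)) +
        (- Re (deriv (deriv \<Lambda>) z) - real n * (log_cap'' (e k) (T z) * (2 * (Im z - Im a))\<^sup>2 + 2 * log_cap' (e k) (T z))))
        = real n * truncated_density (e k) (- a + z)" (is "\<phi> z * ?l = _") for z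
    proof -
      have "?l = - real n * (4 * log_cap' (e k) (T z) + 4 * T z * log_cap'' (e k) (T z))"
        by (simp add: T_def power2_eq_square algebra_simps)
      also have "\<dots> = real n * truncated_density (e k) (- a + z)"
        by (subst log_cap_laplacian[OF e(1)]) (auto simp: T truncated_density_def)
      finally have l: "?l = real n * truncated_density (e k) (- a + z)" .
      show ?thesis
      proof (cases "cmod (z - a) < e k")
        case True
        then have "\<phi> z = 1" using e(2)[of k] by (intro \<rho>(2)) (auto simp: dist_norm norm_minus_commute)
        then show ?thesis unfolding l by simp
      next
        case False
        then have "truncated_density (e k) (- a + z) = 0" by (intro truncated_density_eq_0[OF e(1)]) simp
        then show ?thesis unfolding l by simp
      qed
    qed
    then have "(\<integral>z. V k z * laplacian \<phi> z \<partial>lborel) = (\<integral>z. real n * truncated_density (e k) (- a + z) \<partial>lborel)"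
      unfolding g(3) by (intro Bochner_Integration.integral_cong) auto
    also have "\<dots> = real n * (\<integral>z. truncated_density (e k) (- a + z) \<partial>lborel)" by simp
    also have "(\<integral>z. truncated_density (e k) (- a + z) \<partial>lborel) = (\<integral>z. truncated_density (e k) z \<partial>(distr lborel borel ((+) (- a))))"
      using borel_measurable_continuous_onI[OF truncated_density_continuous[OF e(1)[of k]]] by (subst integral_distr) auto
    also have "\<dots> = 2 * pi"
      unfolding lborel_distr_plus using truncated_mass_eq[OF e(1)[of k]] by (simp add: truncated_mass_def)
    finally show "(\<integral>z. V k z * laplacian \<phi> z \<partial>lborel) = 2 * pi * real n" by simp
  qed
  have V_out: "V k z = v z" if "z \<in> ball a r" "z \<noteq> a" "e k \<le> cmod (z - a)" for k z
  proof -
    have "\<not> (cmod (z - a))\<^sup>2 < (e k)\<^sup>2" using that(3) e(1)[of k] by (simp add: not_less power_mono)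
    then have "log_cap (e k) ((cmod (z - a))\<^sup>2) = - ln (cmod (z - a))"
      using that(2) by (simp add: log_cap_def ln_realpow)
    then show ?thesis using v[OF that(1,2)] by (simp add: V_def)
  qed
  \<comment> \<open>Inside the capped disc |ln (e k)| \<le> - ln |z - a|, and that logarithm is
    expressed through v itself, which is locally integrable.\<close>
  have V_le: "\<bar>V k z\<bar> \<le> \<bar>v z\<bar> + (2 * C + real n)" if z: "z \<in> K" "z \<noteq> a" for k z
  proof (cases "e k \<le> cmod (z - a)")
    case True
    then show ?thesis using V_out[of z k] z K(2) C[OF z(1)] by auto
  next
    case False
    have c: "0 < cmod (z - a)" using z by simp
    have "\<bar>log_cap (e k) ((cmod (z - a))\<^sup>2)\<bar> \<le> \<bar>ln (e k)\<bar> + 1"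
      using False by (intro log_cap_abs_le e) (auto intro: power_mono)
    also have "\<bar>ln (e k)\<bar> = - ln (e k)" using e(1,3)[of k] by simp
    also have "- ln (e k) \<le> - ln (cmod (z - a))" using False c e(1)[of k] by simp
    finally have "real n * \<bar>log_cap (e k) ((cmod (z - a))\<^sup>2)\<bar> \<le> real n * (- ln (cmod (z - a)) + 1)"
      by (intro mult_left_mono) auto
    also have "\<dots> = Re (\<Lambda> z) - v z + real n" using v[of z] z K(2) by (auto simp: algebra_simps)
    finally have "\<bar>real n * log_cap (e k) ((cmod (z - a))\<^sup>2)\<bar> \<le> Re (\<Lambda> z) - v z + real n" by (simp add: abs_mult)
    then show ?thesis unfolding V_def using C[OF z(1)] by linarith
  qed
  have vI: "integrable lborel (\<lambda>z. indicator K z * v z)" unfolding v_def by (rule int[OF K(1,2)])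
  have AE: "AE z in lborel. z \<noteq> a" by (rule AE_lborel_singleton)
  have "(\<lambda>k. \<integral>z. V k z * laplacian \<phi> z \<partial>lborel) \<longlonglongrightarrow> (\<integral>z. (indicator K z * v z) * laplacian \<phi> z \<partial>lborel)"
  proof (rule integral_dominated_convergence[where w = "\<lambda>z. L * \<bar>indicator K z * v z\<bar> + (2 * C + real n) * \<bar>laplacian \<phi> z\<bar>"])
    show "(\<lambda>z. indicator K z * v z * laplacian \<phi> z) \<in> borel_measurable lborel"
      using borel_measurable_integrable[OF vI] lapm by simp
    show "(\<lambda>z. V k z * laplacian \<phi> z) \<in> borel_measurable lborel" for k using green(1) by (rule borel_measurable_integrable)
    show "integrable lborel (\<lambda>z. L * \<bar>indicator K z * v z\<bar> + (2 * C + real n) * \<bar>laplacian \<phi> z\<bar>)"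
      using vI lapI by (intro Bochner_Integration.integrable_add integrable_mult_right integrable_abs)
    show "AE z in lborel. (\<lambda>k. V k z * laplacian \<phi> z) \<longlonglongrightarrow> indicator K z * v z * laplacian \<phi> z"
      using AE
    proof eventually_elim
      fix z assume za: "z \<noteq> a"
      show "(\<lambda>k. V k z * laplacian \<phi> z) \<longlonglongrightarrow> indicator K z * v z * laplacian \<phi> z"
      proof (cases "z \<in> K")
        case True
        have "0 < cmod (z - a)" using za by simp
        from order_tendstoD(2)[OF e0 this] have "\<forall>\<^sub>F k in sequentially. V k z * laplacian \<phi> z = indicator K z * v z * laplacian \<phi> z"
          by eventually_elim (use True K(2) za V_out in auto)
        then show ?thesis by (rule tendsto_eventually)
      qed (simp add: K(4))
    qed
    show "AE z in lborel. norm (V k z * laplacian \<phi> z) \<le> L * \<bar>indicator K z * v z\<bar> + (2 * C + real n) * \<bar>laplacian \<phi> z\<bar>" for k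
      using AE
    proof eventually_elim
      fix z assume za: "z \<noteq> a"
      show "norm (V k z * laplacian \<phi> z) \<le> L * \<bar>indicator K z * v z\<bar> + (2 * C + real n) * \<bar>laplacian \<phi> z\<bar>"
      proof (cases "z \<in> K")
        case True
        have "norm (V k z * laplacian \<phi> z) \<le> (\<bar>v z\<bar> + (2 * C + real n)) * \<bar>laplacian \<phi> z\<bar>"
          unfolding real_norm_def abs_mult by (rule mult_right_mono[OF V_le[OF True za]]) simp
        also have "\<dots> = \<bar>laplacian \<phi> z\<bar> * \<bar>v z\<bar> + (2 * C + real n) * \<bar>laplacian \<phi> z\<bar>" by (simp add: algebra_simps)
        also have "\<dots> \<le> L * \<bar>v z\<bar> + (2 * C + real n) * \<bar>laplacian \<phi> z\<bar>"
          using L[OF True] by (intro add_right_mono mult_right_mono) auto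
        finally show ?thesis using True by simp
      qed (simp add: K(4))
    qed
  qed
  then have "(\<integral>z. (indicator K z * v z) * laplacian \<phi> z \<partial>lborel) = 2 * pi * real n"
    unfolding green(2) by (rule LIMSEQ_unique[OF _ tendsto_const])
  also have "(\<integral>z. (indicator K z * v z) * laplacian \<phi> z \<partial>lborel) = (\<integral>z. real_of_ereal (u z) * laplacian \<phi> z \<partial>lborel)"
    by (intro Bochner_Integration.integral_cong) (auto simp: v_def K(4) split: split_indicator)
  finally have val: "(\<integral>z. real_of_ereal (u z) * laplacian \<phi> z \<partial>lborel) = 2 * pi * real n" .
  have \<phi>D: "test_function D \<phi>" using \<phi>(1) r unfolding test_function_def by blast
  show ?thesis unfolding riesz_measure_test_function(1)[OF \<nu> \<phi>D \<phi>(2)] val by simp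
qed

text \<open>Cutoffs from both sides show that every disc about \<open>a\<close> of radius below r
  has mass n. Continuity from above puts this mass on the centre, leaving none for the punctured
  disc.\<close>

lemma riesz_measure_log_atom:
  fixes \<Lambda> :: "complex \<Rightarrow> complex" and n :: nat
  assumes \<nu>: "is_riesz_measure D u \<nu>" and r: "0 < r" "ball a r \<subseteq> D"
    and \<Lambda>: "\<Lambda> holomorphic_on ball a r"
    and u: "\<And>z. z \<in> ball a r \<Longrightarrow> z \<noteq> a \<Longrightarrow> u z = ereal (Re (\<Lambda> z) + real n * ln (cmod (z - a)))"
    and int: "\<And>K. compact K \<Longrightarrow> K \<subseteq> ball a r \<Longrightarrow> integrable lborel (\<lambda>z. indicator K z * real_of_ereal (u z))"
  shows "emeasure \<nu> {a} = ennreal (real n)" and "emeasure \<nu> (ball a (r/2) - {a}) = 0"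
proof -
  have sets: "B \<in> sets \<nu>" if "B \<in> sets borel" "B \<subseteq> D" for B
    using \<nu> that by (auto simp: is_riesz_measure_def sets_restrict_space intro!: image_eqI[of _ _ B])
  have sets': "ball a \<rho> \<in> sets \<nu>" "cball a \<rho> \<in> sets \<nu>" if "\<rho> < r" for \<rho>
  proof -
    have "cball a \<rho> \<subseteq> D" "ball a \<rho> \<subseteq> D" using that r by (auto simp: subset_eq)
    then show "ball a \<rho> \<in> sets \<nu>" "cball a \<rho> \<in> sets \<nu>" by (auto intro!: sets)
  qed
  have aD: "a \<in> D" using r by auto
  have ball: "emeasure \<nu> (ball a \<rho>) = ennreal (real n)" if \<rho>: "0 < \<rho>" "\<rho> < r" for \<rho>
  proof (rule antisym)
    have "cball a \<rho> \<subseteq> ball a r" using \<rho> by auto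
    then obtain h where h: "test_function (ball a r) h" "\<And>z. 0 \<le> h z" "\<And>z. h z \<le> 1" "\<And>z. z \<in> cball a \<rho> \<Longrightarrow> h z = 1"
      using smooth_cutoff[OF compact_cball open_ball, of a \<rho> a r thesis] by blast
    have "emeasure \<nu> (ball a \<rho>) = (\<integral>\<^sup>+z. indicator (ball a \<rho>) z \<partial>\<nu>)" using sets'(1)[OF \<rho>(2)] by simp
    also have "\<dots> \<le> (\<integral>\<^sup>+z. ennreal (h z) \<partial>\<nu>)"
      by (intro nn_integral_mono) (auto simp: h(4) split: split_indicator)
    also have "\<dots> = ennreal (real n)"
      by (rule riesz_measure_log_test_function[OF \<nu> r(2) \<Lambda> u int h(1,2) \<rho>(1) h(4)])
    finally show "emeasure \<nu> (ball a \<rho>) \<le> ennreal (real n)" .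
    have "cball a (\<rho>/2) \<subseteq> ball a \<rho>" using \<rho> by auto
    then obtain h where h: "test_function (ball a \<rho>) h" "\<And>z. 0 \<le> h z" "\<And>z. h z \<le> 1" "\<And>z. z \<in> cball a (\<rho>/2) \<Longrightarrow> h z = 1"
      using smooth_cutoff[OF compact_cball open_ball, of a "\<rho>/2" a \<rho> thesis] by blast
    obtain K where K: "K \<subseteq> ball a \<rho>" "\<And>z. z \<notin> K \<Longrightarrow> h z = 0"
      using test_functionE[OF h(1), of thesis] by blast
    have h': "test_function (ball a r) h"
      using h(1) \<rho> subset_ball[of \<rho> r a] unfolding test_function_def by auto
    have \<rho>2: "0 < \<rho> / 2" using \<rho> by simp
    have "(\<integral>\<^sup>+z. ennreal (h z) \<partial>\<nu>) = ennreal (real n)"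
      by (rule riesz_measure_log_test_function[OF \<nu> r(2) \<Lambda> u int h' h(2) \<rho>2 h(4)])
    then have "ennreal (real n) = (\<integral>\<^sup>+z. ennreal (h z) \<partial>\<nu>)" by (rule sym)
    also have "\<dots> \<le> (\<integral>\<^sup>+z. indicator (ball a \<rho>) z \<partial>\<nu>)"
    proof (intro nn_integral_mono)
      fix z show "ennreal (h z) \<le> indicator (ball a \<rho>) z"
        using h(3)[of z] K by (cases "z \<in> ball a \<rho>") (auto simp: subset_eq)
    qed
    also have "\<dots> = emeasure \<nu> (ball a \<rho>)" using sets'(1)[OF \<rho>(2)] by simp
    finally show "ennreal (real n) \<le> emeasure \<nu> (ball a \<rho>)" .
  qed
  define e where "e k = r / real (k + 2)" for k
  have e: "0 < e k" "e k < r" for k using r(1) by (auto simp: e_def field_simps add_pos_nonneg)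
  have Int: "(\<Inter>k. ball a (e k)) = {a}"
  proof (intro equalityI subsetI)
    fix z assume z: "z \<in> (\<Inter>k. ball a (e k))"
    have "(\<lambda>k. r * (1 / real (k + 2))) \<longlonglongrightarrow> r * 0"
      by (intro tendsto_mult tendsto_const LIMSEQ_ignore_initial_segment[OF lim_1_over_n])
    then have "e \<longlonglongrightarrow> 0" by (simp add: e_def[abs_def])
    then have "dist a z \<le> 0" by (rule tendsto_lowerbound) (use z in \<open>auto intro!: always_eventually less_imp_le\<close>)
    then show "z \<in> {a}" by simp
  qed (use e in auto)
  have "decseq (\<lambda>k. ball a (e k))"
    using r(1) by (auto simp: decseq_def e_def intro!: subset_ball divide_left_mono)
  then have "(\<lambda>k. emeasure \<nu> (ball a (e k))) \<longlonglongrightarrow> emeasure \<nu> (\<Inter>k. ball a (e k))"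
    by (intro Lim_emeasure_decseq) (use sets' e ball in auto)
  then show atom: "emeasure \<nu> {a} = ennreal (real n)"
    unfolding Int ball[OF e] by (intro LIMSEQ_unique[OF _ tendsto_const])
  have "emeasure \<nu> (ball a (r/2) - {a}) = emeasure \<nu> (ball a (r/2)) - emeasure \<nu> {a}"
    using r aD by (intro emeasure_Diff) (auto simp: atom intro!: sets' sets)
  then show "emeasure \<nu> (ball a (r/2) - {a}) = 0" using r by (simp add: atom ball)
qed

text \<open>Near each point h(z) = g(z) (z - a)^n with g free of zeros, also with n = 0 when h(a) is
  nonzero. By Lindelof countably many of the resulting discs cover \<open>D\<close>, and each has no
  mass off its centre.\<close>

theorem riesz_measure_log_holomorphic:
  assumes D: "open D" "connected D" and u: "subharmonic_on D u" and \<nu>: "is_riesz_measure D u \<nu>"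
    and h: "h holomorphic_on D" "\<exists>z\<in>D. h z \<noteq> 0" and uh: "\<And>z. z \<in> D \<Longrightarrow> u z = log_abs h z"
  obtains C where "countable C" "C \<subseteq> D" "emeasure \<nu> (D - C) = 0"
    "\<And>a. a \<in> D \<Longrightarrow> emeasure \<nu> {a} = ennreal (real (nat (zorder h a)))"
proof -
  have sets: "B \<in> sets \<nu>" if "B \<in> sets borel" "B \<subseteq> D" for B
    using \<nu> that by (auto simp: is_riesz_measure_def sets_restrict_space intro!: image_eqI[of _ _ B])
  obtain z1 where z1: "z1 \<in> D" "h z1 \<noteq> 0" using h(2) by blast
  have uz1: "u z1 \<noteq> - \<infinity>" using uh[OF z1(1)] z1(2) by (simp add: log_abs_def)
  have local: "\<exists>r>0. ball a r \<subseteq> D \<and> emeasure \<nu> {a} = ennreal (real (nat (zorder h a))) \<and> emeasure \<nu> (ball a r - {a}) = 0"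
    if a: "a \<in> D" for a
  proof -
    define g where "g = zor_poly h a"
    define n where "n = nat (zorder h a)"
    obtain r where r: "0 < r" "cball a r \<subseteq> D" "g holomorphic_on cball a r"
      "\<And>w. w \<in> cball a r \<Longrightarrow> h w = g w * (w - a) ^ n \<and> g w \<noteq> 0"
      using zorder_exist_zero[OF h(1) D a h(2)] unfolding g_def n_def by blast
    have br: "ball a r \<subseteq> cball a r" by auto
    have gh: "g holomorphic_on ball a r" by (rule holomorphic_on_subset[OF r(3) br])
    have g0: "g x \<noteq> 0" if "x \<in> ball a r" for x using r(4) that br by blast
    obtain \<Lambda> where \<Lambda>: "\<Lambda> holomorphic_on ball a r" "\<And>x. x \<in> ball a r \<Longrightarrow> exp (\<Lambda> x) = g x"
      using holomorphic_logarithm_exists[OF convex_ball open_ball gh g0 centre_in_ball[THEN iffD2, OF r(1)], of thesis] by blast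
    have bD: "ball a r \<subseteq> D" using br r(2) by blast
    have uL: "u z = ereal (Re (\<Lambda> z) + real n * ln (cmod (z - a)))" if z: "z \<in> ball a r" "z \<noteq> a" for z
    proof -
      have hz: "h z = exp (\<Lambda> z) * (z - a) ^ n" using r(4)[of z] \<Lambda>(2)[OF z(1)] z(1) by auto
      then have "h z \<noteq> 0" using z(2) by simp
      moreover have "ln (cmod (h z)) = Re (\<Lambda> z) + real n * ln (cmod (z - a))"
        using z(2) unfolding hz by (simp add: norm_mult norm_power ln_mult ln_realpow)
      ultimately show ?thesis using uh[of z] bD z(1) by (auto simp: log_abs_def)
    qed
    have int: "integrable lborel (\<lambda>z. indicator K z * real_of_ereal (u z))" if "compact K" "K \<subseteq> ball a r" for K
      using subharmonic_set_integrable(1)[OF u D(2) z1(1) uz1 that(1)] that(2) bD by blast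
    note atom = riesz_measure_log_atom[OF \<nu> r(1) bD \<Lambda>(1) uL int]
    have "ball a (r/2) \<subseteq> D" using bD r(1) subset_ball[of "r/2" r a] by auto
    then show ?thesis using atom r(1) unfolding n_def by (intro exI[of _ "r/2"]) auto
  qed
  then obtain \<rho> where \<rho>: "\<And>a. a \<in> D \<Longrightarrow> 0 < \<rho> a" "\<And>a. a \<in> D \<Longrightarrow> ball a (\<rho> a) \<subseteq> D"
    "\<And>a. a \<in> D \<Longrightarrow> emeasure \<nu> {a} = ennreal (real (nat (zorder h a)))"
    "\<And>a. a \<in> D \<Longrightarrow> emeasure \<nu> (ball a (\<rho> a) - {a}) = 0"
    by metis
  obtain \<F> where \<F>: "\<F> \<subseteq> (\<lambda>a. ball a (\<rho> a)) ` D" "countable \<F>" "\<Union>\<F> = (\<Union>a\<in>D. ball a (\<rho> a))"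
    using Lindelof[of "(\<lambda>a. ball a (\<rho> a)) ` D"] by auto
  obtain C where C: "C \<subseteq> D" "countable C" "\<F> = (\<lambda>a. ball a (\<rho> a)) ` C"
    using countable_subset_image[of \<F> "\<lambda>a. ball a (\<rho> a)" D] \<F>(1,2) by auto
  have cover: "D - C \<subseteq> (\<Union>a\<in>C. ball a (\<rho> a) - {a})"
  proof
    fix z assume z: "z \<in> D - C"
    then have "z \<in> ball z (\<rho> z)" using \<rho>(1) by simp
    then have "z \<in> \<Union>\<F>" using z unfolding \<F>(3) by blast
    then show "z \<in> (\<Union>a\<in>C. ball a (\<rho> a) - {a})" using z unfolding C(3) by auto
  qed
  have null: "ball a (\<rho> a) - {a} \<in> null_sets \<nu>" if "a \<in> C" for a
  proof -
    have aD: "a \<in> D" using that C(1) by blast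
    have "ball a (\<rho> a) - {a} \<in> sets \<nu>" using \<rho>(2)[OF aD] by (intro sets) auto
    then show ?thesis using \<rho>(4)[OF aD] by auto
  qed
  have "(\<Union>a\<in>C. ball a (\<rho> a) - {a}) \<in> null_sets \<nu>" by (rule null_sets_UN'[OF C(2) null])
  moreover have "D - C \<in> sets \<nu>"
    using D(1) by (intro sets sets.Diff) (auto intro!: sets.countable[OF _ C(2)])
  ultimately have "emeasure \<nu> (D - C) = 0" using cover null_sets_subset[of _ \<nu> "D - C"] by blast
  then show thesis using that C(1,2) \<rho>(3) by blast
qed

section \<open>Sums over zeros as integrals over atoms\<close>

lemma infsum_ereal_nonneg:
  fixes g :: "nat \<Rightarrow> real"
  assumes "\<And>k. k \<in> P \<Longrightarrow> 0 \<le> g k"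
  shows "(\<Sum>\<^sub>\<infinity>k\<in>P. ereal (g k)) = enn2ereal (\<integral>\<^sup>+k. ennreal (g k) \<partial>count_space P)"
proof -
  define f where "f k = (if k \<in> P then ennreal (g k) else 0)" for k
  have "(\<Sum>\<^sub>\<infinity>k\<in>P. ereal (g k)) = (\<Sum>\<^sub>\<infinity>k\<in>UNIV. enn2ereal (f k))"
    by (rule infsum_cong_neutral) (auto simp: f_def assms zero_ennreal.rep_eq)
  also have "\<dots> = (\<Sum>k. enn2ereal (f k))"
  proof -
    have "(\<lambda>k. enn2ereal (f k)) summable_on UNIV" by (rule nonneg_summable_on_complete) simp
    then show ?thesis using has_sum_imp_sums[OF has_sum_infsum] sums_unique by blast
  qed
  also have "\<dots> = enn2ereal (\<integral>\<^sup>+k. f k \<partial>count_space UNIV)" by (simp add: nn_integral_count_space_nat)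
  also have "(\<integral>\<^sup>+k. f k \<partial>count_space UNIV) = (\<integral>\<^sup>+k. ennreal (g k) \<partial>count_space P)"
    using nn_integral_count_space_eq[of UNIV P f] by (auto simp: f_def cong: nn_integral_cong_simp)
  finally show ?thesis .
qed

text \<open>Countable additivity of the density measure on singletons; both measures compared in the
  next theorem are of this kind.\<close>

lemma nn_integral_countable_support:
  assumes W: "W \<in> borel_measurable M" and E: "countable E" "\<And>x. x \<in> E \<Longrightarrow> {x} \<in> sets M"
    and null: "emeasure M (space M - E) = 0"
  shows "(\<integral>\<^sup>+x. W x \<partial>M) = (\<integral>\<^sup>+x. W x * emeasure M {x} \<partial>count_space E)"
proof -
  have ES: "E \<in> sets M" by (rule sets.countable[OF E(2,1)])
  have "AE x in M. x \<notin> space M - E" using null ES by (intro AE_not_in) auto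
  then have "AE x in M. W x = W x * indicator E x"
    by (rule AE_mp) (auto intro!: AE_I2 split: split_indicator)
  then have "(\<integral>\<^sup>+x. W x \<partial>M) = (\<integral>\<^sup>+x. W x * indicator E x \<partial>M)" by (rule nn_integral_cong_AE)
  also have "\<dots> = emeasure (density M W) E" by (rule emeasure_density[OF W ES, symmetric])
  also have "\<dots> = (\<integral>\<^sup>+x. emeasure (density M W) {x} \<partial>count_space E)"
    by (rule emeasure_countable_singleton) (use E in auto)
  also have "\<dots> = (\<integral>\<^sup>+x. W x * emeasure M {x} \<partial>count_space E)"
  proof (rule nn_integral_cong)
    fix x assume "x \<in> space (count_space E)"
    then have x: "{x} \<in> sets M" using E(2) by simp
    have "emeasure (density M W) {x} = (\<integral>\<^sup>+y. W y * indicator {x} y \<partial>M)" by (rule emeasure_density[OF W x])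
    also have "\<dots> = (\<integral>\<^sup>+y. W x * indicator {x} y \<partial>M)" by (intro nn_integral_cong) (auto split: split_indicator)
    also have "\<dots> = W x * emeasure M {x}" by (rule nn_integral_cmult_indicator[OF x])
    finally show "emeasure (density M W) {x} = W x * emeasure M {x}" .
  qed
  finally show ?thesis .
qed

text \<open>The sum is an integral against the image of counting measure under Z, whose atoms count
  repetitions. The atoms of \<nu> are the zero orders, so the two integrals are compared atom by
  atom.\<close>

theorem zero_sum_riesz_measure:
  fixes Z :: "nat \<Rightarrow> complex" and w :: "complex \<Rightarrow> real"
  assumes D: "open D" "connected D" and u: "subharmonic_on D u" and \<nu>: "is_riesz_measure D u \<nu>"
    and h: "h holomorphic_on D" "\<exists>z\<in>D. h z \<noteq> 0" and uh: "\<And>z. z \<in> D \<Longrightarrow> u z = log_abs h z"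
    and A: "A \<in> sets borel" and w: "(\<lambda>z. indicator A z * w z) \<in> borel_measurable borel" "\<And>z. z \<in> A \<Longrightarrow> 0 \<le> w z"
    and Z: "range Z \<subseteq> D" "vanishes_on_seq D h Z"
  defines "S \<equiv> \<Sum>\<^sub>\<infinity>k\<in>{k. Z k \<in> A}. ereal (w (Z k))"
  shows "S \<le> enn2ereal (\<integral>\<^sup>+z\<in>A. ennreal (w z) \<partial>\<nu>)"
    and "is_zero_sequence D h Z \<Longrightarrow> S = enn2ereal (\<integral>\<^sup>+z\<in>A. ennreal (w z) \<partial>\<nu>)"
proof -
  obtain C where C: "countable C" "C \<subseteq> D" "emeasure \<nu> (D - C) = 0"
    "\<And>a. a \<in> D \<Longrightarrow> emeasure \<nu> {a} = ennreal (real (nat (zorder h a)))"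
    using riesz_measure_log_holomorphic[OF D u \<nu> h uh, of thesis] by blast
  have sets: "B \<in> sets \<nu>" if "B \<in> sets borel" "B \<subseteq> D" for B
    using \<nu> that by (auto simp: is_riesz_measure_def sets_restrict_space intro!: image_eqI[of _ _ B])
  have space: "space \<nu> = D"
    using sets_eq_imp_space_eq[of \<nu> "restrict_space borel D"] \<nu> by (simp add: is_riesz_measure_def space_restrict_space)
  \<comment> \<open>One countable set outside which both measures vanish: \<nu> off
    \<open>C\<close>, the image measure off the range of Z.\<close>
  define E where "E = C \<union> range Z"
  have E: "countable E" "E \<subseteq> D" using C Z by (auto simp: E_def)
  define W where "W z = ennreal (w z) * indicator A z" for z
  have W_eq: "W z = ennreal (indicator A z * w z)" for z by (auto simp: W_def split: split_indicator)
  have Wm: "W \<in> borel_measurable borel" unfolding W_eq[abs_def] using w(1) by measurable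
  have "W \<in> borel_measurable \<nu>"
    unfolding W_eq[abs_def] using riesz_measure_measurable[OF \<nu> w(1)] by measurable
  then have 1: "(\<integral>\<^sup>+z\<in>A. ennreal (w z) \<partial>\<nu>) = (\<integral>\<^sup>+x. W x * emeasure \<nu> {x} \<partial>count_space E)"
    unfolding W_def[symmetric]
  proof (rule nn_integral_countable_support)
    show "{x} \<in> sets \<nu>" if "x \<in> E" for x using that E by (intro sets) auto
    have "emeasure \<nu> (space \<nu> - E) \<le> emeasure \<nu> (D - C)"
      unfolding space using D(1) by (intro emeasure_mono sets sets.Diff) (auto simp: E_def intro!: sets.countable[OF _ C(1)])
    then show "emeasure \<nu> (space \<nu> - E) = 0" using C(3) by simp
  qed (rule E)
  define N where "N = distr (count_space UNIV) borel Z"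
  have N: "emeasure N B = emeasure (count_space UNIV) (Z -` B)" if "B \<in> sets borel" for B
    unfolding N_def using that by (subst emeasure_distr) auto
  have Natom: "emeasure N {x} = ennreal (real (card {k. Z k = x}))" if "x \<in> E" for x
  proof -
    have "finite {k. Z k = x}" using Z(2) that E(2) by (auto simp: vanishes_on_seq_def)
    moreover have "Z -` {x} = {k. Z k = x}" by auto
    ultimately show ?thesis by (simp add: N emeasure_count_space_finite ennreal_of_nat_eq_real_of_nat)
  qed
  have "(\<integral>\<^sup>+k. ennreal (w (Z k)) \<partial>count_space {k. Z k \<in> A}) = (\<integral>\<^sup>+k. W (Z k) \<partial>count_space UNIV)"
    by (subst nn_integral_count_space_indicator) (auto simp: W_def intro!: nn_integral_cong split: split_indicator)
  also have "\<dots> = (\<integral>\<^sup>+x. W x \<partial>N)" unfolding N_def using Wm by (subst nn_integral_distr) auto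
  also have "\<dots> = (\<integral>\<^sup>+x. W x * emeasure N {x} \<partial>count_space E)"
  proof (rule nn_integral_countable_support[OF _ E(1)])
    show "W \<in> borel_measurable N" using Wm by (simp add: N_def)
    show "{x} \<in> sets N" for x by (simp add: N_def)
    have "E \<in> sets borel" by (rule sets.countable[OF _ E(1)]) simp
    moreover have "Z -` (UNIV - E) = {}" by (auto simp: E_def)
    ultimately show "emeasure N (space N - E) = 0"
      using N[of "UNIV - E"] by (simp add: N_def)
  qed
  also have "\<dots> = (\<integral>\<^sup>+x. W x * ennreal (real (card {k. Z k = x})) \<partial>count_space E)"
    by (intro nn_integral_cong) (simp add: Natom)
  finally have S: "S = enn2ereal (\<integral>\<^sup>+x. W x * ennreal (real (card {k. Z k = x})) \<partial>count_space E)"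
    unfolding S_def by (subst infsum_ereal_nonneg) (auto simp: w(2))
  show "S \<le> enn2ereal (\<integral>\<^sup>+z\<in>A. ennreal (w z) \<partial>\<nu>)"
    unfolding S 1 less_eq_ennreal.rep_eq[symmetric]
  proof (intro nn_integral_mono mult_left_mono)
    fix x assume "x \<in> space (count_space E)"
    then have "x \<in> D" using E(2) by auto
    moreover from this have "card {k. Z k = x} \<le> nat (zorder h x)" using Z(2) by (auto simp: vanishes_on_seq_def)
    ultimately show "ennreal (real (card {k. Z k = x})) \<le> emeasure \<nu> {x}" by (simp add: C(4) ennreal_leI)
  qed simp
  show "S = enn2ereal (\<integral>\<^sup>+z\<in>A. ennreal (w z) \<partial>\<nu>)" if "is_zero_sequence D h Z"
  proof -
    have "emeasure \<nu> {x} = ennreal (real (card {k. Z k = x}))" if "x \<in> E" for x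
    proof -
      have xD: "x \<in> D" using that E(2) by blast
      then have "int (card {k. Z k = x}) = zorder h x" using \<open>is_zero_sequence D h Z\<close> by (simp add: is_zero_sequence_def)
      then have "nat (zorder h x) = card {k. Z k = x}" by linarith
      then show ?thesis using C(4)[OF xD] by simp
    qed
    then show ?thesis unfolding S 1 by (intro arg_cong[where f = enn2ereal] nn_integral_cong) simp
  qed
qed

section \<open>Passage to extended integrals and conclusion\<close>

lemma ext_integral_nonneg:
  assumes "\<And>z. z \<in> A \<Longrightarrow> 0 \<le> g z"
  shows "ext_integral \<mu> A (\<lambda>z. ereal (g z)) = enn2ereal (\<integral>\<^sup>+z\<in>A. ennreal (g z) \<partial>\<mu>)"
proof -
  have "e2ennreal (- ereal (g z)) * indicator A z = 0" for z
    using assms[of z] by (cases "z \<in> A") (auto simp: ennreal_neg)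
  then show ?thesis by (simp add: ext_integral_def zero_ennreal.rep_eq del: mult_eq_0_iff)
qed

theorem mainTheorem13:
  fixes D D0 :: "complex set" and z0 :: complex
  defines "R \<equiv> hyperbolic_radius D"
  assumes "open D" and "convex D" and "D \<noteq> UNIV"
    and "None \<notin> riemann_sphere frontier_of (Some ` D)"
    and "open D0" and "connected D0" and "D0 \<noteq> {}" and "rel_compact_in D0 D"
    and "z0 \<in> D0"
  shows
    "\<exists>C :: real \<Rightarrow> real. (\<forall>b\<ge>0. 0 \<le> C b) \<and>
      (\<forall>M :: complex \<Rightarrow> real. \<exists>C\<^sub>M :: real. 0 \<le> C\<^sub>M \<and>
        (\<forall>(F :: real \<Rightarrow> real) (u :: complex \<Rightarrow> ereal) (\<nu> :: complex measure).
          convex_on {..<0} F \<and> mono_on {..<0} F \<and> C2_on {..<0} F \<and>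
          (\<forall>z\<in>D - D0. M z = F (- R z)) \<and>
          subharmonic_on D u \<and> u z0 \<noteq> - \<infinity> \<and> is_riesz_measure D u \<nu> \<and>
          (\<forall>z\<in>D - D0. u z \<le> ereal (M z))
          \<longrightarrow>
          (\<forall>(b :: real) (f :: real \<Rightarrow> real) (s :: complex \<Rightarrow> real).
            0 \<le> b \<and>
            convex_on {0..} f \<and> mono_on {0..} f \<and> (\<forall>t\<ge>0. 0 \<le> f t) \<and> f 0 = 0 \<and>
            sbh_nonneg (D - D0) s \<and>
            bdd_above ((\<lambda>z. s z / R z) ` (D - D0)) \<and>
            f (SUP z\<in>D - D0. s z / R z) * (SUP z\<in>frontier D0. R z) \<le> b
            \<longrightarrow>
            (let lhs = ext_integral \<nu> (D - D0) (\<lambda>z. ereal (R z * f (s z / R z)));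
                 int_M = ext_integral lborel (D - D0)
                   (\<lambda>z. ereal (R z * f (s z / R z) *
                      (4 * deriv (deriv F) (- R z) +
                       (deriv (deriv F) (- R z) * R z - deriv F (- R z)) * laplacian R z)));
                 rhs = ereal (1 / (2 * pi)) * int_M + ereal (C b * C\<^sub>M) - ereal (C b) * u z0
             in lhs \<le> rhs \<and>
                (\<bar>int_M\<bar> \<noteq> \<infinity> \<longrightarrow> \<bar>lhs\<bar> \<noteq> \<infinity>) \<and>
                (\<forall>(h :: complex \<Rightarrow> complex) (Z :: nat \<Rightarrow> complex).
                  h holomorphic_on D \<and> (\<exists>z\<in>D. h z \<noteq> 0) \<and> (\<forall>z\<in>D. u z = log_abs h z) \<and>
                  range Z \<subseteq> D \<and> vanishes_on_seq D h Z
                  \<longrightarrow>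
                  (let zero_sum = (\<Sum>\<^sub>\<infinity>k\<in>{k. Z k \<in> D - D0}. ereal (R (Z k) * f (s (Z k) / R (Z k))))
                   in zero_sum \<le> lhs \<and> zero_sum \<le> rhs \<and>
                      (is_zero_sequence D h Z \<longrightarrow> lhs = zero_sum)))))))"
proof -
  have bD: "bounded D" by (rule bounded_if_infinity_not_in_frontier[OF assms(5)])
  note cl = rel_compact_in_closure[OF assms(9)]
  have D0D: "D0 \<subseteq> D" using cl(2) closure_subset by blast
  have z0D: "z0 \<in> D" using D0D assms(10) by blast
  have cD: "connected D" by (rule convex_connected[OF assms(3)])
  obtain c A where c: "0 < c" and A: "\<And>M. 0 \<le> A M" and
    W: "\<And>F M u \<nu> u0 b f s. convex_on {..<0} F \<Longrightarrow> mono_on {..<0} F \<Longrightarrow> C2_on {..<0} F \<Longrightarrow>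
      (\<And>z. z \<in> D - D0 \<Longrightarrow> M z = F (- R z)) \<Longrightarrow>
      subharmonic_on D u \<Longrightarrow> u z0 = ereal u0 \<Longrightarrow> is_riesz_measure D u \<nu> \<Longrightarrow>
      (\<And>z. z \<in> D - D0 \<Longrightarrow> u z \<le> ereal (M z)) \<Longrightarrow> 0 \<le> b \<Longrightarrow>
      convex_on {0..} f \<Longrightarrow> mono_on {0..} f \<Longrightarrow> (\<And>t. 0 \<le> t \<Longrightarrow> 0 \<le> f t) \<Longrightarrow> f 0 = 0 \<Longrightarrow>
      sbh_nonneg (D - D0) s \<Longrightarrow> bdd_above ((\<lambda>z. s z / R z) ` (D - D0)) \<Longrightarrow>
      f (SUP z\<in>D - D0. s z / R z) * (SUP z\<in>frontier D0. R z) \<le> b \<Longrightarrow>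
      (\<lambda>z. indicator (D - D0) z * (R z * f (s z / R z))) \<in> borel_measurable borel \<and>
      (\<forall>z\<in>D - D0. 0 \<le> R z * f (s z / R z)) \<and>
      (\<forall>z\<in>D - D0. 0 \<le> R z * f (s z / R z) * (4 * deriv (deriv F) (- R z) +
           (deriv (deriv F) (- R z) * R z - deriv F (- R z)) * laplacian R z)) \<and>
      ((\<integral>\<^sup>+z\<in>D - D0. ennreal (R z * f (s z / R z) * (4 * deriv (deriv F) (- R z) +
           (deriv (deriv F) (- R z) * R z - deriv F (- R z)) * laplacian R z)) \<partial>lborel) < \<infinity> \<longrightarrow>
       (\<exists>X. 0 \<le> X \<and> X \<le> 1 / (2 * pi) * enn2real (\<integral>\<^sup>+z\<in>D - D0. ennreal (R z * f (s z / R z) * (4 * deriv (deriv F) (- R z) +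
           (deriv (deriv F) (- R z) * R z - deriv F (- R z)) * laplacian R z)) \<partial>lborel) + c * (b + 1) * (A M - u0) \<and>
        (\<integral>\<^sup>+z\<in>D - D0. ennreal (R z * f (s z / R z)) \<partial>\<nu>) \<le> ennreal X))"
  proof (rule weighted_riesz_bound[OF assms(2,3) bD assms(6) cl assms(10), folded R_def], goal_cases)
    case (1 c A)
    show thesis by (rule 1(1)[OF 1(2,3)]) (rule 1(4))
  qed
  show ?thesis
  \<comment> \<open>The witness for C, linear in b + 1 because B = (b + 1) / \<delta>; the constant
    for M is \<open>A M\<close>.\<close>
  proof (rule exI[of _ "\<lambda>b. c * (b + 1)"], intro conjI allI impI)
    show "0 \<le> c * (b + 1)" if "0 \<le> b" for b using c that by simp
    fix M :: "complex \<Rightarrow> real"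
    let ?concl = "\<lambda>F u \<nu> b f s.
       (let lhs = ext_integral \<nu> (D - D0) (\<lambda>z. ereal (R z * f (s z / R z)));
            int_M = ext_integral lborel (D - D0)
              (\<lambda>z. ereal (R z * f (s z / R z) *
                 (4 * deriv (deriv F) (- R z) +
                  (deriv (deriv F) (- R z) * R z - deriv F (- R z)) * laplacian R z)));
            rhs = ereal (1 / (2 * pi)) * int_M + ereal (c * (b + 1) * A M) - ereal (c * (b + 1)) * u z0
        in lhs \<le> rhs \<and>
           (\<bar>int_M\<bar> \<noteq> \<infinity> \<longrightarrow> \<bar>lhs\<bar> \<noteq> \<infinity>) \<and>
           (\<forall>(h :: complex \<Rightarrow> complex) (Z :: nat \<Rightarrow> complex).
             h holomorphic_on D \<and> (\<exists>z\<in>D. h z \<noteq> 0) \<and> (\<forall>z\<in>D. u z = log_abs h z) \<and>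
             range Z \<subseteq> D \<and> vanishes_on_seq D h Z
             \<longrightarrow>
             (let zero_sum = (\<Sum>\<^sub>\<infinity>k\<in>{k. Z k \<in> D - D0}. ereal (R (Z k) * f (s (Z k) / R (Z k))))
              in zero_sum \<le> lhs \<and> zero_sum \<le> rhs \<and>
                 (is_zero_sequence D h Z \<longrightarrow> lhs = zero_sum))))"
    have main: "?concl F u \<nu> b f s"
      if F: "convex_on {..<0} F" "mono_on {..<0} F" "C2_on {..<0} F"
        and MF: "\<And>z. z \<in> D - D0 \<Longrightarrow> M z = F (- R z)"
        and u: "subharmonic_on D u" "u z0 \<noteq> - \<infinity>" "is_riesz_measure D u \<nu>" "\<And>z. z \<in> D - D0 \<Longrightarrow> u z \<le> ereal (M z)"
        and b: "0 \<le> b"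
        and f: "convex_on {0..} f" "mono_on {0..} f" "\<And>t. 0 \<le> t \<Longrightarrow> 0 \<le> f t" "f 0 = 0"
        and s: "sbh_nonneg (D - D0) s" "bdd_above ((\<lambda>z. s z / R z) ` (D - D0))"
          "f (SUP z\<in>D - D0. s z / R z) * (SUP z\<in>frontier D0. R z) \<le> b"
      for F u \<nu> b f s
    proof -
      have "u z0 < \<infinity>" using u(1) z0D unfolding subharmonic_on_def by blast
      then obtain u0 where u0: "u z0 = ereal u0" using u(2) by (cases "u z0") auto
      define w where "w z = R z * f (s z / R z)" for z
      define Q where "Q z = 4 * deriv (deriv F) (- R z) + (deriv (deriv F) (- R z) * R z - deriv F (- R z)) * laplacian R z" for z
      define I where "I = (\<integral>\<^sup>+z\<in>D - D0. ennreal (w z) \<partial>\<nu>)"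
      define J where "J = (\<integral>\<^sup>+z\<in>D - D0. ennreal (w z * Q z) \<partial>lborel)"
      note W' = W[OF F MF u(1) u0 u(3,4) b f s, folded w_def Q_def, folded I_def J_def]
      have wm: "(\<lambda>z. indicator (D - D0) z * w z) \<in> borel_measurable borel"
        and w: "\<And>z. z \<in> D - D0 \<Longrightarrow> 0 \<le> w z" and wQ: "\<And>z. z \<in> D - D0 \<Longrightarrow> 0 \<le> w z * Q z"
        and bound: "J < \<infinity> \<Longrightarrow> \<exists>X. 0 \<le> X \<and> X \<le> 1 / (2 * pi) * enn2real J + c * (b + 1) * (A M - u0) \<and> I \<le> ennreal X"
        using W' by blast+
      have lhs: "ext_integral \<nu> (D - D0) (\<lambda>z. ereal (w z)) = enn2ereal I"
        unfolding I_def by (rule ext_integral_nonneg) (rule w)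
      have int_M: "ext_integral lborel (D - D0) (\<lambda>z. ereal (w z * Q z)) = enn2ereal J"
        unfolding J_def by (rule ext_integral_nonneg) (rule wQ)
      define rhs where "rhs = ereal (1 / (2 * pi)) * enn2ereal J + ereal (c * (b + 1) * A M) - ereal (c * (b + 1)) * u z0"
      have le: "enn2ereal I \<le> rhs"
      proof (cases "J < \<infinity>")
        case True
        then obtain X where X: "0 \<le> X" "X \<le> 1 / (2 * pi) * enn2real J + c * (b + 1) * (A M - u0)" "I \<le> ennreal X"
          using bound by blast
        have J: "enn2ereal J = ereal (enn2real J)"
          using True by (cases J) (auto simp: enn2ereal_ennreal)
        have "enn2ereal I \<le> enn2ereal (ennreal X)" using X(3) by (simp add: less_eq_ennreal.rep_eq)
        also have "\<dots> = ereal X" using X(1) by (simp add: enn2ereal_ennreal)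
        also have "\<dots> \<le> ereal (1 / (2 * pi) * enn2real J + c * (b + 1) * (A M - u0))" using X(2) by simp
        also have "\<dots> = rhs" unfolding rhs_def J u0 by (simp add: algebra_simps)
        finally show ?thesis .
      next
        \<comment> \<open>With an infinite integral the right-hand side is \<infinity>; u(z0) is
          finite, so the subtraction is harmless.\<close>
        case False
        then have "J = \<infinity>" by (simp add: less_top[symmetric])
        then have "rhs = \<infinity>" by (simp add: rhs_def u0)
        then show ?thesis by simp
      qed
      have fin: "\<bar>enn2ereal I\<bar> \<noteq> \<infinity>" if "\<bar>enn2ereal J\<bar> \<noteq> \<infinity>"
      proof -
        have "J < \<infinity>" using that by (cases J) auto
        then obtain X where "I \<le> ennreal X" using bound by blast
        then have "I < \<infinity>" using ennreal_less_top order_le_less_trans by (metis infinity_ennreal_def)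
        then show ?thesis by (cases I) (auto simp: enn2ereal_ennreal)
      qed
      have zeros: "S \<le> enn2ereal I \<and> S \<le> rhs \<and> (is_zero_sequence D h Z \<longrightarrow> enn2ereal I = S)"
        if h: "h holomorphic_on D" "\<exists>z\<in>D. h z \<noteq> 0" "\<And>z. z \<in> D \<Longrightarrow> u z = log_abs h z"
          and Z: "range Z \<subseteq> D" "vanishes_on_seq D h Z"
          and S: "S = (\<Sum>\<^sub>\<infinity>k\<in>{k. Z k \<in> D - D0}. ereal (w (Z k)))" for h Z S
      proof -
        have "D - D0 \<in> sets borel" using assms(2,6) by auto
        note zs = zero_sum_riesz_measure[OF assms(2) cD u(1,3) h this wm w Z, folded I_def S]
        show ?thesis using zs le order_trans by blast
      qed
      show ?thesis
        unfolding Let_def w_def[symmetric] Q_def[symmetric] lhs int_M rhs_def[symmetric]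
        using le fin zeros by blast
    qed
    show "\<exists>C\<^sub>M :: real. 0 \<le> C\<^sub>M \<and>
        (\<forall>(F :: real \<Rightarrow> real) (u :: complex \<Rightarrow> ereal) (\<nu> :: complex measure).
          convex_on {..<0} F \<and> mono_on {..<0} F \<and> C2_on {..<0} F \<and>
          (\<forall>z\<in>D - D0. M z = F (- R z)) \<and>
          subharmonic_on D u \<and> u z0 \<noteq> - \<infinity> \<and> is_riesz_measure D u \<nu> \<and>
          (\<forall>z\<in>D - D0. u z \<le> ereal (M z))
          \<longrightarrow>
          (\<forall>(b :: real) (f :: real \<Rightarrow> real) (s :: complex \<Rightarrow> real).
            0 \<le> b \<and>
            convex_on {0..} f \<and> mono_on {0..} f \<and> (\<forall>t\<ge>0. 0 \<le> f t) \<and> f 0 = 0 \<and>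
            sbh_nonneg (D - D0) s \<and>
            bdd_above ((\<lambda>z. s z / R z) ` (D - D0)) \<and>
            f (SUP z\<in>D - D0. s z / R z) * (SUP z\<in>frontier D0. R z) \<le> b
            \<longrightarrow> (let lhs = ext_integral \<nu> (D - D0) (\<lambda>z. ereal (R z * f (s z / R z)));
                 int_M = ext_integral lborel (D - D0)
                   (\<lambda>z. ereal (R z * f (s z / R z) *
                      (4 * deriv (deriv F) (- R z) +
                       (deriv (deriv F) (- R z) * R z - deriv F (- R z)) * laplacian R z)));
                 rhs = ereal (1 / (2 * pi)) * int_M + ereal (c * (b + 1) * C\<^sub>M) - ereal (c * (b + 1)) * u z0
             in lhs \<le> rhs \<and>
                (\<bar>int_M\<bar> \<noteq> \<infinity> \<longrightarrow> \<bar>lhs\<bar> \<noteq> \<infinity>) \<and>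
                (\<forall>(h :: complex \<Rightarrow> complex) (Z :: nat \<Rightarrow> complex).
                  h holomorphic_on D \<and> (\<exists>z\<in>D. h z \<noteq> 0) \<and> (\<forall>z\<in>D. u z = log_abs h z) \<and>
                  range Z \<subseteq> D \<and> vanishes_on_seq D h Z
                  \<longrightarrow>
                  (let zero_sum = (\<Sum>\<^sub>\<infinity>k\<in>{k. Z k \<in> D - D0}. ereal (R (Z k) * f (s (Z k) / R (Z k))))
                   in zero_sum \<le> lhs \<and> zero_sum \<le> rhs \<and>
                      (is_zero_sequence D h Z \<longrightarrow> lhs = zero_sum))))))"
    proof (rule exI[of _ "A M"], intro conjI allI impI A, elim conjE)
      fix F u \<nu> b f s
      assume "convex_on {..<0} F" "mono_on {..<0} F" "C2_on {..<0} F"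
        "\<forall>z\<in>D - D0. M z = F (- R z)" "subharmonic_on D u" "u z0 \<noteq> - \<infinity>" "is_riesz_measure D u \<nu>"
        "\<forall>z\<in>D - D0. u z \<le> ereal (M z)" "0 \<le> b" "convex_on {0..} f" "mono_on {0..} f" "\<forall>t\<ge>0. 0 \<le> f t" "f 0 = 0"
        "sbh_nonneg (D - D0) s" "bdd_above ((\<lambda>z. s z / R z) ` (D - D0))"
        "f (SUP z\<in>D - D0. s z / R z) * (SUP z\<in>frontier D0. R z) \<le> b"
      then show "?concl F u \<nu> b f s" by (intro main) auto
    qed
  qed
qed

end
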